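(* Let $\Lambda$ be an Artin algebra and let $0\to L\xrightarrow{a}N\xrightarrow{b}M\to 0$ be an almost split sequence in $\mathrm{mod}\text{-}\Lambda$. If there is no projective $\Lambda$-module $X$ such that $L$ is isomorphic to a direct summand of $\nu X/\mathrm{soc}(\nu X)$, then $$g^N=g^L+g^M.$$
   Context: $\mathrm{mod}\text{-}\Lambda$ is the category of finitely generated $\Lambda$-modules and $\nu=D\,\mathrm{Hom}_\Lambda(-,\Lambda)$ is the Nakayama functor. Let $P_1,\dots,P_n$ be a complete set of pairwise non-isomorphic indecomposable projective $\Lambda$-modules; $[P_1],\dots,[P_n]$ form a basis of the Grothendieck group $\mathrm{K}_0(\mathrm{prj}\text{-}\Lambda)$ of the category of finitely generated projective modules (with split exact structure). For $M$ in $\mathrm{mod}\text{-}\Lambda$ with minimal projective presentation $P^1\to P^0\to M\to 0$, write $[P^0]-[P^1]=\sum_{i=1}^n g_i^M[P_i]$ in $\mathrm{K}_0(\mathrm{prj}\text{-}\Lambda)$; the vector $g^M=(g_1^M,\dots,g_n^M)$ is the $g$-vector of $M$. *)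

theory Defs
  imports
    "HOL-Algebra.Module" "HOL-Algebra.Ideal" "HOL-Algebra.Generated_Groups" "HOL-Algebra.Free_Abelian_Groups"
begin

section \<open>Modules over a not necessarily commutative ring\<close>

text \<open>
  The library locale \<^locale>\<open>module\<close> requires a commutative ring of scalars, so its axioms are
  repeated here for left modules over an arbitrary ring.  The module record inherits the fields
  \<open>mult\<close> and \<open>one\<close> from the ring record; they carry no meaning for modules.

  All modules are left modules.  Right modules are left modules over the opposite ring, which is
  an Artin algebra whenever the given ring is one.
\<close>

locale lmodule = R?: ring R + M?: abelian_group M
  for R :: "('a, 'k) ring_scheme" (structure) and M :: "('a, 'm) module" (structure) +
  assumes smult_closed [simp, intro]:
      "\<lbrakk>a \<in> carrier R; x \<in> carrier M\<rbrakk> \<Longrightarrow> a \<odot>\<^bsub>M\<^esub> x \<in> carrier M"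
    and smult_l_distr:
      "\<lbrakk>a \<in> carrier R; b \<in> carrier R; x \<in> carrier M\<rbrakk> \<Longrightarrow>
        (a \<oplus> b) \<odot>\<^bsub>M\<^esub> x = a \<odot>\<^bsub>M\<^esub> x \<oplus>\<^bsub>M\<^esub> b \<odot>\<^bsub>M\<^esub> x"
    and smult_r_distr:
      "\<lbrakk>a \<in> carrier R; x \<in> carrier M; y \<in> carrier M\<rbrakk> \<Longrightarrow>
        a \<odot>\<^bsub>M\<^esub> (x \<oplus>\<^bsub>M\<^esub> y) = a \<odot>\<^bsub>M\<^esub> x \<oplus>\<^bsub>M\<^esub> a \<odot>\<^bsub>M\<^esub> y"
    and smult_assoc1:
      "\<lbrakk>a \<in> carrier R; b \<in> carrier R; x \<in> carrier M\<rbrakk> \<Longrightarrow>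
        (a \<otimes> b) \<odot>\<^bsub>M\<^esub> x = a \<odot>\<^bsub>M\<^esub> (b \<odot>\<^bsub>M\<^esub> x)"
    and smult_one [simp]:
      "x \<in> carrier M \<Longrightarrow> \<one> \<odot>\<^bsub>M\<^esub> x = x"

definition mod_span :: "('a, 'k) ring_scheme \<Rightarrow> ('a, 'm) module \<Rightarrow> 'm set \<Rightarrow> 'm set" where
  "mod_span \<Lambda> M S = \<Inter>{H. submodule H \<Lambda> M \<and> S \<subseteq> H}"

definition fin_gen :: "('a, 'k) ring_scheme \<Rightarrow> ('a, 'm) module \<Rightarrow> bool" where
  "fin_gen \<Lambda> M \<longleftrightarrow> (\<exists>S. finite S \<and> S \<subseteq> carrier M \<and> mod_span \<Lambda> M S = carrier M)"

text \<open>The objects of \<open>mod-\<Lambda>\<close>:\<close>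

definition fg_module :: "('a, 'k) ring_scheme \<Rightarrow> ('a, 'm) module \<Rightarrow> bool" where
  "fg_module \<Lambda> M \<longleftrightarrow> lmodule \<Lambda> M \<and> fin_gen \<Lambda> M"

definition mod_hom ::
    "('a, 'k) ring_scheme \<Rightarrow> ('a, 'm) module \<Rightarrow> ('a, 'n) module \<Rightarrow> ('m \<Rightarrow> 'n) set" where
  "mod_hom \<Lambda> M N = {f \<in> hom (add_monoid M) (add_monoid N).
     \<forall>a\<in>carrier \<Lambda>. \<forall>x\<in>carrier M. f (a \<odot>\<^bsub>M\<^esub> x) = a \<odot>\<^bsub>N\<^esub> f x}"

definition mod_isomorphic ::
    "('a, 'k) ring_scheme \<Rightarrow> ('a, 'm) module \<Rightarrow> ('a, 'n) module \<Rightarrow> bool" where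
  "mod_isomorphic \<Lambda> M N \<longleftrightarrow> (\<exists>f\<in>mod_hom \<Lambda> M N. bij_betw f (carrier M) (carrier N))"

definition regular_module :: "('a, 'k) ring_scheme \<Rightarrow> ('a, 'a) module" where
  "regular_module \<Lambda> = \<lparr>carrier = carrier \<Lambda>, monoid.mult = undefined, one = undefined,
     ring.zero = \<zero>\<^bsub>\<Lambda>\<^esub>, add = add \<Lambda>, smult = monoid.mult \<Lambda>\<rparr>"

definition quot_module :: "('a, 'm) module \<Rightarrow> 'm set \<Rightarrow> ('a, 'm set) module" where
  "quot_module M K = \<lparr>carrier = a_rcosets\<^bsub>M\<^esub> K, monoid.mult = undefined, one = undefined,
     ring.zero = K, add = set_add M, smult = (\<lambda>a Y. \<Union>x\<in>Y. K +>\<^bsub>M\<^esub> (a \<odot>\<^bsub>M\<^esub> x))\<rparr>"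


section \<open>A type containing a copy of every finitely generated module\<close>

text \<open>
  Notions such as \<^emph>\<open>projective\<close> or \<^emph>\<open>almost split\<close> quantify over all objects of
  \<open>mod-\<Lambda>\<close>, but HOL cannot quantify over types inside a formula.  If the elements of \<open>\<Lambda>\<close>
  have type \<open>'a\<close>, every finitely generated module is isomorphic to one with elements in the
  following type, so quantification over modules on this type ranges over \<open>mod-\<Lambda>\<close> up to
  isomorphism (lemma \<open>fg_module_univ\<close> below).
\<close>

type_synonym 'a univ = "(nat \<Rightarrow> 'a) set"

lemma (in lmodule) smult_l_null:
  assumes "x \<in> carrier M" shows "\<zero> \<odot>\<^bsub>M\<^esub> x = \<zero>\<^bsub>M\<^esub>"
proof -
  have "\<zero> \<odot>\<^bsub>M\<^esub> x \<oplus>\<^bsub>M\<^esub> \<zero> \<odot>\<^bsub>M\<^esub> x = \<zero> \<odot>\<^bsub>M\<^esub> x \<oplus>\<^bsub>M\<^esub> \<zero>\<^bsub>M\<^esub>"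
    using smult_l_distr[of \<zero> \<zero> x] assms by simp
  then show ?thesis
    using assms by (metis M.add.l_cancel_one' M.r_zero R.zero_closed smult_closed)
qed

lemma (in lmodule) smult_minus_one:
  assumes "x \<in> carrier M" shows "(\<ominus> \<one>) \<odot>\<^bsub>M\<^esub> x = \<ominus>\<^bsub>M\<^esub> x"
proof -
  have "(\<ominus> \<one>) \<odot>\<^bsub>M\<^esub> x \<oplus>\<^bsub>M\<^esub> x = (\<ominus> \<one> \<oplus> \<one>) \<odot>\<^bsub>M\<^esub> x"
    using assms by (subst smult_l_distr) auto
  also have "\<dots> = \<zero>\<^bsub>M\<^esub>"
    using assms by (simp add: R.l_neg smult_l_null)
  finally show ?thesis
    using assms by (simp add: M.minus_equality)
qed

lemma (in lmodule) submoduleI: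
  assumes "H \<subseteq> carrier M" "\<zero>\<^bsub>M\<^esub> \<in> H"
    and add: "\<And>x y. \<lbrakk>x \<in> H; y \<in> H\<rbrakk> \<Longrightarrow> x \<oplus>\<^bsub>M\<^esub> y \<in> H"
    and smult: "\<And>a x. \<lbrakk>a \<in> carrier R; x \<in> H\<rbrakk> \<Longrightarrow> a \<odot>\<^bsub>M\<^esub> x \<in> H"
  shows "submodule H R M"
proof -
  have "\<ominus>\<^bsub>M\<^esub> x \<in> H" if "x \<in> H" for x
    using smult[of "\<ominus> \<one>" x] smult_minus_one[of x] that assms(1) by auto
  then show ?thesis
    using assms by (auto simp: submodule_def subgroup_def submodule_axioms_def a_inv_def)
qed

lemma (in lmodule) carrier_submodule: "submodule (carrier M) R M"
  by (rule submoduleI) auto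

text \<open>A finitely generated module injects into \<^typ>\<open>'a univ\<close> by sending \<open>x\<close> to the set of
  coefficient sequences that represent it.\<close>

lemma (in lmodule) fin_gen_inj:
  assumes "fin_gen R M"
  shows "\<exists>i :: 'm \<Rightarrow> 'a univ. inj_on i (carrier M)"
proof -
  obtain S where S: "finite S" "S \<subseteq> carrier M" "mod_span R M S = carrier M"
    using assms by (auto simp: fin_gen_def)
  obtain k :: nat and e where e: "S = e ` {i. i < k}"
    using S(1) by (metis finite_imp_nat_seg_image_inj_on)
  have eM: "e i \<in> carrier M" if "i < k" for i
    using that e S(2) by auto
  define comb where "comb c = (\<Oplus>\<^bsub>M\<^esub>i\<in>{..<k}. c i \<odot>\<^bsub>M\<^esub> e i)" for c
  define C where "C = (UNIV :: nat set) \<rightarrow> carrier R"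
  have terms: "(\<lambda>i. c i \<odot>\<^bsub>M\<^esub> e i) \<in> {..<k} \<rightarrow> carrier M" if "c \<in> C" for c
    using that eM by (auto simp: C_def)
  have comb_add: "comb (\<lambda>i. c i \<oplus> d i) = comb c \<oplus>\<^bsub>M\<^esub> comb d" if "c \<in> C" "d \<in> C" for c d
  proof -
    have "comb (\<lambda>i. c i \<oplus> d i) = (\<Oplus>\<^bsub>M\<^esub>i\<in>{..<k}. c i \<odot>\<^bsub>M\<^esub> e i \<oplus>\<^bsub>M\<^esub> d i \<odot>\<^bsub>M\<^esub> e i)"
      unfolding comb_def using that eM
      by (intro M.finsum_cong') (auto simp: C_def Pi_iff smult_l_distr)
    also have "\<dots> = comb c \<oplus>\<^bsub>M\<^esub> comb d"
      unfolding comb_def using terms that by (intro M.finsum_addf) auto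
    finally show ?thesis .
  qed
  have smult_sum: "a \<odot>\<^bsub>M\<^esub> (\<Oplus>\<^bsub>M\<^esub>i\<in>I. f i) = (\<Oplus>\<^bsub>M\<^esub>i\<in>I. a \<odot>\<^bsub>M\<^esub> f i)"
    if "finite I" "f \<in> I \<rightarrow> carrier M" "a \<in> carrier R" for a f and I :: "nat set"
    using that
  proof (induction I rule: finite_induct)
    case empty
    have "a \<odot>\<^bsub>M\<^esub> \<zero>\<^bsub>M\<^esub> \<oplus>\<^bsub>M\<^esub> a \<odot>\<^bsub>M\<^esub> \<zero>\<^bsub>M\<^esub> = a \<odot>\<^bsub>M\<^esub> \<zero>\<^bsub>M\<^esub> \<oplus>\<^bsub>M\<^esub> \<zero>\<^bsub>M\<^esub>"
      using smult_r_distr[of a "\<zero>\<^bsub>M\<^esub>" "\<zero>\<^bsub>M\<^esub>"] empty by simp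
    then show ?case
      using empty by (metis M.add.l_cancel_one' M.finsum_empty M.r_zero M.zero_closed smult_closed)
  next
    case (insert j I)
    then show ?case by (simp add: smult_r_distr Pi_iff)
  qed
  have comb_smult: "comb (\<lambda>i. a \<otimes> c i) = a \<odot>\<^bsub>M\<^esub> comb c" if "c \<in> C" "a \<in> carrier R" for a c
  proof -
    have "comb (\<lambda>i. a \<otimes> c i) = (\<Oplus>\<^bsub>M\<^esub>i\<in>{..<k}. a \<odot>\<^bsub>M\<^esub> (c i \<odot>\<^bsub>M\<^esub> e i))"
      unfolding comb_def using that eM
      by (intro M.finsum_cong') (auto simp: C_def Pi_iff smult_assoc1)
    also have "\<dots> = a \<odot>\<^bsub>M\<^esub> comb c"
      unfolding comb_def using smult_sum[OF _ terms] that by simp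
    finally show ?thesis .
  qed
  have "submodule (comb ` C) R M"
  proof (rule submoduleI)
    show "comb ` C \<subseteq> carrier M"
      using terms by (auto simp: comb_def intro!: M.finsum_closed)
    have z: "(\<lambda>i. \<zero>) \<in> C" by (simp add: C_def)
    have "comb (\<lambda>i. \<zero>) = \<zero>\<^bsub>M\<^esub>"
      unfolding comb_def using eM by (intro M.add.finprod_one_eqI) (auto simp: smult_l_null)
    then show "\<zero>\<^bsub>M\<^esub> \<in> comb ` C" using z by (metis imageI)
  next
    fix x y assume "x \<in> comb ` C" "y \<in> comb ` C"
    then obtain c d where cd: "c \<in> C" "d \<in> C" "x = comb c" "y = comb d" by auto
    then have "(\<lambda>i. c i \<oplus> d i) \<in> C" by (auto simp: C_def)
    then show "x \<oplus>\<^bsub>M\<^esub> y \<in> comb ` C" using comb_add[OF cd(1,2)] cd(3,4) by (intro image_eqI) auto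
  next
    fix a x assume ax: "a \<in> carrier R" "x \<in> comb ` C"
    then obtain c where c: "c \<in> C" "x = comb c" by auto
    then have "(\<lambda>i. a \<otimes> c i) \<in> C" using ax by (auto simp: C_def)
    then show "a \<odot>\<^bsub>M\<^esub> x \<in> comb ` C" using comb_smult[OF c(1) ax(1)] c(2) by (intro image_eqI) auto
  qed
  moreover have "S \<subseteq> comb ` C"
  proof
    fix x assume "x \<in> S"
    then obtain j where j: "j < k" "x = e j" using e by auto
    define c where "c i = (if i = j then \<one> else \<zero>)" for i
    have "comb c = (\<Oplus>\<^bsub>M\<^esub>i\<in>{..<k}. if j = i then e i else \<zero>\<^bsub>M\<^esub>)"
      unfolding comb_def c_def using eM
      by (intro M.finsum_cong') (auto simp: smult_l_null)
    also have "\<dots> = e j"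
      using j eM by (intro M.add.finprod_singleton) auto
    finally show "x \<in> comb ` C"
      using j by (auto simp: C_def c_def intro!: image_eqI[of _ _ c])
  qed
  ultimately have span: "carrier M \<subseteq> comb ` C"
    using S(3) by (auto simp: mod_span_def)
  have "inj_on (\<lambda>x. {c \<in> C. comb c = x}) (carrier M)"
  proof (rule inj_onI)
    fix x y assume "x \<in> carrier M" "y \<in> carrier M"
      and eq: "{c \<in> C. comb c = x} = {c \<in> C. comb c = y}"
    then obtain c where "c \<in> C" "comb c = x" using span by auto
    then show "x = y" using eq by blast
  qed
  then show ?thesis by blast
qed

lemma fg_module_univ:
  fixes M :: "('a, 'm) module"
  assumes "fg_module \<Lambda> M"
  shows "\<exists>M' :: ('a, 'a univ) module. fg_module \<Lambda> M' \<and> mod_isomorphic \<Lambda> M M'"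
proof -
  interpret lmodule \<Lambda> M using assms by (simp add: fg_module_def)
  have fg: "fin_gen \<Lambda> M" using assms by (simp add: fg_module_def)
  obtain i :: "'m \<Rightarrow> 'a univ" where inj: "inj_on i (carrier M)"
    using fin_gen_inj[OF fg] by blast
  define j where "j = the_inv_into (carrier M) i"
  have j [simp]: "j (i x) = x" if "x \<in> carrier M" for x
    using that inj by (simp add: j_def the_inv_into_f_f)
  define M' :: "('a, 'a univ) module" where
    "M' = \<lparr>carrier = i ` carrier M, monoid.mult = undefined, one = undefined,
     ring.zero = i \<zero>\<^bsub>M\<^esub>, add = (\<lambda>x y. i (j x \<oplus>\<^bsub>M\<^esub> j y)), smult = (\<lambda>a x. i (a \<odot>\<^bsub>M\<^esub> j x))\<rparr>"
  have [simp]: "carrier M' = i ` carrier M" "\<zero>\<^bsub>M'\<^esub> = i \<zero>\<^bsub>M\<^esub>"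
    "\<And>x y. x \<oplus>\<^bsub>M'\<^esub> y = i (j x \<oplus>\<^bsub>M\<^esub> j y)" "\<And>a x. a \<odot>\<^bsub>M'\<^esub> x = i (a \<odot>\<^bsub>M\<^esub> j x)"
    by (simp_all add: M'_def)
  have "abelian_group M'"
  proof (rule abelian_groupI)
    fix x assume "x \<in> carrier M'"
    then obtain u where "u \<in> carrier M" "x = i u" by auto
    then show "\<exists>y\<in>carrier M'. y \<oplus>\<^bsub>M'\<^esub> x = \<zero>\<^bsub>M'\<^esub>"
      by (auto intro!: bexI[of _ "\<ominus>\<^bsub>M\<^esub> u"] simp: M.l_neg)
  qed (auto simp: M.a_ac)
  then have lm: "lmodule \<Lambda> M'"
    using R.ring_axioms
    by (auto simp: lmodule_def lmodule_axioms_def smult_l_distr smult_r_distr smult_assoc1)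
  interpret M': lmodule \<Lambda> M' by (rule lm)
  have hom: "i \<in> mod_hom \<Lambda> M M'"
    by (auto simp: mod_hom_def hom_def)
  obtain S where S: "finite S" "S \<subseteq> carrier M" "mod_span \<Lambda> M S = carrier M"
    using fg by (auto simp: fin_gen_def)
  have "mod_span \<Lambda> M' (i ` S) = carrier M'"
  proof
    show "mod_span \<Lambda> M' (i ` S) \<subseteq> carrier M'"
      unfolding mod_span_def using M'.carrier_submodule S(2)
      by (intro Inter_lower CollectI conjI) auto
    show "carrier M' \<subseteq> mod_span \<Lambda> M' (i ` S)"
      unfolding mod_span_def
    proof (rule Inter_greatest)
      fix H assume "H \<in> {H. submodule H \<Lambda> M' \<and> i ` S \<subseteq> H}"
      then have H: "submodule H \<Lambda> M'" "i ` S \<subseteq> H" by auto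
      interpret H: submodule H \<Lambda> M' by (rule H(1))
      have "submodule {x \<in> carrier M. i x \<in> H} \<Lambda> M"
      proof (rule submoduleI)
        show "\<zero>\<^bsub>M\<^esub> \<in> {x \<in> carrier M. i x \<in> H}"
          using H.one_closed by simp
      next
        fix x y assume "x \<in> {x \<in> carrier M. i x \<in> H}" "y \<in> {x \<in> carrier M. i x \<in> H}"
        then show "x \<oplus>\<^bsub>M\<^esub> y \<in> {x \<in> carrier M. i x \<in> H}"
          using H.m_closed[of "i x" "i y"] by simp
      next
        fix a x assume "a \<in> carrier \<Lambda>" "x \<in> {x \<in> carrier M. i x \<in> H}"
        then show "a \<odot>\<^bsub>M\<^esub> x \<in> {x \<in> carrier M. i x \<in> H}"
          using H.smult_closed[of a "i x"] by simp
      qed auto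
      then have "carrier M \<subseteq> {x \<in> carrier M. i x \<in> H}"
        using S H(2) unfolding mod_span_def by blast
      then show "carrier M' \<subseteq> H" by auto
    qed
  qed
  then have "fin_gen \<Lambda> M'"
    unfolding fin_gen_def using S by (intro exI[of _ "i ` S"]) auto
  then have "fg_module \<Lambda> M'"
    using lm by (simp add: fg_module_def)
  moreover have "mod_isomorphic \<Lambda> M M'"
    unfolding mod_isomorphic_def using hom inj by (intro bexI[of _ i]) (simp_all add: bij_betw_def)
  ultimately show ?thesis by blast
qed


section \<open>Direct sums, projective and injective objects, the socle\<close>

definition direct_decomp ::
    "('a, 'k) ring_scheme \<Rightarrow> ('a, 'm) module \<Rightarrow> 'm set \<Rightarrow> 'm set \<Rightarrow> bool" where
  "direct_decomp \<Lambda> M A B \<longleftrightarrow> submodule A \<Lambda> M \<and> submodule B \<Lambda> M \<and>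
     A \<inter> B = {\<zero>\<^bsub>M\<^esub>} \<and> A <+>\<^bsub>M\<^esub> B = carrier M"

definition iso_to_direct_summand ::
    "('a, 'k) ring_scheme \<Rightarrow> ('a, 'l) module \<Rightarrow> ('a, 'm) module \<Rightarrow> bool" where
  "iso_to_direct_summand \<Lambda> L M \<longleftrightarrow>
     (\<exists>A B. direct_decomp \<Lambda> M A B \<and> mod_isomorphic \<Lambda> L (M\<lparr>carrier := A\<rparr>))"

definition indecomposable :: "('a, 'k) ring_scheme \<Rightarrow> ('a, 'm) module \<Rightarrow> bool" where
  "indecomposable \<Lambda> M \<longleftrightarrow> carrier M \<noteq> {\<zero>\<^bsub>M\<^esub>} \<and>
     (\<forall>A B. direct_decomp \<Lambda> M A B \<longrightarrow> A = {\<zero>\<^bsub>M\<^esub>} \<or> B = {\<zero>\<^bsub>M\<^esub>})"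

text \<open>Finitely generated projective modules, i.e. the objects of \<open>prj-\<Lambda>\<close>:\<close>

definition projective :: "('a, 'k) ring_scheme \<Rightarrow> ('a, 'p) module \<Rightarrow> bool" where
  "projective \<Lambda> P \<longleftrightarrow> fg_module \<Lambda> P \<and>
     (\<forall>(A :: ('a, 'a univ) module) (B :: ('a, 'a univ) module).
        \<forall>g\<in>mod_hom \<Lambda> A B. \<forall>f\<in>mod_hom \<Lambda> P B.
        fg_module \<Lambda> A \<longrightarrow> fg_module \<Lambda> B \<longrightarrow> g ` carrier A = carrier B \<longrightarrow>
          (\<exists>h\<in>mod_hom \<Lambda> P A. \<forall>x\<in>carrier P. g (h x) = f x))"

text \<open>Injective objects of \<open>mod-R\<close>, and injective envelopes in \<open>mod-R\<close>:\<close>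

definition injective :: "('r, 'k) ring_scheme \<Rightarrow> ('r, 'j) module \<Rightarrow> bool" where
  "injective R J \<longleftrightarrow> fg_module R J \<and>
     (\<forall>(A :: ('r, 'r univ) module) (B :: ('r, 'r univ) module).
        \<forall>g\<in>mod_hom R A B. \<forall>f\<in>mod_hom R A J.
        fg_module R A \<longrightarrow> fg_module R B \<longrightarrow> inj_on g (carrier A) \<longrightarrow>
          (\<exists>h\<in>mod_hom R B J. \<forall>x\<in>carrier A. h (g x) = f x))"

definition injective_envelope ::
    "('r, 'k) ring_scheme \<Rightarrow> ('r, 'm) module \<Rightarrow> ('r, 'j) module \<Rightarrow> bool" where
  "injective_envelope R M J \<longleftrightarrow> injective R J \<and>
     (\<exists>i\<in>mod_hom R M J. inj_on i (carrier M) \<and>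
        (\<forall>H. submodule H R J \<longrightarrow> H \<inter> i ` carrier M = {\<zero>\<^bsub>J\<^esub>} \<longrightarrow> H = {\<zero>\<^bsub>J\<^esub>}))"

definition simple_submodule :: "('a, 'k) ring_scheme \<Rightarrow> ('a, 'm) module \<Rightarrow> 'm set \<Rightarrow> bool" where
  "simple_submodule \<Lambda> M S \<longleftrightarrow> submodule S \<Lambda> M \<and> S \<noteq> {\<zero>\<^bsub>M\<^esub>} \<and>
     (\<forall>T. submodule T \<Lambda> M \<longrightarrow> T \<subseteq> S \<longrightarrow> T = {\<zero>\<^bsub>M\<^esub>} \<or> T = S)"

definition socle :: "('a, 'k) ring_scheme \<Rightarrow> ('a, 'm) module \<Rightarrow> 'm set" where
  "socle \<Lambda> M = mod_span \<Lambda> M (\<Union>{S. simple_submodule \<Lambda> M S})"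


section \<open>Artin algebras, their duality, and the Nakayama functor\<close>

definition artinian :: "('r, 'k) ring_scheme \<Rightarrow> bool" where
  "artinian R \<longleftrightarrow> (\<forall>I :: nat \<Rightarrow> 'r set. (\<forall>n. ideal (I n) R \<and> I (Suc n) \<subseteq> I n) \<longrightarrow>
     (\<exists>n. \<forall>m\<ge>n. I m = I n))"

definition restrict_scalars :: "('r \<Rightarrow> 'a) \<Rightarrow> ('a, 'm) module \<Rightarrow> ('r, 'm) module" where
  "restrict_scalars \<phi> M = \<lparr>carrier = carrier M, monoid.mult = monoid.mult M, one = one M,
     ring.zero = ring.zero M, add = add M, smult = (\<lambda>r x. \<phi> r \<odot>\<^bsub>M\<^esub> x)\<rparr>"

text \<open>\<open>\<phi>\<close> is the structure map of the \<open>R\<close>-algebra \<open>\<Lambda>\<close>.\<close>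

locale artin_algebra = R: cring R + \<Lambda>: ring \<Lambda>
  for R :: "'r ring" and \<Lambda> :: "'a ring" and \<phi> :: "'r \<Rightarrow> 'a" +
  assumes artinian_base: "artinian R"
    and structure_hom: "\<phi> \<in> ring_hom R \<Lambda>"
    and central: "\<lbrakk>r \<in> carrier R; a \<in> carrier \<Lambda>\<rbrakk> \<Longrightarrow> \<phi> r \<otimes>\<^bsub>\<Lambda>\<^esub> a = a \<otimes>\<^bsub>\<Lambda>\<^esub> \<phi> r"
    and finite_over_base: "fin_gen R (restrict_scalars \<phi> (regular_module \<Lambda>))"

definition jacobson_radical :: "('r, 'k) ring_scheme \<Rightarrow> 'r set" where
  "jacobson_radical R = carrier R \<inter> \<Inter>{I. maximalideal I R}"

text \<open>
  The duality \<open>D\<close> of an Artin \<open>R\<close>-algebra is \<open>Hom\<^sub>R(-, J)\<close>, where \<open>J\<close> is the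
  injective envelope of \<open>R / rad R\<close>.
\<close>

definition dualizing_module :: "('r, 'k) ring_scheme \<Rightarrow> ('r, 'j) module \<Rightarrow> bool" where
  "dualizing_module R J \<longleftrightarrow>
     injective_envelope R (quot_module (regular_module R) (jacobson_radical R)) J"

definition op_ring :: "'a ring \<Rightarrow> 'a ring" where
  "op_ring \<Lambda> = \<Lambda>\<lparr>monoid.mult := \<lambda>x y. y \<otimes>\<^bsub>\<Lambda>\<^esub> x\<rparr>"

text \<open>
  \<open>Hom\<^sub>\<Lambda>(Y, \<Lambda>)\<close> as a right \<open>\<Lambda>\<close>-module, i.e. a left module over \<open>op_ring \<Lambda>\<close>:
  \<open>(f a) x = (f x) a\<close>.  In both Hom modules homomorphisms are represented by functions that are
  \<open>undefined\<close> outside the carrier.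
\<close>

definition ring_dual :: "'a ring \<Rightarrow> ('a, 'x) module \<Rightarrow> ('a, 'x \<Rightarrow> 'a) module" where
  "ring_dual \<Lambda> Y = \<lparr>carrier = mod_hom \<Lambda> Y (regular_module \<Lambda>) \<inter> extensional (carrier Y),
     monoid.mult = undefined, one = undefined,
     ring.zero = (\<lambda>x\<in>carrier Y. \<zero>\<^bsub>\<Lambda>\<^esub>),
     add = (\<lambda>f g. \<lambda>x\<in>carrier Y. f x \<oplus>\<^bsub>\<Lambda>\<^esub> g x),
     smult = (\<lambda>a f. \<lambda>x\<in>carrier Y. f x \<otimes>\<^bsub>\<Lambda>\<^esub> a)\<rparr>"

text \<open>
  \<open>D Y = Hom\<^sub>R(Y, J)\<close> for a right \<open>\<Lambda>\<close>-module \<open>Y\<close>, given as a left module over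
  \<open>op_ring \<Lambda>\<close>.  It is a left \<open>\<Lambda>\<close>-module by \<open>(a f) y = f (y a)\<close>.
\<close>

definition duality ::
    "'r ring \<Rightarrow> ('r \<Rightarrow> 'a) \<Rightarrow> ('r, 'j) module \<Rightarrow> ('a, 'y) module \<Rightarrow> ('a, 'y \<Rightarrow> 'j) module" where
  "duality R \<phi> J Y = \<lparr>carrier = mod_hom R (restrict_scalars \<phi> Y) J \<inter> extensional (carrier Y),
     monoid.mult = undefined, one = undefined,
     ring.zero = (\<lambda>y\<in>carrier Y. \<zero>\<^bsub>J\<^esub>),
     add = (\<lambda>f g. \<lambda>y\<in>carrier Y. f y \<oplus>\<^bsub>J\<^esub> g y),
     smult = (\<lambda>a f. \<lambda>y\<in>carrier Y. f (a \<odot>\<^bsub>Y\<^esub> y))\<rparr>"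

definition nakayama ::
    "'r ring \<Rightarrow> 'a ring \<Rightarrow> ('r \<Rightarrow> 'a) \<Rightarrow> ('r, 'j) module \<Rightarrow> ('a, 'x) module
      \<Rightarrow> ('a, ('x \<Rightarrow> 'a) \<Rightarrow> 'j) module" where
  "nakayama R \<Lambda> \<phi> J Y = duality R \<phi> J (ring_dual \<Lambda> Y)"


section \<open>Almost split sequences\<close>

definition short_exact ::
    "('a, 'k) ring_scheme \<Rightarrow> ('a, 'l) module \<Rightarrow> ('l \<Rightarrow> 'n) \<Rightarrow> ('a, 'n) module \<Rightarrow> ('n \<Rightarrow> 'm)
      \<Rightarrow> ('a, 'm) module \<Rightarrow> bool" where
  "short_exact \<Lambda> L a N b M \<longleftrightarrow> a \<in> mod_hom \<Lambda> L N \<and> b \<in> mod_hom \<Lambda> N M \<and>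
     inj_on a (carrier L) \<and> a ` carrier L = a_kernel N M b \<and> b ` carrier N = carrier M"

definition split_mono ::
    "('a, 'k) ring_scheme \<Rightarrow> ('a, 'l) module \<Rightarrow> ('a, 'n) module \<Rightarrow> ('l \<Rightarrow> 'n) \<Rightarrow> bool" where
  "split_mono \<Lambda> L N a \<longleftrightarrow> a \<in> mod_hom \<Lambda> L N \<and> (\<exists>r\<in>mod_hom \<Lambda> N L. \<forall>x\<in>carrier L. r (a x) = x)"

definition split_epi ::
    "('a, 'k) ring_scheme \<Rightarrow> ('a, 'n) module \<Rightarrow> ('a, 'm) module \<Rightarrow> ('n \<Rightarrow> 'm) \<Rightarrow> bool" where
  "split_epi \<Lambda> N M b \<longleftrightarrow> b \<in> mod_hom \<Lambda> N M \<and> (\<exists>s\<in>mod_hom \<Lambda> M N. \<forall>x\<in>carrier M. b (s x) = x)"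

definition left_almost_split ::
    "('a, 'k) ring_scheme \<Rightarrow> ('a, 'l) module \<Rightarrow> ('a, 'n) module \<Rightarrow> ('l \<Rightarrow> 'n) \<Rightarrow> bool" where
  "left_almost_split \<Lambda> L N a \<longleftrightarrow> a \<in> mod_hom \<Lambda> L N \<and> \<not> split_mono \<Lambda> L N a \<and>
     (\<forall>Y :: ('a, 'a univ) module. \<forall>f\<in>mod_hom \<Lambda> L Y.
        fg_module \<Lambda> Y \<longrightarrow> \<not> split_mono \<Lambda> L Y f \<longrightarrow>
          (\<exists>h\<in>mod_hom \<Lambda> N Y. \<forall>x\<in>carrier L. h (a x) = f x))"

definition right_almost_split ::
    "('a, 'k) ring_scheme \<Rightarrow> ('a, 'n) module \<Rightarrow> ('a, 'm) module \<Rightarrow> ('n \<Rightarrow> 'm) \<Rightarrow> bool" where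
  "right_almost_split \<Lambda> N M b \<longleftrightarrow> b \<in> mod_hom \<Lambda> N M \<and> \<not> split_epi \<Lambda> N M b \<and>
     (\<forall>Y :: ('a, 'a univ) module. \<forall>f\<in>mod_hom \<Lambda> Y M.
        fg_module \<Lambda> Y \<longrightarrow> \<not> split_epi \<Lambda> Y M f \<longrightarrow>
          (\<exists>h\<in>mod_hom \<Lambda> Y N. \<forall>y\<in>carrier Y. b (h y) = f y))"

definition almost_split_sequence ::
    "('a, 'k) ring_scheme \<Rightarrow> ('a, 'l) module \<Rightarrow> ('l \<Rightarrow> 'n) \<Rightarrow> ('a, 'n) module \<Rightarrow> ('n \<Rightarrow> 'm)
      \<Rightarrow> ('a, 'm) module \<Rightarrow> bool" where
  "almost_split_sequence \<Lambda> L a N b M \<longleftrightarrow>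
     fg_module \<Lambda> L \<and> fg_module \<Lambda> N \<and> fg_module \<Lambda> M \<and> short_exact \<Lambda> L a N b M \<and>
     left_almost_split \<Lambda> L N a \<and> right_almost_split \<Lambda> N M b"


section \<open>The Grothendieck group of \<open>prj-\<Lambda>\<close> and g-vectors\<close>

text \<open>
  The generators are the projective modules on the type \<^typ>\<open>'a univ\<close> and the relations are
  \<open>[E] = [A] + [C]\<close> for split exact sequences \<open>0 \<rightarrow> A \<rightarrow> E \<rightarrow> C \<rightarrow> 0\<close>; taking
  \<open>C = 0\<close> identifies isomorphic modules.
\<close>

definition K0_relations ::
    "('a, 'k) ring_scheme \<Rightarrow> (('a, 'a univ) module \<Rightarrow>\<^sub>0 int) set" where
  "K0_relations \<Lambda> = {frag_of E - frag_of A - frag_of C | A E C.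
     projective \<Lambda> A \<and> projective \<Lambda> E \<and> projective \<Lambda> C \<and>
     (\<exists>f g. short_exact \<Lambda> A f E g C \<and> split_epi \<Lambda> E C g)}"

definition free_on_prj :: "('a, 'k) ring_scheme \<Rightarrow> (('a, 'a univ) module \<Rightarrow>\<^sub>0 int) monoid" where
  "free_on_prj \<Lambda> = free_Abelian_group {P :: ('a, 'a univ) module. projective \<Lambda> P}"

definition K0_subgroup :: "('a, 'k) ring_scheme \<Rightarrow> (('a, 'a univ) module \<Rightarrow>\<^sub>0 int) set" where
  "K0_subgroup \<Lambda> = generate (free_on_prj \<Lambda>) (K0_relations \<Lambda>)"

text \<open>
  An abelian group in the multiplicative notation of the library: below, \<open>\<otimes>\<close>, \<open>inv\<close>,
  \<open>[^]\<close> and \<open>\<Otimes>\<close> are the sum, the negative, integer multiples and finite sums in \<open>K\<^sub>0\<close>.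
\<close>

definition K0_prj :: "('a, 'k) ring_scheme \<Rightarrow> (('a, 'a univ) module \<Rightarrow>\<^sub>0 int) set monoid" where
  "K0_prj \<Lambda> = free_on_prj \<Lambda> Mod K0_subgroup \<Lambda>"

definition K0_class ::
    "('a, 'k) ring_scheme \<Rightarrow> ('a, 'a univ) module \<Rightarrow> (('a, 'a univ) module \<Rightarrow>\<^sub>0 int) set" where
  "K0_class \<Lambda> P = K0_subgroup \<Lambda> #>\<^bsub>free_on_prj \<Lambda>\<^esub> frag_of P"

definition complete_indec_projectives ::
    "('a, 'k) ring_scheme \<Rightarrow> nat \<Rightarrow> (nat \<Rightarrow> ('a, 'a univ) module) \<Rightarrow> bool" where
  "complete_indec_projectives \<Lambda> n P \<longleftrightarrow>
     (\<forall>i\<in>{1..n}. projective \<Lambda> (P i) \<and> indecomposable \<Lambda> (P i)) \<and>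
     (\<forall>i\<in>{1..n}. \<forall>j\<in>{1..n}. mod_isomorphic \<Lambda> (P i) (P j) \<longrightarrow> i = j) \<and>
     (\<forall>Q :: ('a, 'a univ) module. projective \<Lambda> Q \<and> indecomposable \<Lambda> Q \<longrightarrow>
        (\<exists>i\<in>{1..n}. mod_isomorphic \<Lambda> Q (P i)))"

definition projective_cover ::
    "('a, 'k) ring_scheme \<Rightarrow> ('a, 'p) module \<Rightarrow> ('p \<Rightarrow> 'm) \<Rightarrow> ('a, 'm) module \<Rightarrow> bool" where
  "projective_cover \<Lambda> P p M \<longleftrightarrow> projective \<Lambda> P \<and> p \<in> mod_hom \<Lambda> P M \<and>
     p ` carrier P = carrier M \<and>
     (\<forall>H. submodule H \<Lambda> P \<longrightarrow> p ` H = carrier M \<longrightarrow> H = carrier P)"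

text \<open>\<open>Q \<rightarrow> P \<rightarrow> M \<rightarrow> 0\<close> with maps \<open>d\<close> and \<open>p\<close>; exactness at \<open>P\<close> is
  surjectivity of \<open>d\<close> onto the kernel of \<open>p\<close>.\<close>

definition minimal_projective_presentation ::
    "('a, 'k) ring_scheme \<Rightarrow> ('a, 'q) module \<Rightarrow> ('q \<Rightarrow> 'p) \<Rightarrow> ('a, 'p) module \<Rightarrow> ('p \<Rightarrow> 'm)
      \<Rightarrow> ('a, 'm) module \<Rightarrow> bool" where
  "minimal_projective_presentation \<Lambda> Q d P p M \<longleftrightarrow>
     projective_cover \<Lambda> P p M \<and> projective_cover \<Lambda> Q d (P\<lparr>carrier := a_kernel P M p\<rparr>)"

definition is_g_vector ::
    "('a, 'k) ring_scheme \<Rightarrow> nat \<Rightarrow> (nat \<Rightarrow> ('a, 'a univ) module) \<Rightarrow> ('a, 'm) module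
      \<Rightarrow> (nat \<Rightarrow> int) \<Rightarrow> bool" where
  "is_g_vector \<Lambda> n P M g \<longleftrightarrow> g \<in> extensional {1..n} \<and>
     (\<exists>P1 d P0 p. minimal_projective_presentation \<Lambda> P1 d P0 p M \<and>
        K0_class \<Lambda> P0 \<otimes>\<^bsub>K0_prj \<Lambda>\<^esub> inv\<^bsub>K0_prj \<Lambda>\<^esub> K0_class \<Lambda> P1 =
          (\<Otimes>\<^bsub>K0_prj \<Lambda>\<^esub>i\<in>{1..n}. K0_class \<Lambda> (P i) [^]\<^bsub>K0_prj \<Lambda>\<^esub> g i))"

definition g_vector ::
    "('a, 'k) ring_scheme \<Rightarrow> nat \<Rightarrow> (nat \<Rightarrow> ('a, 'a univ) module) \<Rightarrow> ('a, 'm) module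
      \<Rightarrow> nat \<Rightarrow> int" where
  "g_vector \<Lambda> n P M = (THE g. is_g_vector \<Lambda> n P M g)"

end

theory Submission
  imports Defs
begin

text \<open>
  Let \<open>I = \<nu>\<Lambda>\<close> and let \<open>T\<close> be its socle.  \<open>I\<close> is an injective cogenerator, so \<open>T\<close> is semisimple and every
  simple module embeds in \<open>T\<close>.  By hypothesis no homomorphism \<open>L \<rightarrow> I / T\<close> is a split monomorphism, so all of
  them factor through \<open>a\<close>; since \<open>Ext\<^sup>1(-, T)\<close> is a quotient of \<open>Hom(-, I / T)\<close>, the map
  \<open>Ext\<^sup>1(N, T) \<rightarrow> Ext\<^sup>1(L, T)\<close> is surjective.

  The projective covers of \<open>L\<close> and \<open>M\<close> give by the horseshoe construction a surjection from a projective module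
  onto \<open>N\<close> whose kernel \<open>K\<close> is an extension of the first syzygies of \<open>M\<close> and \<open>L\<close>.  Surjectivity on \<open>Ext\<^sup>1\<close>
  says that homomorphisms from the syzygy of \<open>L\<close> to \<open>T\<close> extend to \<open>K\<close>, and this makes the sum of the
  projective covers of the two syzygies a projective cover of \<open>K\<close>.  The resulting presentation of \<open>N\<close> need not be
  minimal, but it differs from a minimal one by adding the same projective module to both terms, which cancels in
  the g-vector.

  That g-vectors are well defined rests on the linear independence of the classes of the indecomposable
  projective modules; it is detected by the multiplicity of \<open>U / rad U\<close> in the largest semisimple quotient, which is
  additive.
\<close>


section \<open>Submodules and homomorphisms\<close>

text \<open>The socle \<open>T\<close> of \<open>\<nu>\<Lambda>\<close> serves as a test object: a
  submodule \<open>H\<close> of a finitely generated module is proper exactly if some nonzero map to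
  \<open>T\<close> vanishes on \<open>H\<close>. Minimality of a cover thereby becomes a question
  about maps to \<open>T\<close>, and this is what the almost split property, a statement about
  extending maps out of \<open>L\<close>, can answer. All properties of
  \<open>\<nu>\<Lambda>\<close> come from the adjunction
  \<open>Hom_\<Lambda>(B, \<nu>\<Lambda>) = Hom_R(B, J)\<close>, which reduces them to properties of
  \<open>J\<close> over the commutative ring \<open>R\<close>. Minimality can only be secured at the
  second term: nothing prevents the projective cover of \<open>N\<close> from being smaller than the
  sum of those of \<open>L\<close> and \<open>M\<close>. Hence g-vectors must be readable from
  presentations whose first map is merely onto. The formal obstacle is that the definitions quantify
  over modules on the one type \<open>'a univ\<close>, while direct sums, quotients and
  \<open>\<nu>\<close> change the type of elements. Modules are therefore copied into
  \<open>'a univ\<close> whenever such a quantifier is met. All finiteness arguments go through the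
  length of modules.\<close>

lemma mod_hom_iff:
  "f \<in> mod_hom \<Lambda> M N \<longleftrightarrow> (\<forall>x\<in>carrier M. f x \<in> carrier N) \<and>
     (\<forall>x\<in>carrier M. \<forall>y\<in>carrier M. f (x \<oplus>\<^bsub>M\<^esub> y) = f x \<oplus>\<^bsub>N\<^esub> f y) \<and>
     (\<forall>a\<in>carrier \<Lambda>. \<forall>x\<in>carrier M. f (a \<odot>\<^bsub>M\<^esub> x) = a \<odot>\<^bsub>N\<^esub> f x)"
  by (auto simp: mod_hom_def hom_def)

lemma mod_homI:
  assumes "\<And>x. x \<in> carrier M \<Longrightarrow> f x \<in> carrier N"
    and "\<And>x y. \<lbrakk>x \<in> carrier M; y \<in> carrier M\<rbrakk> \<Longrightarrow> f (x \<oplus>\<^bsub>M\<^esub> y) = f x \<oplus>\<^bsub>N\<^esub> f y"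
    and "\<And>a x. \<lbrakk>a \<in> carrier \<Lambda>; x \<in> carrier M\<rbrakk> \<Longrightarrow> f (a \<odot>\<^bsub>M\<^esub> x) = a \<odot>\<^bsub>N\<^esub> f x"
  shows "f \<in> mod_hom \<Lambda> M N"
  using assms by (simp add: mod_hom_iff)

lemma mod_hom_closed: "\<lbrakk>f \<in> mod_hom \<Lambda> M N; x \<in> carrier M\<rbrakk> \<Longrightarrow> f x \<in> carrier N"
  and mod_hom_add: "\<lbrakk>f \<in> mod_hom \<Lambda> M N; x \<in> carrier M; y \<in> carrier M\<rbrakk> \<Longrightarrow>
    f (x \<oplus>\<^bsub>M\<^esub> y) = f x \<oplus>\<^bsub>N\<^esub> f y"
  and mod_hom_smult: "\<lbrakk>f \<in> mod_hom \<Lambda> M N; a \<in> carrier \<Lambda>; x \<in> carrier M\<rbrakk> \<Longrightarrow>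
    f (a \<odot>\<^bsub>M\<^esub> x) = a \<odot>\<^bsub>N\<^esub> f x"
  by (simp_all add: mod_hom_iff)

lemma lmoduleI:
  fixes \<Lambda> (structure) and M (structure)
  assumes "ring \<Lambda>" and "abelian_group M"
    and "\<And>a x. \<lbrakk>a \<in> carrier \<Lambda>; x \<in> carrier M\<rbrakk> \<Longrightarrow> a \<odot>\<^bsub>M\<^esub> x \<in> carrier M"
    and "\<And>a b x. \<lbrakk>a \<in> carrier \<Lambda>; b \<in> carrier \<Lambda>; x \<in> carrier M\<rbrakk> \<Longrightarrow>
        (a \<oplus>\<^bsub>\<Lambda>\<^esub> b) \<odot>\<^bsub>M\<^esub> x = a \<odot>\<^bsub>M\<^esub> x \<oplus>\<^bsub>M\<^esub> b \<odot>\<^bsub>M\<^esub> x"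
    and "\<And>a x y. \<lbrakk>a \<in> carrier \<Lambda>; x \<in> carrier M; y \<in> carrier M\<rbrakk> \<Longrightarrow>
        a \<odot>\<^bsub>M\<^esub> (x \<oplus>\<^bsub>M\<^esub> y) = a \<odot>\<^bsub>M\<^esub> x \<oplus>\<^bsub>M\<^esub> a \<odot>\<^bsub>M\<^esub> y"
    and "\<And>a b x. \<lbrakk>a \<in> carrier \<Lambda>; b \<in> carrier \<Lambda>; x \<in> carrier M\<rbrakk> \<Longrightarrow>
        (a \<otimes>\<^bsub>\<Lambda>\<^esub> b) \<odot>\<^bsub>M\<^esub> x = a \<odot>\<^bsub>M\<^esub> (b \<odot>\<^bsub>M\<^esub> x)"
    and "\<And>x. x \<in> carrier M \<Longrightarrow> \<one>\<^bsub>\<Lambda>\<^esub> \<odot>\<^bsub>M\<^esub> x = x"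
  shows "lmodule \<Lambda> M"
  using assms by (simp add: lmodule_def lmodule_axioms_def)

lemma (in abelian_group) minus_eq_zero_iff:
  assumes "x \<in> carrier G" "y \<in> carrier G"
  shows "x \<ominus> y = \<zero> \<longleftrightarrow> x = y"
  using assms by (metis a_minus_def a_inv_closed minus_equality minus_minus r_neg)

lemma (in abelian_group) add_diff_cancel:
  "\<lbrakk>x \<in> carrier G; y \<in> carrier G\<rbrakk> \<Longrightarrow> x \<oplus> (y \<ominus> x) = y"
  using a_lcomm[of x y "\<ominus> x"] by (simp add: a_minus_def r_neg)

lemma (in lmodule) smult_r_null:
  assumes "a \<in> carrier R" shows "a \<odot>\<^bsub>M\<^esub> \<zero>\<^bsub>M\<^esub> = \<zero>\<^bsub>M\<^esub>"
proof -
  have "a \<odot>\<^bsub>M\<^esub> \<zero>\<^bsub>M\<^esub> \<oplus>\<^bsub>M\<^esub> a \<odot>\<^bsub>M\<^esub> \<zero>\<^bsub>M\<^esub> = a \<odot>\<^bsub>M\<^esub> \<zero>\<^bsub>M\<^esub> \<oplus>\<^bsub>M\<^esub> \<zero>\<^bsub>M\<^esub>"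
    using smult_r_distr[of a "\<zero>\<^bsub>M\<^esub>" "\<zero>\<^bsub>M\<^esub>"] assms by simp
  then show ?thesis
    using assms by (metis M.add.l_cancel_one' M.r_zero M.zero_closed smult_closed)
qed

lemma (in lmodule) smult_r_minus:
  assumes "a \<in> carrier R" "x \<in> carrier M" shows "a \<odot>\<^bsub>M\<^esub> (\<ominus>\<^bsub>M\<^esub> x) = \<ominus>\<^bsub>M\<^esub> (a \<odot>\<^bsub>M\<^esub> x)"
proof -
  have "a \<odot>\<^bsub>M\<^esub> (\<ominus>\<^bsub>M\<^esub> x) \<oplus>\<^bsub>M\<^esub> a \<odot>\<^bsub>M\<^esub> x = a \<odot>\<^bsub>M\<^esub> (\<ominus>\<^bsub>M\<^esub> x \<oplus>\<^bsub>M\<^esub> x)"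
    using assms by (subst smult_r_distr) auto
  also have "\<dots> = \<zero>\<^bsub>M\<^esub>" using assms by (simp add: M.l_neg smult_r_null)
  finally show ?thesis using assms by (simp add: M.minus_equality)
qed

lemma (in lmodule) smult_r_diff:
  assumes "a \<in> carrier R" "x \<in> carrier M" "y \<in> carrier M"
  shows "a \<odot>\<^bsub>M\<^esub> (x \<ominus>\<^bsub>M\<^esub> y) = a \<odot>\<^bsub>M\<^esub> x \<ominus>\<^bsub>M\<^esub> a \<odot>\<^bsub>M\<^esub> y"
  using assms by (simp add: a_minus_def smult_r_distr smult_r_minus)

lemma (in lmodule) submodule_iff:
  "submodule H R M \<longleftrightarrow> H \<subseteq> carrier M \<and> \<zero>\<^bsub>M\<^esub> \<in> H \<and>
     (\<forall>x\<in>H. \<forall>y\<in>H. x \<oplus>\<^bsub>M\<^esub> y \<in> H) \<and> (\<forall>a\<in>carrier R. \<forall>x\<in>H. a \<odot>\<^bsub>M\<^esub> x \<in> H)"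
proof
  assume "submodule H R M"
  then interpret submodule H R M .
  show "H \<subseteq> carrier M \<and> \<zero>\<^bsub>M\<^esub> \<in> H \<and>
     (\<forall>x\<in>H. \<forall>y\<in>H. x \<oplus>\<^bsub>M\<^esub> y \<in> H) \<and> (\<forall>a\<in>carrier R. \<forall>x\<in>H. a \<odot>\<^bsub>M\<^esub> x \<in> H)"
    using subset one_closed m_closed smult_closed by auto
next
  assume "H \<subseteq> carrier M \<and> \<zero>\<^bsub>M\<^esub> \<in> H \<and>
     (\<forall>x\<in>H. \<forall>y\<in>H. x \<oplus>\<^bsub>M\<^esub> y \<in> H) \<and> (\<forall>a\<in>carrier R. \<forall>x\<in>H. a \<odot>\<^bsub>M\<^esub> x \<in> H)"
  then show "submodule H R M" by (intro submoduleI) auto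
qed

lemma submodule_subset: "submodule H \<Lambda> M \<Longrightarrow> H \<subseteq> carrier M"
  and submodule_zero: "submodule H \<Lambda> M \<Longrightarrow> \<zero>\<^bsub>M\<^esub> \<in> H"
  and submodule_add: "\<lbrakk>submodule H \<Lambda> M; x \<in> H; y \<in> H\<rbrakk> \<Longrightarrow> x \<oplus>\<^bsub>M\<^esub> y \<in> H"
  and submodule_smult: "\<lbrakk>submodule H \<Lambda> M; a \<in> carrier \<Lambda>; x \<in> H\<rbrakk> \<Longrightarrow> a \<odot>\<^bsub>M\<^esub> x \<in> H"
  and submodule_minus: "\<lbrakk>submodule H \<Lambda> M; x \<in> H\<rbrakk> \<Longrightarrow> \<ominus>\<^bsub>M\<^esub> x \<in> H"
  using subgroup.subset[of H "add_monoid M"] subgroup.one_closed[of H "add_monoid M"]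
    subgroup.m_closed[of H "add_monoid M"] subgroup.m_inv_closed[of H "add_monoid M"]
  by (auto simp: submodule_def submodule_axioms_def a_inv_def)

lemma submodule_diff:
  "\<lbrakk>submodule H \<Lambda> M; x \<in> H; y \<in> H\<rbrakk> \<Longrightarrow> x \<ominus>\<^bsub>M\<^esub> y \<in> H"
  by (simp add: a_minus_def submodule_add submodule_minus)

lemma submodule_carrier: "lmodule \<Lambda> M \<Longrightarrow> submodule (carrier M) \<Lambda> M"
  by (rule lmodule.carrier_submodule)

lemma submodule_trivial: "lmodule \<Lambda> M \<Longrightarrow> submodule {\<zero>\<^bsub>M\<^esub>} \<Lambda> M"
proof -
  assume "lmodule \<Lambda> M"
  then interpret lmodule \<Lambda> M .
  show ?thesis by (rule submoduleI) (auto simp: smult_r_null)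
qed

lemma lmodule_submodule:
  assumes "lmodule \<Lambda> M" "submodule H \<Lambda> M"
  shows "lmodule \<Lambda> (M\<lparr>carrier := H\<rparr>)"
proof -
  interpret lmodule \<Lambda> M by fact
  note H = submodule_subset[OF assms(2)] submodule_zero[OF assms(2)] submodule_add[OF assms(2)]
    submodule_smult[OF assms(2)] submodule_minus[OF assms(2)]
  show ?thesis
  proof (rule lmoduleI)
    show "abelian_group (M\<lparr>carrier := H\<rparr>)"
    proof (rule abelian_groupI)
      fix x assume "x \<in> carrier (M\<lparr>carrier := H\<rparr>)"
      then show "\<exists>y\<in>carrier (M\<lparr>carrier := H\<rparr>). y \<oplus>\<^bsub>M\<lparr>carrier := H\<rparr>\<^esub> x = \<zero>\<^bsub>M\<lparr>carrier := H\<rparr>\<^esub>"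
        using H by (intro bexI[of _ "\<ominus>\<^bsub>M\<^esub> x"]) (auto simp: M.l_neg)
    qed (use H in \<open>auto simp: M.a_ac subset_iff\<close>)
  qed (use H R.ring_axioms in \<open>auto simp: smult_l_distr smult_r_distr smult_assoc1 subset_iff\<close>)
qed

lemma submodule_submodule_iff:
  assumes "lmodule \<Lambda> M" "submodule H \<Lambda> M"
  shows "submodule X \<Lambda> (M\<lparr>carrier := H\<rparr>) \<longleftrightarrow> submodule X \<Lambda> M \<and> X \<subseteq> H"
proof -
  interpret M: lmodule \<Lambda> M by fact
  interpret H: lmodule \<Lambda> "M\<lparr>carrier := H\<rparr>" by (rule lmodule_submodule) fact+
  show ?thesis
    unfolding M.submodule_iff H.submodule_iff using submodule_subset[OF assms(2)] by auto
qed

lemma submodule_Int: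
  assumes "lmodule \<Lambda> M" "submodule A \<Lambda> M" "submodule B \<Lambda> M"
  shows "submodule (A \<inter> B) \<Lambda> M"
  using assms by (auto simp: lmodule.submodule_iff)

lemma submodule_mod_span:
  assumes "lmodule \<Lambda> M" "S \<subseteq> carrier M"
  shows "submodule (mod_span \<Lambda> M S) \<Lambda> M"
proof -
  interpret lmodule \<Lambda> M by fact
  show ?thesis
    unfolding mod_span_def submodule_iff using carrier_submodule assms(2)
    by (auto simp: submodule_iff)
qed

lemma mod_span_superset: "S \<subseteq> mod_span \<Lambda> M S"
  by (auto simp: mod_span_def)

lemma mod_span_least: "\<lbrakk>submodule H \<Lambda> M; S \<subseteq> H\<rbrakk> \<Longrightarrow> mod_span \<Lambda> M S \<subseteq> H"
  by (auto simp: mod_span_def)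

text \<open>The same set as the \<open><+>\<close> in \<open>direct_decomp\<close>, written as a
  comprehension so that membership unfolds at once to a pair of summands.\<close>

definition sum_sub :: "('a, 'm) module \<Rightarrow> 'm set \<Rightarrow> 'm set \<Rightarrow> 'm set" where
  "sum_sub M A B = {x \<oplus>\<^bsub>M\<^esub> y | x y. x \<in> A \<and> y \<in> B}"

lemma set_add_eq_sum_sub: "A <+>\<^bsub>M\<^esub> B = sum_sub M A B"
  by (auto simp: set_add_def' sum_sub_def)

lemma sum_subI: "\<lbrakk>x \<in> A; y \<in> B\<rbrakk> \<Longrightarrow> x \<oplus>\<^bsub>M\<^esub> y \<in> sum_sub M A B"
  by (auto simp: sum_sub_def)

lemma submodule_sum:
  assumes "lmodule \<Lambda> M" "submodule A \<Lambda> M" "submodule B \<Lambda> M"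
  shows "submodule (sum_sub M A B) \<Lambda> M" "A \<subseteq> sum_sub M A B" "B \<subseteq> sum_sub M A B"
proof -
  interpret lmodule \<Lambda> M by fact
  note A = submodule_subset[OF assms(2)] submodule_zero[OF assms(2)] submodule_add[OF assms(2)]
    submodule_smult[OF assms(2)]
  note B = submodule_subset[OF assms(3)] submodule_zero[OF assms(3)] submodule_add[OF assms(3)]
    submodule_smult[OF assms(3)]
  show "submodule (sum_sub M A B) \<Lambda> M"
  proof (rule submoduleI)
    show "sum_sub M A B \<subseteq> carrier M" using A(1) B(1) by (auto simp: sum_sub_def)
    show "\<zero>\<^bsub>M\<^esub> \<in> sum_sub M A B" using A(2) B(2) by (metis M.l_zero M.zero_closed sum_subI)
  next
    fix x y assume "x \<in> sum_sub M A B" "y \<in> sum_sub M A B"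
    then obtain a b a' b' where *: "x = a \<oplus>\<^bsub>M\<^esub> b" "y = a' \<oplus>\<^bsub>M\<^esub> b'"
      "a \<in> A" "b \<in> B" "a' \<in> A" "b' \<in> B" by (auto simp: sum_sub_def)
    then have "x \<oplus>\<^bsub>M\<^esub> y = (a \<oplus>\<^bsub>M\<^esub> a') \<oplus>\<^bsub>M\<^esub> (b \<oplus>\<^bsub>M\<^esub> b')"
      using A(1) B(1) by (auto simp: M.a_ac subset_iff)
    then show "x \<oplus>\<^bsub>M\<^esub> y \<in> sum_sub M A B" using * A(3) B(3) by (auto intro: sum_subI)
  next
    fix r x assume r: "r \<in> carrier \<Lambda>" and "x \<in> sum_sub M A B"
    then obtain a b where *: "x = a \<oplus>\<^bsub>M\<^esub> b" "a \<in> A" "b \<in> B" by (auto simp: sum_sub_def)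
    then have "r \<odot>\<^bsub>M\<^esub> x = r \<odot>\<^bsub>M\<^esub> a \<oplus>\<^bsub>M\<^esub> r \<odot>\<^bsub>M\<^esub> b"
      using r A(1) B(1) by (auto simp: smult_r_distr subset_iff)
    then show "r \<odot>\<^bsub>M\<^esub> x \<in> sum_sub M A B" using * r A(4) B(4) by (auto intro: sum_subI)
  qed
  show "A \<subseteq> sum_sub M A B"
  proof
    fix x assume "x \<in> A"
    then have "x \<oplus>\<^bsub>M\<^esub> \<zero>\<^bsub>M\<^esub> \<in> sum_sub M A B" "x \<in> carrier M" using A B by (auto intro: sum_subI)
    then show "x \<in> sum_sub M A B" by simp
  qed
  show "B \<subseteq> sum_sub M A B"
  proof
    fix x assume "x \<in> B"
    then have "\<zero>\<^bsub>M\<^esub> \<oplus>\<^bsub>M\<^esub> x \<in> sum_sub M A B" "x \<in> carrier M" using A B by (auto intro: sum_subI)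
    then show "x \<in> sum_sub M A B" by simp
  qed
qed

lemma sum_sub_least:
  "\<lbrakk>submodule H \<Lambda> M; A \<subseteq> H; B \<subseteq> H\<rbrakk> \<Longrightarrow> sum_sub M A B \<subseteq> H"
  by (auto simp: sum_sub_def intro: submodule_add)

lemma submodule_cyclic:
  assumes "lmodule \<Lambda> M" "x \<in> carrier M"
  shows "submodule ((\<lambda>r. r \<odot>\<^bsub>M\<^esub> x) ` carrier \<Lambda>) \<Lambda> M" "x \<in> (\<lambda>r. r \<odot>\<^bsub>M\<^esub> x) ` carrier \<Lambda>"
proof -
  interpret lmodule \<Lambda> M by fact
  show "submodule ((\<lambda>r. r \<odot>\<^bsub>M\<^esub> x) ` carrier \<Lambda>) \<Lambda> M"
  proof (rule submoduleI)
    show "\<zero>\<^bsub>M\<^esub> \<in> (\<lambda>r. r \<odot>\<^bsub>M\<^esub> x) ` carrier \<Lambda>"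
      using assms smult_l_null[of x] by (metis R.zero_closed image_eqI)
  next
    fix y z assume "y \<in> (\<lambda>r. r \<odot>\<^bsub>M\<^esub> x) ` carrier \<Lambda>" "z \<in> (\<lambda>r. r \<odot>\<^bsub>M\<^esub> x) ` carrier \<Lambda>"
    then obtain r s where rs: "r \<in> carrier \<Lambda>" "s \<in> carrier \<Lambda>" "y = r \<odot>\<^bsub>M\<^esub> x" "z = s \<odot>\<^bsub>M\<^esub> x" by auto
    then have "y \<oplus>\<^bsub>M\<^esub> z = (r \<oplus>\<^bsub>\<Lambda>\<^esub> s) \<odot>\<^bsub>M\<^esub> x" using assms by (simp add: smult_l_distr)
    then show "y \<oplus>\<^bsub>M\<^esub> z \<in> (\<lambda>r. r \<odot>\<^bsub>M\<^esub> x) ` carrier \<Lambda>" using rs by auto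
  next
    fix s y assume "s \<in> carrier \<Lambda>" "y \<in> (\<lambda>r. r \<odot>\<^bsub>M\<^esub> x) ` carrier \<Lambda>"
    then show "s \<odot>\<^bsub>M\<^esub> y \<in> (\<lambda>r. r \<odot>\<^bsub>M\<^esub> x) ` carrier \<Lambda>"
      using assms by (auto simp: smult_assoc1[symmetric])
  qed (use assms in auto)
  show "x \<in> (\<lambda>r. r \<odot>\<^bsub>M\<^esub> x) ` carrier \<Lambda>"
    using assms by (intro image_eqI[of _ _ "\<one>\<^bsub>\<Lambda>\<^esub>"]) auto
qed

lemma mod_hom_zero:
  assumes "lmodule \<Lambda> M" "lmodule \<Lambda> N" "f \<in> mod_hom \<Lambda> M N"
  shows "f \<zero>\<^bsub>M\<^esub> = \<zero>\<^bsub>N\<^esub>"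
proof -
  interpret M: lmodule \<Lambda> M by fact
  interpret N: lmodule \<Lambda> N by fact
  have "f (\<zero>\<^bsub>\<Lambda>\<^esub> \<odot>\<^bsub>M\<^esub> \<zero>\<^bsub>M\<^esub>) = \<zero>\<^bsub>\<Lambda>\<^esub> \<odot>\<^bsub>N\<^esub> f \<zero>\<^bsub>M\<^esub>"
    using assms(3) by (intro mod_hom_smult) auto
  then show ?thesis
    using mod_hom_closed[OF assms(3)] by (simp add: M.smult_l_null N.smult_l_null)
qed

lemma mod_hom_minus:
  assumes "lmodule \<Lambda> M" "lmodule \<Lambda> N" "f \<in> mod_hom \<Lambda> M N" "x \<in> carrier M"
  shows "f (\<ominus>\<^bsub>M\<^esub> x) = \<ominus>\<^bsub>N\<^esub> f x"
proof -
  interpret M: lmodule \<Lambda> M by fact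
  interpret N: lmodule \<Lambda> N by fact
  have "f (\<ominus>\<^bsub>M\<^esub> x) \<oplus>\<^bsub>N\<^esub> f x = f (\<ominus>\<^bsub>M\<^esub> x \<oplus>\<^bsub>M\<^esub> x)"
    using assms by (subst mod_hom_add[OF assms(3)]) auto
  then show ?thesis
    using assms mod_hom_zero[OF assms(1-3)] mod_hom_closed[OF assms(3)]
    by (simp add: M.l_neg N.minus_equality)
qed

lemma mod_hom_diff:
  assumes "lmodule \<Lambda> M" "lmodule \<Lambda> N" "f \<in> mod_hom \<Lambda> M N" "x \<in> carrier M" "y \<in> carrier M"
  shows "f (x \<ominus>\<^bsub>M\<^esub> y) = f x \<ominus>\<^bsub>N\<^esub> f y"
proof -
  interpret M: lmodule \<Lambda> M by fact
  show ?thesis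
    using assms mod_hom_minus[OF assms(1-3)] mod_hom_add[OF assms(3)] by (simp add: a_minus_def)
qed

lemma mod_hom_comp:
  "\<lbrakk>f \<in> mod_hom \<Lambda> M N; g \<in> mod_hom \<Lambda> N K\<rbrakk> \<Longrightarrow> (\<lambda>x. g (f x)) \<in> mod_hom \<Lambda> M K"
  by (simp add: mod_hom_iff)

lemma mod_hom_id: "(\<lambda>x. x) \<in> mod_hom \<Lambda> M M"
  by (simp add: mod_hom_iff)

lemma mod_hom_restrict:
  "\<lbrakk>f \<in> mod_hom \<Lambda> M N; H \<subseteq> carrier M\<rbrakk> \<Longrightarrow> f \<in> mod_hom \<Lambda> (M\<lparr>carrier := H\<rparr>) N"
  by (simp add: mod_hom_iff subset_iff)

lemma mod_hom_into:
  "\<lbrakk>f \<in> mod_hom \<Lambda> M N; f ` carrier M \<subseteq> H\<rbrakk> \<Longrightarrow> f \<in> mod_hom \<Lambda> M (N\<lparr>carrier := H\<rparr>)"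
  by (auto simp: mod_hom_iff)

lemma mod_hom_weaken:
  "\<lbrakk>f \<in> mod_hom \<Lambda> M (N\<lparr>carrier := H\<rparr>); H \<subseteq> carrier N\<rbrakk> \<Longrightarrow> f \<in> mod_hom \<Lambda> M N"
  by (auto simp: mod_hom_iff)

lemma mod_hom_incl: "H \<subseteq> carrier M \<Longrightarrow> (\<lambda>x. x) \<in> mod_hom \<Lambda> (M\<lparr>carrier := H\<rparr>) M"
  by (auto simp: mod_hom_iff)

text \<open>Elements of \<open>mod_hom\<close> are total functions constrained only on the carrier,
  so two representatives of one homomorphism may differ elsewhere.\<close>

lemma mod_hom_cong:
  assumes "lmodule \<Lambda> M" "f \<in> mod_hom \<Lambda> M N" "\<And>x. x \<in> carrier M \<Longrightarrow> g x = f x"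
  shows "g \<in> mod_hom \<Lambda> M N"
proof -
  interpret M: lmodule \<Lambda> M by fact
  show ?thesis using assms by (simp add: mod_hom_iff)
qed

lemma mod_hom_plus:
  assumes "lmodule \<Lambda> M" "lmodule \<Lambda> N" "f \<in> mod_hom \<Lambda> M N" "g \<in> mod_hom \<Lambda> M N"
  shows "(\<lambda>x. f x \<oplus>\<^bsub>N\<^esub> g x) \<in> mod_hom \<Lambda> M N"
proof -
  interpret N: lmodule \<Lambda> N by fact
  show ?thesis
    using mod_hom_closed[OF assms(3)] mod_hom_closed[OF assms(4)]
    by (intro mod_homI) (simp_all add: mod_hom_add[OF assms(3)] mod_hom_add[OF assms(4)]
        mod_hom_smult[OF assms(3)] mod_hom_smult[OF assms(4)] N.smult_r_distr N.a_ac)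
qed

lemma mod_hom_minus_hom:
  assumes "lmodule \<Lambda> M" "lmodule \<Lambda> N" "f \<in> mod_hom \<Lambda> M N" "g \<in> mod_hom \<Lambda> M N"
  shows "(\<lambda>x. f x \<ominus>\<^bsub>N\<^esub> g x) \<in> mod_hom \<Lambda> M N"
proof -
  interpret N: lmodule \<Lambda> N by fact
  show ?thesis
    using mod_hom_closed[OF assms(3)] mod_hom_closed[OF assms(4)]
    by (intro mod_homI) (simp_all add: mod_hom_add[OF assms(3)] mod_hom_add[OF assms(4)]
        mod_hom_smult[OF assms(3)] mod_hom_smult[OF assms(4)] N.smult_r_diff N.a_ac
        a_minus_def N.minus_add N.smult_r_distr N.smult_r_minus)
qed

lemma mod_hom_inv:
  assumes "lmodule \<Lambda> M" "f \<in> mod_hom \<Lambda> M N" "bij_betw f (carrier M) (carrier N)"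
  obtains g where "g \<in> mod_hom \<Lambda> N M" "bij_betw g (carrier N) (carrier M)"
    "\<And>x. x \<in> carrier M \<Longrightarrow> g (f x) = x" "\<And>y. y \<in> carrier N \<Longrightarrow> f (g y) = y"
proof
  interpret M: lmodule \<Lambda> M by fact
  let ?g = "the_inv_into (carrier M) f"
  have inj: "inj_on f (carrier M)" and im: "f ` carrier M = carrier N"
    using assms(3) by (auto simp: bij_betw_def)
  show gf: "?g (f x) = x" if "x \<in> carrier M" for x using that inj by (simp add: the_inv_into_f_f)
  show fg: "f (?g y) = y" if "y \<in> carrier N" for y
    using that inj im by (simp add: f_the_inv_into_f)
  show "bij_betw ?g (carrier N) (carrier M)" using assms(3) by (rule bij_betw_the_inv_into)
  then have cl: "?g y \<in> carrier M" if "y \<in> carrier N" for y using that by (auto simp: bij_betw_def)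
  show "?g \<in> mod_hom \<Lambda> N M"
  proof (rule mod_homI)
    fix x y assume "x \<in> carrier N" "y \<in> carrier N"
    then show "?g (x \<oplus>\<^bsub>N\<^esub> y) = ?g x \<oplus>\<^bsub>M\<^esub> ?g y"
      using mod_hom_add[OF assms(2), of "?g x" "?g y"] gf[of "?g x \<oplus>\<^bsub>M\<^esub> ?g y"] by (simp add: fg cl)
  next
    fix a x assume "a \<in> carrier \<Lambda>" "x \<in> carrier N"
    then show "?g (a \<odot>\<^bsub>N\<^esub> x) = a \<odot>\<^bsub>M\<^esub> ?g x"
      using mod_hom_smult[OF assms(2), of a "?g x"] gf[of "a \<odot>\<^bsub>M\<^esub> ?g x"] by (simp add: fg cl)
  qed (rule cl)
qed

lemma mod_isomorphic_sym:
  "\<lbrakk>lmodule \<Lambda> M; mod_isomorphic \<Lambda> M N\<rbrakk> \<Longrightarrow> mod_isomorphic \<Lambda> N M"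
  unfolding mod_isomorphic_def by (metis mod_hom_inv)

lemma mod_isomorphic_trans:
  assumes "mod_isomorphic \<Lambda> M N" "mod_isomorphic \<Lambda> N K"
  shows "mod_isomorphic \<Lambda> M K"
proof -
  obtain f g where fg: "f \<in> mod_hom \<Lambda> M N" "bij_betw f (carrier M) (carrier N)"
    "g \<in> mod_hom \<Lambda> N K" "bij_betw g (carrier N) (carrier K)"
    using assms by (auto simp: mod_isomorphic_def)
  then show ?thesis unfolding mod_isomorphic_def
    by (intro bexI[OF _ mod_hom_comp[OF fg(1,3)]]) (use bij_betw_trans[OF fg(2,4)] in \<open>simp add: comp_def\<close>)
qed

lemma submodule_image:
  assumes "lmodule \<Lambda> M" "lmodule \<Lambda> N" "f \<in> mod_hom \<Lambda> M N" "submodule H \<Lambda> M"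
  shows "submodule (f ` H) \<Lambda> N"
proof -
  interpret N: lmodule \<Lambda> N by fact
  have H: "\<And>x. x \<in> H \<Longrightarrow> x \<in> carrier M" using submodule_subset[OF assms(4)] by auto
  show ?thesis
  proof (rule N.submoduleI)
    show "f ` H \<subseteq> carrier N" using H mod_hom_closed[OF assms(3)] by auto
    show "\<zero>\<^bsub>N\<^esub> \<in> f ` H"
      using mod_hom_zero[OF assms(1-3)] submodule_zero[OF assms(4)] by (metis imageI)
  next
    fix x y assume "x \<in> f ` H" "y \<in> f ` H"
    then obtain u v where "u \<in> H" "v \<in> H" "x = f u" "y = f v" by auto
    then show "x \<oplus>\<^bsub>N\<^esub> y \<in> f ` H"
      using H mod_hom_add[OF assms(3), of u v] submodule_add[OF assms(4), of u v] by (metis imageI)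
  next
    fix a x assume a: "a \<in> carrier \<Lambda>" and "x \<in> f ` H"
    then obtain u where "u \<in> H" "x = f u" by auto
    then show "a \<odot>\<^bsub>N\<^esub> x \<in> f ` H"
      using a H mod_hom_smult[OF assms(3), of a u] submodule_smult[OF assms(4), of a u] by (metis imageI)
  qed
qed

lemma submodule_vimage:
  assumes "lmodule \<Lambda> M" "lmodule \<Lambda> N" "f \<in> mod_hom \<Lambda> M N" "submodule H \<Lambda> N"
  shows "submodule {x \<in> carrier M. f x \<in> H} \<Lambda> M"
proof -
  interpret M: lmodule \<Lambda> M by fact
  show ?thesis
    using mod_hom_zero[OF assms(1-3)] submodule_zero[OF assms(4)] submodule_add[OF assms(4)]
      submodule_smult[OF assms(4)]
    by (intro M.submoduleI) (auto simp: mod_hom_add[OF assms(3)] mod_hom_smult[OF assms(3)])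
qed

lemma a_kernel_eq: "a_kernel M N f = {x \<in> carrier M. f x = \<zero>\<^bsub>N\<^esub>}"
  by (auto simp: a_kernel_def kernel_def)

lemma submodule_kernel:
  assumes "lmodule \<Lambda> M" "lmodule \<Lambda> N" "f \<in> mod_hom \<Lambda> M N"
  shows "submodule (a_kernel M N f) \<Lambda> M"
  using submodule_vimage[OF assms submodule_trivial[OF assms(2)]] by (simp add: a_kernel_eq)

lemma mod_hom_inj_iff:
  assumes "lmodule \<Lambda> M" "lmodule \<Lambda> N" "f \<in> mod_hom \<Lambda> M N"
  shows "inj_on f (carrier M) \<longleftrightarrow> a_kernel M N f = {\<zero>\<^bsub>M\<^esub>}"
proof -
  interpret M: lmodule \<Lambda> M by fact
  interpret N: lmodule \<Lambda> N by fact
  note z = mod_hom_zero[OF assms]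
  show ?thesis
  proof
    assume "inj_on f (carrier M)"
    then show "a_kernel M N f = {\<zero>\<^bsub>M\<^esub>}"
      using z by (auto simp: a_kernel_eq dest: inj_onD[of f _ _ "\<zero>\<^bsub>M\<^esub>"])
  next
    assume K: "a_kernel M N f = {\<zero>\<^bsub>M\<^esub>}"
    show "inj_on f (carrier M)"
    proof (rule inj_onI)
      fix x y assume *: "x \<in> carrier M" "y \<in> carrier M" "f x = f y"
      then have "f (x \<ominus>\<^bsub>M\<^esub> y) = \<zero>\<^bsub>N\<^esub>"
        using mod_hom_diff[OF assms *(1,2)] mod_hom_closed[OF assms(3)]
        by (simp add: N.r_neg a_minus_def)
      then have "x \<ominus>\<^bsub>M\<^esub> y = \<zero>\<^bsub>M\<^esub>" using K * by (auto simp: a_kernel_eq)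
      then show "x = y" using * M.minus_eq_zero_iff by simp
    qed
  qed
qed

text \<open>Two preimages of a point under \<open>c\<close> differ by an element that
  \<open>q\<close> kills, so \<open>q\<close> of a chosen preimage is well defined. This is the
  universal property of a quotient for an arbitrary surjection \<open>c\<close>; maps out of a
  module are constructed by it without passing to cosets.\<close>

lemma mod_hom_factor:
  assumes "lmodule \<Lambda> M" "lmodule \<Lambda> N" "lmodule \<Lambda> T"
    and c: "c \<in> mod_hom \<Lambda> M N" "c ` carrier M = carrier N" and q: "q \<in> mod_hom \<Lambda> M T"
    and ker: "\<And>x. \<lbrakk>x \<in> carrier M; c x = \<zero>\<^bsub>N\<^esub>\<rbrakk> \<Longrightarrow> q x = \<zero>\<^bsub>T\<^esub>"
  obtains u where "u \<in> mod_hom \<Lambda> N T" "\<And>x. x \<in> carrier M \<Longrightarrow> u (c x) = q x"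
proof
  interpret M: lmodule \<Lambda> M by fact
  interpret N: lmodule \<Lambda> N by fact
  interpret T: lmodule \<Lambda> T by fact
  define u where "u y = q (SOME x. x \<in> carrier M \<and> c x = y)" for y
  show u: "u (c x) = q x" if x: "x \<in> carrier M" for x
  proof -
    define x' where "x' = (SOME x'. x' \<in> carrier M \<and> c x' = c x)"
    have x': "x' \<in> carrier M" "c x' = c x"
      using someI[of "\<lambda>x'. x' \<in> carrier M \<and> c x' = c x" x] x by (auto simp: x'_def)
    have "c (x' \<ominus>\<^bsub>M\<^esub> x) = \<zero>\<^bsub>N\<^esub>"
      using mod_hom_diff[OF assms(1,2) c(1) x'(1) x] x' x mod_hom_closed[OF c(1)]
      by (simp add: a_minus_def N.r_neg)
    then have "q (x' \<ominus>\<^bsub>M\<^esub> x) = \<zero>\<^bsub>T\<^esub>" using x' x by (intro ker) auto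
    then have "q x' = q x"
      using mod_hom_diff[OF assms(1,3) q x'(1) x] x' x mod_hom_closed[OF q]
      by (simp add: T.minus_eq_zero_iff)
    then show ?thesis by (simp add: u_def x'_def)
  qed
  show "u \<in> mod_hom \<Lambda> N T"
  proof (rule mod_homI)
    fix y assume "y \<in> carrier N"
    then obtain v where "v \<in> carrier M" "y = c v" unfolding c(2)[symmetric] by auto
    then show "u y \<in> carrier T" using u[of v] mod_hom_closed[OF q, of v] by simp
  next
    fix y z assume "y \<in> carrier N" "z \<in> carrier N"
    then obtain v w where "v \<in> carrier M" "w \<in> carrier M" "y = c v" "z = c w"
      unfolding c(2)[symmetric] by auto
    then show "u (y \<oplus>\<^bsub>N\<^esub> z) = u y \<oplus>\<^bsub>T\<^esub> u z"
      using u mod_hom_add[OF c(1), of v w] mod_hom_add[OF q, of v w] u[of "v \<oplus>\<^bsub>M\<^esub> w"] by simp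
  next
    fix a y assume "a \<in> carrier \<Lambda>" "y \<in> carrier N"
    then obtain v where "a \<in> carrier \<Lambda>" "v \<in> carrier M" "y = c v"
      unfolding c(2)[symmetric] by auto
    then show "u (a \<odot>\<^bsub>N\<^esub> y) = a \<odot>\<^bsub>T\<^esub> u y"
      using u mod_hom_smult[OF c(1), of a v] mod_hom_smult[OF q, of a v] u[of "a \<odot>\<^bsub>M\<^esub> v"] by simp
  qed
qed

section \<open>External direct sums, the regular module and finite generation\<close>

definition dsum :: "('a, 'm) module \<Rightarrow> ('a, 'n) module \<Rightarrow> ('a, 'm \<times> 'n) module" where
  "dsum A B = \<lparr>carrier = carrier A \<times> carrier B, monoid.mult = undefined, one = undefined,
     ring.zero = (\<zero>\<^bsub>A\<^esub>, \<zero>\<^bsub>B\<^esub>),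
     add = (\<lambda>x y. (fst x \<oplus>\<^bsub>A\<^esub> fst y, snd x \<oplus>\<^bsub>B\<^esub> snd y)),
     smult = (\<lambda>a x. (a \<odot>\<^bsub>A\<^esub> fst x, a \<odot>\<^bsub>B\<^esub> snd x))\<rparr>"

lemma dsum_simps [simp]:
  "carrier (dsum A B) = carrier A \<times> carrier B"
  "\<zero>\<^bsub>dsum A B\<^esub> = (\<zero>\<^bsub>A\<^esub>, \<zero>\<^bsub>B\<^esub>)"
  "x \<oplus>\<^bsub>dsum A B\<^esub> y = (fst x \<oplus>\<^bsub>A\<^esub> fst y, snd x \<oplus>\<^bsub>B\<^esub> snd y)"
  "a \<odot>\<^bsub>dsum A B\<^esub> x = (a \<odot>\<^bsub>A\<^esub> fst x, a \<odot>\<^bsub>B\<^esub> snd x)"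
  by (simp_all add: dsum_def)

lemma lmodule_dsum:
  assumes "lmodule \<Lambda> A" "lmodule \<Lambda> B"
  shows "lmodule \<Lambda> (dsum A B)"
proof -
  interpret A: lmodule \<Lambda> A by fact
  interpret B: lmodule \<Lambda> B by fact
  show ?thesis
  proof (rule lmoduleI)
    show "abelian_group (dsum A B)"
    proof (rule abelian_groupI)
      fix x assume "x \<in> carrier (dsum A B)"
      then show "\<exists>y\<in>carrier (dsum A B). y \<oplus>\<^bsub>dsum A B\<^esub> x = \<zero>\<^bsub>dsum A B\<^esub>"
        by (intro bexI[of _ "(\<ominus>\<^bsub>A\<^esub> fst x, \<ominus>\<^bsub>B\<^esub> snd x)"]) (auto simp: A.l_neg B.l_neg)
    qed (auto simp: A.a_ac B.a_ac)
  qed (use A.R.ring_axioms in \<open>auto simp: A.smult_l_distr B.smult_l_distr A.smult_r_distr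
      B.smult_r_distr A.smult_assoc1 B.smult_assoc1\<close>)
qed

lemma mod_hom_fst: "fst \<in> mod_hom \<Lambda> (dsum A B) A"
  and mod_hom_snd: "snd \<in> mod_hom \<Lambda> (dsum A B) B"
  by (auto simp: mod_hom_iff)

lemma mod_hom_inl:
  assumes "lmodule \<Lambda> B" shows "(\<lambda>x. (x, \<zero>\<^bsub>B\<^esub>)) \<in> mod_hom \<Lambda> A (dsum A B)"
proof -
  interpret B: lmodule \<Lambda> B by fact
  show ?thesis by (auto simp: mod_hom_iff B.smult_r_null)
qed

lemma mod_hom_inr:
  assumes "lmodule \<Lambda> A" shows "(\<lambda>y. (\<zero>\<^bsub>A\<^esub>, y)) \<in> mod_hom \<Lambda> B (dsum A B)"
proof -
  interpret A: lmodule \<Lambda> A by fact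
  show ?thesis by (auto simp: mod_hom_iff A.smult_r_null)
qed

lemma mod_hom_copair:
  assumes "lmodule \<Lambda> A" "lmodule \<Lambda> B" "lmodule \<Lambda> M"
    and "f \<in> mod_hom \<Lambda> A M" "g \<in> mod_hom \<Lambda> B M"
  shows "(\<lambda>x. f (fst x) \<oplus>\<^bsub>M\<^esub> g (snd x)) \<in> mod_hom \<Lambda> (dsum A B) M"
  using assms by (intro mod_hom_plus lmodule_dsum) (auto intro: mod_hom_comp mod_hom_fst mod_hom_snd)

lemma lmodule_regular: "ring \<Lambda> \<Longrightarrow> lmodule \<Lambda> (regular_module \<Lambda>)"
proof -
  assume "ring \<Lambda>"
  then interpret ring \<Lambda> .
  have "abelian_group (regular_module \<Lambda>)"
  proof (rule abelian_groupI)
    fix x assume "x \<in> carrier (regular_module \<Lambda>)"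
    then show "\<exists>y\<in>carrier (regular_module \<Lambda>). y \<oplus>\<^bsub>regular_module \<Lambda>\<^esub> x = \<zero>\<^bsub>regular_module \<Lambda>\<^esub>"
      by (intro bexI[of _ "\<ominus>\<^bsub>\<Lambda>\<^esub> x"]) (auto simp: regular_module_def l_neg)
  qed (auto simp: regular_module_def a_ac)
  then show ?thesis
    by (intro lmoduleI) (auto simp: regular_module_def l_distr r_distr m_assoc ring_axioms)
qed

lemma regular_module_simps [simp]:
  "carrier (regular_module \<Lambda>) = carrier \<Lambda>"
  "\<zero>\<^bsub>regular_module \<Lambda>\<^esub> = \<zero>\<^bsub>\<Lambda>\<^esub>"
  "x \<oplus>\<^bsub>regular_module \<Lambda>\<^esub> y = x \<oplus>\<^bsub>\<Lambda>\<^esub> y"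
  "a \<odot>\<^bsub>regular_module \<Lambda>\<^esub> x = a \<otimes>\<^bsub>\<Lambda>\<^esub> x"
  by (simp_all add: regular_module_def)

lemma mod_hom_scalar:
  assumes "lmodule \<Lambda> M" "x \<in> carrier M"
  shows "(\<lambda>r. r \<odot>\<^bsub>M\<^esub> x) \<in> mod_hom \<Lambda> (regular_module \<Lambda>) M"
proof -
  interpret lmodule \<Lambda> M by fact
  show ?thesis using assms by (intro mod_homI) (simp_all add: smult_l_distr smult_assoc1)
qed

lemma fin_gen_regular:
  assumes "ring \<Lambda>" shows "fin_gen \<Lambda> (regular_module \<Lambda>)"
proof -
  interpret lmodule \<Lambda> "regular_module \<Lambda>" using assms by (rule lmodule_regular)
  have "carrier (regular_module \<Lambda>) \<subseteq> mod_span \<Lambda> (regular_module \<Lambda>) {\<one>\<^bsub>\<Lambda>\<^esub>}"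
  proof
    fix x assume x: "x \<in> carrier (regular_module \<Lambda>)"
    have "x \<odot>\<^bsub>regular_module \<Lambda>\<^esub> \<one>\<^bsub>\<Lambda>\<^esub> \<in> mod_span \<Lambda> (regular_module \<Lambda>) {\<one>\<^bsub>\<Lambda>\<^esub>}"
      using x mod_span_superset[of "{\<one>\<^bsub>\<Lambda>\<^esub>}" \<Lambda> "regular_module \<Lambda>"]
      by (intro submodule_smult[OF submodule_mod_span[OF lmodule_axioms]]) auto
    then show "x \<in> mod_span \<Lambda> (regular_module \<Lambda>) {\<one>\<^bsub>\<Lambda>\<^esub>}" using x by simp
  qed
  moreover have "mod_span \<Lambda> (regular_module \<Lambda>) {\<one>\<^bsub>\<Lambda>\<^esub>} \<subseteq> carrier (regular_module \<Lambda>)"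
    by (intro mod_span_least carrier_submodule) auto
  ultimately show ?thesis unfolding fin_gen_def by (intro exI[of _ "{\<one>\<^bsub>\<Lambda>\<^esub>}"]) auto
qed

lemma fin_gen_image:
  assumes "lmodule \<Lambda> M" "lmodule \<Lambda> N" "f \<in> mod_hom \<Lambda> M N" "f ` carrier M = carrier N" "fin_gen \<Lambda> M"
  shows "fin_gen \<Lambda> N"
proof -
  obtain S where S: "finite S" "S \<subseteq> carrier M" "mod_span \<Lambda> M S = carrier M"
    using assms(5) by (auto simp: fin_gen_def)
  have fS: "f ` S \<subseteq> carrier N" using S(2) assms(4) by auto
  let ?H = "mod_span \<Lambda> N (f ` S)"
  have H: "submodule ?H \<Lambda> N" by (rule submodule_mod_span[OF assms(2) fS])
  have "mod_span \<Lambda> M S \<subseteq> {x \<in> carrier M. f x \<in> ?H}"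
    using mod_span_superset[of "f ` S" \<Lambda> N] S(2)
    by (intro mod_span_least submodule_vimage[OF assms(1-3) H]) auto
  then have "carrier N \<subseteq> ?H" unfolding S(3) assms(4)[symmetric] by auto
  then show ?thesis
    unfolding fin_gen_def using S(1) fS submodule_subset[OF H] by (intro exI[of _ "f ` S"]) auto
qed

lemma fg_module_image:
  "\<lbrakk>fg_module \<Lambda> M; lmodule \<Lambda> N; f \<in> mod_hom \<Lambda> M N; f ` carrier M = carrier N\<rbrakk> \<Longrightarrow> fg_module \<Lambda> N"
  unfolding fg_module_def using fin_gen_image by blast

lemma fg_module_regular: "ring \<Lambda> \<Longrightarrow> fg_module \<Lambda> (regular_module \<Lambda>)"
  by (simp add: fg_module_def fin_gen_regular lmodule_regular)

lemma fg_module_dsum: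
  assumes "fg_module \<Lambda> A" "fg_module \<Lambda> B"
  shows "fg_module \<Lambda> (dsum A B)"
proof -
  interpret A: lmodule \<Lambda> A using assms by (simp add: fg_module_def)
  interpret B: lmodule \<Lambda> B using assms by (simp add: fg_module_def)
  note lm = A.lmodule_axioms B.lmodule_axioms lmodule_dsum[OF A.lmodule_axioms B.lmodule_axioms]
  obtain S where S: "finite S" "S \<subseteq> carrier A" "mod_span \<Lambda> A S = carrier A"
    using assms(1) by (auto simp: fg_module_def fin_gen_def)
  obtain S' where S': "finite S'" "S' \<subseteq> carrier B" "mod_span \<Lambda> B S' = carrier B"
    using assms(2) by (auto simp: fg_module_def fin_gen_def)
  let ?S = "(\<lambda>x. (x, \<zero>\<^bsub>B\<^esub>)) ` S \<union> (\<lambda>y. (\<zero>\<^bsub>A\<^esub>, y)) ` S'"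
  let ?H = "mod_span \<Lambda> (dsum A B) ?S"
  have sub: "?S \<subseteq> carrier (dsum A B)" using S S' by auto
  have H: "submodule ?H \<Lambda> (dsum A B)" by (rule submodule_mod_span[OF lm(3) sub])
  have "mod_span \<Lambda> A S \<subseteq> {x \<in> carrier A. (x, \<zero>\<^bsub>B\<^esub>) \<in> ?H}"
    using mod_span_superset[of ?S \<Lambda> "dsum A B"] S(2)
    by (intro mod_span_least submodule_vimage[OF lm(1,3) mod_hom_inl[OF lm(2)] H]) auto
  moreover have "mod_span \<Lambda> B S' \<subseteq> {y \<in> carrier B. (\<zero>\<^bsub>A\<^esub>, y) \<in> ?H}"
    using mod_span_superset[of ?S \<Lambda> "dsum A B"] S'(2)
    by (intro mod_span_least submodule_vimage[OF lm(2,3) mod_hom_inr[OF lm(1)] H]) auto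
  ultimately have AB: "\<And>x. x \<in> carrier A \<Longrightarrow> (x, \<zero>\<^bsub>B\<^esub>) \<in> ?H" "\<And>y. y \<in> carrier B \<Longrightarrow> (\<zero>\<^bsub>A\<^esub>, y) \<in> ?H"
    using S(3) S'(3) by auto
  have "carrier (dsum A B) \<subseteq> ?H"
  proof
    fix z assume "z \<in> carrier (dsum A B)"
    then show "z \<in> ?H" using submodule_add[OF H AB(1)[of "fst z"] AB(2)[of "snd z"]] by auto
  qed
  then show ?thesis
    unfolding fg_module_def fin_gen_def using S(1) S'(1) sub lm(3) submodule_subset[OF H]
    by (intro conjI exI[of _ ?S]) auto
qed


section \<open>Modules of finite length\<close>

text \<open>Chains omit the zero submodule, so that simple modules have length \<open>1\<close>.\<close>

definition nz_chain :: "('a, 'k) ring_scheme \<Rightarrow> ('a, 'm) module \<Rightarrow> 'm set set \<Rightarrow> bool" where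
  "nz_chain \<Lambda> M C \<longleftrightarrow> finite C \<and> (\<forall>X\<in>C. submodule X \<Lambda> M \<and> X \<noteq> {\<zero>\<^bsub>M\<^esub>}) \<and>
     (\<forall>X\<in>C. \<forall>Y\<in>C. X \<subseteq> Y \<or> Y \<subseteq> X)"

definition fin_len :: "('a, 'k) ring_scheme \<Rightarrow> ('a, 'm) module \<Rightarrow> bool" where
  "fin_len \<Lambda> M \<longleftrightarrow> (\<exists>n. \<forall>C. nz_chain \<Lambda> M C \<longrightarrow> card C \<le> n)"

text \<open>Length as the size of a longest chain; its additivity is proved directly in
  \<open>mlen_exact\<close>. The \<open>GREATEST\<close> has a meaning only under
  \<open>fin_len\<close>.\<close>

definition mlen :: "('a, 'k) ring_scheme \<Rightarrow> ('a, 'm) module \<Rightarrow> nat" where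
  "mlen \<Lambda> M = (GREATEST n. \<exists>C. nz_chain \<Lambda> M C \<and> card C = n)"

lemma fin_lenI: "(\<And>C. nz_chain \<Lambda> M C \<Longrightarrow> card C \<le> n) \<Longrightarrow> fin_len \<Lambda> M"
  by (auto simp: fin_len_def)

lemma nz_chain_empty: "nz_chain \<Lambda> M {}"
  by (simp add: nz_chain_def)

lemma card_le_mlen:
  assumes "fin_len \<Lambda> M" "nz_chain \<Lambda> M C" shows "card C \<le> mlen \<Lambda> M"
proof -
  obtain n where "\<forall>C. nz_chain \<Lambda> M C \<longrightarrow> card C \<le> n" using assms(1) by (auto simp: fin_len_def)
  then show ?thesis
    unfolding mlen_def using assms(2) by (intro Greatest_le_nat[where b = n]) auto
qed

lemma mlen_attained:
  assumes "fin_len \<Lambda> M" obtains C where "nz_chain \<Lambda> M C" "card C = mlen \<Lambda> M"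
proof -
  obtain n where "\<forall>C. nz_chain \<Lambda> M C \<longrightarrow> card C \<le> n" using assms(1) by (auto simp: fin_len_def)
  then have b: "\<And>k. (\<exists>C. nz_chain \<Lambda> M C \<and> card C = k) \<Longrightarrow> k \<le> n" by blast
  have "\<exists>C. nz_chain \<Lambda> M C \<and> card C = 0" using nz_chain_empty by (metis card.empty)
  then have "\<exists>C. nz_chain \<Lambda> M C \<and> card C = mlen \<Lambda> M"
    unfolding mlen_def by (rule GreatestI_nat[where P = "\<lambda>k. \<exists>C. nz_chain \<Lambda> M C \<and> card C = k"]) (rule b)
  then show ?thesis using that by blast
qed

lemma mlen_le:
  assumes "\<And>C. nz_chain \<Lambda> M C \<Longrightarrow> card C \<le> n" shows "mlen \<Lambda> M \<le> n"
  using assms mlen_attained[OF fin_lenI[OF assms]] by metis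

text \<open>A chain on which the pair \<open>(\<alpha>, \<beta>)\<close> is strictly increasing is counted by the values of
  \<open>\<alpha>\<close> and \<open>\<beta>\<close> below each of its members.\<close>

lemma card_chain_le:
  fixes \<alpha> :: "'x set \<Rightarrow> 'y set" and \<beta> :: "'x set \<Rightarrow> 'z set"
  assumes fin: "finite C" and chain: "\<And>X Y. \<lbrakk>X \<in> C; Y \<in> C\<rbrakk> \<Longrightarrow> X \<subseteq> Y \<or> Y \<subseteq> X"
    and mono: "\<And>X Y. \<lbrakk>X \<in> C; Y \<in> C; X \<subseteq> Y\<rbrakk> \<Longrightarrow> \<alpha> X \<subseteq> \<alpha> Y \<and> \<beta> X \<subseteq> \<beta> Y"
    and strict: "\<And>X Y. \<lbrakk>X \<in> C; Y \<in> C; X \<subseteq> Y; \<alpha> X = \<alpha> Y; \<beta> X = \<beta> Y\<rbrakk> \<Longrightarrow> X = Y"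
    and lower: "\<And>X. X \<in> C \<Longrightarrow> z \<subseteq> \<alpha> X \<and> w \<subseteq> \<beta> X"
    and nonzero: "\<And>X. X \<in> C \<Longrightarrow> \<alpha> X \<noteq> z \<or> \<beta> X \<noteq> w"
  shows "card C \<le> card (\<alpha> ` C - {z}) + card (\<beta> ` C - {w})"
proof -
  define A where "A = \<alpha> ` C - {z}"
  define B where "B = \<beta> ` C - {w}"
  have finAB: "finite A" "finite B" using fin by (auto simp: A_def B_def)
  define r where "r X = card {Z \<in> A. Z \<subseteq> \<alpha> X} + card {Z \<in> B. Z \<subseteq> \<beta> X}" for X
  have less: "r X < r Y" if XY: "X \<in> C" "Y \<in> C" "X \<subset> Y" for X Y
  proof -
    have sub: "\<alpha> X \<subseteq> \<alpha> Y" "\<beta> X \<subseteq> \<beta> Y" using mono XY by auto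
    have le: "card {Z \<in> A. Z \<subseteq> \<alpha> X} \<le> card {Z \<in> A. Z \<subseteq> \<alpha> Y}"
      "card {Z \<in> B. Z \<subseteq> \<beta> X} \<le> card {Z \<in> B. Z \<subseteq> \<beta> Y}"
      using sub finAB by (auto intro!: card_mono)
    consider "\<alpha> X \<subset> \<alpha> Y" | "\<beta> X \<subset> \<beta> Y" using strict[of X Y] XY sub by blast
    then show ?thesis
    proof cases
      case 1
      then have "\<alpha> Y \<in> A" using lower[OF XY(1)] XY by (auto simp: A_def)
      then have "card {Z \<in> A. Z \<subseteq> \<alpha> X} < card {Z \<in> A. Z \<subseteq> \<alpha> Y}"
        using 1 finAB by (intro psubset_card_mono) auto
      then show ?thesis using le by (simp add: r_def)
    next
      case 2
      then have "\<beta> Y \<in> B" using lower[OF XY(1)] XY by (auto simp: B_def)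
      then have "card {Z \<in> B. Z \<subseteq> \<beta> X} < card {Z \<in> B. Z \<subseteq> \<beta> Y}"
        using 2 finAB by (intro psubset_card_mono) auto
      then show ?thesis using le by (simp add: r_def)
    qed
  qed
  have inj: "inj_on r C"
  proof (rule inj_onI)
    fix X Y assume *: "X \<in> C" "Y \<in> C" "r X = r Y"
    then show "X = Y" using chain[OF *(1,2)] less[OF *(1,2)] less[OF *(2,1)] by auto
  qed
  \<comment> \<open>The rank starts at 1 because, by \<open>nonzero\<close>, one of the two values
    of \<open>X\<close> is itself among the values counted for \<open>X\<close>.\<close>
  have "r ` C \<subseteq> {1..card A + card B}"
  proof
    fix n assume "n \<in> r ` C"
    then obtain X where X: "X \<in> C" "n = r X" by auto
    have "\<alpha> X \<in> {Z \<in> A. Z \<subseteq> \<alpha> X} \<or> \<beta> X \<in> {Z \<in> B. Z \<subseteq> \<beta> X}"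
      using nonzero[OF X(1)] X(1) by (auto simp: A_def B_def)
    then have "0 < card {Z \<in> A. Z \<subseteq> \<alpha> X} \<or> 0 < card {Z \<in> B. Z \<subseteq> \<beta> X}"
      using finAB by (subst (1 2) card_gt_0_iff) auto
    moreover have "card {Z \<in> A. Z \<subseteq> \<alpha> X} \<le> card A" "card {Z \<in> B. Z \<subseteq> \<beta> X} \<le> card B"
      using finAB by (auto intro: card_mono)
    ultimately show "n \<in> {1..card A + card B}" using X by (auto simp: r_def)
  qed
  then have "card C \<le> card {1..card A + card B}" using inj by (intro card_inj_on_le) auto
  then show ?thesis by (simp add: A_def B_def)
qed

text \<open>Zero is removed because \<open>\<gamma>\<close> may send a nonzero member of the chain
  to it.\<close>

lemma nz_chain_image:
  assumes "nz_chain \<Lambda> N C"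
    and "\<And>X. X \<in> C \<Longrightarrow> submodule (\<gamma> X) \<Delta> M"
    and "\<And>X Y. \<lbrakk>X \<in> C; Y \<in> C; X \<subseteq> Y\<rbrakk> \<Longrightarrow> \<gamma> X \<subseteq> \<gamma> Y"
  shows "nz_chain \<Delta> M (\<gamma> ` C - {{\<zero>\<^bsub>M\<^esub>}})"
proof -
  have "\<gamma> X \<subseteq> \<gamma> Y \<or> \<gamma> Y \<subseteq> \<gamma> X" if "X \<in> C" "Y \<in> C" for X Y
    using assms(1) assms(3)[of X Y] assms(3)[of Y X] that by (auto simp: nz_chain_def)
  moreover have "finite (\<gamma> ` C)" using assms(1) by (simp add: nz_chain_def)
  ultimately show ?thesis unfolding nz_chain_def using assms(2) by simp blast
qed

lemma nz_chain_finite: "nz_chain \<Lambda> M C \<Longrightarrow> finite C"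
  and nz_chain_submodule: "\<lbrakk>nz_chain \<Lambda> M C; X \<in> C\<rbrakk> \<Longrightarrow> submodule X \<Lambda> M"
  and nz_chain_nonzero: "\<lbrakk>nz_chain \<Lambda> M C; X \<in> C\<rbrakk> \<Longrightarrow> X \<noteq> {\<zero>\<^bsub>M\<^esub>}"
  and nz_chain_linear: "\<lbrakk>nz_chain \<Lambda> M C; X \<in> C; Y \<in> C\<rbrakk> \<Longrightarrow> X \<subseteq> Y \<or> Y \<subseteq> X"
  by (auto simp: nz_chain_def)

text \<open>An order embedding of submodule lattices transports chains without loss. No homomorphism
  is involved and the ring may change, so that submodules, preimages along surjections and
  restriction of scalars are all instances.\<close>

lemma fin_len_embed:
  assumes M: "fin_len \<Delta> M"
    and sub: "\<And>X. \<lbrakk>submodule X \<Lambda> N; X \<noteq> {\<zero>\<^bsub>N\<^esub>}\<rbrakk> \<Longrightarrow> submodule (\<gamma> X) \<Delta> M \<and> \<gamma> X \<noteq> {\<zero>\<^bsub>M\<^esub>}"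
    and mono: "\<And>X Y. X \<subseteq> Y \<Longrightarrow> \<gamma> X \<subseteq> \<gamma> Y"
    and inj: "\<And>X Y. \<lbrakk>submodule X \<Lambda> N; submodule Y \<Lambda> N; \<gamma> X = \<gamma> Y\<rbrakk> \<Longrightarrow> X = Y"
  shows "fin_len \<Lambda> N" "mlen \<Lambda> N \<le> mlen \<Delta> M"
proof -
  have *: "card C \<le> mlen \<Delta> M" if C: "nz_chain \<Lambda> N C" for C
  proof -
    have "\<gamma> X \<noteq> {\<zero>\<^bsub>M\<^esub>}" if "X \<in> C" for X using sub[of X] C that by (simp add: nz_chain_def)
    then have "\<gamma> ` C - {{\<zero>\<^bsub>M\<^esub>}} = \<gamma> ` C" by blast
    moreover have "inj_on \<gamma> C"
    proof (rule inj_onI)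
      fix X Y assume "X \<in> C" "Y \<in> C" "\<gamma> X = \<gamma> Y"
      then show "X = Y" using inj[of X Y] C by (simp add: nz_chain_def)
    qed
    ultimately have "card C = card (\<gamma> ` C - {{\<zero>\<^bsub>M\<^esub>}})" by (simp add: card_image)
    also have "\<dots> \<le> mlen \<Delta> M"
    proof (intro card_le_mlen[OF M] nz_chain_image[OF C, where \<gamma> = \<gamma>])
      fix X assume "X \<in> C"
      then show "submodule (\<gamma> X) \<Delta> M" using sub C by (simp add: nz_chain_def)
    qed (rule mono)
    finally show ?thesis .
  qed
  show "fin_len \<Lambda> N" "mlen \<Lambda> N \<le> mlen \<Delta> M" using fin_lenI[OF *] mlen_le[OF *] by auto
qed

section \<open>Length of submodules, images and extensions\<close>

lemma fin_len_submodule: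
  assumes "lmodule \<Lambda> M" "fin_len \<Lambda> M" "submodule H \<Lambda> M"
  shows "fin_len \<Lambda> (M\<lparr>carrier := H\<rparr>)" "mlen \<Lambda> (M\<lparr>carrier := H\<rparr>) \<le> mlen \<Lambda> M"
proof -
  have *: "\<And>X. \<lbrakk>submodule X \<Lambda> (M\<lparr>carrier := H\<rparr>); X \<noteq> {\<zero>\<^bsub>M\<lparr>carrier := H\<rparr>\<^esub>}\<rbrakk> \<Longrightarrow>
      submodule X \<Lambda> M \<and> X \<noteq> {\<zero>\<^bsub>M\<^esub>}"
    by (simp add: submodule_submodule_iff[OF assms(1,3)])
  show "fin_len \<Lambda> (M\<lparr>carrier := H\<rparr>)" "mlen \<Lambda> (M\<lparr>carrier := H\<rparr>) \<le> mlen \<Lambda> M"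
    by (rule fin_len_embed[OF assms(2), where \<gamma> = "\<lambda>X. X", OF *], assumption+)+
qed

text \<open>A longest chain in \<open>H\<close> can be prolonged by
  \<open>carrier M\<close>.\<close>

lemma mlen_submodule_less:
  assumes "lmodule \<Lambda> M" "fin_len \<Lambda> M" "submodule H \<Lambda> M" "H \<noteq> carrier M"
  shows "mlen \<Lambda> (M\<lparr>carrier := H\<rparr>) < mlen \<Lambda> M"
proof -
  obtain C where C: "nz_chain \<Lambda> (M\<lparr>carrier := H\<rparr>) C" "card C = mlen \<Lambda> (M\<lparr>carrier := H\<rparr>)"
    using mlen_attained[OF fin_len_submodule(1)[OF assms(1-3)]] .
  have CH: "submodule X \<Lambda> M" "X \<subseteq> H" "X \<noteq> {\<zero>\<^bsub>M\<^esub>}" if "X \<in> C" for X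
    using that nz_chain_submodule[OF C(1)] nz_chain_nonzero[OF C(1)]
    by (auto simp: submodule_submodule_iff[OF assms(1,3)])
  have HM: "H \<subset> carrier M" using assms(4) submodule_subset[OF assms(3)] by auto
  have "nz_chain \<Lambda> M (insert (carrier M) C)"
  proof -
    have "X \<subseteq> carrier M" if "X \<in> C" for X using CH(2)[OF that] HM by blast
    moreover have "carrier M \<noteq> {\<zero>\<^bsub>M\<^esub>}" using HM submodule_zero[OF assms(3)] by auto
    ultimately show ?thesis
      unfolding nz_chain_def ball_simps
      using nz_chain_finite[OF C(1)] nz_chain_linear[OF C(1)] CH(1,3) submodule_carrier[OF assms(1)]
      by simp
  qed
  then have "card (insert (carrier M) C) \<le> mlen \<Lambda> M" by (rule card_le_mlen[OF assms(2)])
  moreover have "carrier M \<notin> C" using CH(2) HM by blast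
  ultimately show ?thesis using C(2) nz_chain_finite[OF C(1)] by simp
qed

lemma fin_len_image:
  assumes "lmodule \<Lambda> M" "lmodule \<Lambda> N" "f \<in> mod_hom \<Lambda> M N" "f ` carrier M = carrier N" "fin_len \<Lambda> M"
  shows "fin_len \<Lambda> N"
proof (rule fin_len_embed(1)[OF assms(5), where \<gamma> = "\<lambda>X. {x \<in> carrier M. f x \<in> X}"])
  have im: "f ` {x \<in> carrier M. f x \<in> X} = X" if "submodule X \<Lambda> N" for X
  proof
    show "X \<subseteq> f ` {x \<in> carrier M. f x \<in> X}"
    proof
      fix y assume y: "y \<in> X"
      then have "y \<in> f ` carrier M" using submodule_subset[OF that] by (simp add: assms(4) subset_iff)
      then show "y \<in> f ` {x \<in> carrier M. f x \<in> X}" using y by blast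
    qed
  qed blast
  show "X = Y" if "submodule X \<Lambda> N" "submodule Y \<Lambda> N"
    "{x \<in> carrier M. f x \<in> X} = {x \<in> carrier M. f x \<in> Y}" for X Y
    using arg_cong[OF that(3), of "\<lambda>Z. f ` Z"] unfolding im[OF that(1)] im[OF that(2)] .
  show "submodule {x \<in> carrier M. f x \<in> X} \<Lambda> M \<and> {x \<in> carrier M. f x \<in> X} \<noteq> {\<zero>\<^bsub>M\<^esub>}"
    if "submodule X \<Lambda> N" "X \<noteq> {\<zero>\<^bsub>N\<^esub>}" for X
  proof
    show "submodule {x \<in> carrier M. f x \<in> X} \<Lambda> M" by (rule submodule_vimage[OF assms(1-3) that(1)])
    show "{x \<in> carrier M. f x \<in> X} \<noteq> {\<zero>\<^bsub>M\<^esub>}"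
    proof
      assume "{x \<in> carrier M. f x \<in> X} = {\<zero>\<^bsub>M\<^esub>}"
      then have "f ` {x \<in> carrier M. f x \<in> X} = f ` {\<zero>\<^bsub>M\<^esub>}" by (rule arg_cong)
      then have "X = f ` {\<zero>\<^bsub>M\<^esub>}" unfolding im[OF that(1)] .
      then show False using that(2) mod_hom_zero[OF assms(1-3)] by simp
    qed
  qed
  show "{x \<in> carrier M. f x \<in> X} \<subseteq> {x \<in> carrier M. f x \<in> Y}" if "X \<subseteq> Y" for X Y
    using that by blast
qed

text \<open>By the modular law, nested submodules with the same intersection with the kernel and the
  same image coincide. So \<open>card_chain_le\<close> applies to a chain in \<open>M\<close> with
  \<open>\<alpha>\<close> the intersection and \<open>\<beta>\<close> the image.\<close>

lemma fin_len_extension: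
  assumes "lmodule \<Lambda> M" "lmodule \<Lambda> N" "f \<in> mod_hom \<Lambda> M N"
    and "fin_len \<Lambda> (M\<lparr>carrier := a_kernel M N f\<rparr>)" "fin_len \<Lambda> N"
  shows "fin_len \<Lambda> M" "mlen \<Lambda> M \<le> mlen \<Lambda> (M\<lparr>carrier := a_kernel M N f\<rparr>) + mlen \<Lambda> N"
proof -
  let ?K = "a_kernel M N f"
  interpret M: lmodule \<Lambda> M by fact
  interpret N: lmodule \<Lambda> N by fact
  note K = submodule_kernel[OF assms(1-3)]
  have eq: "X = Y" if XY: "submodule X \<Lambda> M" "submodule Y \<Lambda> M" "X \<subseteq> Y" "X \<inter> ?K = Y \<inter> ?K" "f ` X = f ` Y"
    for X Y
  proof
    show "Y \<subseteq> X"
    proof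
      fix y assume y: "y \<in> Y"
      then obtain x where x: "x \<in> X" "f y = f x" using XY(5) by auto
      have c: "x \<in> carrier M" "y \<in> carrier M"
        using x y submodule_subset[OF XY(1)] submodule_subset[OF XY(2)] by auto
      have "y \<ominus>\<^bsub>M\<^esub> x \<in> Y" using x y XY(3) by (intro submodule_diff[OF XY(2)]) auto
      moreover have "y \<ominus>\<^bsub>M\<^esub> x \<in> ?K"
        using c x mod_hom_diff[OF assms(1-3) c(2,1)] mod_hom_closed[OF assms(3)]
        by (simp add: a_kernel_eq N.minus_eq_zero_iff)
      ultimately have "y \<ominus>\<^bsub>M\<^esub> x \<in> X" using XY(4) by auto
      then have "(y \<ominus>\<^bsub>M\<^esub> x) \<oplus>\<^bsub>M\<^esub> x \<in> X" using x by (intro submodule_add[OF XY(1)]) auto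
      then show "y \<in> X" using c by (simp add: a_minus_def M.a_assoc M.l_neg)
    qed
  qed fact
  have *: "card C \<le> mlen \<Lambda> (M\<lparr>carrier := ?K\<rparr>) + mlen \<Lambda> N" if C: "nz_chain \<Lambda> M C" for C
  proof -
    note sub = nz_chain_submodule[OF C]
    have z: "\<zero>\<^bsub>N\<^esub> \<in> f ` X" if "X \<in> C" for X
      using submodule_zero[OF submodule_image[OF assms(1-3) sub[OF that]]] .
    have "card C \<le> card ((\<lambda>X. X \<inter> ?K) ` C - {{\<zero>\<^bsub>M\<^esub>}}) + card ((\<lambda>X. f ` X) ` C - {{\<zero>\<^bsub>N\<^esub>}})"
    proof (rule card_chain_le)
      fix X assume X: "X \<in> C"
      show "{\<zero>\<^bsub>M\<^esub>} \<subseteq> X \<inter> ?K \<and> {\<zero>\<^bsub>N\<^esub>} \<subseteq> f ` X"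
        using submodule_zero[OF sub[OF X]] submodule_zero[OF K] z[OF X] by simp
      show "X \<inter> ?K \<noteq> {\<zero>\<^bsub>M\<^esub>} \<or> f ` X \<noteq> {\<zero>\<^bsub>N\<^esub>}"
      proof (rule ccontr)
        assume "\<not> ?thesis"
        then have "X \<inter> ?K = {\<zero>\<^bsub>M\<^esub>}" "f ` X = {\<zero>\<^bsub>N\<^esub>}" by auto
        then have "X = {\<zero>\<^bsub>M\<^esub>}"
          using submodule_subset[OF sub[OF X]] by (auto simp: a_kernel_eq)
        then show False using nz_chain_nonzero[OF C X] by simp
      qed
    next
      fix X Y assume "X \<in> C" "Y \<in> C" "X \<subseteq> Y" "X \<inter> ?K = Y \<inter> ?K" "f ` X = f ` Y"
      then show "X = Y" by (rule eq[OF sub sub])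
    qed (use nz_chain_finite[OF C] nz_chain_linear[OF C] in auto)
    also have "card ((\<lambda>X. X \<inter> ?K) ` C - {{\<zero>\<^bsub>M\<^esub>}}) \<le> mlen \<Lambda> (M\<lparr>carrier := ?K\<rparr>)"
    proof (rule card_le_mlen[OF assms(4)])
      have "nz_chain \<Lambda> (M\<lparr>carrier := ?K\<rparr>) ((\<lambda>X. X \<inter> ?K) ` C - {{\<zero>\<^bsub>M\<lparr>carrier := ?K\<rparr>\<^esub>}})"
      proof (rule nz_chain_image[OF C, where \<gamma> = "\<lambda>X. X \<inter> ?K"])
        fix X assume "X \<in> C"
        then show "submodule (X \<inter> ?K) \<Lambda> (M\<lparr>carrier := ?K\<rparr>)"
          using submodule_Int[OF assms(1) sub K] by (simp add: submodule_submodule_iff[OF assms(1) K])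
      qed blast
      then show "nz_chain \<Lambda> (M\<lparr>carrier := ?K\<rparr>) ((\<lambda>X. X \<inter> ?K) ` C - {{\<zero>\<^bsub>M\<^esub>}})" by simp
    qed
    also have "card ((\<lambda>X. f ` X) ` C - {{\<zero>\<^bsub>N\<^esub>}}) \<le> mlen \<Lambda> N"
    proof (rule card_le_mlen[OF assms(5) nz_chain_image[OF C, where \<gamma> = "\<lambda>X. f ` X"]])
      fix X assume "X \<in> C"
      then show "submodule (f ` X) \<Lambda> N" by (rule submodule_image[OF assms(1-3) sub])
    qed blast
    finally show ?thesis by simp
  qed
  show "fin_len \<Lambda> M" "mlen \<Lambda> M \<le> mlen \<Lambda> (M\<lparr>carrier := ?K\<rparr>) + mlen \<Lambda> N"
    using fin_lenI[OF *] mlen_le[OF *] by auto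
qed

text \<open>For the remaining inequality, a longest chain in the kernel is continued by the
  preimages of a longest chain in \<open>N\<close>. The two pieces are disjoint because chains omit
  zero, so that every such preimage properly contains the kernel.\<close>

lemma mlen_exact:
  assumes "lmodule \<Lambda> M" "lmodule \<Lambda> N" "f \<in> mod_hom \<Lambda> M N" "f ` carrier M = carrier N" "fin_len \<Lambda> M"
  shows "mlen \<Lambda> M = mlen \<Lambda> (M\<lparr>carrier := a_kernel M N f\<rparr>) + mlen \<Lambda> N"
proof (rule antisym)
  let ?K = "a_kernel M N f"
  note K = submodule_kernel[OF assms(1-3)]
  have fK: "fin_len \<Lambda> (M\<lparr>carrier := ?K\<rparr>)" by (rule fin_len_submodule(1)[OF assms(1,5) K])
  have fN: "fin_len \<Lambda> N" by (rule fin_len_image[OF assms])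
  show "mlen \<Lambda> M \<le> mlen \<Lambda> (M\<lparr>carrier := ?K\<rparr>) + mlen \<Lambda> N"
    by (rule fin_len_extension(2)[OF assms(1-3) fK fN])
  obtain C where C: "nz_chain \<Lambda> (M\<lparr>carrier := ?K\<rparr>) C" "card C = mlen \<Lambda> (M\<lparr>carrier := ?K\<rparr>)"
    using mlen_attained[OF fK] .
  obtain D where D: "nz_chain \<Lambda> N D" "card D = mlen \<Lambda> N"
    using mlen_attained[OF fN] .
  define pre where "pre X = {x \<in> carrier M. f x \<in> X}" for X
  have im: "f ` pre X = X" if "X \<in> D" for X
    using submodule_subset[OF nz_chain_submodule[OF D(1) that]] assms(4) by (auto simp: pre_def)
  have CK: "submodule X \<Lambda> M" "X \<subseteq> ?K" "X \<noteq> {\<zero>\<^bsub>M\<^esub>}" if "X \<in> C" for X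
    using that nz_chain_submodule[OF C(1)] nz_chain_nonzero[OF C(1)]
    by (auto simp: submodule_submodule_iff[OF assms(1) K])
  have DK: "submodule (pre X) \<Lambda> M" "?K \<subseteq> pre X" "\<not> pre X \<subseteq> ?K" "pre X \<noteq> {\<zero>\<^bsub>M\<^esub>}" if X: "X \<in> D" for X
  proof -
    note sX = nz_chain_submodule[OF D(1) X]
    show "submodule (pre X) \<Lambda> M" unfolding pre_def by (rule submodule_vimage[OF assms(1-3) sX])
    show "?K \<subseteq> pre X" using submodule_zero[OF sX] by (auto simp: pre_def a_kernel_eq)
    show 1: "\<not> pre X \<subseteq> ?K"
    proof
      assume "pre X \<subseteq> ?K"
      then have "f ` pre X \<subseteq> {\<zero>\<^bsub>N\<^esub>}" by (auto simp: a_kernel_eq)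
      then have "X \<subseteq> {\<zero>\<^bsub>N\<^esub>}" by (simp only: im[OF X])
      then show False using submodule_zero[OF sX] nz_chain_nonzero[OF D(1) X] by auto
    qed
    show "pre X \<noteq> {\<zero>\<^bsub>M\<^esub>}" using 1 submodule_zero[OF K] by auto
  qed
  have "nz_chain \<Lambda> M (C \<union> pre ` D)"
    unfolding nz_chain_def
  proof (intro conjI ballI)
    show "finite (C \<union> pre ` D)" using nz_chain_finite[OF C(1)] nz_chain_finite[OF D(1)] by simp
    fix X assume X: "X \<in> C \<union> pre ` D"
    show "submodule X \<Lambda> M" using X CK(1) DK(1) by blast
    show "X \<noteq> {\<zero>\<^bsub>M\<^esub>}" using X CK(3) DK(4) by blast
    fix Y assume Y: "Y \<in> C \<union> pre ` D"
    have "pre Z \<subseteq> pre W \<or> pre W \<subseteq> pre Z" if "Z \<in> D" "W \<in> D" for Z W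
      using nz_chain_linear[OF D(1) that] by (auto simp: pre_def)
    then show "X \<subseteq> Y \<or> Y \<subseteq> X"
      using X Y nz_chain_linear[OF C(1)] CK(2) DK(2) by (elim UnE imageE) blast+
  qed
  then have "card (C \<union> pre ` D) \<le> mlen \<Lambda> M" by (rule card_le_mlen[OF assms(5)])
  moreover have "card (C \<union> pre ` D) = card C + card D"
  proof (subst card_Un_disjoint)
    show "C \<inter> pre ` D = {}" using CK(2) DK(3) by blast
    have "inj_on pre D" by (rule inj_on_inverseI[of _ "\<lambda>X. f ` X"]) (rule im)
    then show "card C + card (pre ` D) = card C + card D" by (simp add: card_image)
  qed (use nz_chain_finite[OF C(1)] nz_chain_finite[OF D(1)] in auto)
  ultimately show "mlen \<Lambda> (M\<lparr>carrier := ?K\<rparr>) + mlen \<Lambda> N \<le> mlen \<Lambda> M" using C D by simp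
qed

lemma fin_len_zero:
  assumes "carrier M = {\<zero>\<^bsub>M\<^esub>}"
  shows "fin_len \<Lambda> M" "mlen \<Lambda> M = 0"
proof -
  have *: "card C \<le> 0" if C: "nz_chain \<Lambda> M C" for C
  proof -
    have "X = {\<zero>\<^bsub>M\<^esub>}" if "X \<in> C" for X
      using submodule_subset[OF nz_chain_submodule[OF C that]]
        submodule_zero[OF nz_chain_submodule[OF C that]] assms by auto
    then have "C = {}" using nz_chain_nonzero[OF C] by blast
    then show ?thesis by simp
  qed
  show "fin_len \<Lambda> M" "mlen \<Lambda> M = 0" using fin_lenI[OF *] mlen_le[OF *] by auto
qed

lemma mlen_eq_0_iff:
  assumes "lmodule \<Lambda> M" "fin_len \<Lambda> M"
  shows "mlen \<Lambda> M = 0 \<longleftrightarrow> carrier M = {\<zero>\<^bsub>M\<^esub>}"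
proof
  assume "mlen \<Lambda> M = 0"
  then show "carrier M = {\<zero>\<^bsub>M\<^esub>}"
    using mlen_submodule_less[OF assms submodule_trivial[OF assms(1)]] by auto
qed (rule fin_len_zero)

lemma mlen_iso:
  assumes "lmodule \<Lambda> M" "lmodule \<Lambda> N" "fin_len \<Lambda> M" "mod_isomorphic \<Lambda> M N"
  shows "mlen \<Lambda> M = mlen \<Lambda> N"
proof -
  obtain f where f: "f \<in> mod_hom \<Lambda> M N" "inj_on f (carrier M)" "f ` carrier M = carrier N"
    using assms(4) by (auto simp: mod_isomorphic_def bij_betw_def)
  then show ?thesis
    using mlen_exact[OF assms(1,2) f(1,3) assms(3)] mod_hom_inj_iff[OF assms(1,2) f(1)]
      fin_len_zero(2)[of "M\<lparr>carrier := {\<zero>\<^bsub>M\<^esub>}\<rparr>" \<Lambda>] by simp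
qed

text \<open>Additivity leaves length zero for the kernel. Applied with \<open>N = M\<close>, it
  makes surjective endomorphisms bijective.\<close>

lemma surj_endo_inj:
  assumes "lmodule \<Lambda> M" "lmodule \<Lambda> N" "fin_len \<Lambda> M" "f \<in> mod_hom \<Lambda> M N" "f ` carrier M = carrier N"
    and "mlen \<Lambda> M \<le> mlen \<Lambda> N"
  shows "inj_on f (carrier M)"
proof -
  note K = submodule_kernel[OF assms(1,2,4)]
  have "mlen \<Lambda> (M\<lparr>carrier := a_kernel M N f\<rparr>) = 0"
    using mlen_exact[OF assms(1,2,4,5,3)] assms(6) by simp
  then show ?thesis
    using mlen_eq_0_iff[OF lmodule_submodule[OF assms(1) K] fin_len_submodule(1)[OF assms(1,3) K]]
      mod_hom_inj_iff[OF assms(1,2,4)] by simp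
qed

text \<open>A candidate of least length is minimal, since a proper submodule of it would be shorter.
  Together with its counterpart for greatest length this supplies minimal submodules mapping onto a
  module, complements and maximal proper submodules.\<close>

lemma minimal_submodule:
  assumes "lmodule \<Lambda> M" "fin_len \<Lambda> M" "Q X0" "\<And>X. Q X \<Longrightarrow> submodule X \<Lambda> M"
  obtains X where "Q X" "\<And>Y. \<lbrakk>Q Y; Y \<subseteq> X\<rbrakk> \<Longrightarrow> Y = X"
proof -
  obtain X where X: "Q X" "\<And>Y. Q Y \<Longrightarrow> mlen \<Lambda> (M\<lparr>carrier := X\<rparr>) \<le> mlen \<Lambda> (M\<lparr>carrier := Y\<rparr>)"
    using ex_has_least_nat[of Q X0 "\<lambda>X. mlen \<Lambda> (M\<lparr>carrier := X\<rparr>)"] assms(3) by auto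
  have "Y = X" if Y: "Q Y" "Y \<subseteq> X" for Y
  proof (rule ccontr)
    assume "Y \<noteq> X"
    then have "mlen \<Lambda> (M\<lparr>carrier := Y\<rparr>) < mlen \<Lambda> (M\<lparr>carrier := X\<rparr>)"
      using mlen_submodule_less[OF lmodule_submodule[OF assms(1)] fin_len_submodule(1)[OF assms(1,2)], of X Y]
        assms(4)[OF X(1)] assms(4)[OF Y(1)] Y(2) by (simp add: submodule_submodule_iff[OF assms(1)])
    then show False using X(2)[OF Y(1)] by simp
  qed
  then show ?thesis using that X(1) by blast
qed

lemma maximal_submodule:
  assumes "lmodule \<Lambda> M" "fin_len \<Lambda> M" "Q X0" "\<And>X. Q X \<Longrightarrow> submodule X \<Lambda> M"
  obtains X where "Q X" "\<And>Y. \<lbrakk>Q Y; X \<subseteq> Y\<rbrakk> \<Longrightarrow> Y = X"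
proof -
  have "\<forall>X. Q X \<longrightarrow> mlen \<Lambda> (M\<lparr>carrier := X\<rparr>) < Suc (mlen \<Lambda> M)"
    using fin_len_submodule(2)[OF assms(1,2) assms(4)] by (simp add: less_Suc_eq_le)
  then obtain X where X: "Q X" "\<And>Y. Q Y \<Longrightarrow> mlen \<Lambda> (M\<lparr>carrier := Y\<rparr>) \<le> mlen \<Lambda> (M\<lparr>carrier := X\<rparr>)"
    using ex_has_greatest_nat[of Q X0 "\<lambda>X. mlen \<Lambda> (M\<lparr>carrier := X\<rparr>)" "Suc (mlen \<Lambda> M)"] assms(3) by blast
  have "Y = X" if Y: "Q Y" "X \<subseteq> Y" for Y
  proof (rule ccontr)
    assume "Y \<noteq> X"
    then have "mlen \<Lambda> (M\<lparr>carrier := X\<rparr>) < mlen \<Lambda> (M\<lparr>carrier := Y\<rparr>)"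
      using mlen_submodule_less[OF lmodule_submodule[OF assms(1)] fin_len_submodule(1)[OF assms(1,2)], of Y X]
        assms(4)[OF X(1)] assms(4)[OF Y(1)] Y(2) by (simp add: submodule_submodule_iff[OF assms(1)])
    then show False using X(2)[OF Y(1)] by simp
  qed
  then show ?thesis using that X(1) by blast
qed

text \<open>The internal sum is an image of the external one, which is an extension of
  \<open>B\<close> by a copy of \<open>A\<close>.\<close>

lemma fin_len_sum:
  assumes "lmodule \<Lambda> M" "submodule A \<Lambda> M" "submodule B \<Lambda> M"
    and "fin_len \<Lambda> (M\<lparr>carrier := A\<rparr>)" "fin_len \<Lambda> (M\<lparr>carrier := B\<rparr>)"
  shows "fin_len \<Lambda> (M\<lparr>carrier := sum_sub M A B\<rparr>)"
proof (rule fin_len_image)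
  note lm = lmodule_submodule[OF assms(1,2)] lmodule_submodule[OF assms(1,3)]
  let ?D = "dsum (M\<lparr>carrier := A\<rparr>) (M\<lparr>carrier := B\<rparr>)"
  show D: "lmodule \<Lambda> ?D" by (rule lmodule_dsum[OF lm])
  show "lmodule \<Lambda> (M\<lparr>carrier := sum_sub M A B\<rparr>)"
    by (rule lmodule_submodule[OF assms(1) submodule_sum(1)[OF assms(1-3)]])
  have "(\<lambda>x. fst x \<oplus>\<^bsub>M\<^esub> snd x) \<in> mod_hom \<Lambda> ?D M"
    by (rule mod_hom_copair[OF lm assms(1) mod_hom_incl mod_hom_incl])
      (auto dest: subsetD[OF submodule_subset[OF assms(2)]] subsetD[OF submodule_subset[OF assms(3)]])
  then show "(\<lambda>x. fst x \<oplus>\<^bsub>M\<^esub> snd x) \<in> mod_hom \<Lambda> ?D (M\<lparr>carrier := sum_sub M A B\<rparr>)"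
    by (rule mod_hom_into) (auto intro: sum_subI)
  show "(\<lambda>x. fst x \<oplus>\<^bsub>M\<^esub> snd x) ` carrier ?D = carrier (M\<lparr>carrier := sum_sub M A B\<rparr>)"
    by (force simp: sum_sub_def)
  interpret A: lmodule \<Lambda> "M\<lparr>carrier := A\<rparr>" by (rule lm)
  interpret B: lmodule \<Lambda> "M\<lparr>carrier := B\<rparr>" by (rule lm)
  have inl: "(\<lambda>x. (x, \<zero>\<^bsub>M\<^esub>)) \<in> mod_hom \<Lambda> (M\<lparr>carrier := A\<rparr>) ?D"
    using mod_hom_inl[OF lm(2), of "M\<lparr>carrier := A\<rparr>"] by simp
  show "fin_len \<Lambda> ?D"
  proof (rule fin_len_extension(1)[OF D lm(2) mod_hom_snd _ assms(5)])
    have K: "submodule (a_kernel ?D (M\<lparr>carrier := B\<rparr>) snd) \<Lambda> ?D"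
      by (rule submodule_kernel[OF D lm(2) mod_hom_snd])
    show "fin_len \<Lambda> (?D\<lparr>carrier := a_kernel ?D (M\<lparr>carrier := B\<rparr>) snd\<rparr>)"
      by (rule fin_len_image[OF lm(1) lmodule_submodule[OF D K] _ _ assms(4),
            of "\<lambda>x. (x, \<zero>\<^bsub>M\<^esub>)"])
        (use B.M.zero_closed in \<open>auto simp: a_kernel_eq intro!: mod_hom_into inl\<close>)
  qed
qed

text \<open>A maximal finitely generated submodule absorbs every further element, hence is
  everything.\<close>

lemma fin_len_fin_gen:
  assumes "lmodule \<Lambda> M" "fin_len \<Lambda> M"
  shows "fin_gen \<Lambda> M"
proof -
  interpret lmodule \<Lambda> M by fact
  define Q where "Q X \<longleftrightarrow> (\<exists>S. finite S \<and> S \<subseteq> carrier M \<and> X = mod_span \<Lambda> M S)" for X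
  have "Q (mod_span \<Lambda> M {})" by (auto simp: Q_def)
  then obtain X where X: "Q X" "\<And>Y. \<lbrakk>Q Y; X \<subseteq> Y\<rbrakk> \<Longrightarrow> Y = X"
    by (rule maximal_submodule[OF assms]) (auto simp: Q_def submodule_mod_span[OF assms(1)])
  then obtain S where S: "finite S" "S \<subseteq> carrier M" "X = mod_span \<Lambda> M S" by (auto simp: Q_def)
  have "carrier M \<subseteq> X"
  proof
    fix x assume x: "x \<in> carrier M"
    have sub: "X \<subseteq> mod_span \<Lambda> M (insert x S)"
      unfolding S(3) using x S(2) mod_span_superset[of "insert x S" \<Lambda> M]
      by (intro mod_span_least submodule_mod_span[OF assms(1)]) auto
    have "Q (mod_span \<Lambda> M (insert x S))" using x S by (auto simp: Q_def intro: exI[of _ "insert x S"])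
    then have "mod_span \<Lambda> M (insert x S) = X" using X(2) sub by blast
    then show "x \<in> X" using mod_span_superset[of "insert x S" \<Lambda> M] by auto
  qed
  moreover have "X \<subseteq> carrier M"
    unfolding S(3) using submodule_subset[OF submodule_mod_span[OF assms(1) S(2)]] .
  ultimately show ?thesis using S by (auto simp: fin_gen_def)
qed

text \<open>Generators are adjoined one at a time. The predicate is about subsets of the fixed
  module \<open>M\<close>, so that all stages of the induction share one type.\<close>

lemma fg_induct [consumes 1, case_names zero sum]:
  assumes "fg_module \<Lambda> M" "Q {\<zero>\<^bsub>M\<^esub>}"
    and step: "\<And>x H. \<lbrakk>x \<in> carrier M; submodule H \<Lambda> M; Q H\<rbrakk> \<Longrightarrow>
      Q (sum_sub M ((\<lambda>r. r \<odot>\<^bsub>M\<^esub> x) ` carrier \<Lambda>) H)"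
  shows "Q (carrier M)"
proof -
  have lm: "lmodule \<Lambda> M" using assms(1) by (simp add: fg_module_def)
  obtain S where S: "finite S" "S \<subseteq> carrier M" "mod_span \<Lambda> M S = carrier M"
    using assms(1) by (auto simp: fg_module_def fin_gen_def)
  have "\<exists>H. submodule H \<Lambda> M \<and> S \<subseteq> H \<and> Q H"
    using S(1,2)
  proof (induction S rule: finite_induct)
    case empty
    show ?case using submodule_trivial[OF lm] assms(2) by blast
  next
    case (insert x S)
    then obtain H where H: "submodule H \<Lambda> M" "S \<subseteq> H" "Q H" by auto
    have x: "x \<in> carrier M" using insert by simp
    let ?C = "(\<lambda>r. r \<odot>\<^bsub>M\<^esub> x) ` carrier \<Lambda>"
    note C = submodule_cyclic[OF lm x]
    note CH = submodule_sum[OF lm C(1) H(1)]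
    have "insert x S \<subseteq> sum_sub M ?C H" using CH C(2) H(2) by blast
    then show ?case using CH(1) step[OF x H(1,3)] by blast
  qed
  then obtain H where H: "submodule H \<Lambda> M" "S \<subseteq> H" "Q H" by auto
  then have "H = carrier M"
    using S(3) mod_span_least[OF H(1,2)] submodule_subset[OF H(1)] by blast
  then show ?thesis using H(3) by simp
qed

text \<open>Finite length of the regular module makes all finitely generated modules of finite
  length, and this is the finiteness on which covers and g-vectors rest. Both the base ring
  \<open>R\<close> and the algebra \<open>\<Lambda>\<close> are instances.\<close>

locale fl_ring = ring \<Lambda> for \<Lambda> :: "('a, 'k) ring_scheme" (structure) +
  assumes fin_len_regular: "fin_len \<Lambda> (regular_module \<Lambda>)"
begin

lemma fg_fin_len:
  assumes "fg_module \<Lambda> M" shows "fin_len \<Lambda> M"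
proof -
  have lm: "lmodule \<Lambda> M" using assms by (simp add: fg_module_def)
  have "fin_len \<Lambda> (M\<lparr>carrier := carrier M\<rparr>)"
    using assms
  proof (induction rule: fg_induct)
    case zero
    show ?case by (rule fin_len_zero) simp
  next
    case (sum x H)
    note C = submodule_cyclic[OF lm sum(1)]
    have "fin_len \<Lambda> (M\<lparr>carrier := (\<lambda>r. r \<odot>\<^bsub>M\<^esub> x) ` carrier \<Lambda>\<rparr>)"
      by (rule fin_len_image[OF lmodule_regular[OF ring_axioms] lmodule_submodule[OF lm C(1)] mod_hom_into _
            fin_len_regular, OF mod_hom_scalar[OF lm sum(1)]]) auto
    then show ?case by (intro fin_len_sum lm C(1) sum(2,3))
  qed
  then show ?thesis by simp
qed

lemma fg_submodule:
  assumes "fg_module \<Lambda> M" "submodule H \<Lambda> M"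
  shows "fg_module \<Lambda> (M\<lparr>carrier := H\<rparr>)"
proof -
  have lm: "lmodule \<Lambda> M" using assms by (simp add: fg_module_def)
  show ?thesis
    using lmodule_submodule[OF lm assms(2)] fin_len_submodule(1)[OF lm fg_fin_len[OF assms(1)] assms(2)]
    by (simp add: fg_module_def fin_len_fin_gen)
qed

end


section \<open>Artinian commutative rings and Artin algebras have finite length\<close>

lemma submodule_regular_ideal:
  assumes "cring R" "submodule I R (regular_module R)"
  shows "ideal I R"
proof -
  interpret cring R by fact
  note I = submodule_subset[OF assms(2)] submodule_smult[OF assms(2)]
  show ?thesis
  proof (rule idealI)
    show "ring R" by (rule ring_axioms)
    show "subgroup I (add_monoid R)"
    proof (rule add.subgroupI)
      show "I \<subseteq> carrier R" using I(1) by simp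
      show "I \<noteq> {}" using submodule_zero[OF assms(2)] by auto
      show "\<ominus>\<^bsub>R\<^esub> x \<in> I" if "x \<in> I" for x
        using I(2)[of "\<ominus>\<^bsub>R\<^esub> \<one>\<^bsub>R\<^esub>" x] I(1) that by (auto simp: l_minus)
      show "x \<oplus>\<^bsub>R\<^esub> y \<in> I" if "x \<in> I" "y \<in> I" for x y
        using submodule_add[OF assms(2) that] by simp
    qed
    fix a x assume *: "a \<in> I" "x \<in> carrier R"
    then show "x \<otimes>\<^bsub>R\<^esub> a \<in> I" using I(2) by simp
    then show "a \<otimes>\<^bsub>R\<^esub> x \<in> I" using * I(1) by (simp add: m_comm subset_iff)
  qed
qed

text \<open>If no minimal member existed, dependent choice would produce a strictly descending
  sequence. Commutativity turns submodules of the regular module into the two-sided ideals that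
  \<open>artinian\<close> speaks about.\<close>

lemma artinian_minimal:
  fixes R :: "('a, 'k) ring_scheme" and X0 :: "'a set"
  assumes "cring R" "artinian R" "Q X0" "\<And>X. Q X \<Longrightarrow> submodule X R (regular_module R)"
  obtains X where "Q X" "\<And>Y. \<lbrakk>Q Y; Y \<subseteq> X\<rbrakk> \<Longrightarrow> Y = X"
proof -
  have "\<exists>X. Q X \<and> (\<forall>Y. Q Y \<and> Y \<subseteq> X \<longrightarrow> Y = X)"
  proof (rule ccontr)
    assume "\<not> ?thesis"
    then have *: "\<exists>Y. Q Y \<and> Y \<subset> X" if "Q X" for X using that by blast
    have "\<exists>I :: nat \<Rightarrow> _. \<forall>n. Q (I n) \<and> I (Suc n) \<subset> I n"
      by (rule dependent_nat_choice[where P = "\<lambda>_. Q" and Q = "\<lambda>_ X Y. Y \<subset> X"])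
        (use assms(3) * in blast)+
    then obtain I :: "nat \<Rightarrow> 'a set" where I: "\<And>n. Q (I n)" "\<And>n. I (Suc n) \<subset> I n" by blast
    have "\<forall>n. ideal (I n) R \<and> I (Suc n) \<subseteq> I n"
    proof (intro allI conjI)
      show "ideal (I n) R" for n by (rule submodule_regular_ideal[OF assms(1) assms(4)[OF I(1)]])
      show "I (Suc n) \<subseteq> I n" for n using I(2)[of n] by blast
    qed
    then have "\<exists>n. \<forall>m\<ge>n. I m = I n" by (rule assms(2)[unfolded artinian_def, THEN spec, THEN mp])
    then obtain n where n: "\<And>m. m \<ge> n \<Longrightarrow> I m = I n" by blast
    have "I (Suc n) = I n" by (rule n) simp
    then show False using I(2)[of n] by simp
  qed
  then show ?thesis using that by blast
qed

lemma mult_hom: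
  assumes "cring R" "r \<in> carrier R"
  shows "(\<lambda>x. r \<otimes>\<^bsub>R\<^esub> x) \<in> mod_hom R (regular_module R) (regular_module R)"
proof -
  interpret cring R by fact
  show ?thesis using assms(2) by (intro mod_homI) (simp_all add: r_distr m_lcomm)
qed

text \<open>A minimal ideal \<open>I\<close> of infinite length would be a vector space over a field, because every
  \<open>r\<close> acts on it as zero or invertibly, all of whose proper subspaces have finite length.\<close>

lemma artinian_fin_len:
  fixes R (structure)
  assumes "cring R" "artinian R"
  shows "fin_len R (regular_module R)"
proof (rule ccontr)
  assume contra: "\<not> fin_len R (regular_module R)"
  interpret cring R by fact
  let ?M = "regular_module R"
  note lm = lmodule_regular[OF ring_axioms]
  define Q where "Q X \<longleftrightarrow> submodule X R ?M \<and> \<not> fin_len R (?M\<lparr>carrier := X\<rparr>)" for X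
  have "Q (carrier R)"
    unfolding Q_def using contra submodule_carrier[OF lm] by (simp add: regular_module_def)
  then obtain I where I: "Q I" "\<And>Y. \<lbrakk>Q Y; Y \<subseteq> I\<rbrakk> \<Longrightarrow> Y = I"
    by (rule artinian_minimal[OF assms]) (auto simp: Q_def)
  have sI: "submodule I R ?M" and nI: "\<not> fin_len R (?M\<lparr>carrier := I\<rparr>)"
    using I(1) by (auto simp: Q_def)
  have Ic: "x \<in> carrier R" if "x \<in> I" for x using submodule_subset[OF sI] that by auto
  have proper: "fin_len R (?M\<lparr>carrier := Y\<rparr>)" if "submodule Y R ?M" "Y \<subseteq> I" "Y \<noteq> I" for Y
    using I(2)[of Y] that by (auto simp: Q_def)
  have lI: "lmodule R (?M\<lparr>carrier := I\<rparr>)" by (rule lmodule_submodule[OF lm sI])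
  \<comment> \<open>Otherwise the kernel and the image of multiplication by \<open>r\<close> on
    \<open>I\<close> are both proper in \<open>I\<close>, hence of finite length by minimality, and
    \<open>I\<close> would be an extension of one by the other.\<close>
  have dich: "(\<forall>x\<in>I. r \<otimes> x = \<zero>) \<or> (\<lambda>x. r \<otimes> x) ` I = I" if r: "r \<in> carrier R" for r
  proof (rule ccontr)
    assume neg: "\<not> ?thesis"
    let ?rI = "(\<lambda>x. r \<otimes> x) ` I"
    have hom: "(\<lambda>x. r \<otimes> x) \<in> mod_hom R (?M\<lparr>carrier := I\<rparr>) ?M"
      using mod_hom_restrict[OF mult_hom[OF assms(1) r]] submodule_subset[OF sI] by simp
    have rI: "submodule ?rI R ?M" by (rule submodule_image[OF lm lm mult_hom[OF assms(1) r] sI])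
    have sub: "?rI \<subseteq> I" using submodule_smult[OF sI r] by auto
    have hom': "(\<lambda>x. r \<otimes> x) \<in> mod_hom R (?M\<lparr>carrier := I\<rparr>) (?M\<lparr>carrier := ?rI\<rparr>)"
      by (rule mod_hom_into[OF hom]) simp
    have lr: "lmodule R (?M\<lparr>carrier := ?rI\<rparr>)" by (rule lmodule_submodule[OF lm rI])
    let ?K = "a_kernel (?M\<lparr>carrier := I\<rparr>) (?M\<lparr>carrier := ?rI\<rparr>) (\<lambda>x. r \<otimes> x)"
    have K: "submodule ?K R ?M" "?K \<subseteq> I"
      using submodule_kernel[OF lI lr hom'] by (auto simp: submodule_submodule_iff[OF lm sI])
    have "?K \<noteq> I" using neg by (auto simp: a_kernel_eq)
    then have "fin_len R (?M\<lparr>carrier := ?K\<rparr>)" using proper K by blast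
    moreover have "fin_len R (?M\<lparr>carrier := ?rI\<rparr>)" using proper[OF rI sub] neg by blast
    ultimately have "fin_len R (?M\<lparr>carrier := I\<rparr>)"
      by (intro fin_len_extension(1)[OF lI lr hom']) simp_all
    then show False using nI by simp
  qed
  \<comment> \<open>The principal ideals generated by the powers of \<open>r\<close> become
    stationary, so some power satisfies \<open>r^n = t r^(n+1)\<close>. As \<open>r I = I\<close>,
    every element of \<open>I\<close> is a multiple of \<open>r^n\<close>, and on such elements
    \<open>t r\<close> acts as the identity.\<close>
  have unit: "\<exists>t\<in>carrier R. \<forall>x\<in>I. t \<otimes> (r \<otimes> x) = x" if r: "r \<in> carrier R" and nz: "\<not> (\<forall>x\<in>I. r \<otimes> x = \<zero>)" for r
  proof -
    have rI: "(\<lambda>x. r \<otimes> x) ` I = I" using dich[OF r] nz by blast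
    have pow: "\<exists>y\<in>I. x = r [^] n \<otimes> y" if "x \<in> I" for x and n :: nat
      using that
    proof (induction n arbitrary: x)
      case 0
      then show ?case using Ic by (intro bexI[of _ x]) simp_all
    next
      case (Suc n)
      then obtain y where y: "y \<in> I" "x = r [^] n \<otimes> y" by blast
      then have "y \<in> (\<lambda>x. r \<otimes> x) ` I" by (simp only: rI)
      then obtain z where "z \<in> I" "y = r \<otimes> z" by blast
      then show ?case using y r Ic by (intro bexI[of _ z]) (simp_all add: m_assoc)
    qed
    define P where "P X \<longleftrightarrow> (\<exists>n::nat. X = (\<lambda>s. s \<otimes> r [^] n) ` carrier R)" for X
    have sub: "submodule ((\<lambda>s. s \<otimes> r [^] n) ` carrier R) R ?M" for n :: nat
      using submodule_cyclic(1)[OF lm, of "r [^] n"] r by simp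
    have "P ((\<lambda>s. s \<otimes> r [^] (0::nat)) ` carrier R)" unfolding P_def by blast
    then obtain X where X: "P X" "\<And>Y. \<lbrakk>P Y; Y \<subseteq> X\<rbrakk> \<Longrightarrow> Y = X"
      by (rule artinian_minimal[OF assms]) (use sub in \<open>auto simp: P_def\<close>)
    then obtain n :: nat where n: "X = (\<lambda>s. s \<otimes> r [^] n) ` carrier R" by (auto simp: P_def)
    let ?Y = "(\<lambda>s. s \<otimes> r [^] Suc n) ` carrier R"
    have "P ?Y" unfolding P_def by blast
    moreover have "?Y \<subseteq> X"
    proof
      fix y assume "y \<in> ?Y"
      then obtain s where "s \<in> carrier R" "y = s \<otimes> r [^] Suc n" by auto
      then have "s \<otimes> r \<in> carrier R" "y = (s \<otimes> r) \<otimes> r [^] n" using r by (simp_all add: m_ac)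
      then show "y \<in> X" unfolding n by blast
    qed
    ultimately have "?Y = X" by (rule X(2))
    moreover have "r [^] n \<in> X" unfolding n using r by (intro image_eqI[of _ _ \<one>]) simp_all
    ultimately have "r [^] n \<in> ?Y" by simp
    then obtain t where t: "t \<in> carrier R" "r [^] n = t \<otimes> r [^] Suc n" by auto
    show ?thesis
    proof (intro bexI ballI)
      fix x assume "x \<in> I"
      then obtain y where y: "y \<in> I" "x = r [^] n \<otimes> y" using pow by blast
      have yc: "y \<in> carrier R" by (rule Ic[OF y(1)])
      have "t \<otimes> (r \<otimes> x) = (t \<otimes> r [^] Suc n) \<otimes> y"
        unfolding y(2) using t(1) r yc by (simp add: m_ac)
      then show "t \<otimes> (r \<otimes> x) = x" unfolding t(2)[symmetric] y(2)[symmetric] .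
    qed (rule t(1))
  qed
  have "I \<noteq> {\<zero>}" using nI fin_len_zero(1)[of "?M\<lparr>carrier := {\<zero>}\<rparr>" R] by auto
  then obtain x where x: "x \<in> I" "x \<noteq> \<zero>" using submodule_zero[OF sI] by auto
  \<comment> \<open>In the vector space picture, a maximal \<open>H\<close> avoiding the nonzero
    vector \<open>x\<close> is a hyperplane with \<open>I = H + R x\<close>. Zorn's lemma is used
    because the length of \<open>I\<close> is not yet known to be finite.\<close>
  define S where "S = {H. submodule H R ?M \<and> H \<subseteq> I \<and> x \<notin> H}"
  have "{\<zero>} \<in> S"
    unfolding S_def using submodule_trivial[OF lm] submodule_zero[OF sI] x by simp
  then have "S \<noteq> {}" by blast
  moreover have "\<Union>C \<in> S" if C: "C \<noteq> {}" "subset.chain S C" for C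
  proof -
    have CS: "submodule H R ?M" "H \<subseteq> I" "x \<notin> H" if "H \<in> C" for H
      using C(2) that by (auto simp: subset.chain_def S_def)
    obtain H0 where H0: "H0 \<in> C" using C(1) by blast
    have "submodule (\<Union>C) R ?M"
    proof (rule lmodule.submoduleI[OF lm])
      show "\<Union>C \<subseteq> carrier ?M" using CS(2) Ic by auto
      show "\<zero>\<^bsub>?M\<^esub> \<in> \<Union>C" using H0 submodule_zero[OF CS(1)[OF H0]] by blast
    next
      fix u v assume "u \<in> \<Union>C" "v \<in> \<Union>C"
      then obtain A B where AB: "A \<in> C" "B \<in> C" "u \<in> A" "v \<in> B" by blast
      then have "A \<subseteq> B \<or> B \<subseteq> A" using C(2) by (auto simp: subset.chain_def)
      then show "u \<oplus>\<^bsub>?M\<^esub> v \<in> \<Union>C"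
        using AB submodule_add[OF CS(1)[OF AB(1)], of u v] submodule_add[OF CS(1)[OF AB(2)], of u v]
        by blast
    next
      fix a u assume a: "a \<in> carrier R" and "u \<in> \<Union>C"
      then obtain A where A: "A \<in> C" "u \<in> A" by blast
      then show "a \<odot>\<^bsub>?M\<^esub> u \<in> \<Union>C" using submodule_smult[OF CS(1)[OF A(1)] a A(2)] by blast
    qed
    then show ?thesis using CS(2,3) by (auto simp: S_def)
  qed
  ultimately obtain H where H: "H \<in> S" "\<And>X. \<lbrakk>X \<in> S; H \<subseteq> X\<rbrakk> \<Longrightarrow> X = H"
    using subset_Zorn_nonempty[of S] by metis
  have sH: "submodule H R ?M" and HI: "H \<subseteq> I" and xH: "x \<notin> H" using H(1) by (auto simp: S_def)
  have Hc: "h \<in> carrier R" if "h \<in> H" for h using that HI Ic by blast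
  have xc: "x \<in> carrier ?M" using x Ic by simp
  let ?C = "(\<lambda>r. r \<odot>\<^bsub>?M\<^esub> x) ` carrier R"
  note C = submodule_cyclic[OF lm xc]
  have CI: "?C \<subseteq> I" using submodule_smult[OF sI _ x(1)] by blast
  have "I \<subseteq> sum_sub ?M H ?C"
  proof
    fix y assume y: "y \<in> I"
    have yc: "y \<in> carrier ?M" using y Ic by simp
    let ?D = "(\<lambda>r. r \<odot>\<^bsub>?M\<^esub> y) ` carrier R"
    note D = submodule_cyclic[OF lm yc]
    have DI: "?D \<subseteq> I" using submodule_smult[OF sI _ y] by blast
    note HD = submodule_sum[OF lm sH D(1)]
    show "y \<in> sum_sub ?M H ?C"
    proof (cases "y \<in> H")
      case True
      then show ?thesis using submodule_sum(2)[OF lm sH C(1)] by blast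
    next
      case False
      have "sum_sub ?M H ?D \<notin> S"
      proof
        assume "sum_sub ?M H ?D \<in> S"
        then have "sum_sub ?M H ?D = H" using H(2) HD(2) by blast
        then show False using HD(3) D(2) False by blast
      qed
      moreover have "sum_sub ?M H ?D \<subseteq> I" by (rule sum_sub_least[OF sI HI DI])
      \<comment> \<open>By maximality of \<open>H\<close>, adjoining \<open>y\<close> captures
        \<open>x\<close>. The coefficient \<open>s\<close> of \<open>y\<close> does not act as zero,
        for otherwise \<open>x\<close> would be in \<open>H\<close>; so it can be inverted on
        \<open>I\<close> and the relation solved for \<open>y\<close>.\<close>
      ultimately have "x \<in> sum_sub ?M H ?D" using HD(1) by (simp add: S_def)
      then obtain h s where hs: "h \<in> H" "s \<in> carrier R" "x = h \<oplus> s \<otimes> y" by (auto simp: sum_sub_def)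
      have "\<not> (\<forall>x\<in>I. s \<otimes> x = \<zero>)"
      proof
        assume "\<forall>x\<in>I. s \<otimes> x = \<zero>"
        then have "x = h" using hs y Hc by simp
        then show False using hs xH by simp
      qed
      then obtain t where t: "t \<in> carrier R" "\<forall>x\<in>I. t \<otimes> (s \<otimes> x) = x" using unit[OF hs(2)] by blast
      have "t \<otimes> x = t \<otimes> h \<oplus> y"
        using t y hs Hc Ic by (simp add: r_distr)
      then have "\<ominus> (t \<otimes> h) \<oplus> t \<otimes> x = y"
        using t y hs Hc Ic r_neg1 by simp
      moreover have "\<ominus> t \<otimes> h \<in> H" using submodule_smult[OF sH, of "\<ominus> t" h] t hs by simp
      then have "\<ominus> (t \<otimes> h) \<in> H" using t hs Hc by (simp add: l_minus)
      moreover have "t \<otimes> x \<in> ?C" using t by simp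
      ultimately show ?thesis using sum_subI[of "\<ominus> (t \<otimes> h)" H "t \<otimes> x" ?C ?M] by simp
    qed
  qed
  moreover have "sum_sub ?M H ?C \<subseteq> I" by (rule sum_sub_least[OF sI HI CI])
  ultimately have sum: "sum_sub ?M H ?C = I" by blast
  \<comment> \<open>A nonzero multiple of \<open>x\<close> can be scaled back to \<open>x\<close>,
    so \<open>R x\<close> is simple and has length at most one. With \<open>H\<close> of finite
    length as a proper subspace, \<open>I = H + R x\<close> contradicts the choice of
    \<open>I\<close>.\<close>
  have simple: "X = ?C" if X: "submodule X R (?M\<lparr>carrier := ?C\<rparr>)" "X \<noteq> {\<zero>}" for X
  proof -
    have X': "submodule X R ?M" "X \<subseteq> ?C" using X(1) unfolding submodule_submodule_iff[OF lm C(1)] by blast+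
    obtain y where y: "y \<in> X" "y \<noteq> \<zero>" using X(2) submodule_zero[OF X'(1)] by auto
    then obtain s where s: "s \<in> carrier R" "y = s \<otimes> x" using X'(2) by auto
    then have "\<not> (\<forall>x\<in>I. s \<otimes> x = \<zero>)" using y x by blast
    then obtain t where t: "t \<in> carrier R" "\<forall>x\<in>I. t \<otimes> (s \<otimes> x) = x" using unit[OF s(1)] by blast
    then have "x \<in> X" using submodule_smult[OF X'(1) t(1) y(1)] s x by simp
    then have "?C \<subseteq> X" using submodule_smult[OF X'(1)] by blast
    then show ?thesis using X'(2) by blast
  qed
  have "card D \<le> 1" if D: "nz_chain R (?M\<lparr>carrier := ?C\<rparr>) D" for D
  proof -
    have "D \<subseteq> {?C}" using simple[OF nz_chain_submodule[OF D]] nz_chain_nonzero[OF D] by auto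
    then have "card D \<le> card {?C}" by (intro card_mono) simp_all
    then show ?thesis by simp
  qed
  then have "fin_len R (?M\<lparr>carrier := ?C\<rparr>)" by (rule fin_lenI)
  moreover have "fin_len R (?M\<lparr>carrier := H\<rparr>)" using proper[OF sH HI] xH x(1) by blast
  ultimately have "fin_len R (?M\<lparr>carrier := sum_sub ?M H ?C\<rparr>)" by (intro fin_len_sum lm sH C(1))
  then show False using nI sum by simp
qed

section \<open>Restriction of scalars along the structure map\<close>

lemma restrict_scalars_simps [simp]:
  "carrier (restrict_scalars \<phi> M) = carrier M"
  "\<zero>\<^bsub>restrict_scalars \<phi> M\<^esub> = \<zero>\<^bsub>M\<^esub>"
  "x \<oplus>\<^bsub>restrict_scalars \<phi> M\<^esub> y = x \<oplus>\<^bsub>M\<^esub> y"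
  "r \<odot>\<^bsub>restrict_scalars \<phi> M\<^esub> x = \<phi> r \<odot>\<^bsub>M\<^esub> x"
  "(restrict_scalars \<phi> M)\<lparr>carrier := H\<rparr> = restrict_scalars \<phi> (M\<lparr>carrier := H\<rparr>)"
  by (simp_all add: restrict_scalars_def)

context artin_algebra
begin

lemma structure_closed: "r \<in> carrier R \<Longrightarrow> \<phi> r \<in> carrier \<Lambda>"
  using structure_hom by (auto simp: ring_hom_def)

lemma lmodule_restrict:
  assumes "lmodule \<Lambda> M" shows "lmodule R (restrict_scalars \<phi> M)"
proof -
  interpret lmodule \<Lambda> M by fact
  have ag: "abelian_group (restrict_scalars \<phi> M)"
  proof (rule abelian_groupI)
    fix x assume "x \<in> carrier (restrict_scalars \<phi> M)"
    then show "\<exists>y\<in>carrier (restrict_scalars \<phi> M).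
        y \<oplus>\<^bsub>restrict_scalars \<phi> M\<^esub> x = \<zero>\<^bsub>restrict_scalars \<phi> M\<^esub>"
      by (intro bexI[of _ "\<ominus>\<^bsub>M\<^esub> x"]) (simp_all add: M.l_neg)
  qed (simp_all add: M.a_ac)
  show ?thesis
  proof (rule lmoduleI[OF R.ring_axioms ag])
    fix x assume "x \<in> carrier (restrict_scalars \<phi> M)"
    then show "\<one>\<^bsub>R\<^esub> \<odot>\<^bsub>restrict_scalars \<phi> M\<^esub> x = x"
      using structure_hom by (simp add: ring_hom_def)
  qed (use structure_hom structure_closed in \<open>simp_all add: ring_hom_def smult_l_distr smult_r_distr smult_assoc1\<close>)
qed

lemma submodule_restrict:
  assumes "lmodule \<Lambda> M" "submodule X \<Lambda> M" shows "submodule X R (restrict_scalars \<phi> M)"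
proof -
  show ?thesis
    using assms submodule_smult[OF assms(2) structure_closed]
    by (simp add: lmodule.submodule_iff lmodule_restrict)
qed

lemma mod_hom_restrict_scalars:
  "f \<in> mod_hom \<Lambda> M N \<Longrightarrow> f \<in> mod_hom R (restrict_scalars \<phi> M) (restrict_scalars \<phi> N)"
  by (simp add: mod_hom_iff structure_closed)

lemma fl_ring_base: "fl_ring R"
  using R.ring_axioms artinian_fin_len[OF R.cring_axioms artinian_base]
  by (simp add: fl_ring_def fl_ring_axioms_def)

lemma fin_len_restrict:
  assumes "lmodule \<Lambda> M" "fin_len R (restrict_scalars \<phi> M)"
  shows "fin_len \<Lambda> M"
proof (rule fin_len_embed(1)[OF assms(2), where \<gamma> = "\<lambda>X. X"])
  fix X assume "submodule X \<Lambda> M" "X \<noteq> {\<zero>\<^bsub>M\<^esub>}"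
  then show "submodule X R (restrict_scalars \<phi> M) \<and> X \<noteq> {\<zero>\<^bsub>restrict_scalars \<phi> M\<^esub>}"
    using submodule_restrict[OF assms(1)] by simp
qed

lemma fin_len_restrict_regular: "fin_len R (restrict_scalars \<phi> (regular_module \<Lambda>))"
  by (rule fl_ring.fg_fin_len[OF fl_ring_base])
    (simp add: fg_module_def finite_over_base lmodule_restrict[OF lmodule_regular[OF \<Lambda>.ring_axioms]])

lemma fl_ring: "fl_ring \<Lambda>"
  using \<Lambda>.ring_axioms fin_len_restrict[OF lmodule_regular[OF \<Lambda>.ring_axioms] fin_len_restrict_regular]
  by (simp add: fl_ring_def fl_ring_axioms_def)

text \<open>Needed because injectivity of \<open>J\<close> is stated against finitely generated
  \<open>R\<close>-modules only. The argument goes through finite length over \<open>R\<close>, by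
  induction over generators.\<close>

lemma fg_restrict:
  assumes "fg_module \<Lambda> M" shows "fg_module R (restrict_scalars \<phi> M)"
proof -
  have lm: "lmodule \<Lambda> M" using assms by (simp add: fg_module_def)
  have "fin_len R (restrict_scalars \<phi> (M\<lparr>carrier := carrier M\<rparr>))"
    using assms
  proof (induction rule: fg_induct)
    case zero
    show ?case by (rule fin_len_zero) simp
  next
    case (sum x H)
    let ?C = "(\<lambda>r. r \<odot>\<^bsub>M\<^esub> x) ` carrier \<Lambda>"
    note C = submodule_cyclic[OF lm sum(1)]
    have "(\<lambda>r. r \<odot>\<^bsub>M\<^esub> x) \<in> mod_hom \<Lambda> (regular_module \<Lambda>) (M\<lparr>carrier := ?C\<rparr>)"
      by (rule mod_hom_into[OF mod_hom_scalar[OF lm sum(1)]]) simp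
    from fin_len_image[OF lmodule_restrict[OF lmodule_regular[OF \<Lambda>.ring_axioms]]
        lmodule_restrict[OF lmodule_submodule[OF lm C(1)]] mod_hom_restrict_scalars[OF this] _
        fin_len_restrict_regular]
    have "fin_len R ((restrict_scalars \<phi> M)\<lparr>carrier := ?C\<rparr>)" by simp
    moreover have "fin_len R ((restrict_scalars \<phi> M)\<lparr>carrier := H\<rparr>)" using sum(3) by simp
    ultimately have "fin_len R ((restrict_scalars \<phi> M)\<lparr>carrier := sum_sub (restrict_scalars \<phi> M) ?C H\<rparr>)"
      by (rule fin_len_sum[OF lmodule_restrict[OF lm] submodule_restrict[OF lm C(1)]
            submodule_restrict[OF lm sum(2)]])
    then show ?case by (simp add: sum_sub_def)
  qed
  then have "fin_len R (restrict_scalars \<phi> M)" by simp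
  then show ?thesis
    using lmodule_restrict[OF lm] fin_len_fin_gen by (auto simp: fg_module_def)
qed

end


section \<open>Projective modules and projective covers\<close>

lemma fg_lmodule: "fg_module \<Lambda> M \<Longrightarrow> lmodule \<Lambda> M"
  by (simp add: fg_module_def)

lemma projective_fg: "projective \<Lambda> P \<Longrightarrow> fg_module \<Lambda> P"
  and projective_lmodule: "projective \<Lambda> P \<Longrightarrow> lmodule \<Lambda> P"
  by (simp_all add: projective_def fg_module_def)

text \<open>Both directions of the isomorphism are provided, since moving a diagram into
  \<open>'a univ\<close> and bringing the solution back uses each of them.\<close>

lemma univ_copy:
  fixes M :: "('a, 'm) module"
  assumes "fg_module \<Lambda> M"
  obtains M' :: "('a, 'a univ) module" and i j where
    "fg_module \<Lambda> M'" "i \<in> mod_hom \<Lambda> M M'" "j \<in> mod_hom \<Lambda> M' M"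
    "\<And>x. x \<in> carrier M \<Longrightarrow> j (i x) = x" "\<And>y. y \<in> carrier M' \<Longrightarrow> i (j y) = y"
proof -
  obtain M' :: "('a, 'a univ) module" where M': "fg_module \<Lambda> M'" "mod_isomorphic \<Lambda> M M'"
    using fg_module_univ[OF assms] by blast
  then obtain i where i: "i \<in> mod_hom \<Lambda> M M'" "bij_betw i (carrier M) (carrier M')"
    by (auto simp: mod_isomorphic_def)
  obtain j where "j \<in> mod_hom \<Lambda> M' M" "\<And>x. x \<in> carrier M \<Longrightarrow> j (i x) = x"
    "\<And>y. y \<in> carrier M' \<Longrightarrow> i (j y) = y"
    using mod_hom_inv[OF fg_lmodule[OF assms] i] by metis
  then show ?thesis using that M'(1) i(1) by blast
qed

lemma mod_isomorphicI:
  assumes "f \<in> mod_hom \<Lambda> M N" "g \<in> mod_hom \<Lambda> N M"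
    and "\<And>x. x \<in> carrier M \<Longrightarrow> g (f x) = x" "\<And>y. y \<in> carrier N \<Longrightarrow> f (g y) = y"
  shows "mod_isomorphic \<Lambda> M N"
proof -
  have "bij_betw f (carrier M) (carrier N)"
    by (rule bij_betw_byWitness[where f' = g]) (use assms mod_hom_closed in \<open>auto\<close>)
  then show ?thesis using assms(1) by (auto simp: mod_isomorphic_def)
qed

lemma projectiveD:
  fixes P :: "('a, 'p) module" and A B :: "('a, 'a univ) module"
  assumes "projective \<Lambda> P" "fg_module \<Lambda> A" "fg_module \<Lambda> B" "g \<in> mod_hom \<Lambda> A B"
    "g ` carrier A = carrier B" "f \<in> mod_hom \<Lambda> P B"
  shows "\<exists>h\<in>mod_hom \<Lambda> P A. \<forall>x\<in>carrier P. g (h x) = f x"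
  using assms(1)[unfolded projective_def, THEN conjunct2, THEN spec, THEN spec, THEN bspec, OF assms(4),
      THEN bspec, OF assms(6)] assms(2,3,5) by simp

text \<open>The definition grants liftings only for modules on \<open>'a univ\<close>. Conjugating
  \<open>g\<close> and \<open>f\<close> with copies extends this to modules on any types, as is
  required for direct sums and quotients.\<close>

lemma projective_lift:
  fixes A :: "('a, 'm) module" and B :: "('a, 'n) module"
  assumes P: "projective \<Lambda> P" and "fg_module \<Lambda> A" "fg_module \<Lambda> B"
    and g: "g \<in> mod_hom \<Lambda> A B" "g ` carrier A = carrier B" and f: "f \<in> mod_hom \<Lambda> P B"
  obtains h where "h \<in> mod_hom \<Lambda> P A" "\<And>x. x \<in> carrier P \<Longrightarrow> g (h x) = f x"
proof -
  obtain A' :: "('a, 'a univ) module" and i i' where A': "fg_module \<Lambda> A'" "i \<in> mod_hom \<Lambda> A A'" "i' \<in> mod_hom \<Lambda> A' A"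
    "\<And>x. x \<in> carrier A \<Longrightarrow> i' (i x) = x" "\<And>y. y \<in> carrier A' \<Longrightarrow> i (i' y) = y"
    using univ_copy[OF assms(2)] by blast
  obtain B' :: "('a, 'a univ) module" and j j' where B': "fg_module \<Lambda> B'" "j \<in> mod_hom \<Lambda> B B'" "j' \<in> mod_hom \<Lambda> B' B"
    "\<And>x. x \<in> carrier B \<Longrightarrow> j' (j x) = x" "\<And>y. y \<in> carrier B' \<Longrightarrow> j (j' y) = y"
    using univ_copy[OF assms(3)] by blast
  let ?g = "\<lambda>x. j (g (i' x))"
  have g': "?g \<in> mod_hom \<Lambda> A' B'"
    using mod_hom_comp[OF mod_hom_comp[OF A'(3) g(1)] B'(2)] .
  have "?g ` carrier A' = carrier B'"
  proof
    show "?g ` carrier A' \<subseteq> carrier B'" using mod_hom_closed[OF g'] by blast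
    show "carrier B' \<subseteq> ?g ` carrier A'"
    proof
      fix y assume y: "y \<in> carrier B'"
      then have "j' y \<in> g ` carrier A" unfolding g(2) by (rule mod_hom_closed[OF B'(3)])
      then obtain x where x: "x \<in> carrier A" "j' y = g x" by blast
      then have "?g (i x) = y" using A'(4) B'(5)[OF y] by simp
      then show "y \<in> ?g ` carrier A'" using mod_hom_closed[OF A'(2) x(1)] by blast
    qed
  qed
  moreover have f': "(\<lambda>x. j (f x)) \<in> mod_hom \<Lambda> P B'" by (rule mod_hom_comp[OF f B'(2)])
  ultimately obtain h where h: "h \<in> mod_hom \<Lambda> P A'" "\<forall>x\<in>carrier P. ?g (h x) = j (f x)"
    using projectiveD[OF P A'(1) B'(1) g'] by blast
  show ?thesis
  proof
    show "(\<lambda>x. i' (h x)) \<in> mod_hom \<Lambda> P A" by (rule mod_hom_comp[OF h(1) A'(3)])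
    fix x assume x: "x \<in> carrier P"
    then have "j' (?g (h x)) = j' (j (f x))" using h(2) by simp
    then show "g (i' (h x)) = f x"
      using B'(4) mod_hom_closed[OF f x] mod_hom_closed[OF g(1) mod_hom_closed[OF A'(3) mod_hom_closed[OF h(1) x]]]
      by simp
  qed
qed

lemma projectiveI:
  fixes P :: "('a, 'p) module"
  assumes "fg_module \<Lambda> P"
    and "\<And>(A :: ('a, 'a univ) module) (B :: ('a, 'a univ) module) g f.
      \<lbrakk>fg_module \<Lambda> A; fg_module \<Lambda> B; g \<in> mod_hom \<Lambda> A B; g ` carrier A = carrier B; f \<in> mod_hom \<Lambda> P B\<rbrakk> \<Longrightarrow>
      \<exists>h\<in>mod_hom \<Lambda> P A. \<forall>x\<in>carrier P. g (h x) = f x"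
  shows "projective \<Lambda> P"
  using assms unfolding projective_def by blast

lemma projective_retract:
  assumes P: "projective \<Lambda> P" and Q: "lmodule \<Lambda> Q" and s: "s \<in> mod_hom \<Lambda> Q P" and r: "r \<in> mod_hom \<Lambda> P Q"
    and rs: "\<And>x. x \<in> carrier Q \<Longrightarrow> r (s x) = x"
  shows "projective \<Lambda> Q"
proof (rule projectiveI)
  have "r ` carrier P = carrier Q"
  proof
    show "r ` carrier P \<subseteq> carrier Q" using mod_hom_closed[OF r] by blast
    show "carrier Q \<subseteq> r ` carrier P"
    proof
      fix x assume "x \<in> carrier Q"
      then have "x = r (s x)" "s x \<in> carrier P" using rs mod_hom_closed[OF s] by auto
      then show "x \<in> r ` carrier P" by (rule image_eqI)
    qed
  qed
  then show "fg_module \<Lambda> Q" by (rule fg_module_image[OF projective_fg[OF P] Q r])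
  fix A B :: "('a, 'a univ) module" and g f
  assume AB: "fg_module \<Lambda> A" "fg_module \<Lambda> B" "g \<in> mod_hom \<Lambda> A B" "g ` carrier A = carrier B"
    and f: "f \<in> mod_hom \<Lambda> Q B"
  obtain h where h: "h \<in> mod_hom \<Lambda> P A" "\<And>x. x \<in> carrier P \<Longrightarrow> g (h x) = f (r x)"
    using projective_lift[OF P AB mod_hom_comp[OF r f]] by blast
  have "\<forall>x\<in>carrier Q. g (h (s x)) = f x"
    using h(2) rs mod_hom_closed[OF s] by simp
  then show "\<exists>h\<in>mod_hom \<Lambda> Q A. \<forall>x\<in>carrier Q. g (h x) = f x"
    by (rule bexI[OF _ mod_hom_comp[OF s h(1)]])
qed

lemma projective_iso:
  assumes "projective \<Lambda> P" "lmodule \<Lambda> Q" "mod_isomorphic \<Lambda> P Q"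
  shows "projective \<Lambda> Q"
proof -
  obtain i where i: "i \<in> mod_hom \<Lambda> P Q" "bij_betw i (carrier P) (carrier Q)"
    using assms(3) by (auto simp: mod_isomorphic_def)
  obtain j where "j \<in> mod_hom \<Lambda> Q P" "\<And>y. y \<in> carrier Q \<Longrightarrow> i (j y) = y"
    using mod_hom_inv[OF projective_lmodule[OF assms(1)] i] by metis
  then show ?thesis using projective_retract[OF assms(1,2) _ i(1)] by blast
qed

lemma projective_dsum:
  assumes P: "projective \<Lambda> P" and Q: "projective \<Lambda> Q"
  shows "projective \<Lambda> (dsum P Q)"
proof (rule projectiveI)
  note lm = projective_lmodule[OF P] projective_lmodule[OF Q]
  interpret P: lmodule \<Lambda> P by (rule lm)
  interpret Q: lmodule \<Lambda> Q by (rule lm)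
  show "fg_module \<Lambda> (dsum P Q)" by (rule fg_module_dsum[OF projective_fg[OF P] projective_fg[OF Q]])
  fix A B :: "('a, 'a univ) module" and g f
  assume AB: "fg_module \<Lambda> A" "fg_module \<Lambda> B" "g \<in> mod_hom \<Lambda> A B" "g ` carrier A = carrier B"
    and f: "f \<in> mod_hom \<Lambda> (dsum P Q) B"
  obtain h where h: "h \<in> mod_hom \<Lambda> P A" "\<And>x. x \<in> carrier P \<Longrightarrow> g (h x) = f (x, \<zero>\<^bsub>Q\<^esub>)"
    using projective_lift[OF P AB mod_hom_comp[OF mod_hom_inl[OF lm(2)] f]] by blast
  obtain k where k: "k \<in> mod_hom \<Lambda> Q A" "\<And>x. x \<in> carrier Q \<Longrightarrow> g (k x) = f (\<zero>\<^bsub>P\<^esub>, x)"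
    using projective_lift[OF Q AB mod_hom_comp[OF mod_hom_inr[OF lm(1)] f]] by blast
  have "g (h (fst z) \<oplus>\<^bsub>A\<^esub> k (snd z)) = f z" if "z \<in> carrier (dsum P Q)" for z
  proof -
    have z: "fst z \<in> carrier P" "snd z \<in> carrier Q" using that by auto
    have "g (h (fst z) \<oplus>\<^bsub>A\<^esub> k (snd z)) = f (fst z, \<zero>\<^bsub>Q\<^esub>) \<oplus>\<^bsub>B\<^esub> f (\<zero>\<^bsub>P\<^esub>, snd z)"
      using mod_hom_add[OF AB(3) mod_hom_closed[OF h(1) z(1)] mod_hom_closed[OF k(1) z(2)]] h(2)[OF z(1)] k(2)[OF z(2)]
      by simp
    also have "\<dots> = f ((fst z, \<zero>\<^bsub>Q\<^esub>) \<oplus>\<^bsub>dsum P Q\<^esub> (\<zero>\<^bsub>P\<^esub>, snd z))"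
      using z by (subst mod_hom_add[OF f]) simp_all
    also have "\<dots> = f z" using z by simp
    finally show ?thesis .
  qed
  then have "\<forall>z\<in>carrier (dsum P Q). g (h (fst z) \<oplus>\<^bsub>A\<^esub> k (snd z)) = f z" by blast
  then show "\<exists>h\<in>mod_hom \<Lambda> (dsum P Q) A. \<forall>x\<in>carrier (dsum P Q). g (h x) = f x"
    by (rule bexI[OF _ mod_hom_copair[OF lm fg_lmodule[OF AB(1)] h(1) k(1)]])
qed

lemma projective_regular:
  assumes "ring \<Lambda>" shows "projective \<Lambda> (regular_module \<Lambda>)"
proof (rule projectiveI)
  interpret ring \<Lambda> by fact
  show "fg_module \<Lambda> (regular_module \<Lambda>)" by (rule fg_module_regular[OF assms])
  fix A B :: "('a, 'a univ) module" and g f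
  assume AB: "fg_module \<Lambda> A" "fg_module \<Lambda> B" "g \<in> mod_hom \<Lambda> A B" "g ` carrier A = carrier B"
    and f: "f \<in> mod_hom \<Lambda> (regular_module \<Lambda>) B"
  have "f \<one>\<^bsub>\<Lambda>\<^esub> \<in> g ` carrier A" unfolding AB(4) using mod_hom_closed[OF f] by simp
  then obtain a where a: "a \<in> carrier A" "f \<one>\<^bsub>\<Lambda>\<^esub> = g a" by blast
  have "g (x \<odot>\<^bsub>A\<^esub> a) = f x" if "x \<in> carrier \<Lambda>" for x
    using mod_hom_smult[OF AB(3) that a(1)] mod_hom_smult[OF f that, of "\<one>\<^bsub>\<Lambda>\<^esub>"] a(2) that by simp
  then show "\<exists>h\<in>mod_hom \<Lambda> (regular_module \<Lambda>) A. \<forall>x\<in>carrier (regular_module \<Lambda>). g (h x) = f x"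
    using mod_hom_scalar[OF fg_lmodule[OF AB(1)] a(1)] by (intro bexI[of _ "\<lambda>x. x \<odot>\<^bsub>A\<^esub> a"]) simp_all
qed

lemma mod_hom_const_zero:
  assumes "lmodule \<Lambda> N" shows "(\<lambda>x. \<zero>\<^bsub>N\<^esub>) \<in> mod_hom \<Lambda> M N"
proof -
  interpret lmodule \<Lambda> N by fact
  show ?thesis by (intro mod_homI) (simp_all add: smult_r_null)
qed

lemma projective_zero:
  assumes "lmodule \<Lambda> P" "carrier P = {\<zero>\<^bsub>P\<^esub>}"
  shows "projective \<Lambda> P"
proof (rule projectiveI)
  have "mod_span \<Lambda> P {} \<subseteq> {\<zero>\<^bsub>P\<^esub>}" using assms(2) submodule_subset[OF submodule_mod_span[OF assms(1)]] by blast
  moreover have "\<zero>\<^bsub>P\<^esub> \<in> mod_span \<Lambda> P {}" using submodule_zero[OF submodule_mod_span[OF assms(1)]] by simp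
  ultimately have "mod_span \<Lambda> P {} = carrier P" using assms(2) by auto
  then show "fg_module \<Lambda> P" using assms(1) unfolding fg_module_def fin_gen_def by blast
  fix A B :: "('a, 'a univ) module" and g f
  assume AB: "fg_module \<Lambda> A" "fg_module \<Lambda> B" "g \<in> mod_hom \<Lambda> A B" "f \<in> mod_hom \<Lambda> P B"
  note lm = fg_lmodule[OF AB(1)] fg_lmodule[OF AB(2)]
  have "g \<zero>\<^bsub>A\<^esub> = f x" if "x \<in> carrier P" for x
    using that mod_hom_zero[OF lm AB(3)] mod_hom_zero[OF assms(1) lm(2) AB(4)] unfolding assms(2) by simp
  then show "\<exists>h\<in>mod_hom \<Lambda> P A. \<forall>x\<in>carrier P. g (h x) = f x"
    by (intro bexI[OF _ mod_hom_const_zero[OF lm(1)]] ballI)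
qed

text \<open>A projective module is built from one copy of the regular module per generator. After
  each step it is copied back into \<open>'a univ\<close>: the direct sum has a new element type,
  and the induction predicate can only quantify over modules of one type.\<close>

lemma projective_onto:
  fixes M :: "('a, 'm) module"
  assumes "fg_module \<Lambda> M"
  obtains P :: "('a, 'a univ) module" and f where
    "projective \<Lambda> P" "f \<in> mod_hom \<Lambda> P M" "f ` carrier P = carrier M"
proof -
  define Q where "Q H \<longleftrightarrow> (\<exists>(P :: ('a, 'a univ) module) f. projective \<Lambda> P \<and> f \<in> mod_hom \<Lambda> P M \<and> f ` carrier P = H)" for H
  interpret lmodule \<Lambda> M by (rule fg_lmodule[OF assms])
  note lm = lmodule_axioms
  have "Q (carrier M)"
    using assms
  proof (induction rule: fg_induct)
    case zero
    let ?Z = "M\<lparr>carrier := {\<zero>\<^bsub>M\<^esub>}\<rparr>"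
    have Z: "projective \<Lambda> ?Z"
      by (rule projective_zero[OF lmodule_submodule[OF lm submodule_trivial[OF lm]]]) simp
    obtain P :: "('a, 'a univ) module" and i j where P: "fg_module \<Lambda> P" "i \<in> mod_hom \<Lambda> ?Z P" "j \<in> mod_hom \<Lambda> P ?Z"
      "\<And>x. x \<in> carrier ?Z \<Longrightarrow> j (i x) = x" "\<And>y. y \<in> carrier P \<Longrightarrow> i (j y) = y"
      using univ_copy[OF projective_fg[OF Z]] by blast
    have "projective \<Lambda> P" by (rule projective_retract[OF Z fg_lmodule[OF P(1)] P(3,2,5)])
    moreover have "j \<in> mod_hom \<Lambda> P M" by (rule mod_hom_weaken[OF P(3)]) simp
    moreover have "j ` carrier P = {\<zero>\<^bsub>M\<^esub>}"
      using mod_hom_closed[OF P(3)] submodule_zero[OF submodule_carrier[OF fg_lmodule[OF P(1)]]] by auto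
    ultimately show ?case unfolding Q_def by blast
  next
    case (sum x H)
    then obtain P :: "('a, 'a univ) module" and f where P: "projective \<Lambda> P" "f \<in> mod_hom \<Lambda> P M" "f ` carrier P = H"
      unfolding Q_def by blast
    let ?D = "dsum (regular_module \<Lambda>) P"
    have D: "projective \<Lambda> ?D" by (rule projective_dsum[OF projective_regular[OF R.ring_axioms] P(1)])
    obtain P' :: "('a, 'a univ) module" and i j where P': "fg_module \<Lambda> P'" "i \<in> mod_hom \<Lambda> ?D P'" "j \<in> mod_hom \<Lambda> P' ?D"
      "\<And>x. x \<in> carrier ?D \<Longrightarrow> j (i x) = x" "\<And>y. y \<in> carrier P' \<Longrightarrow> i (j y) = y"
      using univ_copy[OF projective_fg[OF D]] by blast
    let ?f = "\<lambda>z. fst z \<odot>\<^bsub>M\<^esub> x \<oplus>\<^bsub>M\<^esub> f (snd z)"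
    have f: "?f \<in> mod_hom \<Lambda> ?D M"
      using mod_hom_copair[OF lmodule_regular[OF R.ring_axioms] projective_lmodule[OF P(1)] lm
          mod_hom_scalar[OF lm sum(1)] P(2)] .
    have im: "?f ` carrier ?D = sum_sub M ((\<lambda>r. r \<odot>\<^bsub>M\<^esub> x) ` carrier \<Lambda>) H"
      unfolding P(3)[symmetric] sum_sub_def by force
    have j: "j ` carrier P' = carrier ?D"
    proof
      show "j ` carrier P' \<subseteq> carrier ?D" using mod_hom_closed[OF P'(3)] by blast
      show "carrier ?D \<subseteq> j ` carrier P'"
      proof
        fix z assume z: "z \<in> carrier ?D"
        show "z \<in> j ` carrier P'"
          by (rule image_eqI[where f = j, OF P'(4)[OF z, symmetric] mod_hom_closed[OF P'(2) z]])
      qed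
    qed
    have "projective \<Lambda> P'" by (rule projective_retract[OF D fg_lmodule[OF P'(1)] P'(3,2,5)])
    moreover have "(\<lambda>y. ?f (j y)) \<in> mod_hom \<Lambda> P' M" by (rule mod_hom_comp[OF P'(3) f])
    moreover have "(\<lambda>y. ?f (j y)) ` carrier P' = sum_sub M ((\<lambda>r. r \<odot>\<^bsub>M\<^esub> x) ` carrier \<Lambda>) H"
      unfolding im[symmetric] j[symmetric] image_image ..
    ultimately show ?case unfolding Q_def by blast
  qed
  then show ?thesis using that unfolding Q_def by blast
qed

lemma projective_split:
  assumes "projective \<Lambda> Q" "fg_module \<Lambda> P" "f \<in> mod_hom \<Lambda> P Q" "f ` carrier P = carrier Q"
  obtains s where "s \<in> mod_hom \<Lambda> Q P" "\<And>y. y \<in> carrier Q \<Longrightarrow> f (s y) = y"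
  using projective_lift[OF assms(1,2) projective_fg[OF assms(1)] assms(3,4) mod_hom_id] by blast

lemma projective_kernel:
  assumes "projective \<Lambda> P" "lmodule \<Lambda> Q" "f \<in> mod_hom \<Lambda> P Q"
    and s: "s \<in> mod_hom \<Lambda> Q P" "\<And>y. y \<in> carrier Q \<Longrightarrow> f (s y) = y"
  shows "projective \<Lambda> (P\<lparr>carrier := a_kernel P Q f\<rparr>)"
proof -
  note lm = projective_lmodule[OF assms(1)] assms(2)
  interpret P: lmodule \<Lambda> P by (rule lm)
  interpret Q: lmodule \<Lambda> Q by (rule lm)
  note K = submodule_kernel[OF lm assms(3)]
  have cl: "f x \<in> carrier Q" "s (f x) \<in> carrier P" if "x \<in> carrier P" for x
    using mod_hom_closed[OF assms(3) that] mod_hom_closed[OF s(1)] by auto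
  \<comment> \<open>The idempotent complementary to \<open>s f\<close>; it retracts \<open>P\<close>
    onto the kernel of \<open>f\<close>.\<close>
  let ?r = "\<lambda>x. x \<ominus>\<^bsub>P\<^esub> s (f x)"
  have "?r \<in> mod_hom \<Lambda> P P"
    by (rule mod_hom_minus_hom[OF lm(1,1) mod_hom_id mod_hom_comp[OF assms(3) s(1)]])
  then have r: "?r \<in> mod_hom \<Lambda> P (P\<lparr>carrier := a_kernel P Q f\<rparr>)"
  proof (rule mod_hom_into)
    have "f (?r x) = \<zero>\<^bsub>Q\<^esub>" if "x \<in> carrier P" for x
      using mod_hom_diff[OF lm assms(3) that cl(2)[OF that]] s(2)[OF cl(1)[OF that]] cl(1)[OF that]
      by (simp add: Q.minus_eq_zero_iff)
    then show "?r ` carrier P \<subseteq> a_kernel P Q f" using cl(2) by (auto simp: a_kernel_eq)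
  qed
  have "?r x = x" if "x \<in> carrier (P\<lparr>carrier := a_kernel P Q f\<rparr>)" for x
    using that mod_hom_zero[OF lm(2,1) s(1)] by (simp add: a_kernel_eq a_minus_def)
  then show ?thesis
    using projective_retract[OF assms(1) lmodule_submodule[OF lm(1) K] mod_hom_incl r] submodule_subset[OF K]
    by blast
qed

text \<open>Minimality of a cover in terms of maps: the image of \<open>f\<close> is a submodule of
  \<open>P\<close> that still maps onto \<open>M\<close>.\<close>

lemma cover_surj:
  assumes "projective_cover \<Lambda> P p M" "lmodule \<Lambda> Q" "f \<in> mod_hom \<Lambda> Q P" "(\<lambda>x. p (f x)) ` carrier Q = carrier M"
  shows "f ` carrier Q = carrier P"
proof -
  have P: "lmodule \<Lambda> P" using assms(1) projective_lmodule by (auto simp: projective_cover_def)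
  have "submodule (f ` carrier Q) \<Lambda> P"
    by (rule submodule_image[OF assms(2) P assms(3) submodule_carrier[OF assms(2)]])
  moreover have "p ` (f ` carrier Q) = carrier M" using assms(4) by (simp add: image_image)
  ultimately show ?thesis using assms(1) unfolding projective_cover_def by blast
qed

text \<open>A lift \<open>f\<close> of one cover through the other is onto and splits. Its section
  \<open>s\<close> is again compatible with the covers, hence onto by the same principle, and an
  onto section is inverse to \<open>f\<close>.\<close>

lemma cover_unique:
  assumes "projective_cover \<Lambda> P p M" "projective_cover \<Lambda> P' p' M" "fg_module \<Lambda> M"
  shows "mod_isomorphic \<Lambda> P P'"
proof -
  have P: "projective \<Lambda> P" "p \<in> mod_hom \<Lambda> P M" "p ` carrier P = carrier M"
    using assms(1) by (auto simp: projective_cover_def)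
  have P': "projective \<Lambda> P'" "p' \<in> mod_hom \<Lambda> P' M" "p' ` carrier P' = carrier M"
    using assms(2) by (auto simp: projective_cover_def)
  obtain f where f: "f \<in> mod_hom \<Lambda> P P'" "\<And>x. x \<in> carrier P \<Longrightarrow> p' (f x) = p x"
    using projective_lift[OF P(1) projective_fg[OF P'(1)] assms(3) P'(2,3) P(2)] by blast
  have "(\<lambda>x. p' (f x)) ` carrier P = p ` carrier P" by (rule image_cong[OF refl f(2)])
  then have "f ` carrier P = carrier P'"
    unfolding P(3) by (rule cover_surj[OF assms(2) projective_lmodule[OF P(1)] f(1)])
  then obtain s where s: "s \<in> mod_hom \<Lambda> P' P" "\<And>y. y \<in> carrier P' \<Longrightarrow> f (s y) = y"
    using projective_split[OF P'(1) projective_fg[OF P(1)] f(1)] by blast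
  have "p (s y) = p' y" if "y \<in> carrier P'" for y
    using f(2)[OF mod_hom_closed[OF s(1) that]] s(2)[OF that] by simp
  then have "(\<lambda>y. p (s y)) ` carrier P' = p' ` carrier P'" by (rule image_cong[OF refl])
  then have onto: "s ` carrier P' = carrier P"
    unfolding P'(3) by (rule cover_surj[OF assms(1) projective_lmodule[OF P'(1)] s(1)])
  have "s (f x) = x" if "x \<in> carrier P" for x
  proof -
    have "x \<in> s ` carrier P'" unfolding onto by (rule that)
    then obtain y where "y \<in> carrier P'" "x = s y" by blast
    then show ?thesis using s(2) by simp
  qed
  then show ?thesis using mod_isomorphicI[OF f(1) s(1)] s(2) by blast
qed

section \<open>Existence of projective covers and comparison of presentations\<close>

context fl_ring
begin

text \<open>A minimal submodule \<open>H\<close> that still maps onto \<open>M\<close> is a direct summand, because a lift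
  \<open>P \<rightarrow> H\<close> of \<open>f\<close> restricts to a surjective, hence bijective, endomorphism of \<open>H\<close>.\<close>

lemma minimal_onto_retract:
  assumes "fg_module \<Lambda> M" and P: "projective \<Lambda> P" and f: "f \<in> mod_hom \<Lambda> P M" "f ` carrier P = carrier M"
  obtains H r where "submodule H \<Lambda> P" "f ` H = carrier M"
    "\<And>K. \<lbrakk>submodule K \<Lambda> P; K \<subseteq> H; f ` K = carrier M\<rbrakk> \<Longrightarrow> K = H"
    "r \<in> mod_hom \<Lambda> P (P\<lparr>carrier := H\<rparr>)" "\<And>x. x \<in> H \<Longrightarrow> r x = x"
proof -
  note lP = projective_lmodule[OF P] and fP = projective_fg[OF P]
  define Q where "Q H \<longleftrightarrow> submodule H \<Lambda> P \<and> f ` H = carrier M" for H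
  have "Q (carrier P)" using submodule_carrier[OF lP] f(2) by (simp add: Q_def)
  then obtain H where H0: "Q H" "\<And>K. \<lbrakk>Q K; K \<subseteq> H\<rbrakk> \<Longrightarrow> K = H"
    by (rule minimal_submodule[OF lP fg_fin_len[OF fP]]) (simp add: Q_def, blast)
  have H: "submodule H \<Lambda> P" "f ` H = carrier M" using H0(1) by (simp_all add: Q_def)
  have min: "K = H" if "submodule K \<Lambda> P" "K \<subseteq> H" "f ` K = carrier M" for K
    using H0(2)[of K] that by (simp add: Q_def)
  let ?H = "P\<lparr>carrier := H\<rparr>"
  note lH = lmodule_submodule[OF lP H(1)] and fH = fg_submodule[OF fP H(1)]
  have HP: "H \<subseteq> carrier P" by (rule submodule_subset[OF H(1)])
  obtain e where e: "e \<in> mod_hom \<Lambda> P ?H" "\<And>x. x \<in> carrier P \<Longrightarrow> f (e x) = f x"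
    using projective_lift[OF P fH assms(1) mod_hom_restrict[OF f(1) HP] _ f(1)] H(2) by auto
  have e': "e \<in> mod_hom \<Lambda> P P" by (rule mod_hom_weaken[OF e(1) HP])
  have "e ` H = H"
  proof (rule min)
    show "submodule (e ` H) \<Lambda> P" by (rule submodule_image[OF lP lP e' H(1)])
    show "e ` H \<subseteq> H" using mod_hom_closed[OF e(1)] HP by auto
    have "f ` e ` H = f ` H" unfolding image_image by (rule image_cong[OF refl e(2)]) (use HP in blast)
    then show "f ` e ` H = carrier M" using H(2) by simp
  qed
  moreover have eH: "e \<in> mod_hom \<Lambda> ?H ?H" by (rule mod_hom_restrict[OF e(1) HP])
  ultimately have "bij_betw e (carrier ?H) (carrier ?H)"
    using surj_endo_inj[OF lH lH fg_fin_len[OF fH] eH] by (simp add: bij_betw_def)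
  then obtain u where u: "u \<in> mod_hom \<Lambda> ?H ?H" "\<And>x. x \<in> carrier ?H \<Longrightarrow> u (e x) = x"
    using mod_hom_inv[OF lH eH] by metis
  show ?thesis
    by (rule that[OF H min mod_hom_comp[OF e(1) u(1)]]) (simp_all add: u(2))
qed

lemma cover_exists:
  fixes M :: "('a, 'm) module"
  assumes "fg_module \<Lambda> M"
  obtains P :: "('a, 'a univ) module" and p where "projective_cover \<Lambda> P p M"
proof -
  obtain P :: "('a, 'a univ) module" and f where P: "projective \<Lambda> P" "f \<in> mod_hom \<Lambda> P M" "f ` carrier P = carrier M"
    using projective_onto[OF assms] .
  obtain H r where H: "submodule H \<Lambda> P" "f ` H = carrier M"
    "\<And>K. \<lbrakk>submodule K \<Lambda> P; K \<subseteq> H; f ` K = carrier M\<rbrakk> \<Longrightarrow> K = H"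
    "r \<in> mod_hom \<Lambda> P (P\<lparr>carrier := H\<rparr>)" "\<And>x. x \<in> H \<Longrightarrow> r x = x"
    using minimal_onto_retract[OF assms P] by metis
  note lP = projective_lmodule[OF P(1)]
  have HP: "H \<subseteq> carrier P" by (rule submodule_subset[OF H(1)])
  have "projective \<Lambda> (P\<lparr>carrier := H\<rparr>)"
    by (rule projective_retract[OF P(1) lmodule_submodule[OF lP H(1)] mod_hom_incl[OF HP] H(4)]) (simp add: H(5))
  then have "projective_cover \<Lambda> (P\<lparr>carrier := H\<rparr>) f M"
    unfolding projective_cover_def
    using mod_hom_restrict[OF P(2) HP] H(2,3) by (simp add: submodule_submodule_iff[OF lP H(1)])
  then show ?thesis using that by blast
qed

lemma indecomposable_cover:
  assumes "fg_module \<Lambda> M" and P: "projective \<Lambda> P" "indecomposable \<Lambda> P"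
    and f: "f \<in> mod_hom \<Lambda> P M" "f ` carrier P = carrier M" and M: "carrier M \<noteq> {\<zero>\<^bsub>M\<^esub>}"
  shows "projective_cover \<Lambda> P f M"
proof -
  obtain H r where H: "submodule H \<Lambda> P" "f ` H = carrier M"
    "\<And>K. \<lbrakk>submodule K \<Lambda> P; K \<subseteq> H; f ` K = carrier M\<rbrakk> \<Longrightarrow> K = H"
    "r \<in> mod_hom \<Lambda> P (P\<lparr>carrier := H\<rparr>)" "\<And>x. x \<in> H \<Longrightarrow> r x = x"
    using minimal_onto_retract[OF assms(1) P(1) f] by metis
  note lP = projective_lmodule[OF P(1)]
  interpret P: lmodule \<Lambda> P by (rule lP)
  note lH = lmodule_submodule[OF lP H(1)]
  have HP: "x \<in> carrier P" if "x \<in> H" for x using submodule_subset[OF H(1)] that by blast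
  let ?K = "a_kernel P (P\<lparr>carrier := H\<rparr>) r"
  note K = submodule_kernel[OF lP lH H(4)]
  have r: "r x \<in> H" "r x \<in> carrier P" if "x \<in> carrier P" for x
    using mod_hom_closed[OF H(4) that] HP by auto
  have dif: "x \<ominus>\<^bsub>P\<^esub> r x \<in> ?K" if x: "x \<in> carrier P" for x
  proof -
    have "r (x \<ominus>\<^bsub>P\<^esub> r x) = r x \<ominus>\<^bsub>P\<^esub> r (r x)"
      by (rule mod_hom_diff[OF lP lP mod_hom_weaken[OF H(4)] x]) (use r[OF x] HP in auto)
    then show ?thesis
      using x r[OF x] H(5)[OF r(1)[OF x]] by (simp add: a_kernel_eq P.minus_eq_zero_iff)
  qed
  have "direct_decomp \<Lambda> P H ?K"
    unfolding direct_decomp_def set_add_eq_sum_sub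
  proof (intro conjI H(1) K)
    show "H \<inter> ?K = {\<zero>\<^bsub>P\<^esub>}"
      using submodule_zero[OF H(1)] submodule_zero[OF K] H(5) by (auto simp: a_kernel_eq)
    show "sum_sub P H ?K = carrier P"
    proof
      show "sum_sub P H ?K \<subseteq> carrier P"
        by (rule sum_sub_least[OF submodule_carrier[OF lP] submodule_subset[OF H(1)] submodule_subset[OF K]])
      show "carrier P \<subseteq> sum_sub P H ?K"
      proof
        fix x assume x: "x \<in> carrier P"
        have "r x \<oplus>\<^bsub>P\<^esub> (x \<ominus>\<^bsub>P\<^esub> r x) = x"
          using x r(2)[OF x] by (simp add: a_minus_def P.a_lcomm P.r_neg)
        then show "x \<in> sum_sub P H ?K" using sum_subI[OF r(1)[OF x] dif[OF x], of P] by simp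
      qed
    qed
  qed
  then consider "H = {\<zero>\<^bsub>P\<^esub>}" | "?K = {\<zero>\<^bsub>P\<^esub>}" using P(2) unfolding indecomposable_def by blast
  then have "H = carrier P"
  proof cases
    case 1
    then have "carrier M = {\<zero>\<^bsub>M\<^esub>}"
      using H(2) mod_hom_zero[OF lP fg_lmodule[OF assms(1)] f(1)] by simp
    then show ?thesis using M by simp
  next
    case 2
    have "x \<in> H" if x: "x \<in> carrier P" for x
    proof -
      have "x \<ominus>\<^bsub>P\<^esub> r x = \<zero>\<^bsub>P\<^esub>" using dif[OF x] 2 by blast
      then show ?thesis using r[OF x] x by (simp add: P.minus_eq_zero_iff)
    qed
    then show ?thesis using submodule_subset[OF H(1)] by blast
  qed
  then show ?thesis
    unfolding projective_cover_def using P(1) f H(3) submodule_subset by blast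
qed

text \<open>Any projective presentation whose second map is a projective cover differs from a minimal one
  by adding the same projective module \<open>Q\<close>, the kernel of \<open>f\<close>, to both terms.\<close>

lemma compare_presentations:
  assumes P: "projective \<Lambda> P" and p: "p \<in> mod_hom \<Lambda> P N" "p ` carrier P = carrier N"
    and N: "fg_module \<Lambda> N"
    and P1: "projective_cover \<Lambda> P1 d (P\<lparr>carrier := a_kernel P N p\<rparr>)"
    and min: "minimal_projective_presentation \<Lambda> P1' d' P' p' N"
  obtains f where "f \<in> mod_hom \<Lambda> P P'" "f ` carrier P = carrier P'"
    "projective \<Lambda> (P\<lparr>carrier := a_kernel P P' f\<rparr>)"
    "mod_isomorphic \<Lambda> (dsum P1' (P\<lparr>carrier := a_kernel P P' f\<rparr>)) P1"
proof -
  have cP': "projective_cover \<Lambda> P' p' N" and cP1': "projective_cover \<Lambda> P1' d' (P'\<lparr>carrier := a_kernel P' N p'\<rparr>)"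
    using min by (auto simp: minimal_projective_presentation_def)
  have P': "projective \<Lambda> P'" and p': "p' \<in> mod_hom \<Lambda> P' N" "p' ` carrier P' = carrier N"
    using cP' by (auto simp: projective_cover_def)
  note lP = projective_lmodule[OF P] and lP' = projective_lmodule[OF P'] and lN = fg_lmodule[OF N]
  interpret P: lmodule \<Lambda> P by (rule lP)
  interpret P': lmodule \<Lambda> P' by (rule lP')
  obtain f where f: "f \<in> mod_hom \<Lambda> P P'" "\<And>x. x \<in> carrier P \<Longrightarrow> p' (f x) = p x"
    using projective_lift[OF P projective_fg[OF P'] N p' p(1)] by blast
  have "(\<lambda>x. p' (f x)) ` carrier P = p ` carrier P" by (rule image_cong[OF refl f(2)])
  then have f_onto: "f ` carrier P = carrier P'"
    unfolding p(2) by (rule cover_surj[OF cP' lP f(1)])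
  then obtain s where s: "s \<in> mod_hom \<Lambda> P' P" "\<And>y. y \<in> carrier P' \<Longrightarrow> f (s y) = y"
    using projective_split[OF P' projective_fg[OF P] f(1)] by blast
  have ps: "p (s y) = p' y" if "y \<in> carrier P'" for y
    using f(2)[OF mod_hom_closed[OF s(1) that]] s(2)[OF that] by simp
  let ?Ks = "a_kernel P N p" and ?Ks' = "a_kernel P' N p'" and ?Qs = "a_kernel P P' f"
  let ?K = "P\<lparr>carrier := a_kernel P N p\<rparr>" and ?K' = "P'\<lparr>carrier := a_kernel P' N p'\<rparr>"
    and ?Q = "P\<lparr>carrier := a_kernel P P' f\<rparr>"
  note Ks = submodule_kernel[OF lP lN p(1)] and Ks' = submodule_kernel[OF lP' lN p'(1)]
    and Qs = submodule_kernel[OF lP lP' f(1)]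
  note fK = fg_submodule[OF projective_fg[OF P] Ks] and fK' = fg_submodule[OF projective_fg[OF P'] Ks']
    and lK = lmodule_submodule[OF lP Ks] and lK' = lmodule_submodule[OF lP' Ks'] and lQ = lmodule_submodule[OF lP Qs]
  have Q: "projective \<Lambda> ?Q" by (rule projective_kernel[OF P lP' f(1) s])
  have QK: "?Qs \<subseteq> ?Ks"
    using mod_hom_zero[OF lP' lN p'(1)] by (auto simp: a_kernel_eq f(2)[symmetric])
  have P1p: "projective \<Lambda> P1" and d: "d \<in> mod_hom \<Lambda> P1 ?K" "d ` carrier P1 = ?Ks"
    using P1 by (auto simp: projective_cover_def)
  have P1p': "projective \<Lambda> P1'" and d': "d' \<in> mod_hom \<Lambda> P1' ?K'" "d' ` carrier P1' = ?Ks'"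
    using cP1' by (auto simp: projective_cover_def)
  have dc: "d x \<in> carrier P" "p (d x) = \<zero>\<^bsub>N\<^esub>" if "x \<in> carrier P1" for x
    using mod_hom_closed[OF d(1) that] by (auto simp: a_kernel_eq)
  have dc': "d' x \<in> carrier P'" "p' (d' x) = \<zero>\<^bsub>N\<^esub>" if "x \<in> carrier P1'" for x
    using mod_hom_closed[OF d'(1) that] by (auto simp: a_kernel_eq)
  have dP: "d \<in> mod_hom \<Lambda> P1 P" by (rule mod_hom_weaken[OF d(1) submodule_subset[OF Ks]])
  have dP': "d' \<in> mod_hom \<Lambda> P1' P'" by (rule mod_hom_weaken[OF d'(1) submodule_subset[OF Ks']])
  have fd: "(\<lambda>x. f (d x)) \<in> mod_hom \<Lambda> P1 ?K'"
    by (rule mod_hom_into[OF mod_hom_comp[OF dP f(1)]])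
      (use dc f mod_hom_closed[OF f(1)] in \<open>auto simp: a_kernel_eq\<close>)
  have sd: "(\<lambda>x. s (d' x)) \<in> mod_hom \<Lambda> P1' ?K"
    by (rule mod_hom_into[OF mod_hom_comp[OF dP' s(1)]])
      (use dc' ps mod_hom_closed[OF s(1)] in \<open>auto simp: a_kernel_eq\<close>)
  \<comment> \<open>On the kernels of \<open>p\<close> and \<open>p'\<close>, \<open>g\<close>
    covers \<open>f\<close> and \<open>t\<close> covers the section \<open>s\<close>; further below,
    \<open>r\<close> lifts the inclusion of \<open>Q\<close> into the kernel of \<open>p\<close>
    through \<open>d\<close>.\<close>
  obtain g where g: "g \<in> mod_hom \<Lambda> P1 P1'" "\<And>x. x \<in> carrier P1 \<Longrightarrow> d' (g x) = f (d x)"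
    using projective_lift[OF P1p projective_fg[OF P1p'] fK' d'(1) _ fd] d'(2) by auto
  obtain t where t: "t \<in> mod_hom \<Lambda> P1' P1" "\<And>x. x \<in> carrier P1' \<Longrightarrow> d (t x) = s (d' x)"
    using projective_lift[OF P1p' projective_fg[OF P1p] fK d(1) _ sd] d(2) by auto
  have incl: "(\<lambda>x. x) \<in> mod_hom \<Lambda> ?Q ?K"
    by (rule mod_hom_into[OF mod_hom_incl[OF submodule_subset[OF Qs]]]) (use QK in auto)
  obtain r where r: "r \<in> mod_hom \<Lambda> ?Q P1" "\<And>x. x \<in> ?Qs \<Longrightarrow> d (r x) = x"
    using projective_lift[OF Q projective_fg[OF P1p] fK d(1) _ incl] d(2) by auto
  note lP1 = projective_lmodule[OF P1p] and lP1' = projective_lmodule[OF P1p']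
  interpret P1: lmodule \<Lambda> P1 by (rule lP1)
  interpret P1': lmodule \<Lambda> P1' by (rule lP1')
  have tc: "t x \<in> carrier P1" if "x \<in> carrier P1'" for x using mod_hom_closed[OF t(1) that] .
  have rc: "r x \<in> carrier P1" if "x \<in> ?Qs" for x using mod_hom_closed[OF r(1)] that by simp
  have QP: "x \<in> carrier P" if "x \<in> ?Qs" for x using submodule_subset[OF Qs] that by blast
  \<comment> \<open>The isomorphism to be found. It is onto because \<open>d\<close> is a cover and
    every \<open>x\<close> in the kernel of \<open>p\<close> splits as \<open>s (f x)\<close> plus
    an element of \<open>Q\<close>; the first part is reached through \<open>t\<close>, the second
    through \<open>r\<close>.\<close>
  let ?\<theta> = "\<lambda>z. t (fst z) \<oplus>\<^bsub>P1\<^esub> r (snd z)"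
  let ?D = "dsum P1' ?Q"
  have lD: "lmodule \<Lambda> ?D" by (rule lmodule_dsum[OF lP1' lQ])
  have \<theta>: "?\<theta> \<in> mod_hom \<Lambda> ?D P1" by (rule mod_hom_copair[OF lP1' lQ lP1 t(1) r(1)])
  have d\<theta>: "d (?\<theta> z) = s (d' (fst z)) \<oplus>\<^bsub>P\<^esub> snd z" if "z \<in> carrier ?D" for z
  proof -
    have z: "fst z \<in> carrier P1'" "snd z \<in> ?Qs" using that by auto
    show ?thesis
      using mod_hom_add[OF dP tc[OF z(1)] rc[OF z(2)]] t(2)[OF z(1)] r(2)[OF z(2)] by simp
  qed
  have "(\<lambda>z. d (?\<theta> z)) ` carrier ?D = carrier ?K"
  proof
    show "(\<lambda>z. d (?\<theta> z)) ` carrier ?D \<subseteq> carrier ?K"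
      using mod_hom_closed[OF mod_hom_comp[OF \<theta> d(1)]] by blast
    show "carrier ?K \<subseteq> (\<lambda>z. d (?\<theta> z)) ` carrier ?D"
    proof
      fix x assume "x \<in> carrier ?K"
      then have x: "x \<in> carrier P" "p x = \<zero>\<^bsub>N\<^esub>" by (auto simp: a_kernel_eq)
      have fx: "f x \<in> carrier P'" by (rule mod_hom_closed[OF f(1) x(1)])
      have sfx: "s (f x) \<in> carrier P" by (rule mod_hom_closed[OF s(1) fx])
      have "f x \<in> d' ` carrier P1'" unfolding d'(2) using fx f(2)[OF x(1)] x(2) by (simp add: a_kernel_eq)
      then obtain y where y: "y \<in> carrier P1'" "f x = d' y" by blast
      have "f (x \<ominus>\<^bsub>P\<^esub> s (f x)) = \<zero>\<^bsub>P'\<^esub>"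
        using mod_hom_diff[OF lP lP' f(1) x(1) sfx] s(2)[OF fx] fx by (simp add: P'.minus_eq_zero_iff)
      then have q: "x \<ominus>\<^bsub>P\<^esub> s (f x) \<in> ?Qs" using x sfx by (simp add: a_kernel_eq)
      have "s (d' y) \<oplus>\<^bsub>P\<^esub> (x \<ominus>\<^bsub>P\<^esub> s (f x)) = x"
        unfolding y(2)[symmetric] using x(1) sfx by (simp add: a_minus_def P.a_lcomm P.r_neg)
      then have "x = d (?\<theta> (y, x \<ominus>\<^bsub>P\<^esub> s (f x)))" using d\<theta>[of "(y, x \<ominus>\<^bsub>P\<^esub> s (f x))"] y(1) q by simp
      then show "x \<in> (\<lambda>z. d (?\<theta> z)) ` carrier ?D" by (rule image_eqI) (use y(1) q in simp)
    qed
  qed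
  then have onto: "?\<theta> ` carrier ?D = carrier P1" by (rule cover_surj[OF P1 lD \<theta>])
  \<comment> \<open>\<open>g t\<close> is compatible with the cover \<open>d'\<close>, hence a
    surjective endomorphism of \<open>P1'\<close>, hence injective by length. This is where
    injectivity of \<open>?\<theta>\<close> comes from.\<close>
  have gt: "d' (g (t x)) = d' x" if "x \<in> carrier P1'" for x
    using g(2)[OF tc[OF that]] t(2)[OF that] s(2)[OF dc'(1)[OF that]] by simp
  then have "(\<lambda>x. d' (g (t x))) ` carrier P1' = d' ` carrier P1'" by (rule image_cong[OF refl])
  then have "(\<lambda>x. g (t x)) ` carrier P1' = carrier P1'"
    using d'(2) by (intro cover_surj[OF cP1' lP1' mod_hom_comp[OF t(1) g(1)]]) simp
  then have inj: "inj_on (\<lambda>x. g (t x)) (carrier P1')"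
    by (intro surj_endo_inj[OF lP1' lP1' fg_fin_len[OF projective_fg[OF P1p']] mod_hom_comp[OF t(1) g(1)]]) simp_all
  have "a_kernel ?D P1 ?\<theta> = {\<zero>\<^bsub>?D\<^esub>}"
  proof
    show "{\<zero>\<^bsub>?D\<^esub>} \<subseteq> a_kernel ?D P1 ?\<theta>" using submodule_zero[OF submodule_kernel[OF lD lP1 \<theta>]] by simp
    show "a_kernel ?D P1 ?\<theta> \<subseteq> {\<zero>\<^bsub>?D\<^esub>}"
    proof
      fix z assume "z \<in> a_kernel ?D P1 ?\<theta>"
      then have z: "z \<in> carrier ?D" "?\<theta> z = \<zero>\<^bsub>P1\<^esub>" by (auto simp: a_kernel_eq)
      then have z': "fst z \<in> carrier P1'" "snd z \<in> ?Qs" by auto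
      have eq: "s (d' (fst z)) \<oplus>\<^bsub>P\<^esub> snd z = \<zero>\<^bsub>P\<^esub>"
        using d\<theta>[OF z(1)] z(2) mod_hom_zero[OF lP1 lP dP] by simp
      have c: "s (d' (fst z)) \<in> carrier P" by (rule mod_hom_closed[OF s(1) dc'(1)[OF z'(1)]])
      \<comment> \<open>Applying \<open>f\<close> removes the component in \<open>Q\<close>, so that
        \<open>d' (fst z)\<close> vanishes; then \<open>snd z\<close> does too, and what remains is
        \<open>t (fst z) = 0\<close>.\<close>
      have "f (s (d' (fst z)) \<oplus>\<^bsub>P\<^esub> snd z) = d' (fst z) \<oplus>\<^bsub>P'\<^esub> \<zero>\<^bsub>P'\<^esub>"
        using mod_hom_add[OF f(1) c QP[OF z'(2)]] s(2)[OF dc'(1)[OF z'(1)]] z'(2) by (simp add: a_kernel_eq)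
      then have dz: "d' (fst z) = \<zero>\<^bsub>P'\<^esub>"
        using eq mod_hom_zero[OF lP lP' f(1)] dc'(1)[OF z'(1)] by simp
      then have sz: "snd z = \<zero>\<^bsub>P\<^esub>" using eq mod_hom_zero[OF lP' lP s(1)] QP[OF z'(2)] by simp
      have "r (snd z) = \<zero>\<^bsub>P1\<^esub>" using mod_hom_zero[OF lQ lP1 r(1)] sz by simp
      then have "t (fst z) = \<zero>\<^bsub>P1\<^esub>" using z(2) tc[OF z'(1)] by simp
      then have "g (t (fst z)) = g (t \<zero>\<^bsub>P1'\<^esub>)" using mod_hom_zero[OF lP1' lP1 t(1)] by simp
      then have "fst z = \<zero>\<^bsub>P1'\<^esub>" using inj_onD[OF inj] z'(1) P1'.zero_closed by blast
      then show "z \<in> {\<zero>\<^bsub>?D\<^esub>}" using sz by (simp add: prod_eq_iff)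
    qed
  qed
  then have "bij_betw ?\<theta> (carrier ?D) (carrier P1)"
    using onto mod_hom_inj_iff[OF lD lP1 \<theta>] by (simp add: bij_betw_def)
  then have "mod_isomorphic \<Lambda> ?D P1" using \<theta> unfolding mod_isomorphic_def by blast
  then show ?thesis using that[OF f(1) f_onto Q] by blast
qed

end


section \<open>Quotient modules\<close>

text \<open>Apart from closure and the existence of negatives, the module axioms are equations, and
  all of them descend along a surjection that respects the operations. For quotients this confines
  the work with cosets to the three compatibilities.\<close>

lemma lmodule_onto:
  assumes "lmodule \<Lambda> M" and im: "\<pi> ` carrier M = carrier Q"
    and add: "\<And>x y. \<lbrakk>x \<in> carrier M; y \<in> carrier M\<rbrakk> \<Longrightarrow> \<pi> x \<oplus>\<^bsub>Q\<^esub> \<pi> y = \<pi> (x \<oplus>\<^bsub>M\<^esub> y)"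
    and smult: "\<And>a x. \<lbrakk>a \<in> carrier \<Lambda>; x \<in> carrier M\<rbrakk> \<Longrightarrow> a \<odot>\<^bsub>Q\<^esub> \<pi> x = \<pi> (a \<odot>\<^bsub>M\<^esub> x)"
    and zero: "\<zero>\<^bsub>Q\<^esub> = \<pi> \<zero>\<^bsub>M\<^esub>"
  shows "lmodule \<Lambda> Q" "\<pi> \<in> mod_hom \<Lambda> M Q"
proof -
  interpret lmodule \<Lambda> M by fact
  have ex: "\<exists>x\<in>carrier M. u = \<pi> x" if "u \<in> carrier Q" for u
    using that unfolding im[symmetric] by blast
  have cl: "\<pi> x \<in> carrier Q" if "x \<in> carrier M" for x using that unfolding im[symmetric] by blast
  have ag: "abelian_group Q"
  proof (rule abelian_groupI)
    show "\<zero>\<^bsub>Q\<^esub> \<in> carrier Q" using cl zero by simp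
  next
    fix u assume "u \<in> carrier Q"
    then obtain x where x: "x \<in> carrier M" "u = \<pi> x" using ex by blast
    then show "\<zero>\<^bsub>Q\<^esub> \<oplus>\<^bsub>Q\<^esub> u = u" by (simp add: zero add)
    have "\<pi> (\<ominus>\<^bsub>M\<^esub> x) \<oplus>\<^bsub>Q\<^esub> u = \<zero>\<^bsub>Q\<^esub>" using x by (simp add: zero add M.l_neg)
    then show "\<exists>v\<in>carrier Q. v \<oplus>\<^bsub>Q\<^esub> u = \<zero>\<^bsub>Q\<^esub>" by (rule bexI) (use x cl in simp)
  next
    fix u v assume "u \<in> carrier Q" "v \<in> carrier Q"
    then obtain x y where *: "x \<in> carrier M" "u = \<pi> x" "y \<in> carrier M" "v = \<pi> y" using ex by blast
    then show "u \<oplus>\<^bsub>Q\<^esub> v \<in> carrier Q" "u \<oplus>\<^bsub>Q\<^esub> v = v \<oplus>\<^bsub>Q\<^esub> u"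
      by (simp_all add: add cl M.a_comm)
    fix w assume "w \<in> carrier Q"
    then obtain z where "z \<in> carrier M" "w = \<pi> z" using ex by blast
    then show "u \<oplus>\<^bsub>Q\<^esub> v \<oplus>\<^bsub>Q\<^esub> w = u \<oplus>\<^bsub>Q\<^esub> (v \<oplus>\<^bsub>Q\<^esub> w)" using * by (simp add: add M.a_assoc)
  qed
  show "lmodule \<Lambda> Q"
  proof (rule lmoduleI[OF R.ring_axioms ag])
    fix a b u assume ab: "a \<in> carrier \<Lambda>" "b \<in> carrier \<Lambda>" and "u \<in> carrier Q"
    then obtain x where x: "x \<in> carrier M" "u = \<pi> x" using ex by blast
    show "(a \<oplus>\<^bsub>\<Lambda>\<^esub> b) \<odot>\<^bsub>Q\<^esub> u = a \<odot>\<^bsub>Q\<^esub> u \<oplus>\<^bsub>Q\<^esub> b \<odot>\<^bsub>Q\<^esub> u" "(a \<otimes>\<^bsub>\<Lambda>\<^esub> b) \<odot>\<^bsub>Q\<^esub> u = a \<odot>\<^bsub>Q\<^esub> (b \<odot>\<^bsub>Q\<^esub> u)"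
      using ab x by (simp_all add: smult add smult_l_distr smult_assoc1)
  next
    fix a u v assume a: "a \<in> carrier \<Lambda>" and "u \<in> carrier Q" "v \<in> carrier Q"
    then obtain x y where *: "x \<in> carrier M" "u = \<pi> x" "y \<in> carrier M" "v = \<pi> y" using ex by blast
    then show "a \<odot>\<^bsub>Q\<^esub> (u \<oplus>\<^bsub>Q\<^esub> v) = a \<odot>\<^bsub>Q\<^esub> u \<oplus>\<^bsub>Q\<^esub> a \<odot>\<^bsub>Q\<^esub> v"
      using a by (simp add: smult add smult_r_distr)
  next
    fix a u assume a: "a \<in> carrier \<Lambda>" and "u \<in> carrier Q"
    then obtain x where x: "x \<in> carrier M" "u = \<pi> x" using ex by blast
    then show "a \<odot>\<^bsub>Q\<^esub> u \<in> carrier Q" using a by (simp add: smult cl)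
  next
    fix u assume "u \<in> carrier Q"
    then obtain x where x: "x \<in> carrier M" "u = \<pi> x" using ex by blast
    show "\<one>\<^bsub>\<Lambda>\<^esub> \<odot>\<^bsub>Q\<^esub> u = u" using x by (simp add: smult)
  qed
  show "\<pi> \<in> mod_hom \<Lambda> M Q" by (rule mod_homI) (simp_all add: cl add smult)
qed

lemma quot_module:
  assumes "lmodule \<Lambda> M" "submodule K \<Lambda> M"
  shows "lmodule \<Lambda> (quot_module M K)"
    and "(\<lambda>x. K +>\<^bsub>M\<^esub> x) \<in> mod_hom \<Lambda> M (quot_module M K)"
    and "(\<lambda>x. K +>\<^bsub>M\<^esub> x) ` carrier M = carrier (quot_module M K)"
    and "\<And>x. x \<in> carrier M \<Longrightarrow> K +>\<^bsub>M\<^esub> x = \<zero>\<^bsub>quot_module M K\<^esub> \<longleftrightarrow> x \<in> K"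
proof -
  interpret lmodule \<Lambda> M by fact
  have sg: "subgroup K (add_monoid M)" using assms(2) by (simp add: submodule_def)
  interpret K: abelian_subgroup K M
    by (rule abelian_subgroupI2[OF M.a_comm_group sg])
  have KM: "K \<subseteq> carrier M" by (rule submodule_subset[OF assms(2)])
  let ?Q = "quot_module M K"
  show im: "(\<lambda>x. K +>\<^bsub>M\<^esub> x) ` carrier M = carrier ?Q"
    by (auto simp: quot_module_def A_RCOSETS_def')
  have zero: "\<zero>\<^bsub>?Q\<^esub> = K +>\<^bsub>M\<^esub> \<zero>\<^bsub>M\<^esub>" using KM by (simp add: quot_module_def)
  have add: "(K +>\<^bsub>M\<^esub> x) \<oplus>\<^bsub>?Q\<^esub> (K +>\<^bsub>M\<^esub> y) = K +>\<^bsub>M\<^esub> (x \<oplus>\<^bsub>M\<^esub> y)" if "x \<in> carrier M" "y \<in> carrier M" for x y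
    using K.a_rcos_sum[OF that] by (simp add: quot_module_def)
  have smult: "a \<odot>\<^bsub>?Q\<^esub> (K +>\<^bsub>M\<^esub> x) = K +>\<^bsub>M\<^esub> (a \<odot>\<^bsub>M\<^esub> x)" if a: "a \<in> carrier \<Lambda>" and x: "x \<in> carrier M" for a x
  proof -
    \<comment> \<open>Scalar multiplication in \<open>quot_module\<close> is a union over all
      representatives of the coset, so each representative must be shown to contribute the same
      coset.\<close>
    have "K +>\<^bsub>M\<^esub> (a \<odot>\<^bsub>M\<^esub> y) = K +>\<^bsub>M\<^esub> (a \<odot>\<^bsub>M\<^esub> x)" if y: "y \<in> K +>\<^bsub>M\<^esub> x" for y
    proof -
      obtain k where k: "k \<in> K" "y = k \<oplus>\<^bsub>M\<^esub> x" using y by (auto simp: a_r_coset_def')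
      then have "a \<odot>\<^bsub>M\<^esub> y = a \<odot>\<^bsub>M\<^esub> k \<oplus>\<^bsub>M\<^esub> a \<odot>\<^bsub>M\<^esub> x" using a x KM by (simp add: smult_r_distr subset_iff)
      then have "a \<odot>\<^bsub>M\<^esub> y \<in> K +>\<^bsub>M\<^esub> (a \<odot>\<^bsub>M\<^esub> x)"
        using submodule_smult[OF assms(2) a k(1)] by (auto simp: a_r_coset_def')
      then show ?thesis using M.a_repr_independence[OF _ _ sg] a x by simp
    qed
    then have "(\<Union>y\<in>K +>\<^bsub>M\<^esub> x. K +>\<^bsub>M\<^esub> (a \<odot>\<^bsub>M\<^esub> y)) = (\<Union>y\<in>K +>\<^bsub>M\<^esub> x. K +>\<^bsub>M\<^esub> (a \<odot>\<^bsub>M\<^esub> x))"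
      by (rule SUP_cong[OF refl])
    moreover have "x \<in> K +>\<^bsub>M\<^esub> x" using K.a_rcos_self[OF x] .
    then have "(\<Union>y\<in>K +>\<^bsub>M\<^esub> x. K +>\<^bsub>M\<^esub> (a \<odot>\<^bsub>M\<^esub> x)) = K +>\<^bsub>M\<^esub> (a \<odot>\<^bsub>M\<^esub> x)" by blast
    ultimately show ?thesis by (simp add: quot_module_def)
  qed
  note quot = lmodule_onto[where \<pi> = "\<lambda>x. K +>\<^bsub>M\<^esub> x" and Q = ?Q, OF assms(1) im]
  show "lmodule \<Lambda> ?Q" by (rule quot(1)) (fact add smult zero)+
  show "(\<lambda>x. K +>\<^bsub>M\<^esub> x) \<in> mod_hom \<Lambda> M ?Q" by (rule quot(2)) (fact add smult zero)+
  show "K +>\<^bsub>M\<^esub> x = \<zero>\<^bsub>?Q\<^esub> \<longleftrightarrow> x \<in> K" if x: "x \<in> carrier M" for x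
  proof -
    have "\<zero>\<^bsub>?Q\<^esub> = K" by (simp add: quot_module_def)
    then show ?thesis using M.a_coset_join1[OF _ x sg] M.a_coset_join2[OF x sg] by metis
  qed
qed

section \<open>The Grothendieck group of projective modules\<close>

lemma K0_relations_subset: "K0_relations \<Lambda> \<subseteq> carrier (free_on_prj \<Lambda>)"
proof
  fix x assume "x \<in> K0_relations \<Lambda>"
  then obtain E A C :: "('a, 'a univ) module" where x: "x = frag_of E - frag_of A - frag_of C"
    and prj: "projective \<Lambda> A" "projective \<Lambda> E" "projective \<Lambda> C"
    by (auto simp: K0_relations_def)
  have "Poly_Mapping.keys x \<subseteq> {E, A, C}"
    unfolding x using keys_diff[of "frag_of E - frag_of A" "frag_of C"] keys_diff[of "frag_of E" "frag_of A"]
    by auto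
  then show "x \<in> carrier (free_on_prj \<Lambda>)" using prj by (auto simp: free_on_prj_def)
qed

lemma subgroup_K0: "subgroup (K0_subgroup \<Lambda>) (free_on_prj \<Lambda>)"
  unfolding K0_subgroup_def
  by (rule group.generate_is_subgroup[OF _ K0_relations_subset]) (simp add: free_on_prj_def)

lemma K0_carrier: "x \<in> K0_subgroup \<Lambda> \<Longrightarrow> Poly_Mapping.keys x \<subseteq> {P. projective \<Lambda> P}"
  using subsetD[OF subgroup.subset[OF subgroup_K0], of x \<Lambda>] by (simp add: free_on_prj_def)

lemma K0_add: "\<lbrakk>x \<in> K0_subgroup \<Lambda>; y \<in> K0_subgroup \<Lambda>\<rbrakk> \<Longrightarrow> x + y \<in> K0_subgroup \<Lambda>"
  using subgroup.m_closed[OF subgroup_K0, of x \<Lambda> y] by (simp add: free_on_prj_def)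

lemma K0_minus: "x \<in> K0_subgroup \<Lambda> \<Longrightarrow> - x \<in> K0_subgroup \<Lambda>"
  using subgroup.m_inv_closed[OF subgroup_K0, of x \<Lambda>] K0_carrier[of x \<Lambda>] by (simp add: free_on_prj_def)

lemma K0_diff: "\<lbrakk>x \<in> K0_subgroup \<Lambda>; y \<in> K0_subgroup \<Lambda>\<rbrakk> \<Longrightarrow> x - y \<in> K0_subgroup \<Lambda>"
  using K0_add[OF _ K0_minus] by fastforce

lemma K0_relation:
  fixes A E C :: "('a, 'a univ) module"
  assumes "projective \<Lambda> A" "projective \<Lambda> E" "projective \<Lambda> C" "short_exact \<Lambda> A f E g C" "split_epi \<Lambda> E C g"
  shows "frag_of E - frag_of A - frag_of C \<in> K0_subgroup \<Lambda>"
proof -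
  have "frag_of E - frag_of A - frag_of C \<in> K0_relations \<Lambda>"
    unfolding K0_relations_def using assms by blast
  then show ?thesis unfolding K0_subgroup_def by (rule generate.incl)
qed

text \<open>Moves the defining equation of a g-vector from the quotient group, in multiplicative
  notation, into the free abelian group. From here on all computations in \<open>K0\<close> are
  additive congruences modulo \<open>K0_subgroup\<close>.\<close>

lemma K0_equation_iff:
  assumes P: "projective \<Lambda> P0" "projective \<Lambda> P1" "\<And>i. i \<in> I \<Longrightarrow> projective \<Lambda> (P i)" and "finite I"
  shows "K0_class \<Lambda> P0 \<otimes>\<^bsub>K0_prj \<Lambda>\<^esub> inv\<^bsub>K0_prj \<Lambda>\<^esub> K0_class \<Lambda> P1 =
      (\<Otimes>\<^bsub>K0_prj \<Lambda>\<^esub>i\<in>I. K0_class \<Lambda> (P i) [^]\<^bsub>K0_prj \<Lambda>\<^esub> (g i :: int)) \<longleftrightarrow>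
    frag_of P0 - frag_of P1 - (\<Sum>i\<in>I. frag_cmul (g i) (frag_of (P i))) \<in> K0_subgroup \<Lambda>"
proof -
  let ?G = "free_on_prj \<Lambda>" and ?H = "K0_subgroup \<Lambda>"
  define \<kappa> where "\<kappa> x = ?H #>\<^bsub>?G\<^esub> x" for x
  interpret G: comm_group ?G unfolding free_on_prj_def by (rule abelian_free_Abelian_group)
  interpret H: normal ?H ?G by (rule G.subgroup_imp_normal[OF subgroup_K0])
  interpret K: comm_group "K0_prj \<Lambda>"
    unfolding K0_prj_def by (rule G.abelian_FactGroup[OF subgroup_K0])
  have hom: "\<kappa> \<in> hom ?G (K0_prj \<Lambda>)" unfolding \<kappa>_def K0_prj_def by (rule H.r_coset_hom_Mod)
  interpret \<kappa>: group_hom ?G "K0_prj \<Lambda>" \<kappa>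
    by (rule group_hom.intro[OF G.is_group K.is_group]) (simp add: group_hom_axioms_def hom)
  have cls: "K0_class \<Lambda> X = \<kappa> (frag_of X)" for X by (simp add: K0_class_def \<kappa>_def)
  have mem: "frag_of X \<in> carrier ?G" if "projective \<Lambda> X" for X using that by (simp add: free_on_prj_def)
  have cm: "frag_cmul (g i) (frag_of (P i)) \<in> carrier ?G" if "i \<in> I" for i
    using P(3)[OF that] by (auto simp: free_on_prj_def)
  have pow: "K0_class \<Lambda> (P i) [^]\<^bsub>K0_prj \<Lambda>\<^esub> g i = \<kappa> (frag_cmul (g i) (frag_of (P i)))" if "i \<in> I" for i
    unfolding cls \<kappa>.hom_int_pow[OF mem[OF P(3)[OF that]], symmetric]
    using P(3)[OF that] by (simp add: free_on_prj_def)
  have sum: "(\<Sum>i\<in>J. frag_cmul (g i) (frag_of (P i))) \<in> carrier ?G \<and>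
      \<kappa> (\<Sum>i\<in>J. frag_cmul (g i) (frag_of (P i))) = (\<Otimes>\<^bsub>K0_prj \<Lambda>\<^esub>i\<in>J. K0_class \<Lambda> (P i) [^]\<^bsub>K0_prj \<Lambda>\<^esub> g i)"
    if "finite J" "J \<subseteq> I" for J
    using that
  proof (induction J rule: finite_induct)
    case empty
    show ?case using \<kappa>.hom_one G.one_closed by (simp add: free_on_prj_def)
  next
    case (insert j J)
    let ?s = "\<Sum>i\<in>J. frag_cmul (g i) (frag_of (P i))" and ?t = "frag_cmul (g j) (frag_of (P j))"
    have IH: "?s \<in> carrier ?G" "\<kappa> ?s = (\<Otimes>\<^bsub>K0_prj \<Lambda>\<^esub>i\<in>J. K0_class \<Lambda> (P i) [^]\<^bsub>K0_prj \<Lambda>\<^esub> g i)" and j: "j \<in> I"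
      using insert by auto
    have add: "?t \<otimes>\<^bsub>?G\<^esub> ?s = ?t + ?s" by (simp add: free_on_prj_def)
    have "\<kappa> (?t + ?s) = \<kappa> ?t \<otimes>\<^bsub>K0_prj \<Lambda>\<^esub> \<kappa> ?s"
      using \<kappa>.hom_mult[OF cm[OF j] IH(1)] by (simp only: add)
    moreover have "?t + ?s \<in> carrier ?G" using G.m_closed[OF cm[OF j] IH(1)] by (simp only: add)
    moreover have "(\<lambda>i. K0_class \<Lambda> (P i) [^]\<^bsub>K0_prj \<Lambda>\<^esub> g i) \<in> insert j J \<rightarrow> carrier (K0_prj \<Lambda>)"
      using insert(4) pow cm by auto
    ultimately show ?case
      using insert(1,2) IH(2) pow[OF j] by (simp add: Pi_iff)
  qed
  let ?S = "\<Sum>i\<in>I. frag_cmul (g i) (frag_of (P i))"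
  have S: "?S \<in> carrier ?G" "\<kappa> ?S = (\<Otimes>\<^bsub>K0_prj \<Lambda>\<^esub>i\<in>I. K0_class \<Lambda> (P i) [^]\<^bsub>K0_prj \<Lambda>\<^esub> g i)"
    using sum[OF assms(4)] by auto
  let ?x = "frag_of P0 \<otimes>\<^bsub>?G\<^esub> inv\<^bsub>?G\<^esub> frag_of P1"
  have x: "?x \<in> carrier ?G" using mem P by simp
  have "K0_class \<Lambda> P0 \<otimes>\<^bsub>K0_prj \<Lambda>\<^esub> inv\<^bsub>K0_prj \<Lambda>\<^esub> K0_class \<Lambda> P1 = \<kappa> ?x"
    unfolding cls using mem P by simp
  then have "?thesis \<longleftrightarrow> (\<kappa> ?x = \<kappa> ?S \<longleftrightarrow> frag_of P0 - frag_of P1 - ?S \<in> ?H)"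
    using S(2) by simp
  moreover have "?x \<otimes>\<^bsub>?G\<^esub> inv\<^bsub>?G\<^esub> ?S = frag_of P0 - frag_of P1 - ?S"
    using S(1) P by (simp add: free_on_prj_def)
  moreover have "\<kappa> ?x = \<kappa> ?S \<longleftrightarrow> ?x \<otimes>\<^bsub>?G\<^esub> inv\<^bsub>?G\<^esub> ?S \<in> ?H"
  proof -
    have "\<kappa> ?x = \<kappa> ?S \<longleftrightarrow> ?x \<in> ?H #>\<^bsub>?G\<^esub> ?S"
      unfolding \<kappa>_def using G.repr_independence[OF _ S(1) subgroup_K0] G.rcos_self[OF x subgroup_K0] by auto
    also have "\<dots> \<longleftrightarrow> ?x \<otimes>\<^bsub>?G\<^esub> inv\<^bsub>?G\<^esub> ?S \<in> ?H"
      by (rule H.rcos_module[OF G.is_group S(1) x])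
    finally show ?thesis .
  qed
  ultimately show ?thesis by simp
qed

text \<open>\<open>frag_extend\<close> only maps between free abelian groups, so integer values are read off in the one on
  \<open>()\<close>.\<close>

definition frag_eval :: "('b \<Rightarrow> int) \<Rightarrow> ('b \<Rightarrow>\<^sub>0 int) \<Rightarrow> int" where
  "frag_eval m x = Poly_Mapping.lookup (frag_extend (\<lambda>P. frag_cmul (m P) (frag_of ())) x) ()"

lemma frag_eval_simps [simp]:
  "frag_eval m 0 = 0" "frag_eval m (frag_of P) = m P" "frag_eval m (- x) = - frag_eval m x"
  "frag_eval m (x + y) = frag_eval m x + frag_eval m y"
  "frag_eval m (x - y) = frag_eval m x - frag_eval m y"
  "frag_eval m (frag_cmul c x) = c * frag_eval m x"
  by (simp_all add: frag_eval_def frag_extend_add frag_extend_diff frag_extend_minus frag_extend_cmul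
      lookup_add lookup_minus)

lemma frag_eval_sum: "finite I \<Longrightarrow> frag_eval m (\<Sum>i\<in>I. f i) = (\<Sum>i\<in>I. frag_eval m (f i))"
  by (induction I rule: finite_induct) simp_all

text \<open>The universal property of \<open>K0\<close>: an integer function that is additive on
  split exact sequences kills the relations, hence factors through the quotient. It is the means of
  detecting nonzero classes.\<close>

lemma K0_additive_zero:
  assumes add: "\<And>(A :: ('a, 'a univ) module) E C f g. \<lbrakk>projective \<Lambda> A; projective \<Lambda> E; projective \<Lambda> C;
      short_exact \<Lambda> A f E g C; split_epi \<Lambda> E C g\<rbrakk> \<Longrightarrow> m E = m A + m C"
    and x: "x \<in> K0_subgroup \<Lambda>"
  shows "frag_eval m x = 0"
proof -
  have rel: "frag_eval m y = 0" if "y \<in> K0_relations \<Lambda>" for y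
    using that add unfolding K0_relations_def by fastforce
  show ?thesis
    using x unfolding K0_subgroup_def
  proof (induction rule: generate.induct)
    case one
    then show ?case by (simp add: free_on_prj_def)
  next
    case (incl h)
    then show ?case by (rule rel)
  next
    case (inv h)
    then have "inv\<^bsub>free_on_prj \<Lambda>\<^esub> h = - h"
      using K0_relations_subset[of \<Lambda>] by (auto simp: free_on_prj_def)
    then show ?case using rel[OF inv] by simp
  next
    case (eng h1 h2)
    then show ?case by (simp add: free_on_prj_def)
  qed
qed

section \<open>Classes of projective modules on arbitrary types\<close>

definition prj_copy :: "('a, 'k) ring_scheme \<Rightarrow> ('a, 'm) module \<Rightarrow> ('a, 'a univ) module" where
  "prj_copy \<Lambda> P = (SOME P'. fg_module \<Lambda> P' \<and> mod_isomorphic \<Lambda> P P')"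

text \<open>The generators of \<open>K0\<close> are modules on \<open>'a univ\<close>, but the
  horseshoe presentation consists of direct sums, which are not. The choice of the copy only matters
  up to \<open>K0_subgroup\<close>.\<close>

definition pcls :: "('a, 'k) ring_scheme \<Rightarrow> ('a, 'm) module \<Rightarrow> (('a, 'a univ) module \<Rightarrow>\<^sub>0 int)" where
  "pcls \<Lambda> P = frag_of (prj_copy \<Lambda> P)"

lemma prj_copy:
  assumes "projective \<Lambda> P"
  shows "projective \<Lambda> (prj_copy \<Lambda> P)" "mod_isomorphic \<Lambda> P (prj_copy \<Lambda> P)"
proof -
  have *: "fg_module \<Lambda> (prj_copy \<Lambda> P)" "mod_isomorphic \<Lambda> P (prj_copy \<Lambda> P)"
    using someI_ex[OF fg_module_univ[OF projective_fg[OF assms]]] by (auto simp: prj_copy_def)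
  then show "projective \<Lambda> (prj_copy \<Lambda> P)" "mod_isomorphic \<Lambda> P (prj_copy \<Lambda> P)"
    using projective_iso[OF assms fg_lmodule] by auto
qed

text \<open>Relations are imposed only between modules on \<open>'a univ\<close>; conjugation by the
  isomorphisms moves a split exact sequence there.\<close>

lemma short_exact_iso:
  assumes lm: "lmodule \<Lambda> A" "lmodule \<Lambda> E" "lmodule \<Lambda> C" "lmodule \<Lambda> A'" "lmodule \<Lambda> E'" "lmodule \<Lambda> C'"
    and iso: "mod_isomorphic \<Lambda> A A'" "mod_isomorphic \<Lambda> E E'" "mod_isomorphic \<Lambda> C C'"
    and ex: "short_exact \<Lambda> A f E g C" "split_epi \<Lambda> E C g"
  obtains f' g' where "short_exact \<Lambda> A' f' E' g' C'" "split_epi \<Lambda> E' C' g'"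
proof -
  obtain i i' where i: "i \<in> mod_hom \<Lambda> A A'" "i' \<in> mod_hom \<Lambda> A' A"
    "\<And>x. x \<in> carrier A \<Longrightarrow> i' (i x) = x" "\<And>x. x \<in> carrier A' \<Longrightarrow> i (i' x) = x"
    using iso(1) mod_hom_inv[OF lm(1)] unfolding mod_isomorphic_def by metis
  obtain j j' where j: "j \<in> mod_hom \<Lambda> E E'" "j' \<in> mod_hom \<Lambda> E' E"
    "\<And>x. x \<in> carrier E \<Longrightarrow> j' (j x) = x" "\<And>x. x \<in> carrier E' \<Longrightarrow> j (j' x) = x"
    using iso(2) mod_hom_inv[OF lm(2)] unfolding mod_isomorphic_def by metis
  obtain k k' where k: "k \<in> mod_hom \<Lambda> C C'" "k' \<in> mod_hom \<Lambda> C' C"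
    "\<And>x. x \<in> carrier C \<Longrightarrow> k' (k x) = x" "\<And>x. x \<in> carrier C' \<Longrightarrow> k (k' x) = x"
    using iso(3) mod_hom_inv[OF lm(3)] unfolding mod_isomorphic_def by metis
  have f: "f \<in> mod_hom \<Lambda> A E" and g: "g \<in> mod_hom \<Lambda> E C" and inj: "inj_on f (carrier A)"
    and ker: "f ` carrier A = a_kernel E C g"
    using ex(1) by (auto simp: short_exact_def)
  obtain s where s: "s \<in> mod_hom \<Lambda> C E" "\<And>x. x \<in> carrier C \<Longrightarrow> g (s x) = x"
    using ex(2) by (auto simp: split_epi_def)
  let ?f = "\<lambda>x. j (f (i' x))" and ?g = "\<lambda>x. k (g (j' x))" and ?s = "\<lambda>x. j (s (k' x))"
  have f': "?f \<in> mod_hom \<Lambda> A' E'" by (rule mod_hom_comp[OF mod_hom_comp[OF i(2) f] j(1)])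
  have g': "?g \<in> mod_hom \<Lambda> E' C'" by (rule mod_hom_comp[OF mod_hom_comp[OF j(2) g] k(1)])
  have s': "?s \<in> mod_hom \<Lambda> C' E'" by (rule mod_hom_comp[OF mod_hom_comp[OF k(2) s(1)] j(1)])
  have gs: "?g (?s x) = x" if x: "x \<in> carrier C'" for x
    using j(3)[OF mod_hom_closed[OF s(1) mod_hom_closed[OF k(2) x]]] s(2)[OF mod_hom_closed[OF k(2) x]] k(4)[OF x]
    by simp
  have fc: "f (i' x) \<in> carrier E" if "x \<in> carrier A'" for x
    by (rule mod_hom_closed[OF f mod_hom_closed[OF i(2) that]])
  have "inj_on ?f (carrier A')"
  proof (rule inj_onI)
    fix x y assume xy: "x \<in> carrier A'" "y \<in> carrier A'" "?f x = ?f y"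
    then have "j' (?f x) = j' (?f y)" by simp
    then have "f (i' x) = f (i' y)" using j(3)[OF fc[OF xy(1)]] j(3)[OF fc[OF xy(2)]] by simp
    then have "i' x = i' y" using inj_onD[OF inj _ mod_hom_closed[OF i(2) xy(1)] mod_hom_closed[OF i(2) xy(2)]] by blast
    then have "i (i' x) = i (i' y)" by simp
    then show "x = y" using i(4) xy by simp
  qed
  moreover have "?f ` carrier A' = a_kernel E' C' ?g"
  proof
    show "?f ` carrier A' \<subseteq> a_kernel E' C' ?g"
    proof
      fix y assume "y \<in> ?f ` carrier A'"
      then obtain x where x: "x \<in> carrier A'" "y = ?f x" by blast
      have "f (i' x) \<in> a_kernel E C g" unfolding ker[symmetric] using mod_hom_closed[OF i(2) x(1)] by blast
      then have "?g y = \<zero>\<^bsub>C'\<^esub>"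
        using x j(3)[OF fc[OF x(1)]] mod_hom_zero[OF lm(3,6) k(1)] by (simp add: a_kernel_eq)
      then show "y \<in> a_kernel E' C' ?g" using mod_hom_closed[OF f' x(1)] x(2) by (simp add: a_kernel_eq)
    qed
    show "a_kernel E' C' ?g \<subseteq> ?f ` carrier A'"
    proof
      fix y assume "y \<in> a_kernel E' C' ?g"
      then have y: "y \<in> carrier E'" "k (g (j' y)) = \<zero>\<^bsub>C'\<^esub>" by (auto simp: a_kernel_eq)
      have c: "j' y \<in> carrier E" by (rule mod_hom_closed[OF j(2) y(1)])
      have "k' (k (g (j' y))) = \<zero>\<^bsub>C\<^esub>" using y(2) mod_hom_zero[OF lm(6,3) k(2)] by simp
      then have "g (j' y) = \<zero>\<^bsub>C\<^esub>" using k(3)[OF mod_hom_closed[OF g c]] by simp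
      then have "j' y \<in> f ` carrier A" unfolding ker using c by (simp add: a_kernel_eq)
      then obtain u where u: "u \<in> carrier A" "j' y = f u" by blast
      have "y = ?f (i u)" using i(3)[OF u(1)] u(2)[symmetric] j(4)[OF y(1)] by simp
      then show "y \<in> ?f ` carrier A'" using mod_hom_closed[OF i(1) u(1)] by blast
    qed
  qed
  moreover have "?g ` carrier E' = carrier C'"
  proof
    show "?g ` carrier E' \<subseteq> carrier C'" using mod_hom_closed[OF g'] by blast
    show "carrier C' \<subseteq> ?g ` carrier E'"
    proof
      fix x assume x: "x \<in> carrier C'"
      then show "x \<in> ?g ` carrier E'"
        using image_eqI[where f = ?g, OF gs[OF x, symmetric] mod_hom_closed[OF s' x]] by simp
    qed
  qed
  ultimately have "short_exact \<Lambda> A' ?f E' ?g C'" using f' g' unfolding short_exact_def by blast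
  moreover have "split_epi \<Lambda> E' C' ?g"
    unfolding split_epi_def by (intro conjI g' bexI[OF _ s'] ballI gs)
  ultimately show ?thesis using that by blast
qed

lemma pcls_exact:
  assumes "projective \<Lambda> A" "projective \<Lambda> E" "projective \<Lambda> C" "short_exact \<Lambda> A f E g C" "split_epi \<Lambda> E C g"
  shows "pcls \<Lambda> E - pcls \<Lambda> A - pcls \<Lambda> C \<in> K0_subgroup \<Lambda>"
proof -
  note c = prj_copy[OF assms(1)] prj_copy[OF assms(2)] prj_copy[OF assms(3)]
  obtain f' g' where "short_exact \<Lambda> (prj_copy \<Lambda> A) f' (prj_copy \<Lambda> E) g' (prj_copy \<Lambda> C)"
    "split_epi \<Lambda> (prj_copy \<Lambda> E) (prj_copy \<Lambda> C) g'"
    using short_exact_iso[OF assms(1-3)[THEN projective_lmodule] c(1,3,5)[THEN projective_lmodule] c(2,4,6) assms(4,5)]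
    by blast
  then show ?thesis unfolding pcls_def by (rule K0_relation[OF c(1,3,5)])
qed

text \<open>With identity maps, \<open>0 \<rightarrow> Z \<rightarrow> Z \<rightarrow> Z
  \<rightarrow> 0\<close> is split exact, which gives \<open>[Z] = [Z] + [Z]\<close>.\<close>

lemma K0_zero_class:
  fixes Z :: "('a, 'a univ) module"
  assumes "lmodule \<Lambda> Z" "carrier Z = {\<zero>\<^bsub>Z\<^esub>}"
  shows "frag_of Z \<in> K0_subgroup \<Lambda>"
proof -
  have Z: "projective \<Lambda> Z" by (rule projective_zero[OF assms])
  have "short_exact \<Lambda> Z (\<lambda>x. x) Z (\<lambda>x. x) Z"
    unfolding short_exact_def using mod_hom_id assms(2) by (auto simp: a_kernel_eq)
  moreover have "split_epi \<Lambda> Z Z (\<lambda>x. x)" unfolding split_epi_def using mod_hom_id by auto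
  ultimately have "frag_of Z - frag_of Z - frag_of Z \<in> K0_subgroup \<Lambda>" by (rule K0_relation[OF Z Z Z])
  then have "- frag_of Z \<in> K0_subgroup \<Lambda>" by simp
  then have "- (- frag_of Z) \<in> K0_subgroup \<Lambda>" by (rule K0_minus)
  then show ?thesis by simp
qed

text \<open>An isomorphism is a split exact sequence with zero third term; the zero submodule of
  \<open>P\<close> provides such a term on the right type.\<close>

lemma K0_iso:
  fixes P P' :: "('a, 'a univ) module"
  assumes "projective \<Lambda> P" "projective \<Lambda> P'" "mod_isomorphic \<Lambda> P P'"
  shows "frag_of P' - frag_of P \<in> K0_subgroup \<Lambda>"
proof -
  note lm = projective_lmodule[OF assms(1)] projective_lmodule[OF assms(2)]
  let ?Z = "P\<lparr>carrier := {\<zero>\<^bsub>P\<^esub>}\<rparr>"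
  have lZ: "lmodule \<Lambda> ?Z" by (rule lmodule_submodule[OF lm(1) submodule_trivial[OF lm(1)]])
  have Z: "projective \<Lambda> ?Z" by (rule projective_zero[OF lZ]) simp
  obtain f where f: "f \<in> mod_hom \<Lambda> P P'" "bij_betw f (carrier P) (carrier P')"
    using assms(3) by (auto simp: mod_isomorphic_def)
  have g: "(\<lambda>x. \<zero>\<^bsub>P\<^esub>) \<in> mod_hom \<Lambda> P' ?Z" using mod_hom_const_zero[OF lZ] by simp
  have z: "\<zero>\<^bsub>P'\<^esub> \<in> carrier P'" by (rule submodule_zero[OF submodule_carrier[OF lm(2)]])
  have "short_exact \<Lambda> P f P' (\<lambda>x. \<zero>\<^bsub>P\<^esub>) ?Z"
    unfolding short_exact_def using f g z by (auto simp: bij_betw_def a_kernel_eq)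
  moreover have "split_epi \<Lambda> P' ?Z (\<lambda>x. \<zero>\<^bsub>P\<^esub>)"
    unfolding split_epi_def using g mod_hom_const_zero[OF lm(2), of ?Z]
    by (intro conjI bexI[of _ "\<lambda>x. \<zero>\<^bsub>P'\<^esub>"]) simp_all
  ultimately have "frag_of P' - frag_of P - frag_of ?Z \<in> K0_subgroup \<Lambda>"
    by (rule K0_relation[OF assms(1,2) Z])
  moreover have "frag_of ?Z \<in> K0_subgroup \<Lambda>" by (rule K0_zero_class[OF lZ]) simp
  ultimately have "frag_of P' - frag_of P - frag_of ?Z + frag_of ?Z \<in> K0_subgroup \<Lambda>" by (rule K0_add)
  then show ?thesis by simp
qed

lemma pcls_iso:
  assumes "projective \<Lambda> P" "projective \<Lambda> P'" "mod_isomorphic \<Lambda> P P'"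
  shows "pcls \<Lambda> P' - pcls \<Lambda> P \<in> K0_subgroup \<Lambda>"
proof -
  note c = prj_copy[OF assms(1)] prj_copy[OF assms(2)]
  have "mod_isomorphic \<Lambda> (prj_copy \<Lambda> P) (prj_copy \<Lambda> P')"
    using mod_isomorphic_trans[OF mod_isomorphic_trans[OF mod_isomorphic_sym[OF projective_lmodule[OF assms(1)] c(2)] assms(3)] c(4)] .
  then show ?thesis unfolding pcls_def by (rule K0_iso[OF c(1,3)])
qed

lemma pcls_univ:
  fixes P :: "('a, 'a univ) module"
  assumes "projective \<Lambda> P"
  shows "pcls \<Lambda> P - frag_of P \<in> K0_subgroup \<Lambda>"
  unfolding pcls_def by (rule K0_iso[OF assms prj_copy(1)[OF assms] prj_copy(2)[OF assms]])

lemma pcls_kernel: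
  assumes P: "projective \<Lambda> P" and P': "projective \<Lambda> P'" and f: "f \<in> mod_hom \<Lambda> P P'" "f ` carrier P = carrier P'"
  shows "pcls \<Lambda> P - pcls \<Lambda> (P\<lparr>carrier := a_kernel P P' f\<rparr>) - pcls \<Lambda> P' \<in> K0_subgroup \<Lambda>"
proof -
  obtain s where s: "s \<in> mod_hom \<Lambda> P' P" "\<And>y. y \<in> carrier P' \<Longrightarrow> f (s y) = y"
    using projective_split[OF P' projective_fg[OF P] f] by blast
  have Q: "projective \<Lambda> (P\<lparr>carrier := a_kernel P P' f\<rparr>)"
    by (rule projective_kernel[OF P projective_lmodule[OF P'] f(1) s])
  have "a_kernel P P' f \<subseteq> carrier P" by (auto simp: a_kernel_eq)
  then have "short_exact \<Lambda> (P\<lparr>carrier := a_kernel P P' f\<rparr>) (\<lambda>x. x) P f P'"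
    unfolding short_exact_def using f mod_hom_incl[of "a_kernel P P' f" P \<Lambda>] by simp
  moreover have "split_epi \<Lambda> P P' f" unfolding split_epi_def using f(1) s by blast
  ultimately show ?thesis by (rule pcls_exact[OF Q P P'])
qed

lemma pcls_dsum:
  assumes A: "projective \<Lambda> A" and B: "projective \<Lambda> B"
  shows "pcls \<Lambda> (dsum A B) - pcls \<Lambda> A - pcls \<Lambda> B \<in> K0_subgroup \<Lambda>"
proof -
  note lm = projective_lmodule[OF A] projective_lmodule[OF B]
  have "\<zero>\<^bsub>A\<^esub> \<in> carrier A" "\<zero>\<^bsub>B\<^esub> \<in> carrier B" by (rule submodule_zero[OF submodule_carrier], rule lm)+
  then have "short_exact \<Lambda> A (\<lambda>x. (x, \<zero>\<^bsub>B\<^esub>)) (dsum A B) snd B"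
    unfolding short_exact_def using mod_hom_inl[OF lm(2), of A] mod_hom_snd[of \<Lambda> A B]
    by (auto simp: a_kernel_eq inj_on_def)
  moreover have "split_epi \<Lambda> (dsum A B) B snd"
    unfolding split_epi_def using mod_hom_snd mod_hom_inr[OF lm(1), of B]
    by (intro conjI bexI[of _ "\<lambda>y. (\<zero>\<^bsub>A\<^esub>, y)"]) simp_all
  ultimately show ?thesis by (rule pcls_exact[OF A projective_dsum[OF A B] B])
qed


section \<open>Existence and uniqueness of g-vectors\<close>

text \<open>For projective \<open>P\<close> every map to \<open>U / X\<close> lifts to
  \<open>U\<close>. So this is the reject of \<open>U / X\<close> in \<open>P\<close>, the joint
  kernel of all maps to \<open>U / X\<close>, described without forming the quotient.\<close>

definition rej :: "('a, 'k) ring_scheme \<Rightarrow> ('a, 'u) module \<Rightarrow> 'u set \<Rightarrow> ('a, 'm) module \<Rightarrow> 'm set" where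
  "rej \<Lambda> U X P = {x \<in> carrier P. \<forall>f\<in>mod_hom \<Lambda> P U. f x \<in> X}"

text \<open>If \<open>U\<close> is an indecomposable projective module with maximal submodule \<open>X\<close>, then
  \<open>P / rej P\<close> is the largest quotient of \<open>P\<close> that is a sum of copies of \<open>U / X\<close>.\<close>

definition top_mult :: "('a, 'k) ring_scheme \<Rightarrow> ('a, 'u) module \<Rightarrow> 'u set \<Rightarrow> ('a, 'm) module \<Rightarrow> int" where
  "top_mult \<Lambda> U X P = int (mlen \<Lambda> P) - int (mlen \<Lambda> (P\<lparr>carrier := rej \<Lambda> U X P\<rparr>))"

lemma submodule_rej:
  assumes "lmodule \<Lambda> P" "lmodule \<Lambda> U" "submodule X \<Lambda> U"
  shows "submodule (rej \<Lambda> U X P) \<Lambda> P"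
proof -
  interpret P: lmodule \<Lambda> P by fact
  show ?thesis
  proof (rule P.submoduleI)
    show "rej \<Lambda> U X P \<subseteq> carrier P" by (auto simp: rej_def)
    have "f \<zero>\<^bsub>P\<^esub> \<in> X" if "f \<in> mod_hom \<Lambda> P U" for f
      using mod_hom_zero[OF assms(1,2) that] submodule_zero[OF assms(3)] by simp
    then show "\<zero>\<^bsub>P\<^esub> \<in> rej \<Lambda> U X P" by (simp add: rej_def)
    show "x \<oplus>\<^bsub>P\<^esub> y \<in> rej \<Lambda> U X P" if "x \<in> rej \<Lambda> U X P" "y \<in> rej \<Lambda> U X P" for x y
      using that submodule_add[OF assms(3)] by (simp add: rej_def mod_hom_add)
    show "a \<odot>\<^bsub>P\<^esub> x \<in> rej \<Lambda> U X P" if "a \<in> carrier \<Lambda>" "x \<in> rej \<Lambda> U X P" for a x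
      using that submodule_smult[OF assms(3)] by (simp add: rej_def mod_hom_smult)
  qed
qed

text \<open>Functoriality of the reject; a split exact sequence thus induces maps, sections
  included, between the rejects.\<close>

lemma rej_hom:
  assumes "h \<in> mod_hom \<Lambda> P Q" "x \<in> rej \<Lambda> U X P"
  shows "h x \<in> rej \<Lambda> U X Q"
proof -
  have x: "x \<in> carrier P" "\<And>f. f \<in> mod_hom \<Lambda> P U \<Longrightarrow> f x \<in> X" using assms(2) by (auto simp: rej_def)
  have "f (h x) \<in> X" if "f \<in> mod_hom \<Lambda> Q U" for f using x(2)[OF mod_hom_comp[OF assms(1) that]] .
  then show ?thesis using mod_hom_closed[OF assms(1) x(1)] by (simp add: rej_def)
qed

section \<open>Additivity of the multiplicity and its values on indecomposable projectives\<close>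

context fl_ring
begin

text \<open>The inclusion, the projection and their splittings all respect rejects, so the rejects
  form a split exact sequence as well. Both lengths in the difference are then additive.\<close>

lemma top_mult_add:
  assumes fg: "fg_module \<Lambda> A" "fg_module \<Lambda> E" "fg_module \<Lambda> C"
    and ex: "short_exact \<Lambda> A f E g C" "split_epi \<Lambda> E C g"
    and U: "lmodule \<Lambda> U" "submodule X \<Lambda> U"
  shows "top_mult \<Lambda> U X E = top_mult \<Lambda> U X A + top_mult \<Lambda> U X C"
proof -
  note lm = fg_lmodule[OF fg(1)] fg_lmodule[OF fg(2)] fg_lmodule[OF fg(3)]
  interpret E: lmodule \<Lambda> E by (rule lm)
  interpret C: lmodule \<Lambda> C by (rule lm)
  have f: "f \<in> mod_hom \<Lambda> A E" and g: "g \<in> mod_hom \<Lambda> E C" and inj: "inj_on f (carrier A)"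
    and ker: "f ` carrier A = a_kernel E C g" and onto: "g ` carrier E = carrier C"
    using ex(1) by (auto simp: short_exact_def)
  obtain s where s: "s \<in> mod_hom \<Lambda> C E" "\<And>x. x \<in> carrier C \<Longrightarrow> g (s x) = x"
    using ex(2) by (auto simp: split_epi_def)
  let ?I = "E\<lparr>carrier := a_kernel E C g\<rparr>"
  note K = submodule_kernel[OF lm(2,3) g]
  note lI = lmodule_submodule[OF lm(2) K]
  have fI: "f \<in> mod_hom \<Lambda> A ?I" by (rule mod_hom_into[OF f]) (simp add: ker)
  have bij: "bij_betw f (carrier A) (carrier ?I)" using inj ker by (simp add: bij_betw_def)
  obtain f' where f': "f' \<in> mod_hom \<Lambda> ?I A" "\<And>x. x \<in> carrier A \<Longrightarrow> f' (f x) = x"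
    using mod_hom_inv[OF lm(1) fI bij] by metis
  let ?\<rho> = "\<lambda>x. x \<ominus>\<^bsub>E\<^esub> s (g x)"
  have "?\<rho> \<in> mod_hom \<Lambda> E E"
    by (rule mod_hom_minus_hom[OF lm(2,2) mod_hom_id mod_hom_comp[OF g s(1)]])
  then have \<rho>: "?\<rho> \<in> mod_hom \<Lambda> E ?I"
  proof (rule mod_hom_into)
    have "?\<rho> x \<in> a_kernel E C g" if x: "x \<in> carrier E" for x
    proof -
      have c: "g x \<in> carrier C" "s (g x) \<in> carrier E" using mod_hom_closed[OF g x] mod_hom_closed[OF s(1)] by auto
      show ?thesis using mod_hom_diff[OF lm(2,3) g x c(2)] s(2)[OF c(1)] c x by (simp add: a_kernel_eq C.minus_eq_zero_iff)
    qed
    then show "?\<rho> ` carrier E \<subseteq> a_kernel E C g" by blast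
  qed
  let ?r = "\<lambda>x. f' (?\<rho> x)"
  have r: "?r \<in> mod_hom \<Lambda> E A" by (rule mod_hom_comp[OF \<rho> f'(1)])
  have rf: "?r (f u) = u" if u: "u \<in> carrier A" for u
  proof -
    have "f u \<in> a_kernel E C g" using u ker by blast
    then have "?\<rho> (f u) = f u" using mod_hom_zero[OF lm(3,2) s(1)] by (simp add: a_kernel_eq a_minus_def)
    then show ?thesis using f'(2)[OF u] by simp
  qed
  have fl: "fin_len \<Lambda> A" "fin_len \<Lambda> E" using fg_fin_len fg by auto
  have "mlen \<Lambda> A = mlen \<Lambda> ?I"
    using mlen_iso[OF lm(1) lI fl(1)] fI bij unfolding mod_isomorphic_def by blast
  then have 1: "mlen \<Lambda> E = mlen \<Lambda> A + mlen \<Lambda> C" using mlen_exact[OF lm(2,3) g onto fl(2)] by simp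
  let ?A = "A\<lparr>carrier := rej \<Lambda> U X A\<rparr>" and ?E = "E\<lparr>carrier := rej \<Lambda> U X E\<rparr>" and ?C = "C\<lparr>carrier := rej \<Lambda> U X C\<rparr>"
  note rj = submodule_rej[OF lm(1) U] submodule_rej[OF lm(2) U] submodule_rej[OF lm(3) U]
  note lr = lmodule_submodule[OF lm(1) rj(1)] lmodule_submodule[OF lm(2) rj(2)] lmodule_submodule[OF lm(3) rj(3)]
  have frj: "fin_len \<Lambda> ?A" "fin_len \<Lambda> ?E"
    using fin_len_submodule(1)[OF lm(1) fl(1) rj(1)] fin_len_submodule(1)[OF lm(2) fl(2) rj(2)] by auto
  have g': "g \<in> mod_hom \<Lambda> ?E ?C"
    by (rule mod_hom_into[OF mod_hom_restrict[OF g submodule_subset[OF rj(2)]]]) (use rej_hom[OF g] in auto)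
  have "g ` carrier ?E = carrier ?C"
  proof
    show "g ` carrier ?E \<subseteq> carrier ?C" using mod_hom_closed[OF g'] by blast
    show "carrier ?C \<subseteq> g ` carrier ?E"
    proof
      fix y assume y: "y \<in> carrier ?C"
      then have "s y \<in> carrier ?E" "g (s y) = y"
        using rej_hom[OF s(1)] s(2) submodule_subset[OF rj(3)] by auto
      then show "y \<in> g ` carrier ?E" by (metis image_eqI)
    qed
  qed
  note ex' = mlen_exact[OF lr(2,3) g' this frj(2)]
  let ?K = "?E\<lparr>carrier := a_kernel ?E ?C g\<rparr>"
  have f'': "f \<in> mod_hom \<Lambda> ?A ?K"
  proof (rule mod_hom_into[OF mod_hom_into[OF mod_hom_restrict[OF f submodule_subset[OF rj(1)]]]])
    show "f ` carrier ?A \<subseteq> rej \<Lambda> U X E" using rej_hom[OF f] by auto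
    moreover have "f ` carrier ?A \<subseteq> a_kernel E C g" unfolding ker[symmetric] using submodule_subset[OF rj(1)] by auto
    ultimately show "f ` carrier ?A \<subseteq> a_kernel ?E ?C g" by (auto simp: a_kernel_eq)
  qed
  have "bij_betw f (carrier ?A) (carrier ?K)"
    unfolding bij_betw_def
  proof
    show "inj_on f (carrier ?A)" using inj_on_subset[OF inj submodule_subset[OF rj(1)]] by simp
    show "f ` carrier ?A = carrier ?K"
    proof
      show "f ` carrier ?A \<subseteq> carrier ?K" using mod_hom_closed[OF f''] by blast
      show "carrier ?K \<subseteq> f ` carrier ?A"
      proof
        fix x assume "x \<in> carrier ?K"
        then have x: "x \<in> rej \<Lambda> U X E" "g x = \<zero>\<^bsub>C\<^esub>" by (auto simp: a_kernel_eq)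
        then have "x \<in> f ` carrier A" unfolding ker using submodule_subset[OF rj(2)] by (auto simp: a_kernel_eq)
        then obtain u where u: "u \<in> carrier A" "x = f u" by blast
        then have "u \<in> rej \<Lambda> U X A" using rej_hom[OF r x(1)] rf[OF u(1)] by simp
        then show "x \<in> f ` carrier ?A" using u(2) by simp
      qed
    qed
  qed
  then have "mod_isomorphic \<Lambda> ?A ?K" using f'' unfolding mod_isomorphic_def by blast
  then have "mlen \<Lambda> ?A = mlen \<Lambda> ?K"
    by (rule mlen_iso[OF lr(1) lmodule_submodule[OF lr(2) submodule_kernel[OF lr(2,3) g']] frj(1)])
  then show ?thesis using 1 ex' by (simp add: top_mult_def)
qed

lemma maximal_proper_submodule:
  assumes "fg_module \<Lambda> M" "submodule H \<Lambda> M" "H \<noteq> carrier M"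
  obtains X where "submodule X \<Lambda> M" "H \<subseteq> X" "X \<noteq> carrier M"
    "\<And>Y. \<lbrakk>submodule Y \<Lambda> M; X \<subseteq> Y\<rbrakk> \<Longrightarrow> Y = X \<or> Y = carrier M"
proof -
  define Q where "Q X \<longleftrightarrow> submodule X \<Lambda> M \<and> H \<subseteq> X \<and> X \<noteq> carrier M" for X
  have "Q H" using assms(2,3) by (simp add: Q_def)
  then obtain X where X: "Q X" "\<And>Y. \<lbrakk>Q Y; X \<subseteq> Y\<rbrakk> \<Longrightarrow> Y = X"
    by (rule maximal_submodule[OF fg_lmodule[OF assms(1)] fg_fin_len[OF assms(1)]]) (simp add: Q_def, blast)
  have "Y = X \<or> Y = carrier M" if "submodule Y \<Lambda> M" "X \<subseteq> Y" for Y
    using X that by (auto simp: Q_def)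
  then show ?thesis using that X(1) by (auto simp: Q_def)
qed

text \<open>By indecomposability \<open>U \<rightarrow> U / X\<close> is a projective cover, and
  \<open>Y\<close> maps onto \<open>U / X\<close>.\<close>

lemma indecomposable_superfluous:
  assumes U: "projective \<Lambda> U" "indecomposable \<Lambda> U" and X: "submodule X \<Lambda> U" "X \<noteq> carrier U"
    and Y: "submodule Y \<Lambda> U" "sum_sub U X Y = carrier U"
  shows "Y = carrier U"
proof -
  note lU = projective_lmodule[OF U(1)]
  interpret U: lmodule \<Lambda> U by (rule lU)
  let ?\<pi> = "\<lambda>x. X +>\<^bsub>U\<^esub> x" and ?Q = "quot_module U X"
  note q = quot_module[OF lU X(1)]
  interpret Q: lmodule \<Lambda> ?Q by (rule q)
  have fQ: "fg_module \<Lambda> ?Q" by (rule fg_module_image[OF projective_fg[OF U(1)] q(1,2,3)])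
  have "carrier ?Q \<noteq> {\<zero>\<^bsub>?Q\<^esub>}"
  proof
    assume "carrier ?Q = {\<zero>\<^bsub>?Q\<^esub>}"
    then have "x \<in> X" if "x \<in> carrier U" for x
      using mod_hom_closed[OF q(2) that] q(4)[OF that] by simp
    then show False using X submodule_subset[OF X(1)] by blast
  qed
  then have cov: "projective_cover \<Lambda> U ?\<pi> ?Q" by (rule indecomposable_cover[OF fQ U q(2,3)])
  have "?\<pi> ` Y = carrier ?Q"
  proof
    show "?\<pi> ` Y \<subseteq> carrier ?Q" using mod_hom_closed[OF q(2)] submodule_subset[OF Y(1)] by blast
    show "carrier ?Q \<subseteq> ?\<pi> ` Y"
    proof
      fix u assume "u \<in> carrier ?Q"
      then have "u \<in> ?\<pi> ` sum_sub U X Y" unfolding Y(2) q(3) .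
      then obtain x y where xy: "x \<in> X" "y \<in> Y" "u = ?\<pi> (x \<oplus>\<^bsub>U\<^esub> y)" by (auto simp: sum_sub_def)
      then have c: "x \<in> carrier U" "y \<in> carrier U" using submodule_subset[OF X(1)] submodule_subset[OF Y(1)] by auto
      have "u = ?\<pi> y"
        using xy(3) mod_hom_add[OF q(2) c] q(4)[OF c(1)] xy(1) mod_hom_closed[OF q(2) c(2)] by simp
      then show "u \<in> ?\<pi> ` Y" using xy(2) by blast
    qed
  qed
  then show ?thesis using cov Y(1) unfolding projective_cover_def by blast
qed

text \<open>The identity of \<open>U\<close> forces the reject into \<open>X\<close>, so it is a
  proper submodule and shorter than \<open>U\<close>.\<close>

lemma top_mult_self:
  assumes "fg_module \<Lambda> U" "submodule X \<Lambda> U" "X \<noteq> carrier U"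
  shows "top_mult \<Lambda> U X U \<noteq> 0"
proof -
  note lU = fg_lmodule[OF assms(1)]
  have "rej \<Lambda> U X U \<subseteq> X"
  proof
    fix x assume "x \<in> rej \<Lambda> U X U"
    then have "\<forall>f\<in>mod_hom \<Lambda> U U. f x \<in> X" by (simp add: rej_def)
    from bspec[OF this mod_hom_id] show "x \<in> X" .
  qed
  then have "rej \<Lambda> U X U \<noteq> carrier U" using assms(3) submodule_subset[OF assms(2)] by blast
  then show ?thesis
    using mlen_submodule_less[OF lU fg_fin_len[OF assms(1)] submodule_rej[OF lU lU assms(2)]] by (simp add: top_mult_def)
qed

text \<open>A map \<open>V \<rightarrow> U\<close> whose image is not inside the maximal
  \<open>X\<close> has image summing with \<open>X\<close> to \<open>U\<close>, hence is onto. It is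
  then a projective cover of \<open>U\<close>, as is the identity of \<open>U\<close>, and
  uniqueness of covers would make \<open>V\<close> and \<open>U\<close> isomorphic. So the reject is
  all of \<open>V\<close>.\<close>

lemma top_mult_other:
  assumes U: "projective \<Lambda> U" "indecomposable \<Lambda> U" and V: "projective \<Lambda> V" "indecomposable \<Lambda> V"
    and ni: "\<not> mod_isomorphic \<Lambda> V U"
    and X: "submodule X \<Lambda> U" "X \<noteq> carrier U" "\<And>Y. \<lbrakk>submodule Y \<Lambda> U; X \<subseteq> Y\<rbrakk> \<Longrightarrow> Y = X \<or> Y = carrier U"
  shows "top_mult \<Lambda> U X V = 0"
proof -
  note lU = projective_lmodule[OF U(1)] and lV = projective_lmodule[OF V(1)]
  have "f x \<in> X" if f: "f \<in> mod_hom \<Lambda> V U" and x: "x \<in> carrier V" for f x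
  proof (rule ccontr)
    assume nX: "f x \<notin> X"
    let ?Y = "f ` carrier V"
    have Y: "submodule ?Y \<Lambda> U" by (rule submodule_image[OF lV lU f submodule_carrier[OF lV]])
    note XY = submodule_sum[OF lU X(1) Y]
    have "f x \<in> sum_sub U X ?Y" using XY(3) x by blast
    then have "sum_sub U X ?Y \<noteq> X" using nX by blast
    then have "sum_sub U X ?Y = carrier U" using X(3)[OF XY(1,2)] by blast
    then have onto: "?Y = carrier U" by (rule indecomposable_superfluous[OF U X(1,2) Y])
    have "carrier U \<noteq> {\<zero>\<^bsub>U\<^esub>}" using U(2) by (simp add: indecomposable_def)
    then have c: "projective_cover \<Lambda> V f U" by (rule indecomposable_cover[OF projective_fg[OF U(1)] V f onto])
    have "projective_cover \<Lambda> U (\<lambda>x. x) U"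
      unfolding projective_cover_def using U(1) mod_hom_id by simp
    then show False using cover_unique[OF c _ projective_fg[OF U(1)]] ni by blast
  qed
  then have "rej \<Lambda> U X V = carrier V" by (auto simp: rej_def)
  then show ?thesis by (simp add: top_mult_def)
qed

end

text \<open>Addition maps the external sum onto \<open>M\<close> and is injective because the
  summands meet in zero, so the second projection factors through it.\<close>

lemma direct_decomp_projection:
  assumes "lmodule \<Lambda> M" "direct_decomp \<Lambda> M A B"
  obtains p where "p \<in> mod_hom \<Lambda> M (M\<lparr>carrier := B\<rparr>)" "\<And>b. b \<in> B \<Longrightarrow> p b = b"
    "a_kernel M (M\<lparr>carrier := B\<rparr>) p = A"
proof -
  interpret lmodule \<Lambda> M by fact
  have A: "submodule A \<Lambda> M" and B: "submodule B \<Lambda> M" and int: "A \<inter> B = {\<zero>\<^bsub>M\<^esub>}" and sum: "sum_sub M A B = carrier M"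
    using assms(2) by (auto simp: direct_decomp_def set_add_eq_sum_sub)
  note lB = lmodule_submodule[OF assms(1) B]
  have AM: "a \<in> carrier M" if "a \<in> A" for a using submodule_subset[OF A] that by blast
  have BM: "b \<in> carrier M" if "b \<in> B" for b using submodule_subset[OF B] that by blast
  define D where "D = dsum (M\<lparr>carrier := A\<rparr>) (M\<lparr>carrier := B\<rparr>)"
  let ?h = "\<lambda>z. fst z \<oplus>\<^bsub>M\<^esub> snd z"
  note lA = lmodule_submodule[OF assms(1) A]
  have lD: "lmodule \<Lambda> D" unfolding D_def by (rule lmodule_dsum[OF lA lB])
  have h: "?h \<in> mod_hom \<Lambda> D M"
    unfolding D_def
    by (rule mod_hom_copair[OF lA lB assms(1) mod_hom_incl[OF submodule_subset[OF A]] mod_hom_incl[OF submodule_subset[OF B]]])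
  have onto: "?h ` carrier D = carrier M" unfolding sum[symmetric] sum_sub_def D_def by force
  have ker: "snd z = \<zero>\<^bsub>M\<^esub>" if z: "z \<in> carrier D" "?h z = \<zero>\<^bsub>M\<^esub>" for z
  proof -
    have z': "fst z \<in> A" "snd z \<in> B" using z(1) by (auto simp: D_def)
    have "\<ominus>\<^bsub>M\<^esub> snd z = fst z" using M.minus_equality[OF z(2)] AM[OF z'(1)] BM[OF z'(2)] by simp
    then have "snd z = \<ominus>\<^bsub>M\<^esub> fst z" using BM[OF z'(2)] by (metis M.minus_minus)
    then have "snd z \<in> A \<inter> B" using z' submodule_minus[OF A z'(1)] by simp
    then show ?thesis using int by simp
  qed
  have snd: "snd \<in> mod_hom \<Lambda> D (M\<lparr>carrier := B\<rparr>)" unfolding D_def by (rule mod_hom_snd)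
  obtain p where p: "p \<in> mod_hom \<Lambda> M (M\<lparr>carrier := B\<rparr>)" "\<And>z. z \<in> carrier D \<Longrightarrow> p (?h z) = snd z"
    by (rule mod_hom_factor[OF lD assms(1) lB h onto snd]) (use ker in simp_all)
  have z: "\<zero>\<^bsub>M\<^esub> \<in> A" "\<zero>\<^bsub>M\<^esub> \<in> B" by (rule submodule_zero, fact)+
  show ?thesis
  proof
    show "p \<in> mod_hom \<Lambda> M (M\<lparr>carrier := B\<rparr>)" by (rule p)
    show "p b = b" if "b \<in> B" for b
      using p(2)[of "(\<zero>\<^bsub>M\<^esub>, b)"] that z BM[OF that] by (simp add: D_def)
    show "a_kernel M (M\<lparr>carrier := B\<rparr>) p = A"
    proof
      show "A \<subseteq> a_kernel M (M\<lparr>carrier := B\<rparr>) p"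
      proof
        fix a assume a: "a \<in> A"
        then show "a \<in> a_kernel M (M\<lparr>carrier := B\<rparr>) p"
          using p(2)[of "(a, \<zero>\<^bsub>M\<^esub>)"] z AM[OF a] by (simp add: D_def a_kernel_eq)
      qed
      show "a_kernel M (M\<lparr>carrier := B\<rparr>) p \<subseteq> A"
      proof
        fix x assume "x \<in> a_kernel M (M\<lparr>carrier := B\<rparr>) p"
        then have x: "x \<in> carrier M" "p x = \<zero>\<^bsub>M\<^esub>" by (auto simp: a_kernel_eq)
        then have "x \<in> ?h ` carrier D" unfolding onto by simp
        then obtain w where w: "w \<in> carrier D" "x = ?h w" by blast
        then have "snd w = \<zero>\<^bsub>M\<^esub>" using p(2)[OF w(1)] x(2) by simp
        moreover have "fst w \<in> A" using w(1) by (auto simp: D_def)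
        ultimately show "x \<in> A" using w(2) AM by simp
      qed
    qed
  qed
qed

section \<open>Spanning and independence of the classes of indecomposable projectives\<close>

definition csum :: "nat \<Rightarrow> (nat \<Rightarrow> ('a, 'a univ) module) \<Rightarrow> (nat \<Rightarrow> int) \<Rightarrow> (('a, 'a univ) module \<Rightarrow>\<^sub>0 int)" where
  "csum n P c = (\<Sum>i\<in>{1..n}. frag_cmul (c i) (frag_of (P i)))"

lemma csum_add: "csum n P (\<lambda>i. c i + d i) = csum n P c + csum n P d"
  and csum_diff: "csum n P (\<lambda>i. c i - d i) = csum n P c - csum n P d"
  by (simp_all add: csum_def frag_cmul_distrib frag_cmul_diff_distrib sum.distrib sum_subtractf)

lemma csum_cong: "(\<And>i. i \<in> {1..n} \<Longrightarrow> c i = d i) \<Longrightarrow> csum n P c = csum n P d"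
  unfolding csum_def by (rule sum.cong) simp_all

lemma complete_indec_projectivesD:
  fixes Q :: "('a, 'a univ) module"
  assumes "complete_indec_projectives \<Lambda> n P"
  shows "i \<in> {1..n} \<Longrightarrow> projective \<Lambda> (P i)" "i \<in> {1..n} \<Longrightarrow> indecomposable \<Lambda> (P i)"
    and "\<lbrakk>i \<in> {1..n}; j \<in> {1..n}; mod_isomorphic \<Lambda> (P i) (P j)\<rbrakk> \<Longrightarrow> i = j"
    and "\<lbrakk>projective \<Lambda> Q; indecomposable \<Lambda> Q\<rbrakk> \<Longrightarrow> \<exists>i\<in>{1..n}. mod_isomorphic \<Lambda> Q (P i)"
proof -
  note c = assms[unfolded complete_indec_projectives_def]
  show "i \<in> {1..n} \<Longrightarrow> projective \<Lambda> (P i)" "i \<in> {1..n} \<Longrightarrow> indecomposable \<Lambda> (P i)"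
    by (rule c[THEN conjunct1, THEN bspec, THEN conjunct1] c[THEN conjunct1, THEN bspec, THEN conjunct2], assumption)+
  show "\<lbrakk>i \<in> {1..n}; j \<in> {1..n}; mod_isomorphic \<Lambda> (P i) (P j)\<rbrakk> \<Longrightarrow> i = j"
    by (rule c[THEN conjunct2, THEN conjunct1, THEN bspec, THEN bspec, THEN mp])
  show "\<lbrakk>projective \<Lambda> Q; indecomposable \<Lambda> Q\<rbrakk> \<Longrightarrow> \<exists>i\<in>{1..n}. mod_isomorphic \<Lambda> Q (P i)"
    by (rule c[THEN conjunct2, THEN conjunct2, THEN spec, THEN mp, OF conjI])
qed

lemma is_g_vector_iff:
  assumes "complete_indec_projectives \<Lambda> n P"
  shows "is_g_vector \<Lambda> n P M g \<longleftrightarrow> g \<in> extensional {1..n} \<and>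
    (\<exists>P1 d P0 p. minimal_projective_presentation \<Lambda> P1 d P0 p M \<and> frag_of P0 - frag_of P1 - csum n P g \<in> K0_subgroup \<Lambda>)"
proof -
  note P = complete_indec_projectivesD(1)[OF assms]
  have *: "K0_class \<Lambda> P0 \<otimes>\<^bsub>K0_prj \<Lambda>\<^esub> inv\<^bsub>K0_prj \<Lambda>\<^esub> K0_class \<Lambda> P1 =
          (\<Otimes>\<^bsub>K0_prj \<Lambda>\<^esub>i\<in>{1..n}. K0_class \<Lambda> (P i) [^]\<^bsub>K0_prj \<Lambda>\<^esub> g i) \<longleftrightarrow>
      frag_of P0 - frag_of P1 - csum n P g \<in> K0_subgroup \<Lambda>"
    if "minimal_projective_presentation \<Lambda> P1 d P0 p M" for P1 d P0 p
    unfolding csum_def using that P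
    by (intro K0_equation_iff) (auto simp: minimal_projective_presentation_def projective_cover_def)
  show ?thesis unfolding is_g_vector_def by (intro conj_cong[OF refl] ex_cong1 *)
qed

context fl_ring
begin

text \<open>Induction on length: a decomposable projective is a split extension of two strictly
  shorter projectives, whose coefficient vectors are added.\<close>

lemma projective_class_spanned:
  fixes Q :: "('a, 'a univ) module"
  assumes "complete_indec_projectives \<Lambda> n P" "projective \<Lambda> Q"
  shows "\<exists>c. pcls \<Lambda> Q - csum n P c \<in> K0_subgroup \<Lambda>"
  using assms(2)
proof (induction "mlen \<Lambda> Q" arbitrary: Q rule: less_induct)
  case less
  note Q = less.prems and lQ = projective_lmodule[OF less.prems] and fQ = projective_fg[OF less.prems]
  consider "carrier Q = {\<zero>\<^bsub>Q\<^esub>}" | "indecomposable \<Lambda> Q"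
    | A B where "direct_decomp \<Lambda> Q A B" "A \<noteq> {\<zero>\<^bsub>Q\<^esub>}" "B \<noteq> {\<zero>\<^bsub>Q\<^esub>}"
    by (auto simp: indecomposable_def)
  then show ?case
  proof cases
    case 1
    let ?Z = "prj_copy \<Lambda> Q"
    note Z = prj_copy[OF Q]
    have "mlen \<Lambda> ?Z = 0"
      using mlen_iso[OF lQ projective_lmodule[OF Z(1)] fg_fin_len[OF fQ] Z(2)] fin_len_zero(2)[OF 1] by metis
    then have "carrier ?Z = {\<zero>\<^bsub>?Z\<^esub>}"
      using mlen_eq_0_iff[OF projective_lmodule[OF Z(1)] fg_fin_len[OF projective_fg[OF Z(1)]]] by simp
    then have "pcls \<Lambda> Q \<in> K0_subgroup \<Lambda>"
      unfolding pcls_def by (rule K0_zero_class[OF projective_lmodule[OF Z(1)]])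
    moreover have "csum n P (\<lambda>i. 0) = 0" by (simp add: csum_def)
    ultimately show ?thesis by (intro exI[of _ "\<lambda>i. 0"]) simp
  next
    case 2
    then obtain i where i: "i \<in> {1..n}" "mod_isomorphic \<Lambda> Q (P i)"
      using complete_indec_projectivesD(4)[OF assms(1) Q] by blast
    note Pi = complete_indec_projectivesD(1)[OF assms(1) i(1)]
    have "csum n P (\<lambda>j. if j = i then 1 else 0) = (\<Sum>j\<in>{1..n}. if j = i then frag_of (P j) else 0)"
      unfolding csum_def by (rule sum.cong) simp_all
    also have "\<dots> = frag_of (P i)" using i(1) by simp
    finally have "csum n P (\<lambda>j. if j = i then 1 else 0) = frag_of (P i)" .
    moreover have "(pcls \<Lambda> Q - frag_of Q) - (frag_of (P i) - frag_of Q) \<in> K0_subgroup \<Lambda>"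
      by (rule K0_diff[OF pcls_univ[OF Q] K0_iso[OF Q Pi i(2)]])
    ultimately show ?thesis by (intro exI[of _ "\<lambda>j. if j = i then 1 else 0"]) simp
  next
    case 3
    let ?A = "Q\<lparr>carrier := A\<rparr>" and ?B = "Q\<lparr>carrier := B\<rparr>"
    have AB: "submodule A \<Lambda> Q" "submodule B \<Lambda> Q" "A \<inter> B = {\<zero>\<^bsub>Q\<^esub>}"
      using 3(1) by (auto simp: direct_decomp_def)
    obtain p where p: "p \<in> mod_hom \<Lambda> Q ?B" "\<And>b. b \<in> B \<Longrightarrow> p b = b" "a_kernel Q ?B p = A"
      using direct_decomp_projection[OF lQ 3(1)] by blast
    note incl = mod_hom_incl[OF submodule_subset[OF AB(2)], of \<Lambda>]
    note lB = lmodule_submodule[OF lQ AB(2)]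
    have pB: "projective \<Lambda> ?B" by (rule projective_retract[OF Q lB incl p(1)]) (simp add: p(2))
    have pA: "projective \<Lambda> ?A"
      using projective_kernel[OF Q lB p(1) incl] p(2) unfolding p(3) by simp
    have onto: "p ` carrier Q = carrier ?B"
    proof
      show "p ` carrier Q \<subseteq> carrier ?B" using mod_hom_closed[OF p(1)] by blast
      show "carrier ?B \<subseteq> p ` carrier Q"
      proof
        fix b assume "b \<in> carrier ?B"
        then have "b = p b" "b \<in> carrier Q" using p(2) submodule_subset[OF AB(2)] by auto
        then show "b \<in> p ` carrier Q" by (rule image_eqI)
      qed
    qed
    have "A \<noteq> carrier Q"
    proof
      assume "A = carrier Q"
      then have "B \<subseteq> A \<inter> B" using submodule_subset[OF AB(2)] by blast
      then show False using AB(3) 3(3) submodule_zero[OF AB(2)] by blast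
    qed
    then have lessA: "mlen \<Lambda> ?A < mlen \<Lambda> Q" by (rule mlen_submodule_less[OF lQ fg_fin_len[OF fQ] AB(1)])
    have "B \<noteq> carrier Q"
    proof
      assume "B = carrier Q"
      then have "A \<subseteq> A \<inter> B" using submodule_subset[OF AB(1)] by blast
      then show False using AB(3) 3(2) submodule_zero[OF AB(1)] by blast
    qed
    then have lessB: "mlen \<Lambda> ?B < mlen \<Lambda> Q" by (rule mlen_submodule_less[OF lQ fg_fin_len[OF fQ] AB(2)])
    obtain c where c: "pcls \<Lambda> ?A - csum n P c \<in> K0_subgroup \<Lambda>" using less.hyps[OF lessA pA] by blast
    obtain d where d: "pcls \<Lambda> ?B - csum n P d \<in> K0_subgroup \<Lambda>" using less.hyps[OF lessB pB] by blast
    have "pcls \<Lambda> Q - pcls \<Lambda> ?A - pcls \<Lambda> ?B \<in> K0_subgroup \<Lambda>"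
      using pcls_kernel[OF Q pB p(1) onto] unfolding p(3) .
    from K0_add[OF K0_add[OF this c] d] have "pcls \<Lambda> Q - csum n P (\<lambda>i. c i + d i) \<in> K0_subgroup \<Lambda>"
      by (simp add: csum_add algebra_simps)
    then show ?thesis by blast
  qed
qed

text \<open>The multiplicity attached to \<open>P j\<close> is additive, nonzero on
  \<open>P j\<close> and zero on the other \<open>P i\<close>, so evaluating it on the relation
  isolates the coefficient \<open>c j\<close>.\<close>

lemma projective_classes_independent:
  assumes "complete_indec_projectives \<Lambda> n P" "csum n P c \<in> K0_subgroup \<Lambda>" "j \<in> {1..n}"
  shows "c j = 0"
proof -
  note P = complete_indec_projectivesD(1,2)[OF assms(1)]
  have ni: "\<not> mod_isomorphic \<Lambda> (P i) (P j)" if "i \<in> {1..n}" "i \<noteq> j" for i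
    using complete_indec_projectivesD(3)[OF assms(1) that(1) assms(3)] that(2) by blast
  note Pj = P[OF assms(3)]
  note lj = projective_lmodule[OF Pj(1)]
  have "{\<zero>\<^bsub>P j\<^esub>} \<noteq> carrier (P j)" using Pj(2) by (auto simp: indecomposable_def)
  then obtain X where X: "submodule X \<Lambda> (P j)" "X \<noteq> carrier (P j)"
    "\<And>Y. \<lbrakk>submodule Y \<Lambda> (P j); X \<subseteq> Y\<rbrakk> \<Longrightarrow> Y = X \<or> Y = carrier (P j)"
    using maximal_proper_submodule[OF projective_fg[OF Pj(1)] submodule_trivial[OF lj]] by metis
  let ?m = "top_mult \<Lambda> (P j) X :: ('a, 'a univ) module \<Rightarrow> int"
  have "frag_eval ?m (csum n P c) = 0"
    by (rule K0_additive_zero[OF _ assms(2)])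
      (rule top_mult_add[OF projective_fg projective_fg projective_fg _ _ lj X(1)])
  moreover have "frag_eval ?m (csum n P c) = (\<Sum>i\<in>{1..n}. c i * ?m (P i))"
    unfolding csum_def by (simp add: frag_eval_sum)
  moreover have "(\<Sum>i\<in>{1..n}. c i * ?m (P i)) = (\<Sum>i\<in>{1..n}. if i = j then c j * ?m (P j) else 0)"
    using top_mult_other[OF Pj P ni X] by (intro sum.cong) auto
  moreover have "(\<Sum>i\<in>{1..n}. if i = j then c j * ?m (P j) else 0) = c j * ?m (P j)" using assms(3) by simp
  ultimately show ?thesis using top_mult_self[OF projective_fg[OF Pj(1)] X(1,2)] by simp
qed

text \<open>Both \<open>[P]\<close> and \<open>[P1]\<close> exceed their minimal counterparts by the
  class of the same kernel, which cancels in the difference.\<close>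

lemma compare_presentations_class:
  assumes P: "projective \<Lambda> P" and p: "p \<in> mod_hom \<Lambda> P N" "p ` carrier P = carrier N"
    and N: "fg_module \<Lambda> N"
    and P1: "projective_cover \<Lambda> P1 d (P\<lparr>carrier := a_kernel P N p\<rparr>)"
    and min: "minimal_projective_presentation \<Lambda> P1' d' P' p' N"
  shows "(pcls \<Lambda> P - pcls \<Lambda> P1) - (pcls \<Lambda> P' - pcls \<Lambda> P1') \<in> K0_subgroup \<Lambda>"
proof -
  obtain f where f: "f \<in> mod_hom \<Lambda> P P'" "f ` carrier P = carrier P'"
    "projective \<Lambda> (P\<lparr>carrier := a_kernel P P' f\<rparr>)"
    "mod_isomorphic \<Lambda> (dsum P1' (P\<lparr>carrier := a_kernel P P' f\<rparr>)) P1"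
    using compare_presentations[OF assms] by blast
  let ?Q = "P\<lparr>carrier := a_kernel P P' f\<rparr>"
  have prj: "projective \<Lambda> P'" "projective \<Lambda> P1'" "projective \<Lambda> P1"
    using min P1 by (auto simp: minimal_projective_presentation_def projective_cover_def)
  note 1 = pcls_kernel[OF P prj(1) f(1,2)]
  note 2 = pcls_dsum[OF prj(2) f(3)]
  note 3 = pcls_iso[OF projective_dsum[OF prj(2) f(3)] prj(3) f(4)]
  show ?thesis using K0_diff[OF K0_diff[OF 1 2] 3] by (simp add: algebra_simps)
qed

text \<open>Reads the g-vector off a presentation in which only the second map has to be a cover.
  This is the shape of the horseshoe presentation of \<open>N\<close>.\<close>

lemma g_vectorI:
  assumes ci: "complete_indec_projectives \<Lambda> n P" and N: "fg_module \<Lambda> N"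
    and P0: "projective \<Lambda> P0" and p: "p \<in> mod_hom \<Lambda> P0 N" "p ` carrier P0 = carrier N"
    and P1: "projective_cover \<Lambda> P1 d (P0\<lparr>carrier := a_kernel P0 N p\<rparr>)"
    and g: "pcls \<Lambda> P0 - pcls \<Lambda> P1 - csum n P g \<in> K0_subgroup \<Lambda>"
  shows "\<forall>i\<in>{1..n}. g_vector \<Lambda> n P N i = g i"
proof -
  \<comment> \<open>A g-vector is extensional on \<open>{1..n}\<close>, so the arbitrary solution
    \<open>g\<close> is cut down to that range before uniqueness can hold.\<close>
  define g0 where "g0 = restrict g {1..n}"
  have g0: "csum n P g0 = csum n P g" by (rule csum_cong) (simp add: g0_def)
  have key: "frag_of Q0 - frag_of Q1 - csum n P g \<in> K0_subgroup \<Lambda>"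
    if min: "minimal_projective_presentation \<Lambda> Q1 e Q0 q N" for Q1 e Q0 q
  proof -
    have prj: "projective \<Lambda> Q0" "projective \<Lambda> Q1"
      using min by (auto simp: minimal_projective_presentation_def projective_cover_def)
    note c = compare_presentations_class[OF P0 p N P1 min]
    show ?thesis
      using K0_add[OF K0_diff[OF K0_diff[OF g c] pcls_univ[OF prj(1)]] pcls_univ[OF prj(2)]]
      by (simp add: algebra_simps)
  qed
  obtain Q0 :: "('a, 'a univ) module" and q where Q0: "projective_cover \<Lambda> Q0 q N" using cover_exists[OF N] by blast
  then have pQ: "projective \<Lambda> Q0" "q \<in> mod_hom \<Lambda> Q0 N" by (auto simp: projective_cover_def)
  have "fg_module \<Lambda> (Q0\<lparr>carrier := a_kernel Q0 N q\<rparr>)"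
    by (rule fg_submodule[OF projective_fg[OF pQ(1)] submodule_kernel[OF projective_lmodule[OF pQ(1)] fg_lmodule[OF N] pQ(2)]])
  then obtain Q1 :: "('a, 'a univ) module" and e where "projective_cover \<Lambda> Q1 e (Q0\<lparr>carrier := a_kernel Q0 N q\<rparr>)"
    using cover_exists by blast
  then have min: "minimal_projective_presentation \<Lambda> Q1 e Q0 q N"
    using Q0 by (simp add: minimal_projective_presentation_def)
  have "is_g_vector \<Lambda> n P N g0"
    unfolding is_g_vector_iff[OF ci] g0 using min key[OF min] by (auto simp: g0_def)
  moreover have "h = g0" if hg: "is_g_vector \<Lambda> n P N h" for h
  proof -
    obtain Q1 e Q0 q where h: "h \<in> extensional {1..n}" "minimal_projective_presentation \<Lambda> Q1 e Q0 q N"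
      "frag_of Q0 - frag_of Q1 - csum n P h \<in> K0_subgroup \<Lambda>"
      using hg unfolding is_g_vector_iff[OF ci] by blast
    have "csum n P (\<lambda>i. h i - g i) \<in> K0_subgroup \<Lambda>"
      using K0_diff[OF key[OF h(2)] h(3)] by (simp add: csum_diff)
    then have "h i = g i" if "i \<in> {1..n}" for i
      using projective_classes_independent[OF ci _ that] by fastforce
    then show ?thesis
      by (intro extensionalityI[OF h(1), of g0]) (simp_all add: g0_def)
  qed
  ultimately have "g_vector \<Lambda> n P N = g0" unfolding g_vector_def by (rule the_equality)
  then show ?thesis by (simp add: g0_def)
qed

text \<open>Conversely, makes \<open>g_vector\<close> concrete: coefficients of the classes of two
  successive covers exist by spanning, and \<open>g_vectorI\<close> identifies their difference with
  the g-vector.\<close>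

lemma g_vectorE:
  fixes M :: "('a, 'm) module"
  assumes ci: "complete_indec_projectives \<Lambda> n P" and M: "fg_module \<Lambda> M"
  obtains P0 P1 :: "('a, 'a univ) module" and p d where
    "projective_cover \<Lambda> P0 p M" "projective_cover \<Lambda> P1 d (P0\<lparr>carrier := a_kernel P0 M p\<rparr>)"
    "pcls \<Lambda> P0 - pcls \<Lambda> P1 - csum n P (g_vector \<Lambda> n P M) \<in> K0_subgroup \<Lambda>"
proof -
  obtain P0 :: "('a, 'a univ) module" and p where P0: "projective_cover \<Lambda> P0 p M" using cover_exists[OF M] by blast
  then have p: "projective \<Lambda> P0" "p \<in> mod_hom \<Lambda> P0 M" "p ` carrier P0 = carrier M" by (auto simp: projective_cover_def)
  have "fg_module \<Lambda> (P0\<lparr>carrier := a_kernel P0 M p\<rparr>)"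
    by (rule fg_submodule[OF projective_fg[OF p(1)] submodule_kernel[OF projective_lmodule[OF p(1)] fg_lmodule[OF M] p(2)]])
  then obtain P1 :: "('a, 'a univ) module" and d where P1: "projective_cover \<Lambda> P1 d (P0\<lparr>carrier := a_kernel P0 M p\<rparr>)"
    using cover_exists by blast
  then have P1p: "projective \<Lambda> P1" by (simp add: projective_cover_def)
  obtain c where c: "pcls \<Lambda> P0 - csum n P c \<in> K0_subgroup \<Lambda>" using projective_class_spanned[OF ci p(1)] by blast
  obtain e where e: "pcls \<Lambda> P1 - csum n P e \<in> K0_subgroup \<Lambda>" using projective_class_spanned[OF ci P1p] by blast
  have g: "pcls \<Lambda> P0 - pcls \<Lambda> P1 - csum n P (\<lambda>i. c i - e i) \<in> K0_subgroup \<Lambda>"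
    using K0_diff[OF c e] by (simp add: csum_diff algebra_simps)
  have "csum n P (g_vector \<Lambda> n P M) = csum n P (\<lambda>i. c i - e i)"
    by (rule csum_cong) (use g_vectorI[OF ci M p P1 g] in blast)
  then show ?thesis using that[OF P0 P1] g by simp
qed

end


section \<open>The socle\<close>

context fl_ring
begin

lemma submodule_socle:
  assumes "lmodule \<Lambda> I" shows "submodule (socle \<Lambda> I) \<Lambda> I"
  unfolding socle_def
  by (rule submodule_mod_span[OF assms]) (use submodule_subset in \<open>unfold simple_submodule_def, blast\<close>)

lemma simple_subset_socle: "simple_submodule \<Lambda> I S \<Longrightarrow> S \<subseteq> socle \<Lambda> I"
  unfolding socle_def using mod_span_superset[of "\<Union>{S. simple_submodule \<Lambda> I S}" \<Lambda> I] by blast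

text \<open>Semisimplicity of the socle. Take \<open>Y\<close> maximal in the socle with zero
  intersection with \<open>X\<close>. A simple submodule outside \<open>X + Y\<close> meets it in
  zero and could be added to \<open>Y\<close>; so all simple submodules lie in
  \<open>X + Y\<close>.\<close>

lemma socle_complement:
  assumes "fg_module \<Lambda> I" and X: "submodule X \<Lambda> I" "X \<subseteq> socle \<Lambda> I"
  obtains Y where "submodule Y \<Lambda> I" "X \<inter> Y = {\<zero>\<^bsub>I\<^esub>}" "sum_sub I X Y = socle \<Lambda> I"
proof -
  note lI = fg_lmodule[OF assms(1)]
  interpret I: lmodule \<Lambda> I by (rule lI)
  note soc = submodule_socle[OF lI]
  define Q where "Q Y \<longleftrightarrow> submodule Y \<Lambda> I \<and> Y \<subseteq> socle \<Lambda> I \<and> X \<inter> Y = {\<zero>\<^bsub>I\<^esub>}" for Y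
  have "Q {\<zero>\<^bsub>I\<^esub>}"
    unfolding Q_def using submodule_trivial[OF lI] submodule_zero[OF soc] submodule_zero[OF X(1)] by simp
  then obtain Y where Y0: "Q Y" "\<And>Z. \<lbrakk>Q Z; Y \<subseteq> Z\<rbrakk> \<Longrightarrow> Z = Y"
    by (rule maximal_submodule[OF lI fg_fin_len[OF assms(1)]]) (simp add: Q_def, blast)
  have Y: "submodule Y \<Lambda> I" "Y \<subseteq> socle \<Lambda> I" "X \<inter> Y = {\<zero>\<^bsub>I\<^esub>}" using Y0(1) by (simp_all add: Q_def)
  note XY = submodule_sum[OF lI X(1) Y(1)]
  have simple: "S \<subseteq> sum_sub I X Y" if S: "simple_submodule \<Lambda> I S" for S
  proof (rule ccontr)
    assume neg: "\<not> S \<subseteq> sum_sub I X Y"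
    have sS: "submodule S \<Lambda> I" using S by (simp add: simple_submodule_def)
    have "submodule (S \<inter> sum_sub I X Y) \<Lambda> I" by (rule submodule_Int[OF lI sS XY(1)])
    then have int: "S \<inter> sum_sub I X Y = {\<zero>\<^bsub>I\<^esub>}" using S neg unfolding simple_submodule_def by blast
    note YS = submodule_sum[OF lI Y(1) sS]
    have "X \<inter> sum_sub I Y S \<subseteq> {\<zero>\<^bsub>I\<^esub>}"
    proof
      fix x assume x: "x \<in> X \<inter> sum_sub I Y S"
      then obtain y s where ys: "y \<in> Y" "s \<in> S" "x = y \<oplus>\<^bsub>I\<^esub> s" by (auto simp: sum_sub_def)
      have c: "x \<in> carrier I" "y \<in> carrier I" "s \<in> carrier I"
        using x ys submodule_subset[OF X(1)] submodule_subset[OF Y(1)] submodule_subset[OF sS] by auto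
      have "x \<ominus>\<^bsub>I\<^esub> y \<in> sum_sub I X Y"
        by (rule submodule_diff[OF XY(1)]) (use x ys(1) XY(2,3) in auto)
      moreover have "x \<ominus>\<^bsub>I\<^esub> y = s" using c unfolding ys(3) by (simp add: a_minus_def I.a_ac I.r_neg I.r_neg1 I.r_neg2)
      ultimately have "s = \<zero>\<^bsub>I\<^esub>" using int ys(2) by auto
      then have "x \<in> X \<inter> Y" using x ys c by simp
      then show "x \<in> {\<zero>\<^bsub>I\<^esub>}" using Y(3) by simp
    qed
    moreover have "\<zero>\<^bsub>I\<^esub> \<in> X \<inter> sum_sub I Y S" using submodule_zero[OF X(1)] submodule_zero[OF YS(1)] by simp
    moreover have "sum_sub I Y S \<subseteq> socle \<Lambda> I" by (rule sum_sub_least[OF soc Y(2) simple_subset_socle[OF S]])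
    ultimately have "Q (sum_sub I Y S)" using YS(1) unfolding Q_def by blast
    then have "sum_sub I Y S = Y" using Y0(2) YS(2) by blast
    then show False using YS(3) XY(3) neg by blast
  qed
  have "socle \<Lambda> I \<subseteq> sum_sub I X Y" unfolding socle_def by (rule mod_span_least[OF XY(1)]) (use simple in blast)
  moreover have "sum_sub I X Y \<subseteq> socle \<Lambda> I" by (rule sum_sub_least[OF soc X(2) Y(2)])
  ultimately show ?thesis using that[OF Y(1,3)] by blast
qed

text \<open>The kernel of a cover dies in every semisimple target. Choose a complement
  \<open>Y\<close> of the image of the kernel in the socle. The preimage of \<open>Y\<close> still
  maps onto \<open>A\<close>, because elements can be corrected by the kernel, so it is all of
  \<open>P\<close>; hence the image of the kernel lies in \<open>Y\<close> and is zero.\<close>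

lemma cover_kernel_socle:
  assumes cov: "projective_cover \<Lambda> P c A" and "lmodule \<Lambda> A" and I: "fg_module \<Lambda> I"
    and q: "q \<in> mod_hom \<Lambda> P I" "q ` carrier P \<subseteq> socle \<Lambda> I" and x: "x \<in> carrier P" "c x = \<zero>\<^bsub>A\<^esub>"
  shows "q x = \<zero>\<^bsub>I\<^esub>"
proof -
  have P: "projective \<Lambda> P" "c \<in> mod_hom \<Lambda> P A" "c ` carrier P = carrier A"
    using cov by (auto simp: projective_cover_def)
  note lP = projective_lmodule[OF P(1)] and lI = fg_lmodule[OF I]
  interpret P: lmodule \<Lambda> P by (rule lP)
  interpret I: lmodule \<Lambda> I by (rule lI)
  interpret A: lmodule \<Lambda> A by fact
  let ?K = "a_kernel P A c"
  note K = submodule_kernel[OF lP assms(2) P(2)]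
  have qK: "submodule (q ` ?K) \<Lambda> I" by (rule submodule_image[OF lP lI q(1) K])
  have "q ` ?K \<subseteq> socle \<Lambda> I" using q(2) submodule_subset[OF K] by blast
  then obtain Y where Y: "submodule Y \<Lambda> I" "q ` ?K \<inter> Y = {\<zero>\<^bsub>I\<^esub>}" "sum_sub I (q ` ?K) Y = socle \<Lambda> I"
    using socle_complement[OF I qK] by blast
  let ?V = "{x \<in> carrier P. q x \<in> Y}"
  have V: "submodule ?V \<Lambda> P" by (rule submodule_vimage[OF lP lI q(1) Y(1)])
  have "c ` ?V = carrier A"
  proof
    show "c ` ?V \<subseteq> carrier A" using mod_hom_closed[OF P(2)] by blast
    show "carrier A \<subseteq> c ` ?V"
    proof
      fix a assume "a \<in> carrier A"
      then have "a \<in> c ` carrier P" unfolding P(3) .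
      then obtain z where z: "z \<in> carrier P" "a = c z" by blast
      then have "q z \<in> sum_sub I (q ` ?K) Y" unfolding Y(3) using q(2) by blast
      then obtain k y where ky: "k \<in> ?K" "y \<in> Y" "q z = q k \<oplus>\<^bsub>I\<^esub> y" by (auto simp: sum_sub_def)
      have k: "k \<in> carrier P" "c k = \<zero>\<^bsub>A\<^esub>" using ky(1) by (auto simp: a_kernel_eq)
      have yc: "y \<in> carrier I" using submodule_subset[OF Y(1)] ky(2) by blast
      have "q (z \<ominus>\<^bsub>P\<^esub> k) = y"
        unfolding mod_hom_diff[OF lP lI q(1) z(1) k(1)] ky(3) using mod_hom_closed[OF q(1) k(1)] yc
        by (simp add: a_minus_def I.a_ac I.r_neg I.r_neg1 I.r_neg2)
      then have "z \<ominus>\<^bsub>P\<^esub> k \<in> ?V" using z k ky(2) by simp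
      moreover have "c (z \<ominus>\<^bsub>P\<^esub> k) = a"
        unfolding mod_hom_diff[OF lP assms(2) P(2) z(1) k(1)] k(2) z(2)
        using mod_hom_closed[OF P(2) z(1)] by (simp add: a_minus_def)
      ultimately show "a \<in> c ` ?V" by blast
    qed
  qed
  then have "?V = carrier P" using cov V unfolding projective_cover_def by blast
  then have "q x \<in> Y" using x(1) by blast
  moreover have "q x \<in> q ` ?K" using x by (simp add: a_kernel_eq)
  ultimately show ?thesis using Y(2) by blast
qed

end

section \<open>The injective module \<open>\<nu>\<Lambda>\<close>\<close>

text \<open>The counterpart of \<open>projective_lift\<close>: extension along injections between
  modules on arbitrary types.\<close>

lemma injective_extend:
  fixes A :: "('a, 'm) module" and B :: "('a, 'n) module" and J :: "('a, 'j) module"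
  assumes J: "injective R J" and "fg_module R A" "fg_module R B"
    and g: "g \<in> mod_hom R A B" "inj_on g (carrier A)" and f: "f \<in> mod_hom R A J"
  obtains h where "h \<in> mod_hom R B J" "\<And>x. x \<in> carrier A \<Longrightarrow> h (g x) = f x"
proof -
  obtain A' :: "('a, 'a univ) module" and i i' where A': "fg_module R A'" "i \<in> mod_hom R A A'" "i' \<in> mod_hom R A' A"
    "\<And>x. x \<in> carrier A \<Longrightarrow> i' (i x) = x" "\<And>y. y \<in> carrier A' \<Longrightarrow> i (i' y) = y"
    using univ_copy[OF assms(2)] by blast
  obtain B' :: "('a, 'a univ) module" and j j' where B': "fg_module R B'" "j \<in> mod_hom R B B'" "j' \<in> mod_hom R B' B"
    "\<And>x. x \<in> carrier B \<Longrightarrow> j' (j x) = x" "\<And>y. y \<in> carrier B' \<Longrightarrow> j (j' y) = y"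
    using univ_copy[OF assms(3)] by blast
  let ?g = "\<lambda>x. j (g (i' x))"
  have g': "?g \<in> mod_hom R A' B'" by (rule mod_hom_comp[OF mod_hom_comp[OF A'(3) g(1)] B'(2)])
  have inj: "inj_on ?g (carrier A')"
  proof (rule inj_onI)
    fix x y assume xy: "x \<in> carrier A'" "y \<in> carrier A'" "?g x = ?g y"
    have c: "i' x \<in> carrier A" "i' y \<in> carrier A" using mod_hom_closed[OF A'(3)] xy by auto
    have "j' (?g x) = j' (?g y)" using xy(3) by simp
    then have "g (i' x) = g (i' y)"
      unfolding B'(4)[OF mod_hom_closed[OF g(1) c(1)]] B'(4)[OF mod_hom_closed[OF g(1) c(2)]] .
    then have "i' x = i' y" by (rule inj_onD[OF g(2) _ c])
    then have "i (i' x) = i (i' y)" by simp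
    then show "x = y" unfolding A'(5)[OF xy(1)] A'(5)[OF xy(2)] .
  qed
  have f': "(\<lambda>x. f (i' x)) \<in> mod_hom R A' J" by (rule mod_hom_comp[OF A'(3) f])
  from J[unfolded injective_def, THEN conjunct2, THEN spec, THEN spec, THEN bspec, OF g', THEN bspec, OF f',
      THEN mp, OF A'(1), THEN mp, OF B'(1), THEN mp, OF inj]
  obtain h where h: "h \<in> mod_hom R B' J" "\<forall>x\<in>carrier A'. h (?g x) = f (i' x)" by blast
  show ?thesis
  proof
    show "(\<lambda>x. h (j x)) \<in> mod_hom R B J" by (rule mod_hom_comp[OF B'(2) h(1)])
    show "h (j (g x)) = f x" if "x \<in> carrier A" for x
      using h(2)[THEN bspec, OF mod_hom_closed[OF A'(2) that]] A'(4)[OF that] by simp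
  qed
qed

text \<open>Finitely many maximal ideals cut out the radical; because \<open>m\<close> is prime, \<open>z\<close> can be chosen outside
  \<open>m\<close> but in all the others.\<close>

lemma radical_annihilator:
  fixes R (structure)
  assumes "cring R" "artinian R" and m: "maximalideal m R"
  obtains z where "z \<in> carrier R" "z \<notin> jacobson_radical R" "\<And>r. r \<in> m \<Longrightarrow> r \<otimes> z \<in> jacobson_radical R"
proof -
  interpret cring R by fact
  interpret m: maximalideal m R by (rule m)
  interpret mp: primeideal m R by (rule maximalideal_prime[OF m])
  define Q where "Q X \<longleftrightarrow> (\<exists>F. finite F \<and> (\<forall>I\<in>F. maximalideal I R) \<and> X = carrier R \<inter> \<Inter>F)" for X
  have sub: "submodule X R (regular_module R)" if X: "Q X" for X
  proof -
    obtain F where F: "\<forall>I\<in>F. maximalideal I R" "X = carrier R \<inter> \<Inter>F" using X by (auto simp: Q_def)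
    have id: "ideal I R" if "I \<in> F" for I using F(1) that maximalideal.axioms(1) by blast
    show ?thesis
    proof (rule lmodule.submoduleI[OF lmodule_regular[OF ring_axioms]])
      show "\<zero>\<^bsub>regular_module R\<^esub> \<in> X" unfolding F(2)
        using additive_subgroup.zero_closed[OF ideal.axioms(1)[OF id]] by simp
    next
      fix x y assume "x \<in> X" "y \<in> X"
      then show "x \<oplus>\<^bsub>regular_module R\<^esub> y \<in> X" unfolding F(2)
        using additive_subgroup.a_closed[OF ideal.axioms(1)[OF id]] by simp
    next
      fix a x assume "a \<in> carrier R" "x \<in> X"
      then show "a \<odot>\<^bsub>regular_module R\<^esub> x \<in> X" unfolding F(2) using ideal.I_l_closed[OF id] by simp
    qed (simp add: F(2))
  qed
  have "Q (carrier R)" unfolding Q_def by (intro exI[of _ "{}"]) simp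
  then obtain X where X: "Q X" "\<And>Y. \<lbrakk>Q Y; Y \<subseteq> X\<rbrakk> \<Longrightarrow> Y = X"
    by (rule artinian_minimal[OF assms(1,2)]) (use sub in blast)+
  then obtain F where F: "finite F" "\<And>I. I \<in> F \<Longrightarrow> maximalideal I R" "X = carrier R \<inter> \<Inter>F" by (auto simp: Q_def)
  \<comment> \<open>Intersecting with one more maximal ideal cannot shrink a minimal finite
    intersection.\<close>
  have XI: "X \<subseteq> I" if I: "maximalideal I R" for I
  proof -
    have "Q (carrier R \<inter> \<Inter>(insert I F))"
      unfolding Q_def by (rule exI[of _ "insert I F"]) (use F I in simp)
    moreover have "carrier R \<inter> \<Inter>(insert I F) \<subseteq> X" unfolding F(3) by blast
    ultimately have "carrier R \<inter> \<Inter>(insert I F) = X" by (rule X(2))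
    then show ?thesis by blast
  qed
  have rad: "X \<subseteq> jacobson_radical R" unfolding jacobson_radical_def using XI F(3) by blast
  have "\<exists>z\<in>carrier R - m. \<forall>I\<in>G. z \<in> I" if "finite G" "G \<subseteq> F - {m}" for G
    using that
  proof (induction G rule: finite_induct)
    case empty
    have "\<one> \<notin> m" using m.I_notcarr m.one_imp_carrier by blast
    then show ?case by blast
  next
    case (insert I G)
    then obtain z where z: "z \<in> carrier R" "z \<notin> m" "\<forall>I\<in>G. z \<in> I" by blast
    have I: "maximalideal I R" using insert(4) F(2) by blast
    interpret I: maximalideal I R by (rule I)
    have "\<not> I \<subseteq> m"
    proof
      assume "I \<subseteq> m"
      then have "m = I \<or> m = carrier R" using I.I_maximal[OF m.is_ideal] m.a_subset by blast
      then show False using insert(4) m.I_notcarr by blast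
    qed
    then obtain y where y: "y \<in> I" "y \<notin> m" by blast
    have yc: "y \<in> carrier R" using y(1) I.a_subset by blast
    have "y \<otimes> z \<notin> m" using mp.I_prime[OF yc z(1)] y(2) z(2) by blast
    moreover have "y \<otimes> z \<in> I" by (rule I.I_r_closed[OF y(1) z(1)])
    moreover have "y \<otimes> z \<in> I'" if "I' \<in> G" for I'
    proof -
      have "maximalideal I' R" using that insert(4) F(2) by blast
      then have "ideal I' R" by (rule maximalideal.axioms(1))
      then show ?thesis using z(3) that yc by (simp add: ideal.I_l_closed)
    qed
    ultimately show ?case using yc z(1) by (intro bexI[of _ "y \<otimes> z"]) auto
  qed
  from this[of "F - {m}"] obtain z where z: "z \<in> carrier R" "z \<notin> m" "\<And>I. I \<in> F - {m} \<Longrightarrow> z \<in> I"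
    using F(1) by auto
  have "z \<notin> jacobson_radical R" unfolding jacobson_radical_def using z(2) m by blast
  moreover have "r \<otimes> z \<in> jacobson_radical R" if r: "r \<in> m" for r
  proof -
    have rc: "r \<in> carrier R" using r m.a_subset by blast
    have "r \<otimes> z \<in> I" if I: "I \<in> F" for I
    proof (cases "I = m")
      case True
      then show ?thesis using m.I_r_closed[OF r z(1)] by simp
    next
      case False
      then show ?thesis
        using ideal.I_l_closed[OF maximalideal.axioms(1)[OF F(2)[OF I]] z(3) rc] I by simp
    qed
    then have "r \<otimes> z \<in> X" unfolding F(3) using rc z(1) by simp
    then show ?thesis using rad by blast
  qed
  ultimately show ?thesis using that z(1) by blast
qed

text \<open>Enlarge \<open>H\<close> to a maximal submodule \<open>X\<close>. Then
  \<open>M / X\<close> is isomorphic to \<open>R / m\<close> for a maximal ideal \<open>m\<close>,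
  and \<open>R / m\<close> embeds in \<open>R / rad R\<close>, hence in \<open>J\<close>, by
  \<open>radical_annihilator\<close>. The composite from \<open>M\<close> to \<open>J\<close> kills
  exactly \<open>X\<close>.\<close>

lemma dualizing_cogenerator:
  fixes R :: "'r ring" and J :: "('r, 'j) module" and M :: "('r, 'm) module"
  assumes R: "cring R" "artinian R" and J: "dualizing_module R J" and M: "fg_module R M"
    and H: "submodule H R M" "H \<noteq> carrier M"
  obtains g y where "g \<in> mod_hom R M J" "\<And>x. x \<in> H \<Longrightarrow> g x = \<zero>\<^bsub>J\<^esub>" "y \<in> carrier M" "g y \<noteq> \<zero>\<^bsub>J\<^esub>"
proof -
  interpret cring R by (rule R)
  interpret fl_ring R
    using ring_axioms artinian_fin_len[OF R] by (simp add: fl_ring_def fl_ring_axioms_def)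
  have inj: "injective R J" and
    "\<exists>i\<in>mod_hom R (quot_module (regular_module R) (jacobson_radical R)) J.
      inj_on i (carrier (quot_module (regular_module R) (jacobson_radical R)))"
    using J by (auto simp: dualizing_module_def injective_envelope_def)
  then obtain i where i: "i \<in> mod_hom R (quot_module (regular_module R) (jacobson_radical R)) J"
    "inj_on i (carrier (quot_module (regular_module R) (jacobson_radical R)))" by blast
  have lJ: "lmodule R J" using inj by (simp add: injective_def fg_module_def)
  interpret J: lmodule R J by (rule lJ)
  note lM = fg_lmodule[OF M]
  interpret M: lmodule R M by (rule lM)
  obtain X where X: "submodule X R M" "H \<subseteq> X" "X \<noteq> carrier M"
    "\<And>Y. \<lbrakk>submodule Y R M; X \<subseteq> Y\<rbrakk> \<Longrightarrow> Y = X \<or> Y = carrier M"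
    using maximal_proper_submodule[OF M H] by metis
  have Xc: "x \<in> carrier M" if "x \<in> X" for x using submodule_subset[OF X(1)] that by blast
  obtain y where y: "y \<in> carrier M" "y \<notin> X" using X(3) submodule_subset[OF X(1)] by blast
  note lr = lmodule_regular[OF ring_axioms]
  have XR: "sum_sub M X ((\<lambda>r. r \<odot>\<^bsub>M\<^esub> z) ` carrier R) = carrier M" if z: "z \<in> carrier M" "z \<notin> X" for z
  proof -
    note C = submodule_cyclic[OF lM z(1)]
    note s = submodule_sum[OF lM X(1) C(1)]
    show ?thesis using X(4)[OF s(1,2)] s(3) C(2) z(2) by blast
  qed
  \<comment> \<open>The annihilator of the class of \<open>y\<close>, which generates the simple
    module \<open>M / X\<close>.\<close>
  define m where "m = {r \<in> carrier (regular_module R). r \<odot>\<^bsub>M\<^esub> y \<in> X}"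
  have m_iff: "r \<in> m \<longleftrightarrow> r \<in> carrier R \<and> r \<odot>\<^bsub>M\<^esub> y \<in> X" for r by (simp add: m_def)
  have sm: "submodule m R (regular_module R)"
    unfolding m_def by (rule submodule_vimage[OF lr lM mod_hom_scalar[OF lM y(1)] X(1)])
  have one: "\<one>\<^bsub>R\<^esub> \<notin> m" using y by (simp add: m_iff)
  have "maximalideal m R"
  proof (rule maximalidealI[OF submodule_regular_ideal[OF R(1) sm]])
    show "carrier R \<noteq> m" using one by blast
    fix I assume I: "ideal I R" "m \<subseteq> I" "I \<subseteq> carrier R"
    interpret I: ideal I R by (rule I(1))
    show "I = m \<or> I = carrier R"
    proof (cases "m = I")
      case False
      then obtain s where s: "s \<in> I" "s \<notin> m" using I(2) by blast
      have sc: "s \<in> carrier R" using s(1) I(3) by blast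
      have sy: "s \<odot>\<^bsub>M\<^esub> y \<in> carrier M" "s \<odot>\<^bsub>M\<^esub> y \<notin> X" using s(2) sc y(1) by (simp_all add: m_iff)
      have "y \<in> sum_sub M X ((\<lambda>r. r \<odot>\<^bsub>M\<^esub> (s \<odot>\<^bsub>M\<^esub> y)) ` carrier R)" unfolding XR[OF sy] by (rule y(1))
      then obtain x t where xt: "x \<in> X" "t \<in> carrier R" "y = x \<oplus>\<^bsub>M\<^esub> t \<odot>\<^bsub>M\<^esub> (s \<odot>\<^bsub>M\<^esub> y)" by (auto simp: sum_sub_def)
      \<comment> \<open>\<open>?u\<close> sends \<open>y\<close> to \<open>x\<close>, an element of
        \<open>X\<close>, so it belongs to \<open>m\<close> and thus to \<open>I\<close>; adding the
        multiple \<open>t s\<close> of \<open>s\<close> puts the unit into \<open>I\<close>.\<close>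
      let ?u = "\<one>\<^bsub>R\<^esub> \<ominus>\<^bsub>R\<^esub> t \<otimes>\<^bsub>R\<^esub> s"
      have tsy: "(t \<otimes>\<^bsub>R\<^esub> s) \<odot>\<^bsub>M\<^esub> y \<in> carrier M" using xt(2) sc y(1) by simp
      have "?u \<oplus>\<^bsub>R\<^esub> t \<otimes>\<^bsub>R\<^esub> s = \<one>\<^bsub>R\<^esub>" using xt(2) sc by (simp add: a_minus_def a_assoc l_neg)
      then have "?u \<odot>\<^bsub>M\<^esub> y \<oplus>\<^bsub>M\<^esub> (t \<otimes>\<^bsub>R\<^esub> s) \<odot>\<^bsub>M\<^esub> y = y"
        using M.smult_l_distr[of ?u "t \<otimes>\<^bsub>R\<^esub> s" y] xt(2) sc y(1) by simp
      also have "y = x \<oplus>\<^bsub>M\<^esub> (t \<otimes>\<^bsub>R\<^esub> s) \<odot>\<^bsub>M\<^esub> y" using xt sc y(1) by (simp add: M.smult_assoc1)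
      finally have "?u \<odot>\<^bsub>M\<^esub> y = x"
        using xt(1,2) sc y(1) Xc[OF xt(1)] tsy by simp
      then have "?u \<in> m" using xt(1,2) sc by (simp add: m_iff)
      then have "?u \<oplus>\<^bsub>R\<^esub> t \<otimes>\<^bsub>R\<^esub> s \<in> I" using I(2) I.I_l_closed[OF s(1) xt(2)] by (intro I.a_closed) auto
      then have "\<one>\<^bsub>R\<^esub> \<in> I" using \<open>?u \<oplus>\<^bsub>R\<^esub> t \<otimes>\<^bsub>R\<^esub> s = \<one>\<^bsub>R\<^esub>\<close> by simp
      then show ?thesis using I.one_imp_carrier by blast
    qed simp
  qed
  then obtain z where z: "z \<in> carrier R" "z \<notin> jacobson_radical R" "\<And>r. r \<in> m \<Longrightarrow> r \<otimes>\<^bsub>R\<^esub> z \<in> jacobson_radical R"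
    using radical_annihilator[OF R] by blast
  have srad: "submodule (jacobson_radical R) R (regular_module R)"
  proof (rule lmodule.submoduleI[OF lr])
    have id: "ideal I R" if "maximalideal I R" for I using that by (rule maximalideal.axioms(1))
    show "jacobson_radical R \<subseteq> carrier (regular_module R)" by (auto simp: jacobson_radical_def)
    show "\<zero>\<^bsub>regular_module R\<^esub> \<in> jacobson_radical R"
      using additive_subgroup.zero_closed[OF ideal.axioms(1)[OF id]] by (simp add: jacobson_radical_def)
    show "x \<oplus>\<^bsub>regular_module R\<^esub> y \<in> jacobson_radical R" if "x \<in> jacobson_radical R" "y \<in> jacobson_radical R" for x y
      using that additive_subgroup.a_closed[OF ideal.axioms(1)[OF id]] by (simp add: jacobson_radical_def)
    show "a \<odot>\<^bsub>regular_module R\<^esub> x \<in> jacobson_radical R" if "a \<in> carrier R" "x \<in> jacobson_radical R" for a x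
      using that ideal.I_l_closed[OF id] by (simp add: jacobson_radical_def)
  qed
  let ?rad = "jacobson_radical R" and ?M = "regular_module R"
  let ?\<pi> = "\<lambda>x. ?rad +>\<^bsub>?M\<^esub> x" and ?Q = "quot_module ?M ?rad"
  note q = quot_module[OF lr srad]
  have zc: "z \<in> carrier ?M" using z(1) by simp
  \<comment> \<open>The image in \<open>J\<close> of the class of \<open>z\<close> modulo the
    radical: nonzero, and annihilated by \<open>m\<close>.\<close>
  define j where "j = i (?\<pi> z)"
  have jc: "j \<in> carrier J" unfolding j_def by (rule mod_hom_closed[OF i(1) mod_hom_closed[OF q(2) zc]])
  have jnz: "j \<noteq> \<zero>\<^bsub>J\<^esub>"
  proof
    assume "j = \<zero>\<^bsub>J\<^esub>"
    then have "i (?\<pi> z) = i \<zero>\<^bsub>?Q\<^esub>" using mod_hom_zero[OF q(1) lJ i(1)] by (simp add: j_def)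
    then have "?\<pi> z = \<zero>\<^bsub>?Q\<^esub>"
      by (rule inj_onD[OF i(2) _ mod_hom_closed[OF q(2) zc] submodule_zero[OF submodule_carrier[OF q(1)]]])
    then show False using q(4)[OF zc] z(2) by simp
  qed
  have ann: "r \<odot>\<^bsub>J\<^esub> j = \<zero>\<^bsub>J\<^esub>" if r: "r \<in> m" for r
  proof -
    have rc: "r \<in> carrier R" using r by (simp add: m_iff)
    have "r \<odot>\<^bsub>J\<^esub> j = i (?\<pi> (r \<odot>\<^bsub>?M\<^esub> z))"
      unfolding j_def mod_hom_smult[OF q(2) rc zc] mod_hom_smult[OF i(1) rc mod_hom_closed[OF q(2) zc]] ..
    also have "?\<pi> (r \<odot>\<^bsub>?M\<^esub> z) = \<zero>\<^bsub>?Q\<^esub>" using q(4)[of "r \<odot>\<^bsub>?M\<^esub> z"] z(1) z(3)[OF r] rc by simp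
    finally show ?thesis using mod_hom_zero[OF q(1) lJ i(1)] by simp
  qed
  \<comment> \<open>The map \<open>M \<rightarrow> J\<close> sends \<open>x + r y\<close> to
    \<open>r j\<close>. It is defined on pairs \<open>(x, r)\<close> and factored through the sum;
    if \<open>x + r y\<close> vanishes then \<open>r y\<close> lies in \<open>X\<close>, so
    \<open>r\<close> is in \<open>m\<close> and kills \<open>j\<close>.\<close>
  let ?D = "dsum (M\<lparr>carrier := X\<rparr>) ?M"
  note lX = lmodule_submodule[OF lM X(1)]
  have lD: "lmodule R ?D" by (rule lmodule_dsum[OF lX lr])
  let ?c = "\<lambda>w. fst w \<oplus>\<^bsub>M\<^esub> snd w \<odot>\<^bsub>M\<^esub> y"
  have c: "?c \<in> mod_hom R ?D M"
    by (rule mod_hom_copair[OF lX lr lM mod_hom_incl[OF submodule_subset[OF X(1)]] mod_hom_scalar[OF lM y(1)]])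
  have c_onto: "?c ` carrier ?D = carrier M"
    unfolding XR[OF y, symmetric] sum_sub_def by force
  have qh: "(\<lambda>w. snd w \<odot>\<^bsub>J\<^esub> j) \<in> mod_hom R ?D J"
    by (rule mod_hom_comp[OF mod_hom_snd mod_hom_scalar[OF lJ jc]])
  have "snd w \<odot>\<^bsub>J\<^esub> j = \<zero>\<^bsub>J\<^esub>" if w: "w \<in> carrier ?D" "?c w = \<zero>\<^bsub>M\<^esub>" for w
  proof -
    have w': "fst w \<in> X" "snd w \<in> carrier R" using w(1) by auto
    have "\<ominus>\<^bsub>M\<^esub> (snd w \<odot>\<^bsub>M\<^esub> y) = fst w" using M.minus_equality[OF w(2)] Xc[OF w'(1)] w'(2) y(1) by simp
    then have "snd w \<odot>\<^bsub>M\<^esub> y = \<ominus>\<^bsub>M\<^esub> fst w" using w'(2) y(1) by (metis M.minus_minus M.smult_closed)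
    then have "snd w \<in> m" using submodule_minus[OF X(1) w'(1)] w'(2) by (simp add: m_iff)
    then show ?thesis by (rule ann)
  qed
  then obtain u where u: "u \<in> mod_hom R M J" "\<And>w. w \<in> carrier ?D \<Longrightarrow> u (?c w) = snd w \<odot>\<^bsub>J\<^esub> j"
    using mod_hom_factor[OF lD lM lJ c c_onto qh] by blast
  have "u x = \<zero>\<^bsub>J\<^esub>" if "x \<in> H" for x
  proof -
    have xX: "x \<in> X" using that X(2) by blast
    then show ?thesis using u(2)[of "(x, \<zero>\<^bsub>R\<^esub>)"] Xc[OF xX] y(1) jc by (simp add: M.smult_l_null J.smult_l_null)
  qed
  moreover have "u y \<noteq> \<zero>\<^bsub>J\<^esub>"
    using u(2)[of "(\<zero>\<^bsub>M\<^esub>, \<one>\<^bsub>R\<^esub>)"] y(1) jc jnz submodule_zero[OF X(1)] by simp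
  ultimately show ?thesis using that u(1) y(1) by blast
qed


section \<open>The opposite ring and the module structures on the two Hom modules\<close>

lemma ring_op:
  assumes "ring \<Lambda>" shows "ring (op_ring \<Lambda>)"
proof -
  interpret ring \<Lambda> by fact
  show ?thesis
  proof (rule ringI)
    show "abelian_group (op_ring \<Lambda>)"
    proof (rule abelian_groupI)
      fix x assume "x \<in> carrier (op_ring \<Lambda>)"
      then show "\<exists>y\<in>carrier (op_ring \<Lambda>). y \<oplus>\<^bsub>op_ring \<Lambda>\<^esub> x = \<zero>\<^bsub>op_ring \<Lambda>\<^esub>"
        by (intro bexI[of _ "\<ominus>\<^bsub>\<Lambda>\<^esub> x"]) (simp_all add: op_ring_def l_neg)
    qed (simp_all add: op_ring_def a_ac)
    show "Group.monoid (op_ring \<Lambda>)"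
      by (rule monoidI) (simp_all add: op_ring_def m_assoc)
  qed (simp_all add: op_ring_def l_distr r_distr)
qed

lemma op_ring_simps [simp]:
  "carrier (op_ring \<Lambda>) = carrier \<Lambda>" "x \<oplus>\<^bsub>op_ring \<Lambda>\<^esub> y = x \<oplus>\<^bsub>\<Lambda>\<^esub> y" "\<one>\<^bsub>op_ring \<Lambda>\<^esub> = \<one>\<^bsub>\<Lambda>\<^esub>"
  "x \<otimes>\<^bsub>op_ring \<Lambda>\<^esub> y = y \<otimes>\<^bsub>\<Lambda>\<^esub> x"
  by (simp_all add: op_ring_def)

lemma ring_dual_simps [simp]:
  "carrier (ring_dual \<Lambda> Y) = mod_hom \<Lambda> Y (regular_module \<Lambda>) \<inter> extensional (carrier Y)"
  "\<zero>\<^bsub>ring_dual \<Lambda> Y\<^esub> = (\<lambda>x\<in>carrier Y. \<zero>\<^bsub>\<Lambda>\<^esub>)"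
  "f \<oplus>\<^bsub>ring_dual \<Lambda> Y\<^esub> g = (\<lambda>x\<in>carrier Y. f x \<oplus>\<^bsub>\<Lambda>\<^esub> g x)"
  "a \<odot>\<^bsub>ring_dual \<Lambda> Y\<^esub> f = (\<lambda>x\<in>carrier Y. f x \<otimes>\<^bsub>\<Lambda>\<^esub> a)"
  by (simp_all add: ring_dual_def)

lemma duality_simps [simp]:
  "carrier (duality R \<phi> J Y) = mod_hom R (restrict_scalars \<phi> Y) J \<inter> extensional (carrier Y)"
  "\<zero>\<^bsub>duality R \<phi> J Y\<^esub> = (\<lambda>y\<in>carrier Y. \<zero>\<^bsub>J\<^esub>)"
  "F \<oplus>\<^bsub>duality R \<phi> J Y\<^esub> G = (\<lambda>y\<in>carrier Y. F y \<oplus>\<^bsub>J\<^esub> G y)"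
  "a \<odot>\<^bsub>duality R \<phi> J Y\<^esub> F = (\<lambda>y\<in>carrier Y. F (a \<odot>\<^bsub>Y\<^esub> y))"
  by (simp_all add: duality_def)

lemma mod_hom_restrict_ext:
  assumes "lmodule \<Lambda> M" "f \<in> mod_hom \<Lambda> M N"
  shows "(\<lambda>x\<in>carrier M. f x) \<in> mod_hom \<Lambda> M N"
  by (rule mod_hom_cong[OF assms]) simp

lemma lmodule_ring_dual:
  assumes "lmodule \<Lambda> Y" shows "lmodule (op_ring \<Lambda>) (ring_dual \<Lambda> Y)"
proof -
  interpret Y: lmodule \<Lambda> Y by fact
  note lr = lmodule_regular[OF Y.R.ring_axioms]
  have cl: "f x \<in> carrier \<Lambda>" if "f \<in> mod_hom \<Lambda> Y (regular_module \<Lambda>)" "x \<in> carrier Y" for f x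
    using mod_hom_closed[OF that] by simp
  have plus: "(\<lambda>x\<in>carrier Y. f x \<oplus>\<^bsub>\<Lambda>\<^esub> g x) \<in> mod_hom \<Lambda> Y (regular_module \<Lambda>)"
    if "f \<in> mod_hom \<Lambda> Y (regular_module \<Lambda>)" "g \<in> mod_hom \<Lambda> Y (regular_module \<Lambda>)" for f g
    using mod_hom_restrict_ext[OF assms mod_hom_plus[OF assms lr that]] by simp
  have zero: "(\<lambda>x\<in>carrier Y. \<zero>\<^bsub>\<Lambda>\<^esub>) \<in> mod_hom \<Lambda> Y (regular_module \<Lambda>)"
    using mod_hom_restrict_ext[OF assms mod_hom_const_zero[OF lr]] by simp
  have smult: "(\<lambda>x\<in>carrier Y. f x \<otimes>\<^bsub>\<Lambda>\<^esub> a) \<in> mod_hom \<Lambda> Y (regular_module \<Lambda>)"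
    if "f \<in> mod_hom \<Lambda> Y (regular_module \<Lambda>)" "a \<in> carrier \<Lambda>" for f a
  proof -
    have "(\<lambda>x. f x \<odot>\<^bsub>regular_module \<Lambda>\<^esub> a) \<in> mod_hom \<Lambda> Y (regular_module \<Lambda>)"
      using that(2) by (intro mod_hom_comp[OF that(1) mod_hom_scalar[OF lr]]) simp
    then show ?thesis using mod_hom_restrict_ext[OF assms, of "\<lambda>x. f x \<odot>\<^bsub>regular_module \<Lambda>\<^esub> a"] by simp
  qed
  have ag: "abelian_group (ring_dual \<Lambda> Y)"
  proof (rule abelian_groupI)
    fix f g assume "f \<in> carrier (ring_dual \<Lambda> Y)" "g \<in> carrier (ring_dual \<Lambda> Y)"
    then show "f \<oplus>\<^bsub>ring_dual \<Lambda> Y\<^esub> g \<in> carrier (ring_dual \<Lambda> Y)" using plus by simp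
  next
    fix f g assume "f \<in> carrier (ring_dual \<Lambda> Y)" "g \<in> carrier (ring_dual \<Lambda> Y)"
    then show "f \<oplus>\<^bsub>ring_dual \<Lambda> Y\<^esub> g = g \<oplus>\<^bsub>ring_dual \<Lambda> Y\<^esub> f" by (auto simp: cl Y.R.a_comm)
  next
    fix f g h assume "f \<in> carrier (ring_dual \<Lambda> Y)" "g \<in> carrier (ring_dual \<Lambda> Y)" "h \<in> carrier (ring_dual \<Lambda> Y)"
    then show "f \<oplus>\<^bsub>ring_dual \<Lambda> Y\<^esub> g \<oplus>\<^bsub>ring_dual \<Lambda> Y\<^esub> h = f \<oplus>\<^bsub>ring_dual \<Lambda> Y\<^esub> (g \<oplus>\<^bsub>ring_dual \<Lambda> Y\<^esub> h)"
      by (auto simp: cl Y.R.a_assoc)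
  next
    fix f assume f: "f \<in> carrier (ring_dual \<Lambda> Y)"
    then show "\<zero>\<^bsub>ring_dual \<Lambda> Y\<^esub> \<oplus>\<^bsub>ring_dual \<Lambda> Y\<^esub> f = f"
      by (intro extensionalityI[where A = "carrier Y"]) (simp_all add: cl)
    \<comment> \<open>The negative is written as right multiplication by minus one, so that its
      membership follows from closure under scalars.\<close>
    have "(\<lambda>x\<in>carrier Y. f x \<otimes>\<^bsub>\<Lambda>\<^esub> (\<ominus>\<^bsub>\<Lambda>\<^esub> \<one>\<^bsub>\<Lambda>\<^esub>)) \<oplus>\<^bsub>ring_dual \<Lambda> Y\<^esub> f = \<zero>\<^bsub>ring_dual \<Lambda> Y\<^esub>"
      using f by (auto simp: cl Y.R.r_minus Y.R.l_neg)
    then show "\<exists>g\<in>carrier (ring_dual \<Lambda> Y). g \<oplus>\<^bsub>ring_dual \<Lambda> Y\<^esub> f = \<zero>\<^bsub>ring_dual \<Lambda> Y\<^esub>"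
      using smult f by (intro bexI[of _ "\<lambda>x\<in>carrier Y. f x \<otimes>\<^bsub>\<Lambda>\<^esub> (\<ominus>\<^bsub>\<Lambda>\<^esub> \<one>\<^bsub>\<Lambda>\<^esub>)"]) simp_all
  qed (simp add: zero)
  show ?thesis
  proof (rule lmoduleI[OF ring_op[OF Y.R.ring_axioms] ag])
    fix a f assume "a \<in> carrier (op_ring \<Lambda>)" "f \<in> carrier (ring_dual \<Lambda> Y)"
    then show "a \<odot>\<^bsub>ring_dual \<Lambda> Y\<^esub> f \<in> carrier (ring_dual \<Lambda> Y)" using smult by simp
  next
    fix f assume f: "f \<in> carrier (ring_dual \<Lambda> Y)"
    then show "\<one>\<^bsub>op_ring \<Lambda>\<^esub> \<odot>\<^bsub>ring_dual \<Lambda> Y\<^esub> f = f"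
      by (intro extensionalityI[where A = "carrier Y"]) (simp_all add: cl)
  qed (auto simp: cl Y.R.l_distr Y.R.r_distr Y.R.m_assoc)
qed

context artin_algebra
begin

lemma lmodule_duality:
  assumes W: "lmodule (op_ring \<Lambda>) W" and J: "lmodule R J"
  shows "lmodule \<Lambda> (duality R \<phi> J W)"
proof -
  interpret W: lmodule "op_ring \<Lambda>" W by fact
  interpret J: lmodule R J by fact
  let ?W = "restrict_scalars \<phi> W" and ?D = "duality R \<phi> J W"
  have smW: "a \<odot>\<^bsub>W\<^esub> x \<in> carrier W" if "a \<in> carrier \<Lambda>" "x \<in> carrier W" for a x using W.smult_closed that by simp
  have lW: "F \<in> mod_hom R ?W J \<Longrightarrow> (\<And>x. x \<in> carrier W \<Longrightarrow> G x = F x) \<Longrightarrow> G \<in> mod_hom R ?W J" for F G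
    using smW structure_closed by (simp add: mod_hom_iff)
  have cl: "F x \<in> carrier J" if "F \<in> mod_hom R ?W J" "x \<in> carrier W" for F x
    using mod_hom_closed[OF that(1)] that(2) by simp
  have addF: "F (x \<oplus>\<^bsub>W\<^esub> y) = F x \<oplus>\<^bsub>J\<^esub> F y" if "F \<in> mod_hom R ?W J" "x \<in> carrier W" "y \<in> carrier W" for F x y
    using mod_hom_add[OF that(1)] that(2,3) by simp
  have smF: "F (\<phi> r \<odot>\<^bsub>W\<^esub> x) = r \<odot>\<^bsub>J\<^esub> F x" if "F \<in> mod_hom R ?W J" "x \<in> carrier W" "r \<in> carrier R" for F x r
    using mod_hom_smult[OF that(1,3)] that(2) by simp
  have plus: "(\<lambda>x\<in>carrier W. F x \<oplus>\<^bsub>J\<^esub> G x) \<in> mod_hom R ?W J"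
    if "F \<in> mod_hom R ?W J" "G \<in> mod_hom R ?W J" for F G
    using smW structure_closed
    by (intro mod_homI) (simp_all add: that cl addF smF J.M.a_ac J.smult_r_distr)
  have zero: "(\<lambda>x\<in>carrier W. \<zero>\<^bsub>J\<^esub>) \<in> mod_hom R ?W J"
    by (rule lW[OF mod_hom_const_zero[OF J]]) simp
  have minus: "(\<lambda>x\<in>carrier W. \<ominus>\<^bsub>J\<^esub> F x) \<in> mod_hom R ?W J" if "F \<in> mod_hom R ?W J" for F
    using smW structure_closed
    by (intro mod_homI) (simp_all add: that cl addF smF J.M.minus_add J.smult_r_minus)
  have smult: "(\<lambda>x\<in>carrier W. F (a \<odot>\<^bsub>W\<^esub> x)) \<in> mod_hom R ?W J" if F: "F \<in> mod_hom R ?W J" and a: "a \<in> carrier \<Lambda>" for F a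
  proof (rule mod_homI)
    fix r x assume r: "r \<in> carrier R" and x: "x \<in> carrier ?W"
    note fr = structure_closed[OF r]
    \<comment> \<open>\<open>R\<close>-linearity of a translated functional: over the opposite ring
      the two scalars are multiplied in reverse order, and \<open>central\<close> exchanges
      them.\<close>
    have "a \<odot>\<^bsub>W\<^esub> (\<phi> r \<odot>\<^bsub>W\<^esub> x) = (\<phi> r \<otimes>\<^bsub>\<Lambda>\<^esub> a) \<odot>\<^bsub>W\<^esub> x"
      using W.smult_assoc1[of a "\<phi> r" x] a fr x by simp
    also have "\<dots> = \<phi> r \<odot>\<^bsub>W\<^esub> (a \<odot>\<^bsub>W\<^esub> x)"
      unfolding central[OF r a] using W.smult_assoc1[of "\<phi> r" a x] a fr x by simp
    finally show "(\<lambda>x\<in>carrier W. F (a \<odot>\<^bsub>W\<^esub> x)) (r \<odot>\<^bsub>?W\<^esub> x) = r \<odot>\<^bsub>J\<^esub> (\<lambda>x\<in>carrier W. F (a \<odot>\<^bsub>W\<^esub> x)) x"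
      using x fr a smW smF[OF F _ r] by simp
  next
    fix x y assume "x \<in> carrier ?W" "y \<in> carrier ?W"
    then show "(\<lambda>x\<in>carrier W. F (a \<odot>\<^bsub>W\<^esub> x)) (x \<oplus>\<^bsub>?W\<^esub> y)
      = (\<lambda>x\<in>carrier W. F (a \<odot>\<^bsub>W\<^esub> x)) x \<oplus>\<^bsub>J\<^esub> (\<lambda>x\<in>carrier W. F (a \<odot>\<^bsub>W\<^esub> x)) y"
      using a smW addF[OF F] W.smult_r_distr[of a x y] by simp
  qed (use F a smW cl in simp)
  have ag: "abelian_group ?D"
  proof (rule abelian_groupI)
    fix F G assume "F \<in> carrier ?D" "G \<in> carrier ?D"
    then show "F \<oplus>\<^bsub>?D\<^esub> G \<in> carrier ?D" using plus by simp
  next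
    fix F G assume "F \<in> carrier ?D" "G \<in> carrier ?D"
    then show "F \<oplus>\<^bsub>?D\<^esub> G = G \<oplus>\<^bsub>?D\<^esub> F" by (auto simp: cl J.M.a_comm)
  next
    fix F G H assume "F \<in> carrier ?D" "G \<in> carrier ?D" "H \<in> carrier ?D"
    then show "F \<oplus>\<^bsub>?D\<^esub> G \<oplus>\<^bsub>?D\<^esub> H = F \<oplus>\<^bsub>?D\<^esub> (G \<oplus>\<^bsub>?D\<^esub> H)" by (auto simp: cl J.M.a_assoc)
  next
    fix F assume F: "F \<in> carrier ?D"
    then show "\<zero>\<^bsub>?D\<^esub> \<oplus>\<^bsub>?D\<^esub> F = F"
      by (intro extensionalityI[where A = "carrier W"]) (simp_all add: cl)
    have "(\<lambda>x\<in>carrier W. \<ominus>\<^bsub>J\<^esub> F x) \<oplus>\<^bsub>?D\<^esub> F = \<zero>\<^bsub>?D\<^esub>" using F by (auto simp: cl J.M.l_neg)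
    then show "\<exists>G\<in>carrier ?D. G \<oplus>\<^bsub>?D\<^esub> F = \<zero>\<^bsub>?D\<^esub>" 
      using minus F by (intro bexI[of _ "\<lambda>x\<in>carrier W. \<ominus>\<^bsub>J\<^esub> F x"]) simp_all
  qed (simp add: zero)
  show ?thesis
  proof (rule lmoduleI[OF \<Lambda>.ring_axioms ag])
    fix a F assume "a \<in> carrier \<Lambda>" "F \<in> carrier ?D"
    then show "a \<odot>\<^bsub>?D\<^esub> F \<in> carrier ?D" using smult by simp
  next
    fix F assume F: "F \<in> carrier ?D"
    show "\<one>\<^bsub>\<Lambda>\<^esub> \<odot>\<^bsub>?D\<^esub> F = F"
      using F W.smult_one by (intro extensionalityI[where A = "carrier W"]) simp_all
  next
    fix a b F assume *: "a \<in> carrier \<Lambda>" "b \<in> carrier \<Lambda>" "F \<in> carrier ?D"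
    then have F: "F \<in> mod_hom R ?W J" by simp
    show "(a \<oplus>\<^bsub>\<Lambda>\<^esub> b) \<odot>\<^bsub>?D\<^esub> F = a \<odot>\<^bsub>?D\<^esub> F \<oplus>\<^bsub>?D\<^esub> b \<odot>\<^bsub>?D\<^esub> F"
      using *(1,2) W.smult_l_distr[of a b] addF[OF F] smW by auto
    show "(a \<otimes>\<^bsub>\<Lambda>\<^esub> b) \<odot>\<^bsub>?D\<^esub> F = a \<odot>\<^bsub>?D\<^esub> (b \<odot>\<^bsub>?D\<^esub> F)"
      using *(1,2) W.smult_assoc1[of b a] smW by auto
  next
    fix a F G assume "a \<in> carrier \<Lambda>" "F \<in> carrier ?D" "G \<in> carrier ?D"
    then show "a \<odot>\<^bsub>?D\<^esub> (F \<oplus>\<^bsub>?D\<^esub> G) = a \<odot>\<^bsub>?D\<^esub> F \<oplus>\<^bsub>?D\<^esub> a \<odot>\<^bsub>?D\<^esub> G" using smW by auto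
  qed
qed

end

text \<open>Here \<open>Y\<close> is free with basis \<open>y0\<close>, so that \<open>\<nu>Y\<close> is a copy of
  \<open>Hom\<^sub>R(\<Lambda>, J)\<close>; \<open>\<epsilon>\<close> is the coordinate function.\<close>

locale nakayama_free = artin_algebra R \<Lambda> \<phi>
  for R :: "'r ring" and \<Lambda> :: "'a ring" and \<phi> :: "'r \<Rightarrow> 'a" +
  fixes J :: "('r, 'j) module" and Y :: "('a, 'y) module" and \<iota> :: "'a \<Rightarrow> 'y" and \<kappa> :: "'y \<Rightarrow> 'a"
  assumes dualizing: "dualizing_module R J" and lY: "lmodule \<Lambda> Y"
    and \<iota>: "\<iota> \<in> mod_hom \<Lambda> (regular_module \<Lambda>) Y" and \<kappa>: "\<kappa> \<in> mod_hom \<Lambda> Y (regular_module \<Lambda>)"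
    and \<kappa>\<iota>: "\<And>x. x \<in> carrier \<Lambda> \<Longrightarrow> \<kappa> (\<iota> x) = x" and \<iota>\<kappa>: "\<And>y. y \<in> carrier Y \<Longrightarrow> \<iota> (\<kappa> y) = y"
begin

definition "y0 = \<iota> \<one>\<^bsub>\<Lambda>\<^esub>"
definition "\<epsilon> = restrict \<kappa> (carrier Y)"

abbreviation "W \<equiv> ring_dual \<Lambda> Y"
abbreviation "I \<equiv> nakayama R \<Lambda> \<phi> J Y"

lemma y0: "y0 \<in> carrier Y"
  using mod_hom_closed[OF \<iota>] by (simp add: y0_def)

lemma y_eq: "y \<in> carrier Y \<Longrightarrow> y = \<kappa> y \<odot>\<^bsub>Y\<^esub> y0"
  using mod_hom_smult[OF \<iota>, of "\<kappa> y" "\<one>\<^bsub>\<Lambda>\<^esub>"] \<iota>\<kappa>[of y] mod_hom_closed[OF \<kappa>, of y] by (simp add: y0_def)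

lemma injective_J: "injective R J"
  using dualizing by (simp add: dualizing_module_def injective_envelope_def)

lemma fg_J: "fg_module R J" and lJ: "lmodule R J"
  using injective_J by (simp_all add: injective_def fg_module_def)

lemma lW: "lmodule (op_ring \<Lambda>) W"
  by (rule lmodule_ring_dual[OF lY])

lemma lI: "lmodule \<Lambda> I"
  unfolding nakayama_def by (rule lmodule_duality[OF lW lJ])

lemma \<epsilon>: "\<epsilon> \<in> carrier W" "\<epsilon> y0 = \<one>\<^bsub>\<Lambda>\<^esub>"
  using mod_hom_restrict_ext[OF lY \<kappa>] y0 \<kappa>\<iota>[of "\<one>\<^bsub>\<Lambda>\<^esub>"] by (simp_all add: \<epsilon>_def y0_def)

text \<open>A functional on \<open>Y\<close> is determined by its value at the basis element
  \<open>y0\<close>. So \<open>W\<close> is free of rank one over the opposite ring with basis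
  \<open>\<epsilon>\<close>, and evaluation at \<open>y0\<close> gives the coordinate.\<close>

lemma W_eq:
  assumes "\<psi> \<in> carrier W" shows "\<psi> y0 \<in> carrier \<Lambda>" "\<psi> = \<psi> y0 \<odot>\<^bsub>W\<^esub> \<epsilon>"
proof -
  have \<psi>: "\<psi> \<in> mod_hom \<Lambda> Y (regular_module \<Lambda>)" "\<psi> \<in> extensional (carrier Y)" using assms by simp_all
  show "\<psi> y0 \<in> carrier \<Lambda>" using mod_hom_closed[OF \<psi>(1) y0] by simp
  show "\<psi> = \<psi> y0 \<odot>\<^bsub>W\<^esub> \<epsilon>"
  proof (rule extensionalityI[OF \<psi>(2)])
    fix y assume y: "y \<in> carrier Y"
    have ky: "\<kappa> y \<in> carrier \<Lambda>" using mod_hom_closed[OF \<kappa> y] by simp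
    have "\<psi> y = \<psi> (\<kappa> y \<odot>\<^bsub>Y\<^esub> y0)" by (rule arg_cong[OF y_eq[OF y]])
    then show "\<psi> y = (\<psi> y0 \<odot>\<^bsub>W\<^esub> \<epsilon>) y"
      using mod_hom_smult[OF \<psi>(1) ky y0] y by (simp add: \<epsilon>_def)
  qed simp
qed

lemma W_smult: "\<lbrakk>a \<in> carrier \<Lambda>; \<psi> \<in> carrier W\<rbrakk> \<Longrightarrow> a \<odot>\<^bsub>W\<^esub> \<psi> \<in> carrier W"
  using lmodule.smult_closed[OF lW, of a \<psi>] by (simp only: op_ring_simps)

lemma W_ev: "\<lbrakk>a \<in> carrier \<Lambda>; \<psi> \<in> carrier W\<rbrakk> \<Longrightarrow> (a \<odot>\<^bsub>W\<^esub> \<psi>) y0 = \<psi> y0 \<otimes>\<^bsub>\<Lambda>\<^esub> a"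
  using y0 by simp

text \<open>This and the next rules describe \<open>I\<close> pointwise on \<open>W\<close>, so that
  \<open>nakayama\<close> can stay folded in the rest of the argument.\<close>

lemma I_iff: "F \<in> carrier I \<longleftrightarrow> F \<in> mod_hom R (restrict_scalars \<phi> W) J \<and> F \<in> extensional (carrier W)"
  unfolding nakayama_def by (simp only: duality_simps Int_iff)

lemma I_smult: "\<psi> \<in> carrier W \<Longrightarrow> (a \<odot>\<^bsub>I\<^esub> F) \<psi> = F (a \<odot>\<^bsub>W\<^esub> \<psi>)"
  unfolding nakayama_def by (simp only: duality_simps restrict_apply')

lemma I_add: "\<psi> \<in> carrier W \<Longrightarrow> (F \<oplus>\<^bsub>I\<^esub> G) \<psi> = F \<psi> \<oplus>\<^bsub>J\<^esub> G \<psi>"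
  unfolding nakayama_def by (simp only: duality_simps restrict_apply')

lemma I_zero: "\<psi> \<in> carrier W \<Longrightarrow> \<zero>\<^bsub>I\<^esub> \<psi> = \<zero>\<^bsub>J\<^esub>"
  unfolding nakayama_def by (simp only: duality_simps restrict_apply')

lemma I_eqI:
  assumes "F \<in> carrier I" "G \<in> carrier I" "\<And>a. a \<in> carrier \<Lambda> \<Longrightarrow> F (a \<odot>\<^bsub>W\<^esub> \<epsilon>) = G (a \<odot>\<^bsub>W\<^esub> \<epsilon>)"
  shows "F = G"
proof (rule extensionalityI)
  show "F \<in> extensional (carrier W)" "G \<in> extensional (carrier W)" using assms(1,2) by (simp_all only: I_iff)
  fix \<psi> assume "\<psi> \<in> carrier W"
  from assms(3)[OF W_eq(1)[OF this]] show "F \<psi> = G \<psi>" unfolding W_eq(2)[OF \<open>\<psi> \<in> carrier W\<close>, symmetric] .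
qed

text \<open>One direction of the adjunction \<open>Hom_R(B, J) = Hom_\<Lambda>(B, I)\<close>. At the
  functional with coordinate \<open>a\<close>, that is \<open>a \<epsilon>\<close>, its value is
  \<open>g (a b)\<close>; this is the usual coinduced map into
  \<open>Hom_R(\<Lambda>, J)\<close>.\<close>

definition coind :: "('a, 'b) module \<Rightarrow> ('b \<Rightarrow> 'j) \<Rightarrow> 'b \<Rightarrow> (('y \<Rightarrow> 'a) \<Rightarrow> 'j)" where
  "coind B g b = (\<lambda>\<psi>\<in>carrier W. g (\<psi> y0 \<odot>\<^bsub>B\<^esub> b))"

lemma coind_apply: "\<psi> \<in> carrier W \<Longrightarrow> coind B g b \<psi> = g (\<psi> y0 \<odot>\<^bsub>B\<^esub> b)"
  unfolding coind_def by (simp only: restrict_apply')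

lemma coind_hom:
  assumes B: "lmodule \<Lambda> B" and g: "g \<in> mod_hom R (restrict_scalars \<phi> B) J"
  shows "coind B g \<in> mod_hom \<Lambda> B I"
proof -
  interpret B: lmodule \<Lambda> B by fact
  interpret W: lmodule "op_ring \<Lambda>" W by (rule lW)
  have gc: "g x \<in> carrier J" if "x \<in> carrier B" for x using mod_hom_closed[OF g] that by simp
  have ga: "g (x \<oplus>\<^bsub>B\<^esub> y) = g x \<oplus>\<^bsub>J\<^esub> g y" if "x \<in> carrier B" "y \<in> carrier B" for x y
    using mod_hom_add[OF g] that by simp
  have gs: "g (\<phi> r \<odot>\<^bsub>B\<^esub> x) = r \<odot>\<^bsub>J\<^esub> g x" if "r \<in> carrier R" "x \<in> carrier B" for r x
    using mod_hom_smult[OF g] that by simp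
  have ev_add: "(\<psi> \<oplus>\<^bsub>W\<^esub> \<chi>) y0 = \<psi> y0 \<oplus>\<^bsub>\<Lambda>\<^esub> \<chi> y0" for \<psi> \<chi> using y0 by simp
  have cI: "coind B g b \<in> carrier I" if b: "b \<in> carrier B" for b
    unfolding I_iff
  proof
    show "coind B g b \<in> extensional (carrier W)" unfolding coind_def by (rule restrict_extensional)
    show "coind B g b \<in> mod_hom R (restrict_scalars \<phi> W) J"
    proof (rule mod_homI, unfold restrict_scalars_simps)
      fix \<psi> assume \<psi>: "\<psi> \<in> carrier W"
      show "coind B g b \<psi> \<in> carrier J" unfolding coind_apply[OF \<psi>] using W_eq(1)[OF \<psi>] b by (intro gc) simp
      show "coind B g b (\<phi> r \<odot>\<^bsub>W\<^esub> \<psi>) = r \<odot>\<^bsub>J\<^esub> coind B g b \<psi>" if r: "r \<in> carrier R" for r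
        unfolding coind_apply[OF \<psi>] coind_apply[OF W_smult[OF structure_closed[OF r] \<psi>]]
          W_ev[OF structure_closed[OF r] \<psi>] central[OF r W_eq(1)[OF \<psi>], symmetric]
        using W_eq(1)[OF \<psi>] structure_closed[OF r] r b by (simp only: B.smult_assoc1 gs B.smult_closed)
      show "coind B g b (\<psi> \<oplus>\<^bsub>W\<^esub> \<chi>) = coind B g b \<psi> \<oplus>\<^bsub>J\<^esub> coind B g b \<chi>" if \<chi>: "\<chi> \<in> carrier W" for \<chi>
        unfolding coind_apply[OF \<psi>] coind_apply[OF \<chi>] coind_apply[OF W.M.a_closed[OF \<psi> \<chi>]] ev_add
        using W_eq(1)[OF \<psi>] W_eq(1)[OF \<chi>] b by (simp only: B.smult_l_distr ga B.smult_closed)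
    qed
  qed
  show ?thesis
  proof (rule mod_homI[OF cI])
    fix b c assume bc: "b \<in> carrier B" "c \<in> carrier B"
    show "coind B g (b \<oplus>\<^bsub>B\<^esub> c) = coind B g b \<oplus>\<^bsub>I\<^esub> coind B g c"
    proof (rule I_eqI)
      show "coind B g (b \<oplus>\<^bsub>B\<^esub> c) \<in> carrier I" using bc by (intro cI) simp
      show "coind B g b \<oplus>\<^bsub>I\<^esub> coind B g c \<in> carrier I"
        by (rule submodule_add[OF submodule_carrier[OF lI] cI[OF bc(1)] cI[OF bc(2)]])
      fix a assume "a \<in> carrier \<Lambda>"
      then have \<psi>: "a \<odot>\<^bsub>W\<^esub> \<epsilon> \<in> carrier W" by (rule W_smult[OF _ \<epsilon>(1)])
      show "coind B g (b \<oplus>\<^bsub>B\<^esub> c) (a \<odot>\<^bsub>W\<^esub> \<epsilon>) = (coind B g b \<oplus>\<^bsub>I\<^esub> coind B g c) (a \<odot>\<^bsub>W\<^esub> \<epsilon>)"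
        unfolding I_add[OF \<psi>] coind_apply[OF \<psi>] using W_eq(1)[OF \<psi>] bc by (simp only: B.smult_r_distr ga B.smult_closed)
    qed
  next
    fix c b assume cb: "c \<in> carrier \<Lambda>" "b \<in> carrier B"
    show "coind B g (c \<odot>\<^bsub>B\<^esub> b) = c \<odot>\<^bsub>I\<^esub> coind B g b"
    proof (rule I_eqI)
      show "coind B g (c \<odot>\<^bsub>B\<^esub> b) \<in> carrier I" using cb by (intro cI) simp
      show "c \<odot>\<^bsub>I\<^esub> coind B g b \<in> carrier I" by (rule submodule_smult[OF submodule_carrier[OF lI] cb(1) cI[OF cb(2)]])
      fix a assume "a \<in> carrier \<Lambda>"
      then have \<psi>: "a \<odot>\<^bsub>W\<^esub> \<epsilon> \<in> carrier W" by (rule W_smult[OF _ \<epsilon>(1)])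
      show "coind B g (c \<odot>\<^bsub>B\<^esub> b) (a \<odot>\<^bsub>W\<^esub> \<epsilon>) = (c \<odot>\<^bsub>I\<^esub> coind B g b) (a \<odot>\<^bsub>W\<^esub> \<epsilon>)"
        unfolding I_smult[OF \<psi>] coind_apply[OF \<psi>] coind_apply[OF W_smult[OF cb(1) \<psi>]] W_ev[OF cb(1) \<psi>]
        using W_eq(1)[OF \<psi>] cb by (simp only: B.smult_assoc1)
    qed
  qed
qed

lemma coind_ev:
  assumes "lmodule \<Lambda> B" "b \<in> carrier B" shows "coind B g b \<epsilon> = g b"
  unfolding coind_apply[OF \<epsilon>(1)] \<epsilon>(2) using lmodule.smult_one[OF assms] by simp

text \<open>The other direction of the adjunction, evaluation at the basis element;
  \<open>coind_ev\<close> states that coinduction followed by evaluation returns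
  \<open>g\<close>.\<close>

lemma ev_hom: 
  assumes f: "f \<in> mod_hom \<Lambda> A I"
  shows "(\<lambda>x. f x \<epsilon>) \<in> mod_hom R (restrict_scalars \<phi> A) J"
proof (rule mod_homI, unfold restrict_scalars_simps)
  have fI: "f x \<in> mod_hom R (restrict_scalars \<phi> W) J" if "x \<in> carrier A" for x
    using mod_hom_closed[OF f that] by (simp only: I_iff)
  have \<epsilon>': "\<epsilon> \<in> carrier (restrict_scalars \<phi> W)" using \<epsilon>(1) by (simp only: restrict_scalars_simps)
  fix x assume x: "x \<in> carrier A"
  show "f x \<epsilon> \<in> carrier J" by (rule mod_hom_closed[OF fI[OF x] \<epsilon>'])
  show "f (x \<oplus>\<^bsub>A\<^esub> y) \<epsilon> = f x \<epsilon> \<oplus>\<^bsub>J\<^esub> f y \<epsilon>" if "y \<in> carrier A" for y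
    unfolding mod_hom_add[OF f x that] by (rule I_add[OF \<epsilon>(1)])
  show "f (\<phi> r \<odot>\<^bsub>A\<^esub> x) \<epsilon> = r \<odot>\<^bsub>J\<^esub> f x \<epsilon>" if r: "r \<in> carrier R" for r
    unfolding mod_hom_smult[OF f structure_closed[OF r] x] I_smult[OF \<epsilon>(1)]
    using mod_hom_smult[OF fI[OF x] r \<epsilon>'] by (simp only: restrict_scalars_simps)
qed

text \<open>Coinduction is right adjoint to restriction of scalars, which preserves injections, so
  it carries the injective \<open>J\<close> to an injective module. Concretely, the
  \<open>J\<close>-valued map adjoint to \<open>f\<close> is extended over \<open>R\<close> and the
  extension is coinduced.\<close>

lemma injective_I:
  assumes A: "fg_module \<Lambda> A" and B: "fg_module \<Lambda> B" and g: "g \<in> mod_hom \<Lambda> A B" "inj_on g (carrier A)"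
    and f: "f \<in> mod_hom \<Lambda> A I"
  obtains h where "h \<in> mod_hom \<Lambda> B I" "\<And>x. x \<in> carrier A \<Longrightarrow> h (g x) = f x"
proof -
  note lA = fg_lmodule[OF A] and lB = fg_lmodule[OF B]
  have inj: "inj_on g (carrier (restrict_scalars \<phi> A))" using g(2) by simp
  obtain h where h: "h \<in> mod_hom R (restrict_scalars \<phi> B) J" "\<And>x. x \<in> carrier (restrict_scalars \<phi> A) \<Longrightarrow> h (g x) = f x \<epsilon>"
    using injective_extend[OF injective_J fg_restrict[OF A] fg_restrict[OF B] mod_hom_restrict_scalars[OF g(1)] inj ev_hom[OF f]]
    by blast
  note c = coind_hom[OF lB h(1)]
  have "coind B h (g x) = f x" if x: "x \<in> carrier A" for x
  proof (rule I_eqI)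
    have gx: "g x \<in> carrier B" by (rule mod_hom_closed[OF g(1) x])
    show "coind B h (g x) \<in> carrier I" by (rule mod_hom_closed[OF c gx])
    show "f x \<in> carrier I" by (rule mod_hom_closed[OF f x])
    fix a assume a: "a \<in> carrier \<Lambda>"
    have ax: "a \<odot>\<^bsub>A\<^esub> x \<in> carrier A" by (rule lmodule.smult_closed[OF lA a x])
    \<comment> \<open>Agreement is known only at \<open>\<epsilon>\<close>. The coefficient
      \<open>a\<close> is moved onto \<open>x\<close> by linearity, compared there, and moved
      back.\<close>
    have "coind B h (g x) (a \<odot>\<^bsub>W\<^esub> \<epsilon>) = (a \<odot>\<^bsub>I\<^esub> coind B h (g x)) \<epsilon>" by (rule I_smult[OF \<epsilon>(1), symmetric])
    also have "\<dots> = coind B h (g (a \<odot>\<^bsub>A\<^esub> x)) \<epsilon>"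
      unfolding mod_hom_smult[OF g(1) a x] mod_hom_smult[OF c a gx] ..
    also have "\<dots> = f (a \<odot>\<^bsub>A\<^esub> x) \<epsilon>"
      unfolding coind_ev[OF lB mod_hom_closed[OF g(1) ax]] using h(2) ax by simp
    also have "\<dots> = f x (a \<odot>\<^bsub>W\<^esub> \<epsilon>)" unfolding mod_hom_smult[OF f a x] by (rule I_smult[OF \<epsilon>(1)])
    finally show "coind B h (g x) (a \<odot>\<^bsub>W\<^esub> \<epsilon>) = f x (a \<odot>\<^bsub>W\<^esub> \<epsilon>)" .
  qed
  then show ?thesis using that[OF c] by blast
qed

text \<open>A functional to \<open>J\<close> separating \<open>P\<close> from \<open>H\<close>
  exists over \<open>R\<close>. Its coinduced map still kills \<open>H\<close>, because
  \<open>H\<close> is stable under \<open>\<Lambda>\<close>, and evaluation at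
  \<open>\<epsilon>\<close> recovers the functional, so the map is nonzero.\<close>

lemma cogenerator_I:
  assumes P: "fg_module \<Lambda> P" and H: "submodule H \<Lambda> P" "H \<noteq> carrier P"
  obtains q y where "q \<in> mod_hom \<Lambda> P I" "\<And>x. x \<in> H \<Longrightarrow> q x = \<zero>\<^bsub>I\<^esub>" "y \<in> carrier P" "q y \<noteq> \<zero>\<^bsub>I\<^esub>"
proof -
  note lP = fg_lmodule[OF P]
  have H': "H \<noteq> carrier (restrict_scalars \<phi> P)" using H(2) by simp
  obtain g y where g: "g \<in> mod_hom R (restrict_scalars \<phi> P) J" "\<And>x. x \<in> H \<Longrightarrow> g x = \<zero>\<^bsub>J\<^esub>"
    "y \<in> carrier (restrict_scalars \<phi> P)" "g y \<noteq> \<zero>\<^bsub>J\<^esub>"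
    using dualizing_cogenerator[OF R.cring_axioms artinian_base dualizing fg_restrict[OF P] submodule_restrict[OF lP H(1)] H']
    by blast
  have yP: "y \<in> carrier P" using g(3) by simp
  note c = coind_hom[OF lP g(1)]
  have "coind P g x = \<zero>\<^bsub>I\<^esub>" if x: "x \<in> H" for x
  proof (rule I_eqI)
    have xP: "x \<in> carrier P" using submodule_subset[OF H(1)] x by blast
    show "coind P g x \<in> carrier I" by (rule mod_hom_closed[OF c xP])
    show "\<zero>\<^bsub>I\<^esub> \<in> carrier I" by (rule submodule_zero[OF submodule_carrier[OF lI]])
    fix a assume "a \<in> carrier \<Lambda>"
    then have \<psi>: "a \<odot>\<^bsub>W\<^esub> \<epsilon> \<in> carrier W" by (rule W_smult[OF _ \<epsilon>(1)])
    show "coind P g x (a \<odot>\<^bsub>W\<^esub> \<epsilon>) = \<zero>\<^bsub>I\<^esub> (a \<odot>\<^bsub>W\<^esub> \<epsilon>)"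
      unfolding I_zero[OF \<psi>] coind_apply[OF \<psi>] by (rule g(2)[OF submodule_smult[OF H(1) W_eq(1)[OF \<psi>] x]])
  qed
  moreover have "coind P g y \<noteq> \<zero>\<^bsub>I\<^esub>"
  proof
    assume "coind P g y = \<zero>\<^bsub>I\<^esub>"
    then have "coind P g y \<epsilon> = \<zero>\<^bsub>J\<^esub>" using I_zero[OF \<epsilon>(1)] by simp
    then show False using coind_ev[OF lP yP] g(4) by simp
  qed
  ultimately show ?thesis using that[OF c _ yP] by blast
qed

text \<open>An element of \<open>I\<close> is determined by its values at
  \<open>a \<epsilon>\<close> for \<open>a\<close> in a finite set generating
  \<open>\<Lambda>\<close> over \<open>R\<close>. Hence \<open>I\<close> behaves like a submodule of
  a finite power of \<open>J\<close>, and finite length over \<open>R\<close> follows by peeling off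
  one value at a time.\<close>

lemma fg_I: "fg_module \<Lambda> I"
proof -
  note lrI = lmodule_restrict[OF lI]
  interpret fR: fl_ring R by (rule fl_ring_base)
  let ?I = "restrict_scalars \<phi> I"
  define V where "V S = {F \<in> carrier I. \<forall>a\<in>S. F (a \<odot>\<^bsub>W\<^esub> \<epsilon>) = \<zero>\<^bsub>J\<^esub>}" for S
  have ev: "(\<lambda>F. F (a \<odot>\<^bsub>W\<^esub> \<epsilon>)) \<in> mod_hom R ?I J" if a: "a \<in> carrier \<Lambda>" for a
  proof (rule mod_homI, unfold restrict_scalars_simps)
    have \<psi>: "a \<odot>\<^bsub>W\<^esub> \<epsilon> \<in> carrier W" by (rule W_smult[OF a \<epsilon>(1)])
    then have \<psi>': "a \<odot>\<^bsub>W\<^esub> \<epsilon> \<in> carrier (restrict_scalars \<phi> W)" by (simp only: restrict_scalars_simps)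
    fix F assume "F \<in> carrier I"
    then have F: "F \<in> mod_hom R (restrict_scalars \<phi> W) J" by (simp only: I_iff)
    show "F (a \<odot>\<^bsub>W\<^esub> \<epsilon>) \<in> carrier J" by (rule mod_hom_closed[OF F \<psi>'])
    show "(F \<oplus>\<^bsub>I\<^esub> G) (a \<odot>\<^bsub>W\<^esub> \<epsilon>) = F (a \<odot>\<^bsub>W\<^esub> \<epsilon>) \<oplus>\<^bsub>J\<^esub> G (a \<odot>\<^bsub>W\<^esub> \<epsilon>)" for G by (rule I_add[OF \<psi>])
    show "(\<phi> r \<odot>\<^bsub>I\<^esub> F) (a \<odot>\<^bsub>W\<^esub> \<epsilon>) = r \<odot>\<^bsub>J\<^esub> F (a \<odot>\<^bsub>W\<^esub> \<epsilon>)" if "r \<in> carrier R" for r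
      unfolding I_smult[OF \<psi>] using mod_hom_smult[OF F that \<psi>'] by (simp only: restrict_scalars_simps)
  qed
  have V_insert: "V (insert a S) = V S \<inter> {F \<in> carrier ?I. F (a \<odot>\<^bsub>W\<^esub> \<epsilon>) \<in> {\<zero>\<^bsub>J\<^esub>}}" for a S
    by (auto simp: V_def)
  have V: "submodule (V S) R ?I" if "finite S" "S \<subseteq> carrier \<Lambda>" for S
    using that
  proof (induction S rule: finite_induct)
    case empty
    then show ?case using submodule_carrier[OF lrI] by (simp add: V_def)
  next
    case (insert a S)
    then show ?case unfolding V_insert
      by (intro submodule_Int[OF lrI] submodule_vimage[OF lrI lJ ev submodule_trivial[OF lJ]]) auto
  qed
  \<comment> \<open>The induction moves elements from \<open>S\<close> to \<open>T\<close>: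
    evaluation at \<open>a \<epsilon>\<close> maps \<open>V T\<close> to \<open>J\<close>, and its
    kernel is the same space with \<open>a\<close> added to \<open>T\<close>.\<close>
  have fl: "fin_len R (?I\<lparr>carrier := V T\<rparr>)"
    if "finite S" "finite T" "S \<subseteq> carrier \<Lambda>" "T \<subseteq> carrier \<Lambda>" "V (S \<union> T) = {\<zero>\<^bsub>I\<^esub>}" for S T
    using that
  proof (induction S arbitrary: T rule: finite_induct)
    case empty
    then show ?case by (intro fin_len_zero) simp
  next
    case (insert a S)
    then have a: "a \<in> carrier \<Lambda>" by simp
    have T: "finite (insert a T)" "insert a T \<subseteq> carrier \<Lambda>" using insert by auto
    have "V (S \<union> insert a T) = {\<zero>\<^bsub>I\<^esub>}" using insert(7) by simp
    then have IH: "fin_len R (?I\<lparr>carrier := V (insert a T)\<rparr>)" using insert(3)[OF T(1) _ T(2)] insert(5) by simp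
    note VT = V[OF insert(4,6)]
    have e: "(\<lambda>F. F (a \<odot>\<^bsub>W\<^esub> \<epsilon>)) \<in> mod_hom R (?I\<lparr>carrier := V T\<rparr>) J"
      by (rule mod_hom_restrict[OF ev[OF a] submodule_subset[OF VT]])
    have k: "a_kernel (?I\<lparr>carrier := V T\<rparr>) J (\<lambda>F. F (a \<odot>\<^bsub>W\<^esub> \<epsilon>)) = V (insert a T)"
      by (auto simp: a_kernel_eq V_def)
    show ?case
      by (rule fin_len_extension(1)[OF lmodule_submodule[OF lrI VT] lJ e _ fR.fg_fin_len[OF fg_J]]) (use IH k in simp)
  qed
  let ?L = "restrict_scalars \<phi> (regular_module \<Lambda>)"
  obtain S where S: "finite S" "S \<subseteq> carrier ?L" "mod_span R ?L S = carrier ?L"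
    using finite_over_base by (auto simp: fin_gen_def)
  have SL: "S \<subseteq> carrier \<Lambda>" using S(2) by simp
  have "V S \<subseteq> {\<zero>\<^bsub>I\<^esub>}"
  proof
    fix F assume F: "F \<in> V S"
    then have FI: "F \<in> carrier I" by (simp add: V_def)
    then have Fh: "F \<in> mod_hom R (restrict_scalars \<phi> W) J" by (simp only: I_iff)
    \<comment> \<open>As a function of the coefficient, \<open>F\<close> is \<open>R\<close>-linear;
      vanishing on the generators therefore gives vanishing on all of
      \<open>\<Lambda>\<close>.\<close>
    have hom: "(\<lambda>a. F (a \<odot>\<^bsub>W\<^esub> \<epsilon>)) \<in> mod_hom R ?L J"
    proof (rule mod_homI, unfold restrict_scalars_simps regular_module_simps)
      fix a assume a: "a \<in> carrier \<Lambda>"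
      note \<psi> = W_smult[OF a \<epsilon>(1)]
      have \<psi>': "a \<odot>\<^bsub>W\<^esub> \<epsilon> \<in> carrier (restrict_scalars \<phi> W)" using \<psi> by (simp only: restrict_scalars_simps)
      show "F (a \<odot>\<^bsub>W\<^esub> \<epsilon>) \<in> carrier J" by (rule mod_hom_closed[OF Fh \<psi>'])
      show "F ((a \<oplus>\<^bsub>\<Lambda>\<^esub> b) \<odot>\<^bsub>W\<^esub> \<epsilon>) = F (a \<odot>\<^bsub>W\<^esub> \<epsilon>) \<oplus>\<^bsub>J\<^esub> F (b \<odot>\<^bsub>W\<^esub> \<epsilon>)" if b: "b \<in> carrier \<Lambda>" for b
      proof -
        have \<chi>': "b \<odot>\<^bsub>W\<^esub> \<epsilon> \<in> carrier (restrict_scalars \<phi> W)" using W_smult[OF b \<epsilon>(1)] by (simp only: restrict_scalars_simps)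
        have "(a \<oplus>\<^bsub>\<Lambda>\<^esub> b) \<odot>\<^bsub>W\<^esub> \<epsilon> = a \<odot>\<^bsub>W\<^esub> \<epsilon> \<oplus>\<^bsub>W\<^esub> b \<odot>\<^bsub>W\<^esub> \<epsilon>"
          using lmodule.smult_l_distr[OF lW, of a b \<epsilon>] a b \<epsilon>(1) by (simp only: op_ring_simps)
        then show ?thesis using mod_hom_add[OF Fh \<psi>' \<chi>'] by (simp only: restrict_scalars_simps)
      qed
      show "F ((\<phi> r \<otimes>\<^bsub>\<Lambda>\<^esub> a) \<odot>\<^bsub>W\<^esub> \<epsilon>) = r \<odot>\<^bsub>J\<^esub> F (a \<odot>\<^bsub>W\<^esub> \<epsilon>)" if r: "r \<in> carrier R" for r
      proof -
        have "(\<phi> r \<otimes>\<^bsub>\<Lambda>\<^esub> a) \<odot>\<^bsub>W\<^esub> \<epsilon> = \<phi> r \<odot>\<^bsub>W\<^esub> (a \<odot>\<^bsub>W\<^esub> \<epsilon>)"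
          unfolding central[OF r a]
          using lmodule.smult_assoc1[OF lW, of "\<phi> r" a \<epsilon>] a structure_closed[OF r] \<epsilon>(1) by (simp only: op_ring_simps)
        then show ?thesis using mod_hom_smult[OF Fh r \<psi>'] by (simp only: restrict_scalars_simps)
      qed
    qed
    have "mod_span R ?L S \<subseteq> {a \<in> carrier ?L. F (a \<odot>\<^bsub>W\<^esub> \<epsilon>) \<in> {\<zero>\<^bsub>J\<^esub>}}"
    proof (rule mod_span_least)
      show "submodule {a \<in> carrier ?L. F (a \<odot>\<^bsub>W\<^esub> \<epsilon>) \<in> {\<zero>\<^bsub>J\<^esub>}} R ?L"
        by (rule submodule_vimage[OF lmodule_restrict[OF lmodule_regular[OF \<Lambda>.ring_axioms]] lJ hom submodule_trivial[OF lJ]])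
      show "S \<subseteq> {a \<in> carrier ?L. F (a \<odot>\<^bsub>W\<^esub> \<epsilon>) \<in> {\<zero>\<^bsub>J\<^esub>}}" using F S(2) by (auto simp: V_def)
    qed
    then have Fz: "F (a \<odot>\<^bsub>W\<^esub> \<epsilon>) = \<zero>\<^bsub>J\<^esub>" if "a \<in> carrier \<Lambda>" for a using that unfolding S(3) by auto
    have "F = \<zero>\<^bsub>I\<^esub>"
    proof (rule I_eqI[OF FI submodule_zero[OF submodule_carrier[OF lI]]])
      fix a assume "a \<in> carrier \<Lambda>"
      then show "F (a \<odot>\<^bsub>W\<^esub> \<epsilon>) = \<zero>\<^bsub>I\<^esub> (a \<odot>\<^bsub>W\<^esub> \<epsilon>)" using Fz I_zero[OF W_smult[OF _ \<epsilon>(1)]] by metis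
    qed
    then show "F \<in> {\<zero>\<^bsub>I\<^esub>}" by simp
  qed
  then have "V (S \<union> {}) = {\<zero>\<^bsub>I\<^esub>}" using submodule_zero[OF V[OF S(1) SL]] by auto
  from fl[OF S(1) _ SL _ this] have "fin_len R (?I\<lparr>carrier := V {}\<rparr>)" by simp
  moreover have "V {} = carrier I" by (simp add: V_def)
  ultimately have "fin_len R ?I" by simp
  then show ?thesis
    using fin_len_fin_gen[OF lI fin_len_restrict[OF lI]] lI by (simp add: fg_module_def)
qed

end


section \<open>Presentations along an almost split sequence\<close>

text \<open>The factorization property is defined for targets on \<open>'a univ\<close>, whereas the
  intended target \<open>I / T\<close> consists of sets of functionals; a copy bridges the two, and
  a splitting of the copied map would split the original.\<close>

lemma left_almost_split_factor:
  assumes las: "left_almost_split \<Lambda> L N a" and lL: "lmodule \<Lambda> L" and Q: "fg_module \<Lambda> Q"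
    and f: "f \<in> mod_hom \<Lambda> L Q" "\<not> split_mono \<Lambda> L Q f"
  obtains h where "h \<in> mod_hom \<Lambda> N Q" "\<And>x. x \<in> carrier L \<Longrightarrow> h (a x) = f x"
proof -
  obtain Q' :: "('a, 'a univ) module" and i j where Q': "fg_module \<Lambda> Q'" "i \<in> mod_hom \<Lambda> Q Q'" "j \<in> mod_hom \<Lambda> Q' Q"
    "\<And>x. x \<in> carrier Q \<Longrightarrow> j (i x) = x" "\<And>y. y \<in> carrier Q' \<Longrightarrow> i (j y) = y"
    using univ_copy[OF Q] by blast
  have if': "(\<lambda>x. i (f x)) \<in> mod_hom \<Lambda> L Q'" by (rule mod_hom_comp[OF f(1) Q'(2)])
  have ns: "\<not> split_mono \<Lambda> L Q' (\<lambda>x. i (f x))"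
  proof
    assume "split_mono \<Lambda> L Q' (\<lambda>x. i (f x))"
    then obtain r where r: "r \<in> mod_hom \<Lambda> Q' L" "\<forall>x\<in>carrier L. r (i (f x)) = x" by (auto simp: split_mono_def)
    have "split_mono \<Lambda> L Q f"
      unfolding split_mono_def by (intro conjI f(1) bexI[OF _ mod_hom_comp[OF Q'(2) r(1)]] r(2))
    then show False using f(2) by simp
  qed
  from las[unfolded left_almost_split_def, THEN conjunct2, THEN conjunct2, THEN spec, THEN bspec, OF if', THEN mp, OF Q'(1), THEN mp, OF ns]
  obtain h where h: "h \<in> mod_hom \<Lambda> N Q'" "\<forall>x\<in>carrier L. h (a x) = i (f x)" by blast
  show ?thesis
  proof
    show "(\<lambda>x. j (h x)) \<in> mod_hom \<Lambda> N Q" by (rule mod_hom_comp[OF h(1) Q'(3)])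
    show "j (h (a x)) = f x" if "x \<in> carrier L" for x
      using h(2)[THEN bspec, OF that] Q'(4)[OF mod_hom_closed[OF f(1) that]] by simp
  qed
qed

text \<open>The image of \<open>f\<close> has the kernel of a retraction as complement. In
  contrapositive form this turns the hypothesis on direct summands into the statement that no map
  \<open>L \<rightarrow> I / T\<close> is a split monomorphism.\<close>

lemma split_mono_summand:
  assumes lL: "lmodule \<Lambda> L" and lQ: "lmodule \<Lambda> Q" and sm: "split_mono \<Lambda> L Q f"
  shows "iso_to_direct_summand \<Lambda> L Q"
proof -
  interpret Q: lmodule \<Lambda> Q by (rule lQ)
  interpret L: lmodule \<Lambda> L by (rule lL)
  have f: "f \<in> mod_hom \<Lambda> L Q" using sm by (simp add: split_mono_def)
  obtain r where r: "r \<in> mod_hom \<Lambda> Q L" "\<And>x. x \<in> carrier L \<Longrightarrow> r (f x) = x"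
    using sm by (auto simp: split_mono_def)
  let ?A = "f ` carrier L" and ?B = "a_kernel Q L r"
  have A: "submodule ?A \<Lambda> Q" by (rule submodule_image[OF lL lQ f submodule_carrier[OF lL]])
  note B = submodule_kernel[OF lQ lL r(1)]
  have "?A \<inter> ?B = {\<zero>\<^bsub>Q\<^esub>}"
  proof
    show "?A \<inter> ?B \<subseteq> {\<zero>\<^bsub>Q\<^esub>}"
    proof
      fix y assume y: "y \<in> ?A \<inter> ?B"
      then obtain x where x: "x \<in> carrier L" "y = f x" by blast
      then have "x = \<zero>\<^bsub>L\<^esub>" using y r(2) by (simp add: a_kernel_eq)
      then show "y \<in> {\<zero>\<^bsub>Q\<^esub>}" using x(2) mod_hom_zero[OF lL lQ f] by simp
    qed
    show "{\<zero>\<^bsub>Q\<^esub>} \<subseteq> ?A \<inter> ?B" using submodule_zero[OF A] submodule_zero[OF B] by simp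
  qed
  moreover have "sum_sub Q ?A ?B = carrier Q"
  proof
    show "sum_sub Q ?A ?B \<subseteq> carrier Q"
      by (rule sum_sub_least[OF submodule_carrier[OF lQ] submodule_subset[OF A] submodule_subset[OF B]])
    show "carrier Q \<subseteq> sum_sub Q ?A ?B"
    proof
      fix y assume y: "y \<in> carrier Q"
      have ry: "r y \<in> carrier L" by (rule mod_hom_closed[OF r(1) y])
      have fry: "f (r y) \<in> carrier Q" by (rule mod_hom_closed[OF f ry])
      have "y \<ominus>\<^bsub>Q\<^esub> f (r y) \<in> ?B"
        using mod_hom_diff[OF lQ lL r(1) y fry] r(2)[OF ry] y fry ry by (simp add: a_kernel_eq L.minus_eq_zero_iff)
      moreover have "f (r y) \<in> ?A" using ry by blast
      ultimately have "f (r y) \<oplus>\<^bsub>Q\<^esub> (y \<ominus>\<^bsub>Q\<^esub> f (r y)) \<in> sum_sub Q ?A ?B" by (intro sum_subI)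
      moreover have "f (r y) \<oplus>\<^bsub>Q\<^esub> (y \<ominus>\<^bsub>Q\<^esub> f (r y)) = y" using y fry by (simp add: a_minus_def Q.a_lcomm Q.r_neg)
      ultimately show "y \<in> sum_sub Q ?A ?B" by simp
    qed
  qed
  ultimately have "direct_decomp \<Lambda> Q ?A ?B" unfolding direct_decomp_def set_add_eq_sum_sub using A B by blast
  moreover have "mod_isomorphic \<Lambda> L (Q\<lparr>carrier := ?A\<rparr>)"
  proof -
    have "inj_on f (carrier L)" by (rule inj_on_inverseI[of _ r]) (rule r(2))
    then have "bij_betw f (carrier L) (carrier (Q\<lparr>carrier := ?A\<rparr>))" by (simp add: bij_betw_def)
    moreover have "f \<in> mod_hom \<Lambda> L (Q\<lparr>carrier := ?A\<rparr>)" by (rule mod_hom_into[OF f]) simp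
    ultimately show ?thesis unfolding mod_isomorphic_def by blast
  qed
  ultimately show ?thesis unfolding iso_to_direct_summand_def by blast
qed

section \<open>Testing covers by maps to the socle\<close>

context nakayama_free
begin

sublocale fl: fl_ring \<Lambda>
  by (rule fl_ring)

abbreviation "T \<equiv> socle \<Lambda> I"

lemma submodule_T: "submodule T \<Lambda> I"
  by (rule fl.submodule_socle[OF lI])

text \<open>Enlarging \<open>H\<close> to a maximal submodule before applying the cogenerator makes
  the image of \<open>q\<close> simple, so it lies in the socle.\<close>

lemma cogenerator_socle:
  assumes P: "fg_module \<Lambda> P" and H: "submodule H \<Lambda> P" "H \<noteq> carrier P"
  obtains q y where "q \<in> mod_hom \<Lambda> P I" "q ` carrier P \<subseteq> T" "\<And>x. x \<in> H \<Longrightarrow> q x = \<zero>\<^bsub>I\<^esub>"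
    "y \<in> carrier P" "q y \<noteq> \<zero>\<^bsub>I\<^esub>"
proof -
  note lP = fg_lmodule[OF P]
  obtain X where X: "submodule X \<Lambda> P" "H \<subseteq> X" "X \<noteq> carrier P"
    "\<And>Y. \<lbrakk>submodule Y \<Lambda> P; X \<subseteq> Y\<rbrakk> \<Longrightarrow> Y = X \<or> Y = carrier P"
    using fl.maximal_proper_submodule[OF P H] by metis
  obtain q y where q: "q \<in> mod_hom \<Lambda> P I" "\<And>x. x \<in> X \<Longrightarrow> q x = \<zero>\<^bsub>I\<^esub>" and y: "y \<in> carrier P" "q y \<noteq> \<zero>\<^bsub>I\<^esub>"
    using cogenerator_I[OF P X(1,3)] by metis
  have im: "submodule (q ` carrier P) \<Lambda> I" by (rule submodule_image[OF lP lI q(1) submodule_carrier[OF lP]])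
  have "simple_submodule \<Lambda> I (q ` carrier P)"
    unfolding simple_submodule_def
  proof (intro conjI allI impI im)
    show "q ` carrier P \<noteq> {\<zero>\<^bsub>I\<^esub>}" using y by blast
    fix S assume S: "submodule S \<Lambda> I" "S \<subseteq> q ` carrier P"
    let ?V = "{x \<in> carrier P. q x \<in> S}"
    have V: "submodule ?V \<Lambda> P" by (rule submodule_vimage[OF lP lI q(1) S(1)])
    have "X \<subseteq> ?V" using q(2) submodule_subset[OF X(1)] submodule_zero[OF S(1)] by auto
    then consider "?V = X" | "?V = carrier P" using X(4)[OF V] by blast
    then show "S = {\<zero>\<^bsub>I\<^esub>} \<or> S = q ` carrier P"
    proof cases
      case 1
      have "s = \<zero>\<^bsub>I\<^esub>" if s: "s \<in> S" for s
      proof -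
        obtain x where x: "x \<in> carrier P" "s = q x" using s S(2) by blast
        then have "x \<in> ?V" using s by simp
        then show ?thesis unfolding 1 x(2) by (rule q(2))
      qed
      then show ?thesis using submodule_zero[OF S(1)] by blast
    next
      case 2
      then show ?thesis using S(2) by blast
    qed
  qed
  then have "q ` carrier P \<subseteq> T" by (rule fl.simple_subset_socle)
  then show ?thesis using that[OF q(1) _ _ y] q(2) X(2) by blast
qed

text \<open>The kernel of the horseshoe map is superfluous as soon as \<open>Hom(B, T) \<rightarrow> Hom(A, T)\<close> is surjective.\<close>

lemma horseshoe_cover:
  assumes lA: "lmodule \<Lambda> A" and lB: "lmodule \<Lambda> B" and lC: "lmodule \<Lambda> C"
    and i: "i \<in> mod_hom \<Lambda> A B" and \<pi>: "\<pi> \<in> mod_hom \<Lambda> B C" and ker: "i ` carrier A = a_kernel B C \<pi>"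
    and cA: "projective_cover \<Lambda> PA c A" and cC: "projective_cover \<Lambda> PC c' C"
    and t: "t \<in> mod_hom \<Lambda> PC B" "\<And>y. y \<in> carrier PC \<Longrightarrow> \<pi> (t y) = c' y"
    and ext: "\<And>u. \<lbrakk>u \<in> mod_hom \<Lambda> A I; u ` carrier A \<subseteq> T\<rbrakk> \<Longrightarrow>
      \<exists>v\<in>mod_hom \<Lambda> B I. v ` carrier B \<subseteq> T \<and> (\<forall>x\<in>carrier A. v (i x) = u x)"
  shows "projective_cover \<Lambda> (dsum PA PC) (\<lambda>z. i (c (fst z)) \<oplus>\<^bsub>B\<^esub> t (snd z)) B"
proof -
  have PA: "projective \<Lambda> PA" "c \<in> mod_hom \<Lambda> PA A" "c ` carrier PA = carrier A"
    using cA by (auto simp: projective_cover_def)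
  have PC: "projective \<Lambda> PC" "c' \<in> mod_hom \<Lambda> PC C" "c' ` carrier PC = carrier C"
    using cC by (auto simp: projective_cover_def)
  note lPA = projective_lmodule[OF PA(1)] and lPC = projective_lmodule[OF PC(1)]
  interpret A: lmodule \<Lambda> A by (rule lA)
  interpret B: lmodule \<Lambda> B by (rule lB)
  interpret C: lmodule \<Lambda> C by (rule lC)
  interpret I: lmodule \<Lambda> I by (rule lI)
  interpret PA: lmodule \<Lambda> PA by (rule lPA)
  interpret PC: lmodule \<Lambda> PC by (rule lPC)
  let ?D = "dsum PA PC" and ?\<psi> = "\<lambda>z. i (c (fst z)) \<oplus>\<^bsub>B\<^esub> t (snd z)"
  have D: "projective \<Lambda> ?D" by (rule projective_dsum[OF PA(1) PC(1)])
  have \<psi>: "?\<psi> \<in> mod_hom \<Lambda> ?D B"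
    by (rule mod_hom_copair[OF lPA lPC lB mod_hom_comp[OF PA(2) i] t(1)])
  have ic: "i (c x) \<in> carrier B" "\<pi> (i (c x)) = \<zero>\<^bsub>C\<^esub>" if x: "x \<in> carrier PA" for x
  proof -
    have "i (c x) \<in> a_kernel B C \<pi>" unfolding ker[symmetric] using mod_hom_closed[OF PA(2) x] by blast
    then show "i (c x) \<in> carrier B" "\<pi> (i (c x)) = \<zero>\<^bsub>C\<^esub>" by (simp_all add: a_kernel_eq)
  qed
  have tc: "t y \<in> carrier B" if "y \<in> carrier PC" for y by (rule mod_hom_closed[OF t(1) that])
  have onto: "?\<psi> ` carrier ?D = carrier B"
  proof
    show "?\<psi> ` carrier ?D \<subseteq> carrier B" using mod_hom_closed[OF \<psi>] by blast
    show "carrier B \<subseteq> ?\<psi> ` carrier ?D"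
    proof
      fix b assume b: "b \<in> carrier B"
      have "\<pi> b \<in> c' ` carrier PC" unfolding PC(3) by (rule mod_hom_closed[OF \<pi> b])
      then obtain y where y: "y \<in> carrier PC" "\<pi> b = c' y" by blast
      have "b \<ominus>\<^bsub>B\<^esub> t y \<in> a_kernel B C \<pi>"
        using mod_hom_diff[OF lB lC \<pi> b tc[OF y(1)]] t(2)[OF y(1)] y(2) b tc[OF y(1)] mod_hom_closed[OF PC(2) y(1)]
        by (simp add: a_kernel_eq C.minus_eq_zero_iff)
      then have "b \<ominus>\<^bsub>B\<^esub> t y \<in> i ` c ` carrier PA" unfolding ker[symmetric] PA(3) .
      then obtain x where x: "x \<in> carrier PA" "b \<ominus>\<^bsub>B\<^esub> t y = i (c x)" by blast
      have "?\<psi> (x, y) = (b \<ominus>\<^bsub>B\<^esub> t y) \<oplus>\<^bsub>B\<^esub> t y" using x(2) by simp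
      also have "\<dots> = b" using b tc[OF y(1)] by (simp add: a_minus_def B.a_assoc B.l_neg)
      finally have "b = ?\<psi> (x, y)" ..
      then show "b \<in> ?\<psi> ` carrier ?D" by (rule image_eqI) (use x y in simp)
    qed
  qed
  \<comment> \<open>A proper \<open>H\<close> is detected by a nonzero map \<open>q\<close> to
    \<open>T\<close> that vanishes on it. The aim is to factor \<open>q\<close> through
    \<open>?\<psi>\<close>; since \<open>?\<psi>\<close> already maps \<open>H\<close> onto
    \<open>B\<close>, this makes \<open>q\<close> zero everywhere.\<close>
  have "H = carrier ?D" if H: "submodule H \<Lambda> ?D" "?\<psi> ` H = carrier B" for H
  proof (rule ccontr)
    assume "H \<noteq> carrier ?D"
    then obtain q z0 where q: "q \<in> mod_hom \<Lambda> ?D I" "q ` carrier ?D \<subseteq> T" "\<And>x. x \<in> H \<Longrightarrow> q x = \<zero>\<^bsub>I\<^esub>"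
      and z0: "z0 \<in> carrier ?D" "q z0 \<noteq> \<zero>\<^bsub>I\<^esub>"
      using cogenerator_socle[OF projective_fg[OF D] H(1)] by metis
    let ?qA = "\<lambda>x. q (x, \<zero>\<^bsub>PC\<^esub>)" and ?qC = "\<lambda>y. q (\<zero>\<^bsub>PA\<^esub>, y)"
    have qA: "?qA \<in> mod_hom \<Lambda> PA I" by (rule mod_hom_comp[OF mod_hom_inl[OF lPC] q(1)])
    have qC: "?qC \<in> mod_hom \<Lambda> PC I" by (rule mod_hom_comp[OF mod_hom_inr[OF lPA] q(1)])
    have qAT: "?qA x \<in> T" if "x \<in> carrier PA" for x
      by (rule subsetD[OF q(2)], rule imageI) (use that in simp)
    have qCT: "?qC y \<in> T" if "y \<in> carrier PC" for y
      by (rule subsetD[OF q(2)], rule imageI) (use that in simp)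
    have kA: "?qA x = \<zero>\<^bsub>I\<^esub>" if "x \<in> carrier PA" "c x = \<zero>\<^bsub>A\<^esub>" for x
      by (rule fl.cover_kernel_socle[OF cA lA fg_I qA _ that]) (use qAT in blast)
    obtain u where u: "u \<in> mod_hom \<Lambda> A I" "\<And>x. x \<in> carrier PA \<Longrightarrow> u (c x) = ?qA x"
      using mod_hom_factor[OF lPA lA lI PA(2,3) qA kA] by blast
    have "u ` carrier A \<subseteq> T" unfolding PA(3)[symmetric] using u(2) qAT by auto
    then obtain v where v: "v \<in> mod_hom \<Lambda> B I" "v ` carrier B \<subseteq> T" "\<And>x. x \<in> carrier A \<Longrightarrow> v (i x) = u x"
      using ext[OF u(1)] by blast
    \<comment> \<open>On \<open>PA\<close> the map \<open>q\<close> agrees with \<open>v\<close>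
      after \<open>?\<psi>\<close>. The discrepancy on \<open>PC\<close> is again a map to
      \<open>T\<close>, so it kills the kernel of the cover \<open>c'\<close> and descends to
      \<open>C\<close>.\<close>
    let ?q' = "\<lambda>y. ?qC y \<ominus>\<^bsub>I\<^esub> v (t y)"
    have q': "?q' \<in> mod_hom \<Lambda> PC I"
      by (rule mod_hom_minus_hom[OF lPC lI qC mod_hom_comp[OF t(1) v(1)]])
    have q'T: "?q' y \<in> T" if "y \<in> carrier PC" for y
      using submodule_diff[OF submodule_T qCT[OF that]] v(2) tc[OF that] by blast
    have kC: "?q' y = \<zero>\<^bsub>I\<^esub>" if "y \<in> carrier PC" "c' y = \<zero>\<^bsub>C\<^esub>" for y
      by (rule fl.cover_kernel_socle[OF cC lC fg_I q' _ that]) (use q'T in blast)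
    obtain u' where u': "u' \<in> mod_hom \<Lambda> C I" "\<And>y. y \<in> carrier PC \<Longrightarrow> u' (c' y) = ?q' y"
      using mod_hom_factor[OF lPC lC lI PC(2,3) q' kC] by blast
    \<comment> \<open>The desired factor of \<open>q\<close>: \<open>v\<close> accounts for the part
      on \<open>PA\<close>, and \<open>u'\<close> pulled back along \<open>\<pi>\<close> repairs the
      part on \<open>PC\<close> without disturbing it.\<close>
    let ?w = "\<lambda>b. v b \<oplus>\<^bsub>I\<^esub> u' (\<pi> b)"
    have qw: "q z = ?w (?\<psi> z)" if z: "z \<in> carrier ?D" for z
    proof -
      have z': "fst z \<in> carrier PA" "snd z \<in> carrier PC" using z by auto
      note ic' = ic[OF z'(1)] and tc' = tc[OF z'(2)]
      have c: "q (fst z, \<zero>\<^bsub>PC\<^esub>) \<in> carrier I" "q (\<zero>\<^bsub>PA\<^esub>, snd z) \<in> carrier I" "v (t (snd z)) \<in> carrier I"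
        using mod_hom_closed[OF qA z'(1)] mod_hom_closed[OF qC z'(2)] mod_hom_closed[OF v(1) tc'] by auto
      have "\<pi> (?\<psi> z) = c' (snd z)"
        using mod_hom_add[OF \<pi> ic'(1) tc'] ic'(2) t(2)[OF z'(2)] mod_hom_closed[OF PC(2) z'(2)] by simp
      moreover have "v (?\<psi> z) = q (fst z, \<zero>\<^bsub>PC\<^esub>) \<oplus>\<^bsub>I\<^esub> v (t (snd z))"
        using mod_hom_add[OF v(1) ic'(1) tc'] v(3)[OF mod_hom_closed[OF PA(2) z'(1)]] u(2)[OF z'(1)] by simp
      ultimately have "?w (?\<psi> z) = (q (fst z, \<zero>\<^bsub>PC\<^esub>) \<oplus>\<^bsub>I\<^esub> v (t (snd z))) \<oplus>\<^bsub>I\<^esub> (q (\<zero>\<^bsub>PA\<^esub>, snd z) \<ominus>\<^bsub>I\<^esub> v (t (snd z)))"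
        using u'(2)[OF z'(2)] by simp
      also have "\<dots> = q (fst z, \<zero>\<^bsub>PC\<^esub>) \<oplus>\<^bsub>I\<^esub> (v (t (snd z)) \<oplus>\<^bsub>I\<^esub> (q (\<zero>\<^bsub>PA\<^esub>, snd z) \<ominus>\<^bsub>I\<^esub> v (t (snd z))))"
        using c by (simp add: I.a_assoc)
      also have "v (t (snd z)) \<oplus>\<^bsub>I\<^esub> (q (\<zero>\<^bsub>PA\<^esub>, snd z) \<ominus>\<^bsub>I\<^esub> v (t (snd z))) = q (\<zero>\<^bsub>PA\<^esub>, snd z)"
        by (rule I.M.add_diff_cancel[OF c(3,2)])
      also have "q (fst z, \<zero>\<^bsub>PC\<^esub>) \<oplus>\<^bsub>I\<^esub> q (\<zero>\<^bsub>PA\<^esub>, snd z) = q ((fst z, \<zero>\<^bsub>PC\<^esub>) \<oplus>\<^bsub>?D\<^esub> (\<zero>\<^bsub>PA\<^esub>, snd z))"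
        by (rule mod_hom_add[OF q(1), symmetric]) (use z' in simp_all)
      also have "(fst z, \<zero>\<^bsub>PC\<^esub>) \<oplus>\<^bsub>?D\<^esub> (\<zero>\<^bsub>PA\<^esub>, snd z) = z" using z' by simp
      finally show ?thesis ..
    qed
    have "?\<psi> z0 \<in> ?\<psi> ` H" unfolding H(2) by (rule mod_hom_closed[OF \<psi> z0(1)])
    then obtain h where h: "h \<in> H" "?\<psi> z0 = ?\<psi> h" by blast
    have "q z0 = q h" unfolding qw[OF z0(1)] qw[OF subsetD[OF submodule_subset[OF H(1)] h(1)]] h(2) ..
    then show False using z0(2) q(3)[OF h(1)] by simp
  qed
  then show ?thesis unfolding projective_cover_def using D \<psi> onto by blast
qed

text \<open>A homomorphism \<open>u\<close> from the first syzygy of \<open>L\<close> to the socle \<open>T\<close> of the injective module \<open>I\<close> extends to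
  the projective cover of \<open>L\<close> with values in \<open>I\<close>, and so induces \<open>L \<rightarrow> I / T\<close>.  Unless this is a split
  monomorphism it factors through \<open>a\<close>; lifting the factorization to \<open>I\<close> extends \<open>u\<close>.\<close>

lemma syzygy_extension:
  assumes fL: "fg_module \<Lambda> L" and fN: "fg_module \<Lambda> N" and las: "left_almost_split \<Lambda> L N a"
    and ns: "\<not> iso_to_direct_summand \<Lambda> L (quot_module I T)"
    and PL: "projective \<Lambda> PL" "pL \<in> mod_hom \<Lambda> PL L" "pL ` carrier PL = carrier L"
    and PM: "projective \<Lambda> PM" and \<tau>: "\<tau> \<in> mod_hom \<Lambda> PM N"
    and p_def: "p = (\<lambda>z. a (pL (fst z)) \<oplus>\<^bsub>N\<^esub> \<tau> (snd z))"
    and u: "u \<in> mod_hom \<Lambda> (PL\<lparr>carrier := a_kernel PL L pL\<rparr>) I" "u ` a_kernel PL L pL \<subseteq> T"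
  shows "\<exists>v\<in>mod_hom \<Lambda> ((dsum PL PM)\<lparr>carrier := a_kernel (dsum PL PM) N p\<rparr>) I.
    v ` a_kernel (dsum PL PM) N p \<subseteq> T \<and> (\<forall>x\<in>a_kernel PL L pL. v (x, \<zero>\<^bsub>PM\<^esub>) = u x)"
proof -
  note lL = fg_lmodule[OF fL] and lN = fg_lmodule[OF fN]
    and lPL = projective_lmodule[OF PL(1)] and lPM = projective_lmodule[OF PM]
  interpret N: lmodule \<Lambda> N by (rule lN)
  interpret I: lmodule \<Lambda> I by (rule lI)
  interpret PL: lmodule \<Lambda> PL by (rule lPL)
  interpret PM: lmodule \<Lambda> PM by (rule lPM)
  have a: "a \<in> mod_hom \<Lambda> L N" using las by (simp add: left_almost_split_def)
  let ?D = "dsum PL PM"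
  have D: "projective \<Lambda> ?D" by (rule projective_dsum[OF PL(1) PM])
  note lD = projective_lmodule[OF D]
  have p: "p \<in> mod_hom \<Lambda> ?D N"
    unfolding p_def by (rule mod_hom_copair[OF lPL lPM lN mod_hom_comp[OF PL(2) a] \<tau>])
  let ?K = "a_kernel ?D N p" and ?KL = "a_kernel PL L pL"
  note K = submodule_kernel[OF lD lN p] and KL = submodule_kernel[OF lPL lL PL(2)]
  let ?\<pi> = "\<lambda>x. T +>\<^bsub>I\<^esub> x" and ?Q = "quot_module I T"
  note q = quot_module[OF lI submodule_T]
  have fQ: "fg_module \<Lambda> ?Q" by (rule fg_module_image[OF fg_I q(1,2,3)])
  interpret Q: lmodule \<Lambda> ?Q by (rule q)
  obtain uI where uI: "uI \<in> mod_hom \<Lambda> PL I" "\<And>x. x \<in> carrier (PL\<lparr>carrier := ?KL\<rparr>) \<Longrightarrow> uI x = u x"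
    using injective_I[OF fl.fg_submodule[OF projective_fg[OF PL(1)] KL] projective_fg[OF PL(1)]
        mod_hom_incl[OF submodule_subset[OF KL]] inj_on_id2 u(1)] by blast
  have uk: "?\<pi> (uI x) = \<zero>\<^bsub>?Q\<^esub>" if x: "x \<in> carrier PL" "pL x = \<zero>\<^bsub>L\<^esub>" for x
  proof -
    have xK: "x \<in> ?KL" using x by (simp add: a_kernel_eq)
    then have "uI x \<in> T" using uI(2)[of x] u(2) by auto
    then show ?thesis using q(4)[OF mod_hom_closed[OF uI(1) x(1)]] by simp
  qed
  obtain f where f: "f \<in> mod_hom \<Lambda> L ?Q" "\<And>x. x \<in> carrier PL \<Longrightarrow> f (pL x) = ?\<pi> (uI x)"
    using mod_hom_factor[OF lPL lL q(1) PL(2,3) mod_hom_comp[OF uI(1) q(2)] uk] by blast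
  have "\<not> split_mono \<Lambda> L ?Q f" using split_mono_summand[OF lL q(1)] ns by blast
  then obtain h where h: "h \<in> mod_hom \<Lambda> N ?Q" "\<And>x. x \<in> carrier L \<Longrightarrow> h (a x) = f x"
    using left_almost_split_factor[OF las lL fQ f(1)] by blast
  obtain vI where vI: "vI \<in> mod_hom \<Lambda> ?D I" "\<And>z. z \<in> carrier ?D \<Longrightarrow> ?\<pi> (vI z) = h (p z)"
    using projective_lift[OF D fg_I fQ q(2,3) mod_hom_comp[OF p h(1)]] by blast
  \<comment> \<open>The lift \<open>vI\<close> need not restrict to \<open>uI\<close> on
    \<open>PL\<close>, but modulo \<open>T\<close> both induce the same map, so their difference
    \<open>?w\<close> has values in \<open>T\<close>.\<close>
  let ?w = "\<lambda>x. vI (x, \<zero>\<^bsub>PM\<^esub>) \<ominus>\<^bsub>I\<^esub> uI x"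
  have w: "?w \<in> mod_hom \<Lambda> PL I"
    by (rule mod_hom_minus_hom[OF lPL lI mod_hom_comp[OF mod_hom_inl[OF lPM] vI(1)] uI(1)])
  have vc: "vI (x, \<zero>\<^bsub>PM\<^esub>) \<in> carrier I" "uI x \<in> carrier I" if "x \<in> carrier PL" for x
    using mod_hom_closed[OF vI(1), of "(x, \<zero>\<^bsub>PM\<^esub>)"] mod_hom_closed[OF uI(1) that] that by simp_all
  have wT: "?w x \<in> T" if x: "x \<in> carrier PL" for x
  proof -
    have px: "pL x \<in> carrier L" by (rule mod_hom_closed[OF PL(2) x])
    have "p (x, \<zero>\<^bsub>PM\<^esub>) = a (pL x)"
      using mod_hom_zero[OF lPM lN \<tau>] mod_hom_closed[OF a px] by (simp add: p_def)
    then have "?\<pi> (vI (x, \<zero>\<^bsub>PM\<^esub>)) = ?\<pi> (uI x)"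
      using vI(2)[of "(x, \<zero>\<^bsub>PM\<^esub>)"] h(2)[OF px] f(2)[OF x] x by simp
    then have "?\<pi> (?w x) = \<zero>\<^bsub>?Q\<^esub>"
      unfolding mod_hom_diff[OF lI q(1,2) vc[OF x]] using mod_hom_closed[OF q(2) vc(2)[OF x]]
      by (simp add: Q.minus_eq_zero_iff)
    then show ?thesis using q(4)[OF mod_hom_closed[OF w x]] by simp
  qed
  \<comment> \<open>Subtracting the error along the first projection makes the restriction to
    \<open>PL\<close> equal to \<open>uI\<close>. Values on the kernel of \<open>p\<close> stay in
    \<open>T\<close>, since there \<open>vI\<close> and \<open>?w\<close> both have values in
    \<open>T\<close>.\<close>
  let ?v = "\<lambda>z. vI z \<ominus>\<^bsub>I\<^esub> ?w (fst z)"
  have v: "?v \<in> mod_hom \<Lambda> ?D I"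
    by (rule mod_hom_minus_hom[OF lD lI vI(1) mod_hom_comp[OF mod_hom_fst w]])
  show ?thesis
  proof (intro bexI[OF _ mod_hom_restrict[OF v submodule_subset[OF K]]] conjI ballI)
    show "?v ` ?K \<subseteq> T"
    proof
      fix y assume "y \<in> ?v ` ?K"
      then obtain z where z: "z \<in> carrier ?D" "p z = \<zero>\<^bsub>N\<^esub>" "y = ?v z" by (auto simp: a_kernel_eq)
      have "?\<pi> (vI z) = \<zero>\<^bsub>?Q\<^esub>" using vI(2)[OF z(1)] z(2) mod_hom_zero[OF lN q(1) h(1)] by simp
      then have "vI z \<in> T" using q(4)[OF mod_hom_closed[OF vI(1) z(1)]] by simp
      moreover have "?w (fst z) \<in> T" by (rule wT) (use z(1) in auto)
      ultimately show "y \<in> T" unfolding z(3) by (rule submodule_diff[OF submodule_T])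
    qed
    fix x assume x: "x \<in> ?KL"
    then have xP: "x \<in> carrier PL" by (simp add: a_kernel_eq)
    have "?v (x, \<zero>\<^bsub>PM\<^esub>) = uI x"
      using vc[OF xP] by (simp add: a_minus_def I.minus_add I.a_ac I.r_neg I.r_neg1 I.r_neg2)
    then show "?v (x, \<zero>\<^bsub>PM\<^esub>) = u x" using uI(2)[of x] x by simp
  qed
qed

text \<open>The kernel of the horseshoe map onto \<open>N\<close> is covered by the sum of the
  covers of the two syzygies. Both terms of this presentation are direct sums, so their classes add,
  and \<open>g_vectorI\<close> reads the sum of the two g-vectors as the g-vector of
  \<open>N\<close>.\<close>

lemma g_vector_additive:
  assumes ci: "complete_indec_projectives \<Lambda> n P" and ass: "almost_split_sequence \<Lambda> L a N b M"
    and ns: "\<not> iso_to_direct_summand \<Lambda> L (quot_module I T)"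
  shows "\<forall>i\<in>{1..n}. g_vector \<Lambda> n P N i = g_vector \<Lambda> n P L i + g_vector \<Lambda> n P M i"
proof -
  have fg: "fg_module \<Lambda> L" "fg_module \<Lambda> N" "fg_module \<Lambda> M" and ex: "short_exact \<Lambda> L a N b M"
    and las: "left_almost_split \<Lambda> L N a"
    using ass by (auto simp: almost_split_sequence_def)
  note lm = fg_lmodule[OF fg(1)] fg_lmodule[OF fg(2)] fg_lmodule[OF fg(3)]
  have a: "a \<in> mod_hom \<Lambda> L N" "inj_on a (carrier L)" and b: "b \<in> mod_hom \<Lambda> N M" "b ` carrier N = carrier M"
    and ab: "a ` carrier L = a_kernel N M b"
    using ex by (auto simp: short_exact_def)
  obtain PL QL :: "('a, 'a univ) module" and pL dL where L: "projective_cover \<Lambda> PL pL L"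
    "projective_cover \<Lambda> QL dL (PL\<lparr>carrier := a_kernel PL L pL\<rparr>)"
    "pcls \<Lambda> PL - pcls \<Lambda> QL - csum n P (g_vector \<Lambda> n P L) \<in> K0_subgroup \<Lambda>"
    using fl.g_vectorE[OF ci fg(1)] by metis
  obtain PM QM :: "('a, 'a univ) module" and pM dM where M: "projective_cover \<Lambda> PM pM M"
    "projective_cover \<Lambda> QM dM (PM\<lparr>carrier := a_kernel PM M pM\<rparr>)"
    "pcls \<Lambda> PM - pcls \<Lambda> QM - csum n P (g_vector \<Lambda> n P M) \<in> K0_subgroup \<Lambda>"
    using fl.g_vectorE[OF ci fg(3)] by metis
  have PL: "projective \<Lambda> PL" "pL \<in> mod_hom \<Lambda> PL L" "pL ` carrier PL = carrier L" and QL: "projective \<Lambda> QL"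
    using L(1,2) by (auto simp: projective_cover_def)
  have PM: "projective \<Lambda> PM" "pM \<in> mod_hom \<Lambda> PM M" "pM ` carrier PM = carrier M" and QM: "projective \<Lambda> QM"
    and dM: "dM \<in> mod_hom \<Lambda> QM (PM\<lparr>carrier := a_kernel PM M pM\<rparr>)"
    using M(1,2) by (auto simp: projective_cover_def)
  obtain \<tau> where \<tau>: "\<tau> \<in> mod_hom \<Lambda> PM N" "\<And>y. y \<in> carrier PM \<Longrightarrow> b (\<tau> y) = pM y"
    using projective_lift[OF PM(1) fg(2,3) b PM(2)] by blast
  note lPL = projective_lmodule[OF PL(1)] and lPM = projective_lmodule[OF PM(1)]
  interpret L: lmodule \<Lambda> L by (rule lm)
  interpret N: lmodule \<Lambda> N by (rule lm)
  interpret M: lmodule \<Lambda> M by (rule lm)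
  interpret PL: lmodule \<Lambda> PL by (rule lPL)
  interpret PM: lmodule \<Lambda> PM by (rule lPM)
  let ?D = "dsum PL PM"
  have D: "projective \<Lambda> ?D" by (rule projective_dsum[OF PL(1) PM(1)])
  note lD = projective_lmodule[OF D]
  \<comment> \<open>The horseshoe map: the cover of \<open>L\<close> pushed along \<open>a\<close>,
    together with a lift \<open>\<tau>\<close> of the cover of \<open>M\<close> along
    \<open>b\<close>. It is onto, but possibly not a cover.\<close>
  define p where "p = (\<lambda>z. a (pL (fst z)) \<oplus>\<^bsub>N\<^esub> \<tau> (snd z))"
  have p: "p \<in> mod_hom \<Lambda> ?D N"
    unfolding p_def by (rule mod_hom_copair[OF lPL lPM lm(2) mod_hom_comp[OF PL(2) a(1)] \<tau>(1)])
  have apc: "a (pL x) \<in> carrier N" "b (a (pL x)) = \<zero>\<^bsub>M\<^esub>" if x: "x \<in> carrier PL" for x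
  proof -
    have "a (pL x) \<in> a_kernel N M b" unfolding ab[symmetric] using mod_hom_closed[OF PL(2) x] by blast
    then show "a (pL x) \<in> carrier N" "b (a (pL x)) = \<zero>\<^bsub>M\<^esub>" by (simp_all add: a_kernel_eq)
  qed
  have \<tau>c: "\<tau> y \<in> carrier N" if "y \<in> carrier PM" for y by (rule mod_hom_closed[OF \<tau>(1) that])
  have lift: "\<exists>x\<in>carrier PL. a (pL x) = w" if "w \<in> carrier N" "b w = \<zero>\<^bsub>M\<^esub>" for w
  proof -
    have "w \<in> a ` pL ` carrier PL" unfolding PL(3) ab using that by (simp add: a_kernel_eq)
    then show ?thesis by blast
  qed
  have p_onto: "p ` carrier ?D = carrier N"
  proof
    show "p ` carrier ?D \<subseteq> carrier N" using mod_hom_closed[OF p] by blast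
    show "carrier N \<subseteq> p ` carrier ?D"
    proof
      fix w assume w: "w \<in> carrier N"
      have "b w \<in> pM ` carrier PM" unfolding PM(3) by (rule mod_hom_closed[OF b(1) w])
      then obtain y where y: "y \<in> carrier PM" "b w = pM y" by blast
      have "b (w \<ominus>\<^bsub>N\<^esub> \<tau> y) = \<zero>\<^bsub>M\<^esub>"
        using mod_hom_diff[OF lm(2,3) b(1) w \<tau>c[OF y(1)]] \<tau>(2)[OF y(1)] y(2) mod_hom_closed[OF PM(2) y(1)]
        by (simp add: M.minus_eq_zero_iff)
      then obtain x where x: "x \<in> carrier PL" "a (pL x) = w \<ominus>\<^bsub>N\<^esub> \<tau> y" using lift w \<tau>c[OF y(1)] by blast
      have "p (x, y) = (w \<ominus>\<^bsub>N\<^esub> \<tau> y) \<oplus>\<^bsub>N\<^esub> \<tau> y" using x(2) by (simp add: p_def)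
      also have "\<dots> = w" using w \<tau>c[OF y(1)] by (simp add: a_minus_def N.a_assoc N.l_neg)
      finally have "w = p (x, y)" ..
      then show "w \<in> p ` carrier ?D" by (rule image_eqI) (use x y in simp)
    qed
  qed
  let ?Ks = "a_kernel ?D N p" and ?KLs = "a_kernel PL L pL" and ?KMs = "a_kernel PM M pM"
  let ?K = "?D\<lparr>carrier := ?Ks\<rparr>" and ?KL = "PL\<lparr>carrier := ?KLs\<rparr>" and ?KM = "PM\<lparr>carrier := ?KMs\<rparr>"
  note Ks = submodule_kernel[OF lD lm(2) p] and KLs = submodule_kernel[OF lPL lm(1) PL(2)]
    and KMs = submodule_kernel[OF lPM lm(3) PM(2)]
  note lK = lmodule_submodule[OF lD Ks] and lKL = lmodule_submodule[OF lPL KLs] and lKM = lmodule_submodule[OF lPM KMs]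
  have fK: "fg_module \<Lambda> ?K" by (rule fl.fg_submodule[OF projective_fg[OF D] Ks])
  have fKM: "fg_module \<Lambda> ?KM" by (rule fl.fg_submodule[OF projective_fg[OF PM(1)] KMs])
  \<comment> \<open>The maps \<open>?i\<close> and \<open>snd\<close> exhibit the kernel of
    \<open>p\<close> as an extension of the syzygy of \<open>M\<close> by the syzygy of
    \<open>L\<close>.\<close>
  let ?i = "\<lambda>x. (x, \<zero>\<^bsub>PM\<^esub>)"
  have p0: "p (x, \<zero>\<^bsub>PM\<^esub>) = a (pL x)" if "x \<in> carrier PL" for x
    using mod_hom_zero[OF lPM lm(2) \<tau>(1)] apc(1)[OF that] by (simp add: p_def)
  have i: "?i \<in> mod_hom \<Lambda> ?KL ?K"
  proof (rule mod_hom_into[OF mod_hom_restrict[OF mod_hom_inl[OF lPM] submodule_subset[OF KLs]]])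
    show "?i ` carrier ?KL \<subseteq> ?Ks"
      using p0 mod_hom_zero[OF lm(1,2) a(1)] by (auto simp: a_kernel_eq)
  qed
  have bp: "b (p z) = pM (snd z)" if z: "z \<in> carrier ?D" for z
  proof -
    have z': "fst z \<in> carrier PL" "snd z \<in> carrier PM" using z by auto
    show ?thesis
      unfolding p_def mod_hom_add[OF b(1) apc(1)[OF z'(1)] \<tau>c[OF z'(2)]]
      using apc(2)[OF z'(1)] \<tau>(2)[OF z'(2)] mod_hom_closed[OF PM(2) z'(2)] by simp
  qed
  have snd: "snd \<in> mod_hom \<Lambda> ?K ?KM"
  proof (rule mod_hom_into[OF mod_hom_restrict[OF mod_hom_snd submodule_subset[OF Ks]]])
    show "snd ` carrier ?K \<subseteq> ?KMs"
      using bp mod_hom_zero[OF lm(2,3) b(1)] by (fastforce simp: a_kernel_eq)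
  qed
  have snd_onto: "snd ` carrier ?K = carrier ?KM"
  proof
    show "snd ` carrier ?K \<subseteq> carrier ?KM" using mod_hom_closed[OF snd] by blast
    show "carrier ?KM \<subseteq> snd ` carrier ?K"
    proof
      fix y assume "y \<in> carrier ?KM"
      then have y: "y \<in> carrier PM" "pM y = \<zero>\<^bsub>M\<^esub>" by (auto simp: a_kernel_eq)
      \<comment> \<open>As \<open>b\<close> kills \<open>\<tau> y\<close>, this element comes from
        \<open>PL\<close>; entering its preimage with a minus sign completes \<open>y\<close> to a
        point of the kernel of \<open>p\<close>.\<close>
      obtain x where x: "x \<in> carrier PL" "a (pL x) = \<tau> y" using lift[OF \<tau>c[OF y(1)]] \<tau>(2)[OF y(1)] y(2) by auto
      have "a (pL (\<ominus>\<^bsub>PL\<^esub> x)) = \<ominus>\<^bsub>N\<^esub> \<tau> y"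
        unfolding mod_hom_minus[OF lPL lm(1) PL(2) x(1)] mod_hom_minus[OF lm(1,2) a(1) mod_hom_closed[OF PL(2) x(1)]] x(2) ..
      then have "p (\<ominus>\<^bsub>PL\<^esub> x, y) = \<zero>\<^bsub>N\<^esub>" using \<tau>c[OF y(1)] by (simp add: p_def N.l_neg)
      then have "(\<ominus>\<^bsub>PL\<^esub> x, y) \<in> carrier ?K" using x(1) y(1) by (simp add: a_kernel_eq)
      then show "y \<in> snd ` carrier ?K" by (rule image_eqI[rotated]) simp
    qed
  qed
  have ker: "?i ` carrier ?KL = a_kernel ?K ?KM snd"
  proof
    show "?i ` carrier ?KL \<subseteq> a_kernel ?K ?KM snd" using mod_hom_closed[OF i] by (auto simp: a_kernel_eq)
    show "a_kernel ?K ?KM snd \<subseteq> ?i ` carrier ?KL"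
    proof
      fix z assume "z \<in> a_kernel ?K ?KM snd"
      then have z: "fst z \<in> carrier PL" "snd z = \<zero>\<^bsub>PM\<^esub>" "p z = \<zero>\<^bsub>N\<^esub>" by (auto simp: a_kernel_eq)
      then have z': "z = ?i (fst z)" by (simp add: prod_eq_iff)
      then have "a (pL (fst z)) = a \<zero>\<^bsub>L\<^esub>" using p0[OF z(1)] z(3) mod_hom_zero[OF lm(1,2) a(1)] by simp
      then have "pL (fst z) = \<zero>\<^bsub>L\<^esub>"
        using inj_onD[OF a(2) _ mod_hom_closed[OF PL(2) z(1)] L.zero_closed] by blast
      then have "fst z \<in> carrier ?KL" using z(1) by (simp add: a_kernel_eq)
      then show "z \<in> ?i ` carrier ?KL" using z' by (rule image_eqI[rotated])
    qed
  qed
  \<comment> \<open>The cover of the syzygy of \<open>M\<close> lifted along \<open>snd\<close>, the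
    datum from which \<open>horseshoe_cover\<close> forms the second component of the cover.\<close>
  obtain t where t: "t \<in> mod_hom \<Lambda> QM ?K" "\<And>y. y \<in> carrier QM \<Longrightarrow> snd (t y) = dM y"
    using projective_lift[OF QM fK fKM snd snd_onto dM] by blast
  have ext: "\<exists>v\<in>mod_hom \<Lambda> ?K I. v ` carrier ?K \<subseteq> T \<and> (\<forall>x\<in>carrier ?KL. v (?i x) = u x)"
    if "u \<in> mod_hom \<Lambda> ?KL I" "u ` carrier ?KL \<subseteq> T" for u
    using syzygy_extension[OF fg(1,2) las ns PL PM(1) \<tau>(1) p_def that(1)] that(2) by simp
  note cov = horseshoe_cover[OF lKL lK lKM i snd ker L(2) M(2) t ext]
  have "pcls \<Lambda> ?D - pcls \<Lambda> (dsum QL QM) - csum n P (\<lambda>i. g_vector \<Lambda> n P L i + g_vector \<Lambda> n P M i) \<in> K0_subgroup \<Lambda>"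
    using K0_diff[OF K0_add[OF K0_add[OF L(3) M(3)] pcls_dsum[OF PL(1) PM(1)]] pcls_dsum[OF QL QM]]
    by (simp add: csum_add algebra_simps)
  from fl.g_vectorI[OF ci fg(2) D p p_onto cov this] show ?thesis .
qed

end

theorem proposition6p8:
  fixes R :: "'r ring" and \<Lambda> :: "'a ring" and \<phi> :: "'r \<Rightarrow> 'a" and J :: "('r, 'j) module"
    and n :: nat and P :: "nat \<Rightarrow> ('a, 'a univ) module"
    and L :: "('a, 'l) module" and N :: "('a, 'n) module" and M :: "('a, 'm) module"
    and a :: "'l \<Rightarrow> 'n" and b :: "'n \<Rightarrow> 'm"
  assumes "artin_algebra R \<Lambda> \<phi>"
    and "dualizing_module R J"
    and "complete_indec_projectives \<Lambda> n P"
    and "almost_split_sequence \<Lambda> L a N b M"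
    and "\<not> (\<exists>Y :: ('a, 'a univ) module. projective \<Lambda> Y \<and>
           iso_to_direct_summand \<Lambda> L
             (quot_module (nakayama R \<Lambda> \<phi> J Y) (socle \<Lambda> (nakayama R \<Lambda> \<phi> J Y))))"
  shows "\<forall>i\<in>{1..n}. g_vector \<Lambda> n P N i = g_vector \<Lambda> n P L i + g_vector \<Lambda> n P M i"
proof -
  interpret artin_algebra R \<Lambda> \<phi> by fact
  have reg: "projective \<Lambda> (regular_module \<Lambda>)" by (rule projective_regular[OF \<Lambda>.ring_axioms])
  \<comment> \<open>The hypothesis ranges over projective modules on \<open>'a univ\<close>, so it
    is applied to a copy \<open>Y\<close> of the regular module, with the coordinate maps
    \<open>\<iota>\<close> and \<open>\<kappa>\<close> that make it free on one generator.\<close>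
  obtain Y :: "('a, 'a univ) module" and \<iota> \<kappa> where Y: "fg_module \<Lambda> Y"
    "\<iota> \<in> mod_hom \<Lambda> (regular_module \<Lambda>) Y" "\<kappa> \<in> mod_hom \<Lambda> Y (regular_module \<Lambda>)"
    "\<And>x. x \<in> carrier (regular_module \<Lambda>) \<Longrightarrow> \<kappa> (\<iota> x) = x" "\<And>y. y \<in> carrier Y \<Longrightarrow> \<iota> (\<kappa> y) = y"
    using univ_copy[OF projective_fg[OF reg]] by blast
  have pY: "projective \<Lambda> Y" by (rule projective_retract[OF reg fg_lmodule[OF Y(1)] Y(3,2,5)])
  have nf: "nakayama_free R \<Lambda> \<phi> J Y \<iota> \<kappa>"
  proof (rule nakayama_free.intro[OF assms(1)], rule nakayama_free_axioms.intro)
    show "\<kappa> (\<iota> x) = x" if "x \<in> carrier \<Lambda>" for x using Y(4) that by simp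
  qed (fact assms(2) fg_lmodule[OF Y(1)] Y(2) Y(3) Y(5))+
  have "\<not> iso_to_direct_summand \<Lambda> L (quot_module (nakayama R \<Lambda> \<phi> J Y) (socle \<Lambda> (nakayama R \<Lambda> \<phi> J Y)))"
    using assms(5)[unfolded not_ex, THEN spec, of Y] pY by simp
  then show ?thesis by (rule nakayama_free.g_vector_additive[OF nf assms(3,4)])
qed

end
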